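(* For every $T>0$ (with the penalization parameter $\delta>0$ sufficiently small, i.e. $0<\delta<\delta_0$ for some $\delta_0\in(0,1)$ depending only on $\lambda$, $G$ and $T$) there exists a weak solution $(u,\mathbf m)$ of the magneto-viscoelasticity problem described in the context, that is, a pair $u:\mathcal Q\to\mathbb R$, $\mathbf m=(m_1,m_2):\mathcal Q\to\mathbb R^2$ such that $$u\in L^\infty(0,T;H^1_0(\Omega)),\quad u_t\in L^\infty(0,T;L^2(\Omega)),\quad \mathbf m\in L^\infty(0,T;H^1(\Omega)),\quad \mathbf m_t\in L^2(\mathcal Q),$$ and such that $$-\int_{\mathcal Q}\phi_t\,u\,dx\,dt+\int_{\mathcal Q}\int_0^t G(t-\tau)\,u_x(x,\tau)\,\phi_x(x,t)\,d\tau\,dx\,dt+\int_{\mathcal Q}\int_0^t\frac{\lambda}{2}\,\bigl(\Lambda(\mathbf m)\cdot\mathbf m\bigr)(x,\tau)\,\phi_x(x,t)\,d\tau\,dx\,dt=\int_{\mathcal Q}\Bigl[u_1(x)+\int_0^t f(x,\tau)\,d\tau\Bigr]\phi(x,t)\,dx\,dt$$ for every smooth $\phi$ on $\overline{\mathcal Q}$ with $\phi(0,t)=\phi(1,t)=0$ for all $t$ and $\phi(\cdot,T)=0$, and $$-\int_{\mathcal Q}\boldsymbol\psi_t\cdot\mathbf m\,dx\,dt+\int_{\mathcal Q}\frac{|\mathbf m|^2-1}{\delta}\,\boldsymbol\psi\cdot\mathbf m\,dx\,dt+\int_{\mathcal Q}\lambda\,u_x\,\Lambda(\mathbf m)\cdot\boldsymbol\psi\,dx\,dt+\int_{\mathcal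 Q}\mathbf m_x\cdot\boldsymbol\psi_x\,dx\,dt-\int_\Omega\mathbf m_0(x)\cdot\boldsymbol\psi(x,0)\,dx=0$$ for every smooth $\boldsymbol\psi=(\psi_1,\psi_2)$ on $\overline{\mathcal Q}$ with $\boldsymbol\psi(\cdot,T)=0$.
   Context: Let $\Omega=(0,1)$, $\mathcal Q=\Omega\times(0,T)$, $\lambda>0$, and let $\Lambda:\mathbb R^2\to\mathbb R^2$ be the linear map $\Lambda(m_1,m_2)=(m_2,m_1)$. The parameter $\delta$ is a small penalization parameter, $0<\delta\ll1$. Data: $u_1\in L^2(\Omega)$, $\mathbf m_0\in H^1(\Omega;\mathbb R^2)$ with $|\mathbf m_0|=1$ in $\Omega$, $f\in L^2(\mathcal Q)$. The relaxation function $G:(0,\infty)\to\mathbb R$ satisfies $G\in L^1(0,T)\cap C^2(0,T)$ for every $T>0$, and $G(t)>0$, $\dot G(t)\le0$, $\ddot G(t)\ge0$ for all $t\in(0,\infty)$. ($G$ may be unbounded at $t=0$.) The problem is: find $(u,\mathbf m)$ with, in $\mathcal Q$, $$u_t(t)-\int_0^tG(t-\tau)u_{xx}(\tau)\,d\tau-u_1-\int_0^t\frac\lambda2\bigl(\Lambda(\mathbf m)\cdot\mathbf m\bigr)_x\,d\tau=\int_0^tf(\tau)\,d\tau,$$ $$\mathbf m_t+\mathbf m\,\frac{|\mathbf m|^2-1}{\delta}+\lambda\,\Lambda(\mathbf m)\,u_x-\mathbf m_{xx}=0,$$ with initial conditions $u(\cdot,0)=0$, $\mathbf m(\cdot,0)=\mathbf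 m_0$ in $\Omega$, and boundary conditions $u=0$, $\partial\mathbf m/\partial\boldsymbol\nu=0$ on $\partial\Omega\times(0,T)$, where $\boldsymbol\nu$ is the outer unit normal. The two integral identities in the claim are the weak form of this problem. *)

theory Defs
  imports "HOL-Analysis.Analysis"
begin

section \<open>Smooth functions and test functions\<close>

definition dir_deriv :: "'a::euclidean_space \<Rightarrow> ('a \<Rightarrow> 'b::euclidean_space) \<Rightarrow> 'a \<Rightarrow> 'b" where
  "dir_deriv v f p = frechet_derivative f (at p) v"

text \<open>Meaningful for open \<open>U\<close>.\<close>
primrec Ck :: "nat \<Rightarrow> 'a::euclidean_space set \<Rightarrow> ('a \<Rightarrow> 'b::euclidean_space) \<Rightarrow> bool" where
  "Ck 0 U f \<longleftrightarrow> continuous_on U f"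
| "Ck (Suc k) U f \<longleftrightarrow> (\<forall>p\<in>U. f differentiable (at p)) \<and> (\<forall>v. Ck k U (dir_deriv v f))"

text \<open>For a set \<open>S\<close> that is not open, smoothness means smoothness on an open neighbourhood.\<close>
definition smooth_on :: "'a::euclidean_space set \<Rightarrow> ('a \<Rightarrow> 'b::euclidean_space) \<Rightarrow> bool" where
  "smooth_on S f \<longleftrightarrow> (\<exists>U. open U \<and> S \<subseteq> U \<and> (\<forall>k. Ck k U f))"

definition test_function :: "'a::euclidean_space set \<Rightarrow> ('a \<Rightarrow> 'b::euclidean_space) \<Rightarrow> bool" where
  "test_function S \<phi> \<longleftrightarrow>
     smooth_on UNIV \<phi> \<and> (\<exists>K. compact K \<and> K \<subseteq> S \<and> (\<forall>p. p \<notin> K \<longrightarrow> \<phi> p = 0))"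


section \<open>Lebesgue and Sobolev spaces\<close>

text \<open>Elements of all these spaces are represented by functions; every predicate below is
  invariant under changes on null sets.\<close>

definition L2 :: "'a::euclidean_space set \<Rightarrow> ('a \<Rightarrow> 'b::euclidean_space) \<Rightarrow> bool" where
  "L2 S f \<longleftrightarrow> f \<in> borel_measurable (lebesgue_on S) \<and>
     integrable (lebesgue_on S) (\<lambda>p. (norm (f p))\<^sup>2)"

definition L2_norm :: "'a::euclidean_space set \<Rightarrow> ('a \<Rightarrow> 'b::euclidean_space) \<Rightarrow> real" where
  "L2_norm S f = sqrt (LINT p|lebesgue_on S. (norm (f p))\<^sup>2)"

definition locally_integrable :: "'a::euclidean_space set \<Rightarrow> ('a \<Rightarrow> 'b::euclidean_space) \<Rightarrow> bool" where
  "locally_integrable S f \<longleftrightarrow> (\<forall>K. compact K \<and> K \<subseteq> S \<longrightarrow> integrable (lebesgue_on K) f)"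

definition has_weak_deriv ::
  "'a::euclidean_space set \<Rightarrow> 'a \<Rightarrow> ('a \<Rightarrow> 'b::euclidean_space) \<Rightarrow> ('a \<Rightarrow> 'b) \<Rightarrow> bool" where
  "has_weak_deriv S v f g \<longleftrightarrow> locally_integrable S f \<and> locally_integrable S g \<and>
     (\<forall>\<phi> :: 'a \<Rightarrow> real. test_function S \<phi> \<longrightarrow>
        (LINT p|lebesgue_on S. dir_deriv v \<phi> p *\<^sub>R f p) = - (LINT p|lebesgue_on S. \<phi> p *\<^sub>R g p))"

text \<open>A weak derivative on an open set is unique up to null sets, so the choice is immaterial.\<close>
definition weak_deriv ::
  "'a::euclidean_space set \<Rightarrow> 'a \<Rightarrow> ('a \<Rightarrow> 'b::euclidean_space) \<Rightarrow> 'a \<Rightarrow> 'b" where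
  "weak_deriv S v f = (SOME g. has_weak_deriv S v f g)"

definition H1 :: "real set \<Rightarrow> (real \<Rightarrow> 'b::euclidean_space) \<Rightarrow> bool" where
  "H1 S f \<longleftrightarrow> L2 S f \<and> (\<exists>g. has_weak_deriv S 1 f g \<and> L2 S g)"

definition H1_norm :: "real set \<Rightarrow> (real \<Rightarrow> 'b::euclidean_space) \<Rightarrow> real" where
  "H1_norm S f = sqrt ((L2_norm S f)\<^sup>2 + (L2_norm S (weak_deriv S 1 f))\<^sup>2)"

text \<open>Closure of the test functions in the norm of \<open>H1\<close>.\<close>
definition H1_0 :: "real set \<Rightarrow> (real \<Rightarrow> 'b::euclidean_space) \<Rightarrow> bool" where
  "H1_0 S f \<longleftrightarrow> H1 S f \<and>
     (\<exists>\<phi>. (\<forall>n. test_function S (\<phi> n)) \<and> (\<lambda>n. H1_norm S (\<lambda>x. \<phi> n x - f x)) \<longlonglongrightarrow> 0)"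


section \<open>Bochner spaces and the space-time cylinder\<close>

text \<open>\<open>L\<^sup>\<infinity>(0,T;X)\<close> for a function space given by its membership predicate \<open>X\<close> and norm \<open>N\<close>,
  applied to \<open>t \<mapsto> w(\<cdot>,t)\<close>: strongly measurable (an a.e. limit of \<open>X\<close>-valued simple functions) and
  essentially bounded.\<close>
definition Linf_Bochner ::
  "real \<Rightarrow> ((real \<Rightarrow> 'b::euclidean_space) \<Rightarrow> bool) \<Rightarrow> ((real \<Rightarrow> 'b) \<Rightarrow> real) \<Rightarrow> (real \<times> real \<Rightarrow> 'b) \<Rightarrow> bool"
  where
  "Linf_Bochner T X N w \<longleftrightarrow>
     (AE t in lebesgue_on {0<..<T}. X (\<lambda>x. w (x, t))) \<and>
     (\<exists>s :: nat \<Rightarrow> real \<Rightarrow> real \<Rightarrow> 'b.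
        (\<forall>n. simple_function (lebesgue_on {0<..<T}) (s n) \<and> (\<forall>t. X (s n t))) \<and>
        (AE t in lebesgue_on {0<..<T}. (\<lambda>n. N (\<lambda>x. s n t x - w (x, t))) \<longlonglongrightarrow> 0)) \<and>
     (\<exists>C. AE t in lebesgue_on {0<..<T}. N (\<lambda>x. w (x, t)) \<le> C)"

definition Omega :: "real set" where
  "Omega = {0<..<1}"

text \<open>Points of the cylinder are pairs \<open>(x, t)\<close>.\<close>
definition Cyl :: "real \<Rightarrow> (real \<times> real) set" where
  "Cyl T = Omega \<times> {0<..<T}"

abbreviation (input) e_x :: "real \<times> real" where "e_x \<equiv> (1, 0)"
abbreviation (input) e_t :: "real \<times> real" where "e_t \<equiv> (0, 1)"


section \<open>Data of the magneto-viscoelasticity problem\<close>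

definition Lam :: "real ^ 2 \<Rightarrow> real ^ 2" where
  "Lam m = vector [m $ 2, m $ 1]"

definition relaxation_function :: "(real \<Rightarrow> real) \<Rightarrow> bool" where
  "relaxation_function G \<longleftrightarrow>
     (\<forall>T>0. integrable (lebesgue_on {0<..<T}) G \<and> Ck 2 {0<..<T} G) \<and>
     (\<forall>t>0. G t > 0 \<and> deriv G t \<le> 0 \<and> deriv (deriv G) t \<ge> 0)"


section \<open>Weak formulation\<close>

definition weak_momentum_equation ::
  "real \<Rightarrow> real \<Rightarrow> (real \<Rightarrow> real) \<Rightarrow> (real \<Rightarrow> real) \<Rightarrow> (real \<times> real \<Rightarrow> real) \<Rightarrow>
   (real \<times> real \<Rightarrow> real) \<Rightarrow> (real \<times> real \<Rightarrow> real) \<Rightarrow> (real \<times> real \<Rightarrow> real ^ 2) \<Rightarrow> bool" where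
  "weak_momentum_equation T lam G u1 f u ux m \<longleftrightarrow>
     (\<forall>\<phi> :: real \<times> real \<Rightarrow> real.
        smooth_on (closure (Cyl T)) \<phi> \<longrightarrow>
        (\<forall>t\<in>{0..T}. \<phi> (0, t) = 0 \<and> \<phi> (1, t) = 0) \<longrightarrow> (\<forall>x\<in>{0..1}. \<phi> (x, T) = 0) \<longrightarrow>
        - (LINT (x, t)|lebesgue_on (Cyl T). dir_deriv e_t \<phi> (x, t) * u (x, t))
        + (LINT (x, t)|lebesgue_on (Cyl T).
             LINT \<tau>|lebesgue_on {0<..<t}. G (t - \<tau>) * ux (x, \<tau>) * dir_deriv e_x \<phi> (x, t))
        + (LINT (x, t)|lebesgue_on (Cyl T).
             LINT \<tau>|lebesgue_on {0<..<t}.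
               lam / 2 * (Lam (m (x, \<tau>)) \<bullet> m (x, \<tau>)) * dir_deriv e_x \<phi> (x, t))
        = (LINT (x, t)|lebesgue_on (Cyl T).
             (u1 x + (LINT \<tau>|lebesgue_on {0<..<t}. f (x, \<tau>))) * \<phi> (x, t)))"

definition weak_magnetization_equation ::
  "real \<Rightarrow> real \<Rightarrow> real \<Rightarrow> (real \<Rightarrow> real ^ 2) \<Rightarrow>
   (real \<times> real \<Rightarrow> real) \<Rightarrow> (real \<times> real \<Rightarrow> real ^ 2) \<Rightarrow> (real \<times> real \<Rightarrow> real ^ 2) \<Rightarrow> bool" where
  "weak_magnetization_equation T lam \<delta> m0 ux m mx \<longleftrightarrow>
     (\<forall>\<psi> :: real \<times> real \<Rightarrow> real ^ 2.
        smooth_on (closure (Cyl T)) \<psi> \<longrightarrow> (\<forall>x\<in>{0..1}. \<psi> (x, T) = 0) \<longrightarrow>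
        - (LINT p|lebesgue_on (Cyl T). dir_deriv e_t \<psi> p \<bullet> m p)
        + (LINT p|lebesgue_on (Cyl T). ((norm (m p))\<^sup>2 - 1) / \<delta> * (\<psi> p \<bullet> m p))
        + (LINT p|lebesgue_on (Cyl T). lam * ux p * (Lam (m p) \<bullet> \<psi> p))
        + (LINT p|lebesgue_on (Cyl T). mx p \<bullet> dir_deriv e_x \<psi> p)
        - (LINT x|lebesgue_on Omega. m0 x \<bullet> \<psi> (x, 0)) = 0)"

end

(*
Space and time are discretised with N cells each. In every time step the displacement and then the
magnetization are obtained by minimising a quadratic and a coercive quartic functional; convexity and
monotonicity of G make the discrete memory term dissipative, and for 4 lam^2 delta <= G(2T) the coupling
is absorbed, which gives bounds independent of N. By a discrete embedding the magnetizations are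
asymptotically equicontinuous, so a subsequence converges uniformly. For the remaining, linear, quantities
convex combinations that converge strongly in L2 (Mazur) replace weak compactness: an identity that is
linear in them passes to the limit along convex combinations, and the same combinations of step functions
are the simple functions required for strong measurability in the Bochner spaces. Convolutions with G are
moved to the test function, where they converge uniformly.
*)
theory Submission
  imports Defs "HOL-Complex_Analysis.Great_Picard"
begin

text \<open>The kernel may blow up at time zero, so neither G(0) nor pointwise kernel samples are
  available. The scheme uses cell means of \<open>G\<close>: they are finite, inherit sign,
  monotonicity and convexity, and make the discrete convolution an exact integral of
  \<open>G\<close> against step functions, so no kernel approximation error arises. The coupling
  energy has no sign. Displacement steps use the old magnetization and magnetization steps the new
  displacement, so the coupling telescopes; Young's inequality then trades it against half of the
  memory energy and half of the double well. The last kernel mean involved covers lags from T to T +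
  T/N, hence \<open>G (2 * T)\<close>. In the limit all products are of the type bounded in L2 times
  uniformly convergent; the nonlinear terms settle along one subsequence, and tail convex
  combinations leave their limits unchanged. Mazur is applied once, to the quadruple of discrete
  derivatives, so that all linear terms share the same weights. The displacement is then defined as
  the spatial primitive of the limit strain, and the magnetization is recognised on almost every
  time slice as a primitive of \<open>mx\<close>.\<close>

abbreviation seq_tendsto :: "(nat => 'a::topological_space) => 'a => bool" (infix "---->" 60) where
 "X ----> L == X \<longlonglongrightarrow> L"
abbreviation scale :: "real => 'a::real_vector => 'a" (infixr "*R" 75) where "a *R x == a *\<^sub>R x"
abbreviation inner_product :: "'a::real_inner => 'a => real" (infix "<.>" 70) where "x <.> y == x \<bullet> y"
abbreviation "ind == indicator"
abbreviation "rind == indicat_real"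
abbreviation "bms == borel_measurable"
abbreviation pair_meas (infixr "OX" 80) where "M OX N == M \<Otimes>\<^sub>M N"
abbreviation rS :: "nat => real" where "rS n == of_nat (Suc n)"
lemmas Bint_cong = Bochner_Integration.integral_cong
lemmas Bitg_cong = Bochner_Integration.integrable_cong
lemmas Bint_add = Bochner_Integration.integral_add
lemmas Bint_diff = Bochner_Integration.integral_diff
lemmas Bint_sum = Bochner_Integration.integral_sum
lemmas Bitg_bound = Bochner_Integration.integrable_bound
lemmas Bitg_add = Bochner_Integration.integrable_add


section \<open>Smooth compactly supported functions of one variable\<close>

text \<open>\<open>Ck\<close> quantifies over all directions at every order, which makes closure
  under products and substitutions awkward. On the line one derivative function per order suffices,
  and \<open>Dk_imp_Ck\<close> leads back, a directional derivative being a constant multiple of the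
  ordinary one.\<close>

primrec Dk :: "nat => (real => real) => bool" where
 "Dk 0 f \<longleftrightarrow> continuous_on UNIV f"
| "Dk (Suc k) f \<longleftrightarrow> (\<exists>f'. (\<forall>x. (f has_real_derivative f' x) (at x)) & Dk k f')"

lemma Dk_continuous: "Dk k f ==> continuous_on UNIV f"
proof (cases k)
 case (Suc j)
 assume "Dk k f"
 with Suc obtain f' where "!!x. (f has_real_derivative f' x) (at x)" by auto
 then show ?thesis by (meson DERIV_isCont continuous_at_imp_continuous_on)
qed simp

lemma Dk_cong_deriv:
 assumes "!!x. (f has_real_derivative f' x) (at x)" "Dk k f'"
 shows "Dk (Suc k) f"
 using assms by auto

lemma Dk_Suc_D: "Dk (Suc k) f ==> Dk k f"
proof (induction k arbitrary: f)
 case 0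
 then show ?case using Dk_continuous[of "Suc 0" f] by (simp del: Dk.simps(2))
next
 case (Suc k)
 then obtain f' where f': "!!x. (f has_real_derivative f' x) (at x)" "Dk (Suc k) f'" by (auto simp del: Dk.simps(2) simp: Dk.simps(2)[of "Suc k"])
 show ?case by (rule Dk_cong_deriv[OF f'(1) Suc.IH[OF f'(2)]])
qed

lemma Dk_const: "Dk k (%x. c)"
proof (induction k arbitrary: c)
 case (Suc k)
 show ?case by (rule Dk_cong_deriv[where f' = "%x. 0"]) (auto intro: Suc)
qed auto

lemma Dk_add: "Dk k f ==> Dk k g ==> Dk k (%x. f x + g x)"
proof (induction k arbitrary: f g)
 case (Suc k)
 then obtain f' g' where "!!x. (f has_real_derivative f' x) (at x)" "Dk k f'"
  "!!x. (g has_real_derivative g' x) (at x)" "Dk k g'" by auto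
 then show ?case by (intro Dk_cong_deriv[where f' = "%x. f' x + g' x"] DERIV_add Suc.IH)
qed (simp add: continuous_on_add)

lemma Dk_mult: "Dk k f ==> Dk k g ==> Dk k (%x. f x * g x)"
proof (induction k arbitrary: f g)
 case (Suc k)
 then obtain f' g' where d: "!!x. (f has_real_derivative f' x) (at x)" "Dk k f'"
  "!!x. (g has_real_derivative g' x) (at x)" "Dk k g'" by auto
 show ?case
  by (rule Dk_cong_deriv[where f' = "%x. f' x * g x + g' x * f x"])
  (auto intro!: DERIV_mult Dk_add Suc.IH d Dk_Suc_D[OF Suc.prems(1)] Dk_Suc_D[OF Suc.prems(2)])
qed (simp add: continuous_on_mult)

lemma Dk_affine: "Dk k f ==> Dk k (%x. f (a * x + b))"
proof (induction k arbitrary: f)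
 case 0
 have "continuous_on UNIV (%x. a * x + b)" by (intro continuous_intros)
 with 0 show ?case by (auto intro: continuous_on_compose2)
next
 case (Suc k)
 then obtain f' where d: "!!x. (f has_real_derivative f' x) (at x)" "Dk k f'" by auto
 have "((%x. f (a * x + b)) has_real_derivative f' (a * x + b) * a) (at x)" for x
  by (rule DERIV_chain2[OF d(1)]) (auto intro!: derivative_eq_intros)
 then show ?case
  by (rule Dk_cong_deriv) (intro Dk_mult Dk_const Suc.IH d)
qed

lemma Dk_sum: "(!!i. i \<in> I ==> Dk k (f i)) ==> Dk k (%x. \<Sum>i\<in>I. f i x)"
 by (induction I rule: infinite_finite_induct) (auto intro: Dk_add Dk_const)

lemma dir_deriv_real:
 fixes f :: "real => real"
 assumes "(f has_real_derivative D) (at x)"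
 shows "dir_deriv v f x = v * D"
proof -
 have "(f has_derivative (*) D) (at x)" using assms by (simp add: has_field_derivative_def)
 then have "frechet_derivative f (at x) = (*) D" by (rule frechet_derivative_at[symmetric])
 then show ?thesis by (simp add: dir_deriv_def mult.commute)
qed

lemma Dk_imp_Ck: "Dk k f ==> Ck k UNIV f"
proof (induction k arbitrary: f)
 case (Suc k)
 then obtain f' where d: "!!x. (f has_real_derivative f' x) (at x)" "Dk k f'" by auto
 have "f differentiable (at p)" for p using d(1) real_differentiable_def by blast
 moreover have "dir_deriv v f = (%x. v * f' x)" for v using dir_deriv_real[OF d(1)] by auto
 ultimately show ?case using Suc.IH[OF Dk_mult[OF Dk_const d(2)]] by simp
qed auto

lemma Dk_test_function:
 assumes "!!k. Dk k f" "compact K" "K \<subseteq> S" "!!x. x \<notin> K ==> f x = 0"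
 shows "test_function S f"
 unfolding test_function_def smooth_on_def using assms Dk_imp_Ck by blast

text \<open>Polynomials in 1/z times exp(-1/z), extended by zero, form a class closed under
  differentiation; smoothness of all orders then follows by one induction on the order with
  \<open>p\<close> arbitrary.\<close>

definition expinv :: "real poly => real => real" where
 "expinv p z = (if z > 0 then poly p (1 / z) * exp (- (1 / z)) else 0)"

lemma poly_exp_decay: "((%y. poly p y * exp (- y)) \<longlongrightarrow> (0::real)) at_top"
proof -
 have "((%y. \<Sum>i\<le>degree p. coeff p i * (y ^ i / exp y)) \<longlongrightarrow> (\<Sum>i\<le>degree p. coeff p i * 0)) at_top"
  by (intro tendsto_sum tendsto_mult tendsto_const tendsto_power_div_exp_0)
 moreover have "(\<Sum>i\<le>degree p. coeff p i * (y ^ i / exp y)) = poly p y * exp (- y)" for y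
  by (simp add: poly_altdef sum_distrib_right exp_minus divide_inverse mult.assoc)
 ultimately show ?thesis by simp
qed

text \<open>Away from zero this is the chain rule, the factor \<open>[:0, 0, 1:]\<close> being the
  1/z^2 of the inner derivative. At zero the right difference quotient is again a polynomial in 1/h
  times exp(-1/h), hence decays.\<close>

lemma expinv_deriv: "(expinv p has_real_derivative expinv ([:0, 0, 1:] * (p - pderiv p)) z) (at z)"
proof -
 consider "z > 0" | "z < 0" | "z = 0" by linarith
 then show ?thesis
 proof cases
  case 1
  have "((%z. poly p (1 / z) * exp (- (1 / z))) has_real_derivative expinv ([:0, 0, 1:] * (p - pderiv p)) z) (at z)"
  using 1 by (auto intro!: derivative_eq_intros DERIV_chain2[OF poly_DERIV] simp: expinv_def field_simps power2_eq_square)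
  then show ?thesis
  by (rule has_field_derivative_transform_within_open[where S = "{0<..}"]) (use 1 in \<open>auto simp: expinv_def\<close>)
 next
  case 2
  have "((%z. 0) has_real_derivative expinv ([:0, 0, 1:] * (p - pderiv p)) z) (at z)"
  using 2 by (auto simp: expinv_def)
  then show ?thesis
  by (rule has_field_derivative_transform_within_open[where S = "{..<0}"]) (use 2 in \<open>auto simp: expinv_def\<close>)
 next
  case 3
  have "((%h. expinv p h / h) \<longlongrightarrow> 0) (at_right 0)"
  proof -
  have "((%h. poly ([:0, 1:] * p) (inverse h) * exp (- inverse h)) \<longlongrightarrow> 0) (at_right (0::real))"
  by (rule filterlim_compose[OF poly_exp_decay filterlim_inverse_at_top_right])
  then show ?thesis
  by (rule Lim_transform_eventually) (auto simp: eventually_at_right_field expinv_def divide_inverse intro!: exI[of _ 1])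
  qed
  moreover have "((%h. expinv p h / h) \<longlongrightarrow> 0) (at_left 0)"
  by (rule Lim_transform_eventually[OF tendsto_const]) (auto simp: eventually_at_left_field expinv_def intro!: exI[of _ "-1"])
  ultimately have "((%h. expinv p h / h) \<longlongrightarrow> 0) (at 0)"
  by (simp add: filterlim_split_at)
  then show ?thesis using 3 by (simp add: DERIV_def expinv_def)
 qed
qed

lemma Dk_expinv: "Dk k (expinv p)"
proof (induction k arbitrary: p)
 case 0
 show ?case using DERIV_isCont[OF expinv_deriv] by (simp add: continuous_at_imp_continuous_on)
next
 case (Suc k)
 then show ?case by (rule Dk_cong_deriv[OF expinv_deriv])
qed

text \<open>There is no plateau of height one. Instead both factors tend to 1 as n grows, which
  gives pointwise convergence to the indicator of the open unit interval while the support stays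
  inside {1/n..1 - 1/n}.\<close>

definition bump :: "nat => real => real" where
 "bump n y = expinv 1 (real n * y - 1) * expinv 1 (real n * (1 - y) - 1)"

lemma Dk_bump: "Dk k (bump n)"
proof -
 have "Dk k (%y. expinv 1 (real n * y + (-1)) * expinv 1 ((- real n) * y + (real n - 1)))"
  by (intro Dk_mult Dk_affine Dk_expinv)
 then show ?thesis by (simp add: bump_def[abs_def] algebra_simps)
qed

lemma expinv_1_bounds: "0 <= expinv 1 z" "expinv 1 z <= 1"
 by (auto simp: expinv_def)

lemma bump_bounds: "0 <= bump n y" "bump n y <= 1"
 unfolding bump_def using expinv_1_bounds by (auto intro: mult_le_one)

lemma bump_zero: "n > 0 ==> y <= 1 / real n \<or> y \<ge> 1 - 1 / real n ==> bump n y = 0"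
 unfolding bump_def expinv_def by (auto simp: field_simps)

lemma bump_zero': "y \<notin> {0<..<1} ==> bump n y = 0"
proof -
 assume "y \<notin> {0<..<1}"
 then have "y <= 0 \<or> 1 - y <= 0" by auto
 then have "real n * y <= 0 \<or> real n * (1 - y) <= 0" by (auto simp: mult_nonneg_nonpos)
 then show ?thesis by (auto simp: bump_def expinv_def)
qed

lemma expinv_1_tendsto: "y > 0 ==> (%n. expinv 1 (real n * y - 1)) ----> 1"
proof -
 assume y: "y > 0"
 have "filterlim (%n. - 1 + real n * y) at_top sequentially"
  by (intro filterlim_tendsto_add_at_top[OF tendsto_const] filterlim_at_top_mult_tendsto_pos[OF tendsto_const y filterlim_real_sequentially])
 then have lim: "filterlim (%n. real n * y - 1) at_top sequentially"
  by simp
 have "(%n. exp (- (1 / (real n * y - 1)))) ----> exp (- 0)"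
  by (intro tendsto_exp tendsto_minus tendsto_divide_0[OF tendsto_const] filterlim_at_top_imp_at_infinity lim)
 moreover
 have "eventually (%n. real n * y - 1 > 0) sequentially"
  using lim unfolding filterlim_at_top_dense by blast
 then have "eventually (%n. exp (- (1 / (real n * y - 1))) = expinv 1 (real n * y - 1)) sequentially"
  by (auto elim!: eventually_mono simp: expinv_def)
 ultimately show ?thesis
  using Lim_transform_eventually by fastforce
qed

lemma bump_tendsto: "(%n. bump n y) ----> ind {0<..<1} y"
proof (cases "y \<in> {0<..<1}")
 case True
 then have "(%n. bump n y) ----> 1 * 1"
  unfolding bump_def by (intro tendsto_mult expinv_1_tendsto) auto
 then show ?thesis using True by simp
next
 case False
 then show ?thesis by (simp add: bump_zero')
qed

text \<open>A smooth ramp. Combinations of shifted ramps are smooth, and their derivatives,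
  combinations of bumps, converge to a prescribed step function; \<open>H1_0_step\<close> and
  \<open>H1_cell_average_diff\<close> rest on this.\<close>

definition bumpint :: "nat => real => real" where
 "bumpint n y = integral {0..y} (bump n)"

lemma continuous_bump: "continuous_on S (bump n)"
 using Dk_continuous[OF Dk_bump] continuous_on_subset by blast

lemma bump_integrable: "bump n integrable_on {a..b}"
 by (rule integrable_continuous_real[OF continuous_bump])

lemma bumpint_nonpos: "y <= 1 / real n ==> n > 0 ==> bumpint n y = 0"
 unfolding bumpint_def by (rule integral_unique, rule has_integral_is_0) (auto intro!: bump_zero)

text \<open>For y <= 0 the defining integral runs over an empty or one-point interval and the
  fundamental theorem gives nothing at y; there the ramp is identically zero on the neighbourhood
  {..<1/n}.\<close>

lemma bumpint_deriv: "n > 0 ==> (bumpint n has_real_derivative bump n y) (at y)"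
proof -
 assume n: "n > 0"
 show ?thesis
 proof (cases "y > 0")
  case True
  have "((%x. integral {0..x} (bump n)) has_real_derivative bump n y) (at y within {0..y+1})"
  by (rule integral_has_real_derivative[OF continuous_bump]) (use True in auto)
  then have "((%x. integral {0..x} (bump n)) has_real_derivative bump n y) (at y)"
  using True by (subst (asm) at_within_interior) auto
  then show ?thesis by (simp add: bumpint_def[abs_def])
 next
  case False
  then have "bump n y = 0" by (auto intro: bump_zero')
  then have "((%x. 0) has_real_derivative bump n y) (at y)" by simp
  then show ?thesis
  by (rule has_field_derivative_transform_within_open[where S = "{..<1 / real n}"])
  (use False n in \<open>auto simp: bumpint_nonpos not_less intro: le_less_trans[of y 0]\<close>)
 qed
qed

lemma Dk_bumpint: "n > 0 ==> Dk k (bumpint n)"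
 by (rule Dk_Suc_D, rule Dk_cong_deriv[OF bumpint_deriv Dk_bump])

lemma bumpint_const: "n > 0 ==> y \<ge> 1 - 1 / real n ==> bumpint n y = bumpint n 1"
proof -
 assume n: "n > 0" and y: "y \<ge> 1 - 1 / real n"
 have *: "bumpint n b = bumpint n a" if ab: "1 - 1 / real n <= a" "a <= b" for a b
 proof -
  have "0 <= a" using ab n by (smt (verit) divide_le_eq_1 of_nat_1 of_nat_le_iff less_one not_le of_nat_0_less_iff)
  then have "integral {0..a} (bump n) + integral {a..b} (bump n) = integral {0..b} (bump n)"
  by (intro Henstock_Kurzweil_Integration.integral_combine bump_integrable ab)
  moreover have "integral {a..b} (bump n) = 0"
  by (rule integral_unique, rule has_integral_is_0) (use ab n in \<open>auto intro!: bump_zero\<close>)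
  ultimately show ?thesis by (simp add: bumpint_def)
 qed
 show ?thesis
 proof (cases "y <= 1")
  case True
  show ?thesis by (rule *[OF y True, symmetric])
 next
  case False
  show ?thesis by (rule *) (use False in auto)
 qed
qed

lemma bumpint_bounds: "n > 0 ==> 0 <= bumpint n y" "n > 0 ==> bumpint n y <= 1"
proof -
 show "n > 0 ==> 0 <= bumpint n y"
  unfolding bumpint_def by (rule Henstock_Kurzweil_Integration.integral_nonneg[OF bump_integrable]) (auto simp: bump_bounds)
 have *: "bumpint n z <= 1" if "z <= 1" for z
 proof (cases "z \<ge> 0")
  case True
  have "bumpint n z <= integral {0..z} (%_. 1)"
  unfolding bumpint_def by (rule integral_le[OF bump_integrable]) (auto simp: bump_bounds)
  then show ?thesis using that True by simp
 qed (simp add: bumpint_def)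
 show "n > 0 ==> bumpint n y <= 1"
 proof (cases "y <= 1")
  case False
  assume n: "n > 0"
  have "1 - 1 / real n <= y" using False by (rule_tac order_trans[of _ 1]) auto
  then have "bumpint n y = bumpint n 1" by (rule bumpint_const[OF n])
  then show ?thesis using *[of 1] by simp
 qed (rule *)
qed

section \<open>Square integrability over a general measure and completeness of L2\<close>

text \<open>The counterpart of \<open>L2\<close> for an arbitrary measure. It is used with
  uncompleted measures, where products and sections stay measurable; \<open>L2_lbo\<close>
  translates back.\<close>

definition sq_int :: "'a measure => ('a => 'b::euclidean_space) => bool" where
 "sq_int M f \<longleftrightarrow> f \<in> bms M & integrable M (%x. (norm (f x))^2)"

definition nsq :: "'a measure => ('a => 'b::euclidean_space) => real" where
 "nsq M f = (\<integral>x. (norm (f x))^2 \<partial>M)"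

lemma nsq_nonneg: "0 <= nsq M f"
 unfolding nsq_def by (rule integral_nonneg_AE) auto

lemma sq_intD: "sq_int M f ==> f \<in> bms M"
 "sq_int M f ==> integrable M (%x. (norm (f x))^2)"
 by (auto simp: sq_int_def)

lemma norm_add_sq_le: "(norm (a + b :: 'b::euclidean_space))^2 <= 2 * (norm a)^2 + 2 * (norm b)^2"
proof -
 have "(norm (a + b))^2 + (norm (a - b))^2 = 2 * (norm a)^2 + 2 * (norm b)^2"
  by (simp add: power2_norm_eq_inner inner_simps)
 then show ?thesis by (smt (verit) zero_le_power2)
qed

lemma norm_mult_le_sq: "norm (a::'b::real_normed_vector) * norm (b::'c::real_normed_vector) <= (norm a)^2 / 2 + (norm b)^2 / 2"
 using sum_squares_bound[of "norm a" "norm b"] by simp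

lemma sq_int_bound:
 assumes "sq_int M g" "f \<in> bms M" "!!x. x \<in> space M ==> norm (f x) <= norm (g x)"
 shows "sq_int M f"
 unfolding sq_int_def
proof (intro conjI assms(2))
 have [measurable]: "f \<in> bms M" by fact
 show "integrable M (%x. (norm (f x))^2)"
  by (rule Bitg_bound[OF sq_intD(2)[OF assms(1)]])
  (auto intro!: AE_I2 power_mono assms(3))
qed

lemma sq_int_add:
 assumes "sq_int M f" "sq_int M g"
 shows "sq_int M (%x. f x + g x)"
proof -
 have [measurable]: "f \<in> bms M" "g \<in> bms M" using assms by (auto simp: sq_int_def)
 have "integrable M (%x. 2 * (norm (f x))^2 + 2 * (norm (g x))^2)"
  using assms by (auto simp: sq_int_def)
 then have "integrable M (%x. (norm (f x + g x))^2)"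
  by (rule Bitg_bound) (auto intro!: AE_I2 simp: norm_add_sq_le)
 then show ?thesis by (simp add: sq_int_def)
qed

lemma sq_int_scale:
 assumes "sq_int M f"
 shows "sq_int M (%x. c *R f x)"
 using assms by (auto simp: sq_int_def power_mult_distrib)

lemma sq_int_uminus: "sq_int M f ==> sq_int M (%x. - f x)"
 using sq_int_scale[of M f "-1"] by simp

lemma sq_int_diff:
 assumes "sq_int M f" "sq_int M g"
 shows "sq_int M (%x. f x - g x)"
 using sq_int_add[OF assms(1) sq_int_uminus[OF assms(2)]] by simp

lemma sq_int_zero: "sq_int M (%x. 0)"
 by (simp add: sq_int_def)

lemma sq_int_sum:
 assumes "!!k. k \<in> A ==> sq_int M (g k)"
 shows "sq_int M (%x. \<Sum>k\<in>A. c k *R g k x)"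
 using assms
proof (induction A rule: infinite_finite_induct)
 case (insert x F)
 then show ?case by (auto intro!: sq_int_add sq_int_scale)
qed (auto simp: sq_int_zero)

lemma nsq_add_le:
 assumes "sq_int M f" "sq_int M g"
 shows "nsq M (%x. f x + g x) <= 2 * nsq M f + 2 * nsq M g"
proof -
 have "nsq M (%x. f x + g x) <= (\<integral>x. 2 * (norm (f x))^2 + 2 * (norm (g x))^2 \<partial>M)"
  unfolding nsq_def
  using sq_int_add[OF assms] assms by (intro integral_mono) (auto simp: sq_int_def norm_add_sq_le)
 also have "... = 2 * nsq M f + 2 * nsq M g"
  using assms by (simp add: nsq_def sq_int_def)
 finally show ?thesis .
qed

lemma nsq_scale: "nsq M (%x. c *R f x) = c^2 * nsq M f"
 by (simp add: nsq_def power_mult_distrib)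

lemma nsq_diff_le:
 assumes "sq_int M f" "sq_int M g"
 shows "nsq M (%x. f x - g x) <= 2 * nsq M f + 2 * nsq M g"
 using nsq_add_le[OF assms(1) sq_int_uminus[OF assms(2)]] by (simp add: nsq_def)

lemma nsq_le_diff:
 assumes "sq_int M f" "sq_int M g"
 shows "nsq M f <= 2 * nsq M g + 2 * nsq M (%x. g x - f x)"
 using nsq_diff_le[OF assms(2) sq_int_diff[OF assms(2,1)]] by simp

text \<open>Stated with the midpoint instead of the sum: in \<open>Mazur_L2\<close> the midpoint is
  again an admissible convex combination, so its norm is bounded below.\<close>

lemma nsq_parallelogram:
 assumes "sq_int M f" "sq_int M g"
 shows "nsq M (%x. f x - g x) = 2 * nsq M f + 2 * nsq M g - 4 * nsq M (%x. (1/2) *R f x + (1/2) *R g x)"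
proof -
 have "nsq M (%x. f x - g x) + nsq M (%x. f x + g x)
  = (\<integral>x. (norm (f x - g x))^2 + (norm (f x + g x))^2 \<partial>M)"
  unfolding nsq_def
  using sq_int_add[OF assms] sq_int_diff[OF assms] by (subst Bint_add) (auto simp: sq_int_def)
 also have "... = (\<integral>x. 2 * (norm (f x))^2 + 2 * (norm (g x))^2 \<partial>M)"
  by (rule Bint_cong) (auto simp: power2_norm_eq_inner inner_simps)
 also have "... = 2 * nsq M f + 2 * nsq M g"
  using assms by (simp add: nsq_def sq_int_def)
 finally have "nsq M (%x. f x - g x) + nsq M (%x. f x + g x) = 2 * nsq M f + 2 * nsq M g" .
 moreover have "nsq M (%x. (1/2) *R f x + (1/2) *R g x) = (1/4) * nsq M (%x. f x + g x)"
  using nsq_scale[of M "1/2" "%x. f x + g x"] by (simp add: scaleR_add_right power2_eq_square)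
 ultimately show ?thesis by simp
qed

lemma sq_int_mult_integrable:
 fixes f :: "'a => 'b::euclidean_space" and g :: "'a => 'c::euclidean_space"
 assumes "sq_int M f" "sq_int M g"
 shows "integrable M (%x. norm (f x) * norm (g x))"
proof -
 have [measurable]: "f \<in> bms M" "g \<in> bms M" using assms by (auto simp: sq_int_def)
 have "integrable M (%x. (norm (f x))^2 / 2 + (norm (g x))^2 / 2)"
  using assms by (auto simp: sq_int_def)
 then show ?thesis
  by (rule Bitg_bound) (auto intro!: AE_I2 norm_mult_le_sq)
qed

lemma sq_int_inner_integrable:
 assumes "sq_int M f" "sq_int M g"
 shows "integrable M (%x. f x <.> g x)"
proof -
 have [measurable]: "f \<in> bms M" "g \<in> bms M" using assms by (auto simp: sq_int_def)
 show ?thesis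
  by (rule Bitg_bound[OF sq_int_mult_integrable[OF assms]])
  (auto intro!: AE_I2 Cauchy_Schwarz_ineq2)
qed

text \<open>The integral of (|f| - t |g|)^2 is a nonnegative quadratic polynomial in t; it is
  evaluated at its minimiser c/b, with the case b = 0 apart.\<close>

lemma Cauchy_Schwarz_integral:
 fixes f :: "'a => 'b::euclidean_space" and g :: "'a => 'c::euclidean_space"
 assumes "sq_int M f" "sq_int M g"
 shows "(\<integral>x. norm (f x) * norm (g x) \<partial>M)^2 <= nsq M f * nsq M g"
proof -
 define c where "c = (\<integral>x. norm (f x) * norm (g x) \<partial>M)"
 define a where "a = nsq M f"
 define b where "b = nsq M g"
 have "0 <= a - 2 * t * c + t^2 * b" for t
 proof -
  have "0 <= (\<integral>x. (norm (f x) - t * norm (g x))^2 \<partial>M)" by (rule integral_nonneg_AE) auto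
  also have "... = (\<integral>x. (norm (f x))^2 - (2 * t) * (norm (f x) * norm (g x)) + t^2 * (norm (g x))^2 \<partial>M)"
  by (rule Bint_cong) (auto simp: power2_eq_square algebra_simps)
  also have "... = a - 2 * t * c + t^2 * b"
  using assms sq_int_mult_integrable[OF assms] unfolding a_def b_def c_def nsq_def sq_int_def by simp
  finally show ?thesis .
 qed
 note q = this
 have a0: "0 <= a" and b0: "0 <= b" by (auto simp: a_def b_def nsq_nonneg)
 have c0: "0 <= c" unfolding c_def by (rule integral_nonneg_AE) auto
 have "c^2 <= a * b"
 proof (cases "b = 0")
  case True
  have "c = 0"
  proof (rule ccontr)
  assume "c ~= 0"
  then have "c > 0" using c0 by simp
  \<comment> \<open>For \<open>b = 0\<close> the polynomial is affine in t, and this t gives it the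
    value -1.\<close>
  with q[of "(a + 1) / (2 * c)"] True show False by (simp add: field_simps)
  qed
  with True show ?thesis by simp
 next
  case False
  with b0 have "b > 0" by simp
  with q[of "c / b"] show ?thesis by (simp add: field_simps power2_eq_square)
 qed
 then show ?thesis by (simp add: a_def b_def c_def)
qed

context finite_measure
begin

lemma sq_int_const: "sq_int M (%x. c)"
 by (simp add: sq_int_def)

lemma sq_int_integrable:
 assumes "sq_int M f"
 shows "integrable M f"
proof -
 have [measurable]: "f \<in> bms M" using assms by (auto simp: sq_int_def)
 have "integrable M (%x. norm (f x) * norm (1::real))"
  using sq_int_mult_integrable[OF assms sq_int_const[of "1::real"]] .
 then show ?thesis by (subst integrable_norm_iff[symmetric]) auto
qed

lemma L1_le_nsq:
 assumes "sq_int M f"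
 shows "(\<integral>x. norm (f x) \<partial>M)^2 <= nsq M f * measure M (space M)"
 using Cauchy_Schwarz_integral[OF assms sq_int_const[of "1::real"]]
 by (simp add: nsq_def)

lemma sq_int_bounded:
 assumes "f \<in> bms M" "!!x. x \<in> space M ==> norm (f x) <= C"
 shows "sq_int M f"
 using sq_int_bound[OF sq_int_const[of C] assms(1)] assms(2) by fastforce

text \<open>Riesz-Fischer on a finite measure space. A rapidly Cauchy subsequence has summable
  increments in L1 and so converges almost everywhere; Fatou's lemma turns the Cauchy estimate for
  \<open>y n\<close> into a bound on the distance from \<open>y n\<close> to the limit.\<close>

lemma L2_complete:
 fixes y :: "nat => 'a => 'b::euclidean_space"
 assumes y: "!!n. sq_int M (y n)"
  and cau: "!!e. e > 0 ==> \<exists>N. \<forall>n\<ge>N. \<forall>m\<ge>N. nsq M (%x. y n x - y m x) < e"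
 shows "\<exists>z. sq_int M z & (%n. nsq M (%x. y n x - z x)) ----> 0"
proof -
 have [measurable]: "y n \<in> bms M" for n using y by (auto simp: sq_int_def)
 obtain N0 where N0: "!!j n m. n \<ge> N0 j ==> m \<ge> N0 j ==> nsq M (%x. y n x - y m x) < (1/4::real)^j"
  using cau[of "(1/4::real)^j" for j] by (metis zero_less_divide_1_iff zero_less_numeral zero_less_power)
 \<comment> \<open>The sum of all thresholds makes \<open>r\<close> monotone and at least
   \<open>N0 j\<close>; the summand \<open>j\<close> makes \<open>r j\<close> exceed every fixed
   index eventually.\<close>
 define r where "r j = (\<Sum>i\<le>j. N0 i) + j" for j
 have rN: "r j \<ge> N0 j" for j
  unfolding r_def by (metis add.commute atMost_iff finite_atMost le_refl member_le_sum trans_le_add2 zero_le)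
 have rmono: "r j <= r (Suc j)" for j unfolding r_def by simp
 have rj: "j <= r j" for j unfolding r_def by simp
 define d where "d j x = y (r (Suc j)) x - y (r j) x" for j x
 have d_sq: "sq_int M (d j)" for j unfolding d_def by (rule sq_int_diff[OF y y])
 have [measurable]: "d j \<in> bms M" for j using d_sq by (auto simp: sq_int_def)
 have d_nsq: "nsq M (d j) <= (1/4)^j" for j
  using N0[of j "r (Suc j)" "r j"] rN[of j] rmono[of j] unfolding d_def by fastforce
 have d_L1: "(\<integral>x. norm (d j x) \<partial>M) <= (1/2)^j * sqrt (measure M (space M))" for j
 proof -
  have "(\<integral>x. norm (d j x) \<partial>M)^2 <= (1/4)^j * measure M (space M)"
  using L1_le_nsq[OF d_sq[of j]] d_nsq[of j] by (meson measure_nonneg mult_right_mono order_trans)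
  also have "... = ((1/2)^j * sqrt (measure M (space M)))^2"
  proof -
  have "(1/4::real)^j = ((1/2)^j)^2" by (simp add: power2_eq_square flip: power_mult_distrib)
  then show ?thesis by (simp add: power_mult_distrib)
  qed
  finally show ?thesis by (rule power2_le_imp_le) simp
 qed
 have "AE x in M. summable (%j. norm (d j x))"
 proof -
  have "(\<integral>\<^sup>+x. (\<Sum>j. ennreal (norm (d j x))) \<partial>M) = (\<Sum>j. \<integral>\<^sup>+x. ennreal (norm (d j x)) \<partial>M)"
  by (rule nn_integral_suminf) simp
  also have "... = (\<Sum>j. ennreal (\<integral>x. norm (d j x) \<partial>M))"
  by (intro suminf_cong nn_integral_eq_integral) (auto intro!: integrable_norm[OF sq_int_integrable[OF d_sq]])
  also have "... <= (\<Sum>j. ennreal ((1/2)^j * sqrt (measure M (space M))))"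
  by (intro suminf_le ennreal_leI d_L1) auto
  also have "... = ennreal (\<Sum>j. (1/2)^j * sqrt (measure M (space M)))"
  by (intro suminf_ennreal2 summable_mult2) auto
  also have "... < \<infinity>" by simp
  finally have "AE x in M. (\<Sum>j. ennreal (norm (d j x))) ~= \<infinity>"
  by (intro nn_integral_noteq_infinite) auto
  then show ?thesis
  by eventually_elim (auto intro!: summable_suminf_not_top)
 qed
 then have conv: "AE x in M. convergent (%j. y (r j) x)"
 proof eventually_elim
  case (elim x)
  then have "summable (%j. d j x)" by (rule summable_norm_cancel)
  moreover have "(SUM i<n. d i x) = y (r n) x - y (r 0) x" for n
  unfolding d_def by (rule sum_lessThan_telescope)
  ultimately have "convergent (%n. y (r n) x - y (r 0) x)"
  by (simp add: summable_iff_convergent)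
  then have "convergent (%n. (y (r n) x - y (r 0) x) + y (r 0) x)"
  by (intro convergent_add convergent_const)
  then show ?case by simp
 qed
 define z where "z x = lim (%j. y (r j) x)" for x
 have [measurable]: "z \<in> bms M" unfolding z_def by measurable
 have lim: "AE x in M. (%j. y (r j) x) ----> z x"
  using conv by eventually_elim (simp add: z_def convergent_LIMSEQ_iff)
 have key: "integrable M (%x. (norm (y n x - z x))^2) & nsq M (%x. y n x - z x) <= e"
  if "e > 0" and n: "!!m. m \<ge> N ==> nsq M (%x. y n x - y m x) < e" for n N e
 proof -
  have "(\<integral>\<^sup>+x. ennreal ((norm (y n x - z x))^2) \<partial>M) = (\<integral>\<^sup>+x. liminf (%j. ennreal ((norm (y n x - y (r j) x))^2)) \<partial>M)"
  proof (rule nn_integral_cong_AE, use lim in eventually_elim)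
  case (elim x)
  have *: "(%j. ennreal ((norm (y n x - y (r j) x))^2)) ----> ennreal ((norm (y n x - z x))^2)"
  by (intro tendsto_ennrealI tendsto_power tendsto_norm tendsto_diff tendsto_const elim)
  show ?case by (rule lim_imp_Liminf[OF trivial_limit_sequentially *, symmetric])
  qed
  also have "... <= liminf (%j. \<integral>\<^sup>+x. ennreal ((norm (y n x - y (r j) x))^2) \<partial>M)"
  by (rule nn_integral_liminf) simp
  also have "... = liminf (%j. ennreal (nsq M (%x. y n x - y (r j) x)))"
  unfolding nsq_def using sq_int_diff[OF y y] by (subst nn_integral_eq_integral) (auto simp: sq_int_def)
  also have "... <= ennreal e"
  proof -
  have "eventually (%j. ennreal (nsq M (%x. y n x - y (r j) x)) <= ennreal e) sequentially"
  using eventually_ge_at_top[of N]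
  proof eventually_elim
  case (elim j)
  then have "N <= r j" using rj[of j] by linarith
  then show ?case using n[of "r j"] by (intro ennreal_leI) simp
  qed
  then have "liminf (%j. ennreal (nsq M (%x. y n x - y (r j) x))) <= liminf (%j. ennreal e)"
  by (rule Liminf_mono)
  then show ?thesis by (simp add: Liminf_const)
  qed
  finally have le: "(\<integral>\<^sup>+x. ennreal ((norm (y n x - z x))^2) \<partial>M) <= ennreal e" .
  then have i: "integrable M (%x. (norm (y n x - z x))^2)"
  by (subst integrable_iff_bounded) (auto intro: le_less_trans)
  moreover have "nsq M (%x. y n x - z x) <= e"
  using le i \<open>e > 0\<close> unfolding nsq_def by (subst (asm) nn_integral_eq_integral) (auto simp: ennreal_le_iff)
  ultimately show ?thesis by simp
 qed
 obtain N1 where N1: "\<forall>n\<ge>N1. \<forall>m\<ge>N1. nsq M (%x. y n x - y m x) < 1" using cau[of 1] by auto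
 have "sq_int M (%x. y N1 x - z x)"
  using key[of 1 N1 N1] N1 by (auto simp: sq_int_def)
 then have "sq_int M (%x. y N1 x - (y N1 x - z x))" by (rule sq_int_diff[OF y])
 then have "sq_int M z" by simp
 moreover have "(%n. nsq M (%x. y n x - z x)) ----> 0"
 proof (rule LIMSEQ_I)
  fix e :: real assume "e > 0"
  then obtain N where N: "\<forall>n\<ge>N. \<forall>m\<ge>N. nsq M (%x. y n x - y m x) < e/2" using cau[of "e/2"] by auto
  show "\<exists>no. \<forall>n\<ge>no. norm (nsq M (%x. y n x - z x) - 0) < e"
  proof (intro exI[of _ N] allI impI)
  fix n assume "n \<ge> N"
  then have "nsq M (%x. y n x - z x) <= e / 2" using key[of "e/2" N n] N \<open>e > 0\<close> by auto
  then show "norm (nsq M (%x. y n x - z x) - 0) < e" using nsq_nonneg[of M "%x. y n x - z x"] \<open>e > 0\<close> by simp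
  qed
 qed
 ultimately show ?thesis by blast
qed

end

section \<open>Tail convex combinations and Mazur's lemma\<close>

text \<open>That the indices start at \<open>n\<close> is what makes the combinations of a
  convergent sequence converge to the same limit, see \<open>conv_weights_tendsto\<close>.\<close>

definition conv_weights :: "nat => nat set => (nat => real) => bool" where
 "conv_weights n A c \<longleftrightarrow> finite A & A \<subseteq> {n..} & (\<forall>k\<in>A. 0 <= c k) & sum c A = 1"

lemma conv_weights_mono: "conv_weights n A c ==> m <= n ==> conv_weights m A c"
 by (auto simp: conv_weights_def)

text \<open>The new weights are chosen before \<open>g\<close>: one pair \<open>E\<close>,
  \<open>e\<close> serves every sequence. Both weight functions are extended by zero to the union of
  the index sets and averaged.\<close>

lemma conv_weights_combine:
 assumes "conv_weights n A c" "conv_weights n B d"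
 obtains E e where "conv_weights n E e"
  "!!g :: nat => 'a => 'b::real_vector. (%x. \<Sum>k\<in>E. e k *R g k x) = (%x. (1/2) *R (\<Sum>k\<in>A. c k *R g k x) + (1/2) *R (\<Sum>k\<in>B. d k *R g k x))"
proof -
 define c' where "c' k = (if k \<in> A then c k else 0)" for k
 define d' where "d' k = (if k \<in> B then d k else 0)" for k
 define e where "e k = (1/2) * c' k + (1/2) * d' k" for k
 have fin: "finite A" "finite B" using assms by (auto simp: conv_weights_def)
 have sA: "(\<Sum>k\<in>A \<union> B. c' k *R h k) = (\<Sum>k\<in>A. c k *R h k)" for h :: "nat => 'c::real_vector"
  using fin by (intro sum.mono_neutral_cong_right) (auto simp: c'_def)
 have sB: "(\<Sum>k\<in>A \<union> B. d' k *R h k) = (\<Sum>k\<in>B. d k *R h k)" for h :: "nat => 'c::real_vector"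
  using fin by (intro sum.mono_neutral_cong_right) (auto simp: d'_def)
 have "(\<Sum>k\<in>A \<union> B. e k) = 1"
  using sA[of "%_. 1::real"] sB[of "%_. 1::real"] assms
  by (simp add: e_def sum.distrib conv_weights_def flip: sum_divide_distrib)
 then have "conv_weights n (A \<union> B) e"
  using assms by (auto simp: conv_weights_def e_def c'_def d'_def)
 moreover have "(\<Sum>k\<in>A \<union> B. e k *R g k x) = (1/2) *R (\<Sum>k\<in>A. c k *R g k x) + (1/2) *R (\<Sum>k\<in>B. d k *R g k x)"
  for x and g :: "nat => 'a => 'b"
 proof -
  have "(\<Sum>k\<in>A \<union> B. e k *R g k x) = (1/2) *R (\<Sum>k\<in>A \<union> B. c' k *R g k x) + (1/2) *R (\<Sum>k\<in>A \<union> B. d' k *R g k x)"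
  by (simp add: e_def scaleR_add_left sum.distrib scaleR_sum_right)
  then show ?thesis by (simp only: sA sB)
 qed
 ultimately show ?thesis using that by blast
qed

lemma conv_weights_tendsto:
 fixes a :: "nat => 'b::real_normed_vector"
 assumes cw: "!!n. conv_weights n (A n) (c n)" and a: "a ----> l"
 shows "(%n. \<Sum>k\<in>A n. c n k *R a k) ----> l"
proof (rule LIMSEQ_I)
 fix e :: real assume "e > 0"
 then obtain N where N: "!!n. n \<ge> N ==> norm (a n - l) < e / 2" using LIMSEQ_D[OF a, of "e/2"] by auto
 show "\<exists>no. \<forall>n\<ge>no. norm ((\<Sum>k\<in>A n. c n k *R a k) - l) < e"
 proof (intro exI[of _ N] allI impI)
  fix n assume "n \<ge> N"
  have cn: "finite (A n)" "A n \<subseteq> {n..}" "\<forall>k\<in>A n. 0 <= c n k" "sum (c n) (A n) = 1"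
  using cw[of n] by (auto simp: conv_weights_def)
  have "(\<Sum>k\<in>A n. c n k *R a k) - l = (\<Sum>k\<in>A n. c n k *R (a k - l))"
  using cn by (simp add: scaleR_diff_right sum_subtractf flip: scaleR_sum_left)
  also have "norm ... <= (\<Sum>k\<in>A n. c n k * (e/2))"
  proof (rule sum_norm_le)
  fix k assume k: "k \<in> A n"
  then have "norm (a k - l) <= e / 2" using cn \<open>n \<ge> N\<close> N[of k] by force
  then show "norm (c n k *R (a k - l)) <= c n k * (e / 2)"
  using mult_left_mono[of "norm (a k - l)" "e / 2" "c n k"] cn k by auto
  qed
  also have "... = e / 2" using cn(4) by (simp only: mult_1 flip: sum_distrib_right)
  finally show "norm ((\<Sum>k\<in>A n. c n k *R a k) - l) < e" using \<open>e > 0\<close> by simp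
 qed
qed

text \<open>Jensen's inequality for the square: the weighted variance about the mean
  \<open>s\<close> is nonnegative.\<close>

lemma conv_weights_norm_sq_le:
 fixes a :: "nat => 'b::euclidean_space"
 assumes "conv_weights n A c"
 shows "(norm (\<Sum>k\<in>A. c k *R a k))^2 <= (\<Sum>k\<in>A. c k * (norm (a k))^2)"
proof -
 have c: "finite A" "\<forall>k\<in>A. 0 <= c k" "sum c A = 1" using assms by (auto simp: conv_weights_def)
 define s where "s = (\<Sum>k\<in>A. c k *R a k)"
 have "0 <= (\<Sum>k\<in>A. c k * (norm (a k - s))^2)" using c by (intro sum_nonneg) auto
 also have "... = (\<Sum>k\<in>A. c k * (norm (a k))^2 - 2 * ((c k *R a k) <.> s) + c k * (norm s)^2)"
  by (intro sum.cong refl) (simp add: power2_norm_eq_inner inner_simps inner_commute algebra_simps)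
 also have "... = (\<Sum>k\<in>A. c k * (norm (a k))^2) - 2 * (s <.> s) + (norm s)^2"
 proof -
  have "s <.> s = (\<Sum>k\<in>A. (c k *R a k) <.> s)" by (subst (1) s_def) (rule inner_sum_left)
  then show ?thesis
  unfolding sum.distrib sum_subtractf
  by (simp only: c(3) mult_1 flip: sum_distrib_left sum_distrib_right)
 qed
 finally show ?thesis by (simp add: power2_norm_eq_inner s_def)
qed

lemma conv_weights_nsq_le:
 assumes cw: "conv_weights n A c" and g: "!!k. k \<in> A ==> sq_int M (g k)" and C: "!!k. k \<in> A ==> nsq M (g k) <= C"
 shows "nsq M (%x. \<Sum>k\<in>A. c k *R g k x) <= C"
proof -
 have c: "finite A" "\<forall>k\<in>A. 0 <= c k" "sum c A = 1" using cw by (auto simp: conv_weights_def)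
 have "nsq M (%x. \<Sum>k\<in>A. c k *R g k x) <= (\<integral>x. (\<Sum>k\<in>A. c k * (norm (g k x))^2) \<partial>M)"
  unfolding nsq_def
  by (rule integral_mono) (use sq_int_sum[of A M g c] g conv_weights_norm_sq_le[OF cw] in \<open>auto simp: sq_int_def\<close>)
 also have "... = (\<Sum>k\<in>A. c k * nsq M (g k))"
  unfolding nsq_def using g by (subst Bint_sum) (auto simp: sq_int_def)
 also have "... <= (\<Sum>k\<in>A. c k * C)" using c C by (intro sum_mono mult_left_mono) auto
 also have "... = C" using c by (simp flip: sum_distrib_right)
 finally show ?thesis .
qed

text \<open>The infimum \<open>d n\<close> of the squared norm over combinations with indices from
  \<open>n\<close> on increases with \<open>n\<close> and stays below \<open>C\<close>, so it
  converges. Near-minimisers are then Cauchy: their midpoint is admissible for the smaller index,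
  and the parallelogram identity bounds their distance by the gap between \<open>d N\<close> and the
  limit of \<open>d\<close>, plus the slack.\<close>

theorem (in finite_measure) Mazur_L2:
 fixes g :: "nat => 'a => 'b::euclidean_space"
 assumes g: "!!n. sq_int M (g n)" and C: "!!n. nsq M (g n) <= C"
 shows "\<exists>z A c. sq_int M z & (\<forall>n. conv_weights n (A n) (c n)) &
  (%n. nsq M (%x. (\<Sum>k\<in>A n. c n k *R g k x) - z x)) ----> 0"
proof -
 define S where "S n = {nsq M (%x. \<Sum>k\<in>A. c k *R g k x) | A c. conv_weights n A c}" for n
 define d where "d n = Inf (S n)" for n
 have bdd: "bdd_below (S n)" for n by (rule bdd_belowI[of _ 0]) (auto simp: S_def nsq_nonneg)
 have ne: "S n ~= {}" for n
 proof -
  have "conv_weights n {n} (%_. 1)" by (auto simp: conv_weights_def)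
  then show ?thesis unfolding S_def by blast
 qed
 have Santi: "S m \<subseteq> S n" if "n <= m" for n m
  unfolding S_def using conv_weights_mono[OF _ that] by blast
 have dmono: "d n <= d m" if "n <= m" for n m
  unfolding d_def by (rule cInf_superset_mono[OF ne bdd Santi[OF that]])
 have dC: "d n <= C" for n
 proof -
  obtain s where s: "s \<in> S n" using ne by blast
  then have "s <= C" unfolding S_def using conv_weights_nsq_le g C by blast
  then show ?thesis unfolding d_def using cInf_lower[OF s bdd] by simp
 qed
 have "\<exists>d'. d ----> d'" 
  using incseq_convergent[of d C] dmono dC by (metis incseq_def)
 then obtain d' where d': "d ----> d'" by blast
 have dle: "d n <= d'" for n
  by (rule incseq_le[OF _ d']) (auto simp: incseq_def dmono)
 have "\<exists>A c. conv_weights n A c & nsq M (%x. \<Sum>k\<in>A. c k *R g k x) < d n + 1 / (rS n)" for n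
 proof -
  have "Inf (S n) < d n + 1 / (rS n)" by (simp add: d_def)
  then obtain s where "s \<in> S n" "s < d n + 1 / (rS n)"
  using cInf_lessD[OF ne] by blast
  then show ?thesis unfolding S_def by blast
 qed
 then obtain A c where cw: "!!n. conv_weights n (A n) (c n)"
  and near: "!!n. nsq M (%x. \<Sum>k\<in>A n. c n k *R g k x) < d n + 1 / (rS n)" by metis
 define y where "y n x = (\<Sum>k\<in>A n. c n k *R g k x)" for n x
 have y: "sq_int M (y n)" for n unfolding y_def by (rule sq_int_sum[OF g])
 have yy: "nsq M (%x. y n x - y m x) <= 4 * (d' - d N) + 4 / real (Suc N)" if nm: "N <= n" "N <= m" for N n m
 proof -
  obtain E e where E: "conv_weights N E e"
  "(%x. \<Sum>k\<in>E. e k *R g k x) = (%x. (1/2) *R y n x + (1/2) *R y m x)"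
  proof -
  obtain E e where E: "conv_weights N E e" and E': "!!g :: nat => 'a => 'b. (%x. \<Sum>k\<in>E. e k *R g k x)
  = (%x. (1/2) *R (\<Sum>k\<in>A n. c n k *R g k x) + (1/2) *R (\<Sum>k\<in>A m. c m k *R g k x))"
  by (rule conv_weights_combine[OF conv_weights_mono[OF cw[of n] nm(1)] conv_weights_mono[OF cw[of m] nm(2)], where ?'a = 'a and ?'b = 'b]) blast
  show thesis
  by (rule that[OF E]) (simp add: E' y_def)
  qed
  have "d N <= nsq M (%x. \<Sum>k\<in>E. e k *R g k x)"
  unfolding d_def by (rule cInf_lower[OF _ bdd]) (use E(1) S_def in blast)
  then have "d N <= nsq M (%x. (1/2) *R y n x + (1/2) *R y m x)" by (simp add: E(2))
  moreover have "nsq M (y n) <= d' + 1 / real (Suc N)"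
  proof -
  have "1 / (rS n) <= 1 / real (Suc N)" using that by (intro divide_left_mono) auto
  then show ?thesis using near[of n] dle[of n] unfolding y_def[abs_def] by linarith
  qed
  moreover have "nsq M (y m) <= d' + 1 / real (Suc N)"
  proof -
  have "1 / real (Suc m) <= 1 / real (Suc N)" using that by (intro divide_left_mono) auto
  then show ?thesis using near[of m] dle[of m] unfolding y_def[abs_def] by linarith
  qed
  ultimately have "nsq M (%x. y n x - y m x) <= 4 * (d' - d N) + 4 * (1 / real (Suc N))"
  using nsq_parallelogram[OF y y, of n m] by argo
  then show ?thesis by simp
 qed
 have "\<exists>N. \<forall>n\<ge>N. \<forall>m\<ge>N. nsq M (%x. y n x - y m x) < e" if "e > 0" for e
 proof -
  have "(%N. 4 * (d' - d N) + 4 * inverse (real (Suc N))) ----> 4 * (d' - d') + 4 * 0"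
  by (intro tendsto_intros d' LIMSEQ_inverse_real_of_nat)
  then have "eventually (%N. 4 * (d' - d N) + 4 * inverse (real (Suc N)) < e) sequentially"
  using \<open>e > 0\<close> by (intro order_tendstoD(2)) auto
  then obtain N where "4 * (d' - d N) + 4 * inverse (real (Suc N)) < e"
  by (auto simp: eventually_sequentially)
  then show ?thesis using yy[of N] by (force simp: divide_inverse)
 qed
 from L2_complete[OF y this] obtain z where "sq_int M z" "(%n. nsq M (%x. y n x - z x)) ----> 0" by blast
 then show ?thesis using cw unfolding y_def by blast
qed

section \<open>Borel and completed Lebesgue measure on subsets\<close>

text \<open>Lebesgue measure on \<open>S\<close> without completion. Products of such measures are
  of the same kind (\<open>lbo_prod\<close>), so Fubini and the measurability of sections are
  available directly; the lemmas below convert to the completed measure of the problem.\<close>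

definition lbo :: "'a::euclidean_space set => 'a measure" where
 "lbo S = restrict_space lborel S"

abbreviation "lO == lbo Omega"
abbreviation "lC T == lbo (Cyl T)"

lemma space_lbo [simp]: "space (lbo S) = S"
 by (simp add: lbo_def space_restrict_space)

lemma borel_imp_lbo: "f \<in> bms borel ==> f \<in> bms (lbo S)"
 unfolding lbo_def by (rule measurable_restrict_space1) simp

lemma lbo_measurable_iff:
 fixes f :: "'a::euclidean_space => 'b::euclidean_space"
 assumes "S \<in> sets borel"
 shows "f \<in> bms (lbo S) \<longleftrightarrow> (%x. ind S x *R f x) \<in> bms borel"
 unfolding lbo_def using assms by (subst borel_measurable_restrict_space_iff) auto

lemma integral_lbo:
 fixes f :: "'a::euclidean_space => 'b::euclidean_space"
 assumes "S \<in> sets borel"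
 shows "integral\<^sup>L (lbo S) f = (\<integral>x. ind S x *R f x \<partial>lborel)"
 unfolding lbo_def using assms by (subst integral_restrict_space) auto

lemma integrable_lbo:
 fixes f :: "'a::euclidean_space => 'b::euclidean_space"
 assumes "S \<in> sets borel"
 shows "integrable (lbo S) f \<longleftrightarrow> integrable lborel (%x. ind S x *R f x)"
 unfolding lbo_def using assms by (subst integrable_restrict_space) auto

lemma lebesgue_on_measurable:
 fixes f :: "'a::euclidean_space => 'b::euclidean_space"
 assumes "S \<in> sets borel" "f \<in> bms (lbo S)"
 shows "f \<in> bms (lebesgue_on S)"
proof -
 have "(%x. ind S x *R f x) \<in> bms lborel" using assms by (simp add: lbo_measurable_iff)
 then have "(%x. ind S x *R f x) \<in> bms lebesgue" by (rule measurable_completion)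
 then show ?thesis using assms(1) by (subst borel_measurable_restrict_space_iff) auto
qed

lemma integral_lebesgue_on:
 fixes f :: "'a::euclidean_space => 'b::euclidean_space"
 assumes "S \<in> sets borel" "f \<in> bms (lbo S)"
 shows "integral\<^sup>L (lebesgue_on S) f = integral\<^sup>L (lbo S) f"
 using assms by (simp add: integral_lbo integral_restrict_space lbo_measurable_iff integral_completion)

lemma integrable_lebesgue_on:
 fixes f :: "'a::euclidean_space => 'b::euclidean_space"
 assumes "S \<in> sets borel" "f \<in> bms (lbo S)"
 shows "integrable (lebesgue_on S) f \<longleftrightarrow> integrable (lbo S) f"
 using assms by (simp add: integrable_lbo integrable_restrict_space lbo_measurable_iff integrable_completion)

lemma AE_lebesgue_on:
 assumes "S \<in> sets borel"
 shows "(AE x in lebesgue_on S. P x) \<longleftrightarrow> (AE x in lbo S. P x)"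
 unfolding lbo_def using assms by (simp add: AE_restrict_space_iff AE_completion_iff)

text \<open>Coordinatewise reduction to the scalar fact that a function measurable for the
  completion agrees almost everywhere with a Borel function.\<close>

lemma borel_representative:
 fixes f :: "'a::euclidean_space => 'b::euclidean_space"
 assumes S: "S \<in> sets borel" and f: "f \<in> bms (lebesgue_on S)"
 obtains f' where "f' \<in> bms borel" "AE x in lbo S. f x = f' x"
proof -
 have "(%x. ind S x *R f x) \<in> bms lebesgue"
  using f S by (subst (asm) borel_measurable_restrict_space_iff) auto
 then have "(%x. (ind S x *R f x) <.> b) \<in> bms lebesgue" for b by measurable
 then have "\<forall>b. \<exists>g\<in>bms lborel. AE x in lborel. (ind S x *R f x) <.> b = g x"
  by (intro allI completion_ex_borel_measurable_real)
 then obtain g where g: "!!b. g b \<in> bms lborel" "!!b. AE x in lborel. (ind S x *R f x) <.> b = g b x"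
  by metis
 define f' where "f' x = (\<Sum>b\<in>Basis. g b x *R b)" for x
 have "f' \<in> bms borel" unfolding f'_def using g(1) by auto
 moreover have "AE x in lborel. \<forall>b\<in>Basis. (ind S x *R f x) <.> b = g b x"
  using g(2) by (subst AE_ball_countable) (auto intro: countable_finite)
 then have "AE x in lborel. ind S x *R f x = f' x"
  by eventually_elim (metis (no_types, lifting) f'_def euclidean_representation sum.cong)
 then have "AE x in lborel. x \<in> S --> f x = f' x" by eventually_elim auto
 then have "AE x in lbo S. f x = f' x" unfolding lbo_def using S by (simp add: AE_restrict_space_iff)
 ultimately show thesis using that by blast
qed

lemma L2_lbo:
 assumes "S \<in> sets borel" "f \<in> bms (lbo S)"
 shows "L2 S f \<longleftrightarrow> sq_int (lbo S) f" "L2_norm S f = sqrt (nsq (lbo S) f)"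
 using assms by (auto simp: L2_def sq_int_def L2_norm_def nsq_def integrable_lebesgue_on integral_lebesgue_on lebesgue_on_measurable)

lemma Omega_borel [simp]: "Omega \<in> sets borel" by (simp add: Omega_def)

lemma measure_lbo:
 assumes "S \<in> sets borel" shows "emeasure (lbo S) S = emeasure lborel S"
 unfolding lbo_def using assms by (subst emeasure_restrict_space) auto

lemma finite_measure_lbo_Ioo: "finite_measure (lbo {a<..<b::real})"
proof (rule finite_measureI)
 have "emeasure lborel {a<..<b} <= emeasure lborel {a..b}" by (rule emeasure_mono) auto
 also have "... < \<infinity>" by (simp add: emeasure_lborel_Icc_eq)
 finally show "emeasure (lbo {a<..<b}) (space (lbo {a<..<b})) ~= \<infinity>" by (simp add: measure_lbo)
qed

interpretation Om: finite_measure "lO"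
 unfolding Omega_def by (rule finite_measure_lbo_Ioo)

lemma measure_Omega: "measure lO Omega = 1"
 by (simp add: measure_def measure_lbo) (simp add: Omega_def)

section \<open>Fundamental lemma of the calculus of variations on the unit interval\<close>

text \<open>The positive and negative parts of \<open>h\<close> are densities of finite measures
  that agree on all rays, hence everywhere. Since \<open>ennreal\<close> truncates negative values
  to zero, \<open>ennreal (h x) = ennreal (- h x)\<close> forces \<open>h x = 0\<close>.\<close>

lemma AE_zero_of_rays:
 fixes h :: "real => real"
 assumes h: "integrable lborel h" and z: "!!y. (\<integral>x. ind {y<..} x * h x \<partial>lborel) = 0"
 shows "AE x in lborel. h x = 0"
proof -
 have [measurable]: "h \<in> bms borel" using h by auto
 have em: "emeasure (density lborel (%x. ennreal (k x))) {y<..} = ennreal (\<integral>x. max 0 (ind {y<..} x * k x) \<partial>lborel)"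
  if k: "integrable lborel k" for k :: "real => real" and y
 proof -
  have [measurable]: "k \<in> bms borel" using k by auto
  have "integrable lborel (%x. ind {y<..} x * k x)" using integrable_mult_indicator[OF _ k, of "{y<..}"] by simp
  then have i: "integrable lborel (%x. max 0 (ind {y<..} x * k x))" by auto
  have "emeasure (density lborel (%x. ennreal (k x))) {y<..} = (\<integral>\<^sup>+x. ennreal (k x) * ind {y<..} x \<partial>lborel)"
  by (simp add: emeasure_density)
  also have "... = (\<integral>\<^sup>+x. ennreal (max 0 (ind {y<..} x * k x)) \<partial>lborel)"
  by (intro nn_integral_cong) (auto simp: indicator_def max_def ennreal_neg)
  also have "... = ennreal (\<integral>x. max 0 (ind {y<..} x * k x) \<partial>lborel)"
  by (rule nn_integral_eq_integral[OF i]) auto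
  finally show ?thesis .
 qed
 have ih: "integrable lborel (%x. ind {y<..} x * h x)" for y
  using integrable_mult_indicator[OF _ h, of "{y<..}"] by simp
 have "density lborel (%x. ennreal (h x)) = density lborel (%x. ennreal (- h x))"
 proof (rule measure_eqI_lessThan)
  fix y
  show "emeasure (density lborel (%x. ennreal (h x))) {y<..} < \<infinity>" by (simp add: em[OF h])
  have "(\<integral>x. max 0 (ind {y<..} x * h x) \<partial>lborel) - (\<integral>x. max 0 (ind {y<..} x * (- h x)) \<partial>lborel)
  = (\<integral>x. max 0 (ind {y<..} x * h x) - max 0 (ind {y<..} x * (- h x)) \<partial>lborel)"
  using ih by (subst Bint_diff) auto
  also have "... = (\<integral>x. ind {y<..} x * h x \<partial>lborel)"
  by (intro Bint_cong) auto
  finally show "emeasure (density lborel (%x. ennreal (h x))) {y<..} = emeasure (density lborel (%x. ennreal (- h x))) {y<..}"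
  using z[of y] h by (simp add: em)
 qed auto
 then have "AE x in lborel. ennreal (h x) = ennreal (- h x)"
 proof (subst (asm) finite_density_unique)
  have "(\<integral>\<^sup>+x. ennreal (h x) \<partial>lborel) <= (\<integral>\<^sup>+x. ennreal (norm (h x)) \<partial>lborel)"
  by (intro nn_integral_mono ennreal_leI) auto
  also have "... < \<infinity>" using h by (simp add: integrable_iff_bounded)
  finally show "(\<integral>\<^sup>+x. ennreal (h x) \<partial>lborel) ~= \<infinity>" by simp
 qed auto
 then show ?thesis
 proof eventually_elim
  case (elim x)
  then show ?case by (cases "h x \<ge> 0") (auto simp: ennreal_neg not_le)
 qed
qed

lemma norm_scaleR_le_one: "0 <= s ==> s <= 1 ==> norm (s *R v) <= norm v"
 by (simp add: mult_left_le_one_le)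

lemma test_bump:
 assumes "a < b" "{a..b} \<subseteq> S" "n > 0"
 shows "test_function S (%x. bump n ((x - a) / (b - a)))"
proof (rule Dk_test_function[where K = "{a..b}"])
 fix k
 have "Dk k (%x. bump n ((1 / (b - a)) * x + (- a / (b - a))))" by (rule Dk_affine[OF Dk_bump])
 then show "Dk k (%x. bump n ((x - a) / (b - a)))" by (simp add: diff_divide_distrib)
next
 fix x assume "x \<notin> {a..b}"
 then show "bump n ((x - a) / (b - a)) = 0"
  using assms by (intro bump_zero') (auto simp: field_simps)
qed (use assms in auto)

lemma test_function_continuous: "test_function S ph ==> continuous_on UNIV ph"
 unfolding test_function_def smooth_on_def
 by (metis Ck.simps(1) top.extremum_uniqueI)

text \<open>\<open>g\<close> is controlled on the compact set \<open>K\<close> alone, which is all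
  that local integrability provides.\<close>

lemma compact_mult_integrable:
 fixes g :: "'a::euclidean_space => 'b::euclidean_space" and ph :: "'a => real"
 assumes ph: "continuous_on UNIV ph" "compact K" "K \<subseteq> S" "!!x. x \<notin> K ==> ph x = 0" and g: "integrable (lebesgue_on K) g" and S: "S \<in> sets borel"
 shows "integrable (lebesgue_on S) (%x. ph x *R g x)"
  "(LINT x|lebesgue_on S. ph x *R g x) = (LINT x|lebesgue_on K. ph x *R g x)"
proof -
 have Kb: "K \<in> sets borel" using ph(2) by (simp add: compact_imp_closed borel_closed)
 have "compact (ph ` K)" using ph(1,2) continuous_on_subset by (blast intro: compact_continuous_image)
 then obtain C where C: "!!x. x \<in> K ==> norm (ph x) <= C" by (meson bounded_iff compact_imp_bounded imageI)
 have [measurable]: "ph \<in> bms (lebesgue_on K)"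
  using ph(1) Kb by (intro lebesgue_on_measurable borel_imp_lbo borel_measurable_continuous_onI)
 have [measurable]: "g \<in> bms (lebesgue_on K)" using g by auto
 have "integrable (lebesgue_on K) (%x. C *R norm (g x))" using g by auto
 then have "integrable (lebesgue_on K) (%x. ph x *R g x)"
 proof (rule Bitg_bound)
  show "AE x in lebesgue_on K. norm (ph x *R g x) <= norm (C *R norm (g x))"
  proof (rule AE_I2)
  fix x assume "x \<in> space (lebesgue_on K)"
  then have "norm (ph x) <= \<bar>C\<bar>" using C[of x] by simp
  then show "norm (ph x *R g x) <= norm (C *R norm (g x))"
  by (simp add: abs_mult mult_right_mono)
  qed
 qed measurable
 moreover have eq: "(%x. ind S x *R (ph x *R g x)) = (%x. ind K x *R (ph x *R g x))"
 proof (rule ext)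
  fix x show "ind S x *R (ph x *R g x) = ind K x *R (ph x *R g x)"
  using ph(3) ph(4)[of x] by (cases "x \<in> K") auto
 qed
 ultimately show "integrable (lebesgue_on S) (%x. ph x *R g x)"
  using S Kb by (simp add: integrable_restrict_space eq del: scaleR_scaleR)
 show "(LINT x|lebesgue_on S. ph x *R g x) = (LINT x|lebesgue_on K. ph x *R g x)"
  using S Kb eq by (simp add: integral_restrict_space del: scaleR_scaleR)
qed

lemma test_mult_integrable:
 fixes g :: "'a::euclidean_space => 'b::euclidean_space" and ph :: "'a => real"
 assumes "test_function S ph" "locally_integrable S g" "S \<in> sets borel"
 shows "integrable (lebesgue_on S) (%x. ph x *R g x)"
proof -
 obtain K where K: "compact K" "K \<subseteq> S" "!!p. p \<notin> K ==> ph p = 0" using assms unfolding test_function_def by blast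
 then have "integrable (lebesgue_on K) g" using assms(2) by (auto simp: locally_integrable_def)
 then show ?thesis using compact_mult_integrable(1)[OF test_function_continuous[OF assms(1)] K _ assms(3)] by blast
qed

lemma bump_affine_tendsto:
 assumes "a < b"
 shows "(%n. bump (Suc n) ((x - a) / (b - a))) ----> ind {a<..<b} x"
proof -
 have "ind {0<..<1} ((x - a) / (b - a)) = (ind {a<..<b} x :: real)"
  using assms by (auto simp: indicator_def field_simps)
 then show ?thesis using LIMSEQ_Suc[OF bump_tendsto[of "(x - a) / (b - a)"]] by simp
qed

text \<open>On a compact interval {c..d} the bumps over (a, d) turn into the indicator of (a, d) by
  dominated convergence, so all ray integrals of \<open>h\<close> cut to {c..d} vanish and
  \<open>AE_zero_of_rays\<close> applies coordinatewise. Countably many such intervals exhaust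
  \<open>Omega\<close>.\<close>

lemma fundamental_lemma:
 fixes h :: "real => 'b::euclidean_space"
 assumes loc: "locally_integrable Omega h"
  and test: "!!ph. test_function Omega ph ==> (LINT x|lebesgue_on Omega. ph x *R h x) = 0"
 shows "AE x in lebesgue_on Omega. h x = 0"
proof -
 have loc': "AE x in lborel. x \<in> {c..d} --> h x = 0" if cd: "0 < c" "c < d" "d < 1" for c d
 proof -
  have ih: "integrable (lebesgue_on {c..d}) h"
  proof -
  have "compact {c..d}" "{c..d} \<subseteq> Omega" using cd by (auto simp: Omega_def)
  then show ?thesis using loc unfolding locally_integrable_def by blast
  qed
  obtain h' where h': "h' \<in> bms borel" "AE x in lbo {c..d}. h x = h' x"
  proof -
  have S: "{c..d} \<in> sets borel" by simp
  show thesis by (rule borel_representative[OF S borel_measurable_integrable[OF ih]]) (rule that)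
  qed
  have [measurable]: "h' \<in> bms borel" by fact
  have h'ae: "AE x in lebesgue_on {c..d}. h x = h' x" using h' by (simp add: AE_lebesgue_on)
  have "integrable (lebesgue_on {c..d}) h'"
  by (rule integrable_cong_AE_imp[OF ih]) (use h'ae in \<open>auto intro!: lebesgue_on_measurable borel_imp_lbo\<close>)
  then have ih': "integrable lborel (%x. ind {c..d} x *R h' x)"
  by (simp add: integrable_lebesgue_on borel_imp_lbo integrable_lbo)
  have bumps: "(\<integral>x. bump n ((x - a) / (d - a)) *R (ind {c..d} x *R h' x) \<partial>lborel) = 0"
  if a: "c <= a" "a < d" and n: "n > 0" for a n
  proof -
  let ?ph = "%x. bump n ((x - a) / (d - a))"
  have cont: "continuous_on UNIV ?ph"
  using test_function_continuous[OF test_bump[of a d UNIV n]] a n by simp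
  have mph: "?ph \<in> bms borel" using cont by (rule borel_measurable_continuous_onI)
  have tf: "test_function Omega ?ph" using a cd n by (intro test_bump) (auto simp: Omega_def)
  have sub: "{c..d} \<subseteq> Omega" using cd by (auto simp: Omega_def)
  have z: "x \<notin> {c..d} ==> ?ph x = 0" for x using a by (intro bump_zero') (auto simp: field_simps)
  have "(LINT x|lebesgue_on Omega. ?ph x *R h x) = (LINT x|lebesgue_on {c..d}. ?ph x *R h x)"
  by (rule compact_mult_integrable(2)[OF cont _ sub z ih]) auto
  also have "... = (LINT x|lebesgue_on {c..d}. ?ph x *R h' x)"
  proof (rule integral_cong_AE)
  have [measurable]: "?ph \<in> bms (lebesgue_on {c..d})" "h' \<in> bms (lebesgue_on {c..d})"
  by (auto intro!: lebesgue_on_measurable borel_imp_lbo mph)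
  have [measurable]: "h \<in> bms (lebesgue_on {c..d})" using ih by (rule borel_measurable_integrable)
  show "(%x. ?ph x *R h x) \<in> bms (lebesgue_on {c..d})"
  "(%x. ?ph x *R h' x) \<in> bms (lebesgue_on {c..d})" by measurable
  show "AE x in lebesgue_on {c..d}. ?ph x *R h x = ?ph x *R h' x"
  using h'ae by eventually_elim simp
  qed
  also have "... = (LINT x|lbo {c..d}. ?ph x *R h' x)"
  by (rule integral_lebesgue_on) (use mph in \<open>auto intro!: borel_imp_lbo borel_measurable_scaleR\<close>)
  also have "... = (\<integral>x. ?ph x *R (ind {c..d} x *R h' x) \<partial>lborel)"
  by (subst integral_lbo) (auto simp: mult.commute)
  finally show ?thesis using test[OF tf] by simp
  qed
  have Ioo: "(\<integral>x. ind {a<..<d} x *R (ind {c..d} x *R h' x) \<partial>lborel) = 0"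
  if a: "c <= a" "a < d" for a
  proof -
  have "(%n. \<integral>x. bump (Suc n) ((x - a) / (d - a)) *R (ind {c..d} x *R h' x) \<partial>lborel)
  ----> (\<integral>x. ind {a<..<d} x *R (ind {c..d} x *R h' x) \<partial>lborel)"
  proof (rule integral_dominated_convergence[where w = "%x. norm (ind {c..d} x *R h' x)"])
  have "(%x. bump (Suc n) ((x - a) / (d - a))) \<in> bms borel" for n
  using test_function_continuous[OF test_bump[of a d UNIV "Suc n"]] a by (intro borel_measurable_continuous_onI) simp
  then show "(%x. bump (Suc n) ((x - a) / (d - a)) *R (ind {c..d} x *R h' x)) \<in> bms lborel" for n
  by measurable
  show "AE x in lborel. (%n. bump (Suc n) ((x - a) / (d - a)) *R (ind {c..d} x *R h' x))
  ----> ind {a<..<d} x *R (ind {c..d} x *R h' x)"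
  using a by (intro AE_I2 tendsto_scaleR bump_affine_tendsto tendsto_const) auto
  show "AE x in lborel. norm (bump (Suc n) ((x - a) / (d - a)) *R (ind {c..d} x *R h' x)) <= norm (ind {c..d} x *R h' x)" for n
  by (intro AE_I2 norm_scaleR_le_one bump_bounds)
  show "integrable lborel (%x. norm (ind {c..d} x *R h' x))" using ih' by (rule integrable_norm)
  qed measurable
  then show ?thesis using bumps[OF a] by (simp add: LIMSEQ_const_iff)
  qed
  have hb: "AE x in lborel. (ind {c..d} x *R h' x) <.> b = 0" for b
  proof (rule AE_zero_of_rays)
  show "integrable lborel (%x. (ind {c..d} x *R h' x) <.> b)"
  using ih' by (rule integrable_inner_left)
  fix y
  show "(\<integral>x. ind {y<..} x * ((ind {c..d} x *R h' x) <.> b) \<partial>lborel) = 0"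
  proof (cases "y < d")
  case True
  define a where "a = max y c"
  have a: "c <= a" "a < d" using True cd by (auto simp: a_def)
  have "(\<integral>x. ind {y<..} x * ((ind {c..d} x *R h' x) <.> b) \<partial>lborel)
  = (\<integral>x. (ind {a<..<d} x *R (ind {c..d} x *R h' x)) <.> b \<partial>lborel)"
  proof (rule integral_cong_AE)
  have "AE x in lborel. x ~= d" "AE x in lborel. x ~= c" using AE_lborel_singleton by auto
  then show "AE x in lborel. ind {y<..} x * ((ind {c..d} x *R h' x) <.> b) = (ind {a<..<d} x *R (ind {c..d} x *R h' x)) <.> b"
  by eventually_elim (auto simp: indicator_def a_def)
  qed auto
  also have "... = (\<integral>x. (ind {a<..<d} x *R (ind {c..d} x *R h' x)) \<partial>lborel) <.> b"
  by (rule integral_inner_left, rule integrable_mult_indicator[OF _ ih']) simp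
  also have "... = 0" by (simp only: Ioo[OF a] inner_zero_left)
  finally show ?thesis .
  next
  case False
  then have "(\<integral>x. ind {y<..} x * ((ind {c..d} x *R h' x) <.> b) \<partial>lborel) = (\<integral>x. 0 \<partial>(lborel::real measure))"
  by (intro Bint_cong refl) (auto simp: indicator_def)
  then show ?thesis by simp
  qed
  qed
  have "AE x in lborel. \<forall>b\<in>Basis. (ind {c..d} x *R h' x) <.> b = 0"
  using hb by (subst AE_ball_countable[OF countable_finite[OF finite_Basis]]) blast
  then have "AE x in lborel. x \<in> {c..d} --> h' x = 0"
  by eventually_elim (metis euclidean_all_zero_iff indicator_simps(1) scaleR_one)
  moreover have "AE x in lborel. x \<in> {c..d} --> h x = h' x"
  using h'(2) unfolding lbo_def by (simp add: AE_restrict_space_iff)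
  ultimately show ?thesis by eventually_elim simp
 qed
 \<comment> \<open>The shift by 3 keeps every interval of the exhaustion nondegenerate, as
   \<open>loc'\<close> demands.\<close>
 have "AE x in lborel. \<forall>n::nat. x \<in> {1 / real (n + 3)..1 - 1 / real (n + 3)} --> h x = 0"
  unfolding AE_all_countable
 proof (intro allI loc')
  fix n :: nat
  have "1 / real (n + 3) <= 1 / 3" by (intro divide_left_mono) auto
  then show "1 / real (n + 3) < 1 - 1 / real (n + 3)" by linarith
 qed auto
 then have "AE x in lborel. x \<in> Omega --> h x = 0"
 proof eventually_elim
  case (elim x)
  show ?case
  proof
  assume "x \<in> Omega"
  then have x: "0 < x" "x < 1" by (auto simp: Omega_def)
  then obtain n where n: "inverse (rS n) < min x (1 - x)" using reals_Archimedean[of "min x (1 - x)"] by auto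
  have "1 / real (n + 3) <= inverse (rS n)" by (simp add: field_simps)
  then show "h x = 0" using elim[rule_format, of n] n by auto
  qed
 qed
 then show ?thesis unfolding AE_lebesgue_on[OF Omega_borel] lbo_def by (simp add: AE_restrict_space_iff)
qed

section \<open>Primitives on the unit interval and integration by parts\<close>

lemma integrable_pair_snd:
 fixes g :: "'b => 'c::euclidean_space"
 assumes M1: "finite_measure M1" and M2: "finite_measure M2" and g: "integrable M2 g"
 shows "integrable (M1 OX M2) (%p. g (snd p))"
proof -
 interpret M1: finite_measure M1 by fact
 interpret M2: finite_measure M2 by fact
 interpret pair_sigma_finite M1 M2 by unfold_locales
 have [measurable]: "g \<in> bms M2" using g by auto
 show ?thesis
  by (rule Fubini_integrable) (use g in auto)
qed

lemma FTC_lbo: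
 fixes ph :: "real => real"
 assumes d: "!!x. x \<in> {0..1} ==> (ph has_real_derivative ph' x) (at x within {0..1})"
  and c: "continuous_on {0..1} ph'" and ab: "0 <= a" "a <= b" "b <= 1"
 shows "(LINT x|lO. ind {a<..<b} x * ph' x) = ph b - ph a"
proof -
 have "(LINT x|lO. ind {a<..<b} x * ph' x) = (\<integral>x. ind Omega x *R (ind {a<..<b} x * ph' x) \<partial>lborel)"
  by (rule integral_lbo) simp
 also have "... = (\<integral>x. ind {a..b} x *R ph' x \<partial>lborel)"
 proof (rule integral_cong_AE)
  have "(%x. ind {a..b} x *R ph' x) \<in> bms borel"
  by (rule borel_measurable_continuous_on_indicator[OF _ continuous_on_subset[OF c]]) (use ab in auto)
  then show m: "(%x. ind {a..b} x *R ph' x) \<in> bms lborel" by simp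
  have "(%x. ind {a<..<b} x *R (ind {a..b} x *R ph' x)) \<in> bms lborel"
  using m by measurable
  moreover have "(%x. ind {a<..<b} x *R (ind {a..b} x *R ph' x)) = (%x. ind Omega x *R (ind {a<..<b} x * ph' x))"
  using ab by (auto simp: indicator_def Omega_def fun_eq_iff)
  ultimately show "(%x. ind Omega x *R (ind {a<..<b} x * ph' x)) \<in> bms lborel" by simp
  have "AE x in lborel. x ~= a" "AE x in lborel. x ~= b" using AE_lborel_singleton by auto
  then show "AE x in lborel. ind Omega x *R (ind {a<..<b} x * ph' x) = ind {a..b} x *R ph' x"
  by eventually_elim (use ab in \<open>auto simp: indicator_def Omega_def\<close>)
 qed
 also have "... = ph b - ph a"
 proof (rule integral_FTC_Icc[OF ab(2)])
  fix x assume "a <= x" "x <= b"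
  then show "(ph has_vector_derivative ph' x) (at x within {a..b})"
  using DERIV_subset[OF d[of x], of "{a..b}"] ab by (auto simp: has_real_derivative_iff_has_vector_derivative)
 next
  show "continuous_on {a..b} ph'" by (rule continuous_on_subset[OF c]) (use ab in auto)
 qed
 finally show ?thesis .
qed

text \<open>The Sobolev function with left trace \<open>c\<close> and weak derivative
  \<open>g\<close>, made total: integration runs over the part of \<open>Omega\<close> to the left
  of x, so the value is \<open>c\<close> for x <= 0 and constant for x >= 1. Primitives replace the
  theory of absolutely continuous representatives.\<close>

definition prim :: "'b => (real => 'b::euclidean_space) => real => 'b" where
 "prim c g x = c + (LINT y|lO. ind {..<x} y *R g y)"

lemma prim_ge1: "1 <= x ==> prim c g x = c + (LINT y|lO. g y)"
 unfolding prim_def by (intro arg_cong2[where f = "(+)"] refl Bint_cong) (auto simp: Omega_def)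

lemma prim_le0: "x <= 0 ==> prim c g x = c"
proof -
 assume "x <= 0"
 then have "(LINT y|lO. ind {..<x} y *R g y) = (LINT y|lO. 0)"
  by (intro Bint_cong) (auto simp: Omega_def)
 then show ?thesis by (simp add: prim_def)
qed

lemma indicator_integrable_lbo:
 fixes g :: "real => 'b::euclidean_space"
 assumes "integrable lO g"
 shows "integrable lO (%y. ind {..<x} y *R g y)"
proof -
 have [measurable]: "g \<in> bms lO" using assms by auto
 have [measurable]: "ind {..<x} \<in> bms lO" by (rule borel_imp_lbo) simp
 show ?thesis
 proof (rule Bitg_bound[OF assms])
  show "AE y in lO. norm (ind {..<x} y *R g y) <= norm (g y)"
  by (intro AE_I2 norm_scaleR_le_one) (auto simp: indicator_def)
 qed measurable
qed

lemma prim_norm_le: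
 assumes "integrable lO g"
 shows "norm (prim c g x) <= norm c + (LINT y|lO. norm (g y))"
proof -
 have "norm (LINT y|lO. ind {..<x} y *R g y) <= (LINT y|lO. norm (g y))"
  by (rule Bochner_Integration.integral_norm_bound_integral[OF indicator_integrable_lbo[OF assms]]) (use assms in \<open>auto simp: indicator_def\<close>)
 then show ?thesis unfolding prim_def using norm_triangle_ineq[of c] by (smt (verit))
qed

lemma prim_measurable:
 fixes g :: "real => 'b::euclidean_space"
 assumes [measurable]: "g \<in> bms lO"
 shows "prim c g \<in> bms borel"
proof -
 have [measurable]: "(%p. snd p :: real) \<in> bms (borel OX lO)"
  by (rule measurable_compose[OF measurable_snd]) (rule borel_imp_lbo, simp)
 have "(%x. LINT y|lO. ind {..<x} y *R g y) \<in> bms borel"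
 proof (rule Om.borel_measurable_lebesgue_integral)
  have "(%p. ind {p. snd p < fst p} p *R g (snd p)) \<in> bms (borel OX lO)"
  by measurable
  then show "(%(x, y). ind {..<x} y *R g y) \<in> bms (borel OX lO)"
  by (simp add: indicator_def case_prod_beta)
 qed
 then show ?thesis unfolding prim_def by measurable
qed

text \<open>Fubini on the triangle y < x: for fixed y the integral of \<open>ph'\<close> over (y, 1)
  is \<open>ph 1 - ph y\<close>.\<close>

lemma prim_by_parts:
 fixes ph :: "real => real" and g :: "real => 'b::euclidean_space"
 assumes d: "!!x. x \<in> {0..1} ==> (ph has_real_derivative ph' x) (at x within {0..1})"
  and c: "continuous_on {0..1} ph'" and g: "integrable lO g"
 shows "(LINT x|lO. ph' x *R prim a g x) = ph 1 *R prim a g 1 - ph 0 *R a - (LINT x|lO. ph x *R g x)"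
proof -
 interpret pair_sigma_finite "lO" "lO" by unfold_locales
 have [measurable]: "g \<in> bms lO" using g by auto
 have "compact (ph' ` {0..1})" using c by (intro compact_continuous_image) auto
 then obtain C where C: "!!x. x \<in> {0..1} ==> \<bar>ph' x\<bar> <= C" by (metis bounded_iff compact_imp_bounded imageI real_norm_def)
 have cph: "continuous_on {0..1} ph" using d by (meson DERIV_continuous_on)
 have meas: "f \<in> bms lO" if "continuous_on {0..1} f" for f :: "real => real"
 proof -
  have "(%x. ind {0..1} x *R f x) \<in> bms borel"
  by (rule borel_measurable_continuous_on_indicator) (use that in auto)
  then have "(%x. ind {0..1} x *R f x) \<in> bms lO" by (rule borel_imp_lbo)
  then show ?thesis by (rule measurable_cong[THEN iffD1, rotated]) (auto simp: Omega_def)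
 qed
 have [measurable]: "ph' \<in> bms lO" "ph \<in> bms lO" using meas c cph by auto
 have [measurable]: "(%p. snd p :: real) \<in> bms (lO OX lO)"
  "(%p. fst p :: real) \<in> bms (lO OX lO)"
  by (auto intro!: measurable_compose[OF measurable_snd] measurable_compose[OF measurable_fst] borel_imp_lbo)
 have iph': "integrable lO ph'"
 proof (rule Om.sq_int_integrable[OF Om.sq_int_bounded])
  show "norm (ph' x) <= C" if "x \<in> space lO" for x using C[of x] that by (auto simp: Omega_def)
 qed measurable
 define F where "F p = (ind {p. snd p < fst p} p * ph' (fst p)) *R g (snd p)" for p
 have iF: "integrable (lO OX lO) F"
 proof (rule Bitg_bound)
  show "integrable (lO OX lO) (%p. C *R g (snd p))"
  by (intro integrable_scaleR_right integrable_pair_snd g Om.finite_measure_axioms)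
  show "F \<in> bms (lO OX lO)" unfolding F_def by measurable
  show "AE p in lO OX lO. norm (F p) <= norm (C *R g (snd p))"
  proof (rule AE_I2)
  fix p assume "p \<in> space (lO OX lO)"
  then have "fst p \<in> {0..1}" by (auto simp: space_pair_measure Omega_def)
  then have "\<bar>ph' (fst p)\<bar> <= \<bar>C\<bar>" using C by fastforce
  then show "norm (F p) <= norm (C *R g (snd p))"
  unfolding F_def by (auto simp: indicator_def intro!: mult_right_mono)
  qed
 qed
 have "(LINT x|lO. ph' x *R prim a g x)
  = (LINT x|lO. ph' x *R a + ph' x *R (LINT y|lO. ind {..<x} y *R g y))"
  by (simp add: prim_def scaleR_add_right)
 also have "... = (LINT x|lO. ph' x *R a + (LINT y|lO. F (x, y)))"
  by (intro Bint_cong refl arg_cong2[where f = "(+)"])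
  (simp add: F_def indicator_def mult.commute flip: integral_scaleR_right scaleR_scaleR)
 also have "... = (LINT x|lO. ph' x *R a) + (LINT x|lO. (LINT y|lO. F (x, y)))"
  by (rule Bint_add) (use iph' integrable_fst'[OF iF] in auto)
 also have "(LINT x|lO. (LINT y|lO. F (x, y))) = (LINT y|lO. (LINT x|lO. F (x, y)))"
  using Fubini_integral[of "%x y. F (x, y)"] iF by simp
 also have "... = (LINT y|lO. ph 1 *R g y - ph y *R g y)"
 proof (rule Bint_cong[OF refl])
  fix y assume "y \<in> space lO"
  then have y: "0 <= y" "y <= 1" by (auto simp: Omega_def)
  have "(LINT x|lO. F (x, y)) = (LINT x|lO. ind {y<..<1} x * ph' x) *R g y"
  proof -
  have [measurable]: "ind {y<..<1} \<in> bms lO" by (rule borel_imp_lbo) simp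
  have "integrable lO (%x. ind {y<..<1} x * ph' x)"
  proof (rule Bitg_bound[OF iph'])
  show "AE x in lO. norm (ind {y<..<1} x * ph' x) <= norm (ph' x)"
  by (intro AE_I2) (auto simp: indicator_def)
  qed measurable
  then have "(LINT x|lO. ind {y<..<1} x * ph' x) *R g y = (LINT x|lO. (ind {y<..<1} x * ph' x) *R g y)"
  by simp
  also have "... = (LINT x|lO. F (x, y))"
  by (rule Bint_cong) (auto simp: F_def indicator_def Omega_def)
  finally show ?thesis by simp
  qed
  then show "(LINT x|lO. F (x, y)) = ph 1 *R g y - ph y *R g y"
  using FTC_lbo[OF d c y(1) y(2), of] y by (simp add: scaleR_diff_left)
 qed
 also have "... = ph 1 *R (LINT y|lO. g y) - (LINT y|lO. ph y *R g y)"
 proof (subst Bint_diff)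
  have "compact (ph ` {0..1})" using cph by (intro compact_continuous_image) auto
  then obtain D where D: "!!x. x \<in> {0..1} ==> \<bar>ph x\<bar> <= D" by (metis bounded_iff compact_imp_bounded imageI real_norm_def)
  have "integrable lO (%y. D *R g y)" using g by auto
  then show "integrable lO (%y. ph y *R g y)"
  proof (rule Bitg_bound)
  show "AE y in lO. norm (ph y *R g y) <= norm (D *R g y)"
  proof (rule AE_I2)
  fix y assume "y \<in> space lO"
  then have "\<bar>ph y\<bar> <= \<bar>D\<bar>" using D[of y] by (auto simp: Omega_def)
  then show "norm (ph y *R g y) <= norm (D *R g y)" by (simp add: mult_right_mono)
  qed
  qed measurable
 qed (use g in auto)
 also have "(LINT x|lO. ph' x *R a) = (ph 1 - ph 0) *R a"
 proof -
  have "(LINT x|lO. ph' x) = (LINT x|lO. ind {0<..<1} x * ph' x)"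
  by (rule Bint_cong) (auto simp: Omega_def)
  also have "... = ph 1 - ph 0" by (rule FTC_lbo[OF d c]) auto
  finally show ?thesis using iph' by simp
 qed
 finally show ?thesis by (simp add: prim_ge1 scaleR_add_right scaleR_diff_left)
qed

lemma test_function_deriv:
 fixes ph :: "real => real"
 assumes "test_function S ph"
 shows "(ph has_real_derivative dir_deriv 1 ph x) (at x)" "continuous_on UNIV (dir_deriv 1 ph)"
proof -
 obtain U where "UNIV \<subseteq> U" "\<forall>k. Ck k U ph" using assms unfolding test_function_def smooth_on_def by blast
 then have "Ck (Suc 0) UNIV ph" by (metis top.extremum_uniqueI)
 then have c: "continuous_on UNIV (dir_deriv 1 ph)" and d: "ph differentiable (at x)" for x by auto
 show "continuous_on UNIV (dir_deriv 1 ph)" by fact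
 obtain D where D: "(ph has_real_derivative D) (at x)" using d real_differentiable_def by blast
 then show "(ph has_real_derivative dir_deriv 1 ph x) (at x)" using dir_deriv_real[OF D, of 1] by simp
qed

lemma locally_integrable_lbo:
 fixes g :: "'a::euclidean_space => 'b::euclidean_space"
 assumes S: "S \<in> sets borel" and g: "integrable (lbo S) g"
 shows "locally_integrable S g"
 unfolding locally_integrable_def
proof (intro allI impI, elim conjE)
 fix K assume K: "compact K" "K \<subseteq> S"
 have Kb: "K \<in> sets borel" using K(1) by (simp add: compact_imp_closed borel_closed)
 have "integrable lborel (%x. ind K x *R (ind S x *R g x))"
  using g S Kb by (subst (asm) integrable_lbo[OF S], elim integrable_mult_indicator[rotated]) simp
 moreover have "(%x. ind K x *R (ind S x *R g x)) = (%x. ind K x *R g x)"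
  using K(2) by (auto simp: indicator_def fun_eq_iff)
 ultimately have "integrable (lbo K) g" using Kb by (simp add: integrable_lbo)
 then show "integrable (lebesgue_on K) g" using Kb by (subst integrable_lebesgue_on) auto
qed

lemma integrable_prim:
 assumes "integrable lO g"
 shows "sq_int lO (prim c g)"
 by (rule Om.sq_int_bounded[OF borel_imp_lbo[OF prim_measurable] prim_norm_le]) (use assms in auto)

lemma has_weak_deriv_prim:
 fixes g :: "real => 'b::euclidean_space"
 assumes g: "integrable lO g"
 shows "has_weak_deriv Omega 1 (prim c g) g"
 unfolding has_weak_deriv_def
proof (intro conjI allI impI)
 show "locally_integrable Omega g" "locally_integrable Omega (prim c g)"
  by (auto intro!: locally_integrable_lbo g Om.sq_int_integrable[OF integrable_prim])
 fix ph :: "real => real" assume t: "test_function Omega ph"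
 then have z: "ph 0 = 0" "ph 1 = 0" unfolding test_function_def Omega_def by force+
 have [measurable]: "g \<in> bms lO" using g by auto
 have [measurable]: "prim c g \<in> bms lO" by (rule borel_imp_lbo[OF prim_measurable]) simp
 have [measurable]: "ph \<in> bms lO" "dir_deriv 1 ph \<in> bms lO"
  using test_function_continuous[OF t] test_function_deriv(2)[OF t] by (auto intro!: borel_imp_lbo borel_measurable_continuous_onI)
 have "(LINT x|lO. dir_deriv 1 ph x *R prim c g x) = ph 1 *R prim c g 1 - ph 0 *R c - (LINT x|lO. ph x *R g x)"
  by (rule prim_by_parts[OF _ _ g])
  (use test_function_deriv[OF t] in \<open>auto intro: has_field_derivative_at_within continuous_on_subset\<close>)
 then show "(LINT p|lebesgue_on Omega. dir_deriv 1 ph p *R prim c g p) = - (LINT p|lebesgue_on Omega. ph p *R g p)"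
  by (subst (1 2) integral_lebesgue_on) (auto simp: z)
qed

section \<open>Minimisation in finite dimension\<close>

text \<open>First variation: along a line through a minimiser the functionals used below change by
  such a polynomial. Its minimum is at s = 0, so the linear coefficient, the Euler-Lagrange
  expression, is zero.\<close>

lemma min_quartic_zero:
 fixes A :: real
 assumes "!!s. 0 <= s * A + s^2 * B + s^3 * C + s^4 * D"
 shows "A = 0"
proof -
 let ?f = "%s. s * A + s^2 * B + s^3 * C + s^4 * D"
 have "(?f has_real_derivative A) (at 0)"
  by (auto intro!: derivative_eq_intros)
 then show ?thesis
  by (rule DERIV_local_min[where d = 1]) (use assms in auto)
qed

text \<open>Grid functions are sequences supported in \<open>I\<close>, so the product topology
  applies: a box is compact by Tychonoff, and coercivity puts every point outside it above the value
  at zero.\<close>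

lemma finite_dim_minimizer:
 fixes J :: "(nat => 'a::euclidean_space) => real"
 assumes cont: "continuous_on UNIV J" and c: "c > 0" and I: "finite I"
  and coer: "!!x. (!!i. i \<notin> I ==> x i = 0) ==> J x \<ge> (\<Sum>i\<in>I. c * (norm (x i))^2) - D"
 obtains x where "!!i. i \<notin> I ==> x i = 0" "!!y. (!!i. i \<notin> I ==> y i = 0) ==> J x <= J y"
proof -
 \<comment> \<open>Chosen with c R^2 >= J(0) + D: a single component of norm above \<open>R\<close>
   already lifts \<open>J\<close> above its value at the zero sequence.\<close>
 define R where "R = sqrt (max 0 ((J (%i. 0) + D) / c))"
 define B where "B i = (if i \<in> I then cball (0::'a) R else {0})" for i
 have "compactin (product_topology (%i. euclidean) UNIV) (PiE UNIV B)"
  by (subst compactin_PiE) (auto simp: B_def)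
 then have comp: "compact (PiE UNIV B)"
  by (simp add: euclidean_product_topology)
 have "(%i. 0) \<in> PiE UNIV B" by (auto simp: B_def R_def)
 then obtain x where x: "x \<in> PiE UNIV B" "!!y. y \<in> PiE UNIV B ==> J x <= J y"
  using continuous_attains_inf[OF comp _ continuous_on_subset[OF cont]] by blast
 show thesis
 proof (rule that)
  show "x i = 0" if "i \<notin> I" for i using PiE_mem[OF x(1), of i] that by (simp add: B_def)
  fix y :: "nat => 'a" assume y: "!!i. i \<notin> I ==> y i = 0"
  show "J x <= J y"
  proof (cases "y \<in> PiE UNIV B")
  case False
  then obtain j where j: "y j \<notin> B j" by auto
  then have "j \<in> I" using y[of j] by (cases "j \<in> I") (auto simp: B_def)
  with j obtain i where i: "i \<in> I" "norm (y i) > R" by (auto simp: B_def)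
  have "(J (%i. 0) + D) / c <= R^2" by (simp add: R_def)
  also have "... < (norm (y i))^2" using i by (intro power_strict_mono) (auto simp: R_def)
  finally have "J (%i. 0) + D < c * (norm (y i))^2" using c by (simp add: field_simps)
  also have "... <= (\<Sum>i\<in>I. c * (norm (y i))^2)" using i(1) I c by (intro member_le_sum) auto
  also have "... <= J y + D" proof -
  have "(\<Sum>i\<in>I. c * (norm (y i))^2) - D <= J y" by (rule coer) (rule y)
  then show ?thesis by simp
  qed
  finally have "J (%i. 0) < J y" by simp
  moreover have "J x <= J (%i. 0)" by (rule x(2)) (auto simp: B_def R_def)
  ultimately show ?thesis by simp
  qed (rule x(2))
 qed
qed

section \<open>Discrete memory and its energy\<close>

definition dconv :: "(nat => real) => (nat => real) => nat => real" where
 "dconv G a k = (\<Sum>j\<le>k. G (k - j) * a j)"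

text \<open>Discrete form of G(t) |a(t)|^2 / 2 minus half the integral over s < t of G'(t - s) |a(t)
  - a(s)|^2; decrements of \<open>G\<close> stand for - G'.\<close>

definition mem_energy :: "(nat => real) => (nat => real) => nat => real" where
 "mem_energy G a k = G k * (a k)^2 / 2 + (SUM j<k. (G (k - 1 - j) - G (k - j)) * (a k - a j)^2) / 2"

text \<open>Abel summation: the increment of the convolution is expressed by decrements of
  \<open>G\<close> acting on the differences \<open>a (Suc k) - a j\<close>, the quantities that
  make up \<open>mem_energy\<close>.\<close>

lemma dconv_diff:
 "dconv G a (Suc k) - dconv G a k = G (Suc k) * a (Suc k) + (\<Sum>j\<le>k. (G (k - j) - G (Suc k - j)) * (a (Suc k) - a j))"
proof -
 have "(\<Sum>j\<le>k. G (k - j) - G (Suc k - j)) = (\<Sum>i\<le>k. G i - G (Suc i))"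
  by (rule sum.reindex_bij_witness[where i = "%i. k - i" and j = "%j. k - j"]) (auto simp: Suc_diff_le)
 also have "... = G 0 - G (Suc k)" by (rule sum_telescope)
 finally have t: "(\<Sum>j\<le>k. G (k - j) - G (Suc k - j)) = G 0 - G (Suc k)" .
 have "(\<Sum>j\<le>k. (G (k - j) - G (Suc k - j)) * (a (Suc k) - a j))
  = (\<Sum>j\<le>k. G (k - j) - G (Suc k - j)) * a (Suc k) - (\<Sum>j\<le>k. (G (k - j) - G (Suc k - j)) * a j)"
  unfolding sum_distrib_right sum_subtractf[symmetric] by (rule sum.cong) (auto simp: algebra_simps)
 also have "... = (G 0 - G (Suc k)) * a (Suc k) - dconv G a k + (\<Sum>j\<le>k. G (Suc k - j) * a j)"
  unfolding t by (simp add: dconv_def left_diff_distrib sum_subtractf)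
 finally show ?thesis by (simp add: dconv_def algebra_simps)
qed

text \<open>The discrete analogue of the dissipativity of a convex decreasing memory kernel.\<close>

lemma mem_energy_step:
 fixes G a :: "nat => real"
 assumes nonneg: "!!n. 0 <= G n" and decr: "!!n. G (Suc n) <= G n"
  and convex: "!!n. G (Suc n) - G (Suc (Suc n)) <= G n - G (Suc n)"
 shows "mem_energy G a (Suc k) - mem_energy G a k <= (a (Suc k) - a k) * (dconv G a (Suc k) - dconv G a k)"
proof -
 let ?g = "%j. G (k - j) - G (Suc k - j)"
 have ineq: "(x^2 - y^2) / 2 <= (x - y) * x" for x y :: real
 proof -
  have "0 <= (x - y)^2" by simp
  then show ?thesis by (simp add: power2_eq_square field_simps)
 qed
 have g0: "0 <= ?g j" if "j <= k" for j using decr[of "k - j"] that by (simp add: Suc_diff_le)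
 have 1: "G (Suc k) * (a (Suc k))^2 / 2 - G k * (a k)^2 / 2 <= (a (Suc k) - a k) * (G (Suc k) * a (Suc k))"
 proof -
  have "G (Suc k) * (((a (Suc k))^2 - (a k)^2) / 2) <= G (Suc k) * ((a (Suc k) - a k) * a (Suc k))"
  by (rule mult_left_mono[OF ineq nonneg])
  moreover have "G (Suc k) * (a k)^2 <= G k * (a k)^2" by (rule mult_right_mono[OF decr]) simp
  ultimately show ?thesis by (simp add: right_diff_distrib left_diff_distrib diff_divide_distrib mult_ac)
 qed
 have 2: "(\<Sum>j\<le>k. ?g j * ((a (Suc k) - a j)^2 / 2)) - (\<Sum>j\<le>k. ?g j * ((a k - a j)^2 / 2))
  <= (\<Sum>j\<le>k. (a (Suc k) - a k) * (?g j * (a (Suc k) - a j)))"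
  unfolding sum_subtractf[symmetric]
 proof (rule sum_mono)
  fix j assume "j \<in> {..k}"
  have "?g j * (((a (Suc k) - a j)^2 - (a k - a j)^2) / 2) <= ?g j * (((a (Suc k) - a j) - (a k - a j)) * (a (Suc k) - a j))"
  using \<open>j \<in> {..k}\<close> by (intro mult_left_mono ineq g0) auto
  then show "?g j * ((a (Suc k) - a j)^2 / 2) - ?g j * ((a k - a j)^2 / 2) <= (a (Suc k) - a k) * (?g j * (a (Suc k) - a j))"
  by (simp add: right_diff_distrib diff_divide_distrib mult_ac)
 qed
 \<comment> \<open>The term \<open>j = k\<close> is zero because it contains
   \<open>a k - a k\<close>.\<close>
 have "(\<Sum>j\<le>k. ?g j * ((a k - a j)^2 / 2)) = (SUM j<k. ?g j * ((a k - a j)^2 / 2))"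
  by (simp add: lessThan_Suc_atMost[symmetric])
 \<comment> \<open>Convexity enters here: a decrement one lag later is not larger, which converts
   the weights of level \<open>Suc k\<close> into those of level \<open>k\<close>.\<close>
 also have "... <= (SUM j<k. (G (k - 1 - j) - G (k - j)) * ((a k - a j)^2 / 2))"
 proof (rule sum_mono, rule mult_right_mono)
  fix j assume "j \<in> {..<k}"
  then have "k - j = Suc (k - 1 - j)" "Suc k - j = Suc (Suc (k - 1 - j))" by auto
  then show "?g j <= G (k - 1 - j) - G (k - j)" using convex[of "k - 1 - j"] by simp
 qed simp
 finally have 3: "(\<Sum>j\<le>k. ?g j * ((a k - a j)^2 / 2)) <= (SUM j<k. (G (k - 1 - j) - G (k - j)) * (a k - a j)^2) / 2"
  by (simp add: sum_divide_distrib)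
 have "mem_energy G a (Suc k) = G (Suc k) * (a (Suc k))^2 / 2 + (\<Sum>j\<le>k. ?g j * ((a (Suc k) - a j)^2 / 2))"
  by (simp add: mem_energy_def lessThan_Suc_atMost sum_divide_distrib)
 with 1 2 3 show ?thesis
  unfolding dconv_diff mem_energy_def[of G a k] by (simp add: distrib_left sum_distrib_left)
qed

lemma mem_energy_ge:
 assumes "!!n. G (Suc n) <= G n"
 shows "G k * (a k)^2 / 2 <= mem_energy G a k"
proof -
 have "0 <= (SUM j<k. (G (k - 1 - j) - G (k - j)) * (a k - a j)^2)"
 proof (rule sum_nonneg, rule mult_nonneg_nonneg)
  fix j assume "j \<in> {..<k}"
  then have "k - j = Suc (k - 1 - j)" by auto
  then show "0 <= G (k - 1 - j) - G (k - j)" using assms[of "k - 1 - j"] by simp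
 qed simp
 then show ?thesis by (simp add: mem_energy_def)
qed

section \<open>The discrete scheme\<close>

definition dx :: "nat => (nat => real) => nat => real" where
 "dx N u i = real N * (u (Suc i) - u i)"

text \<open>No difference is taken at the last cell: this encodes the natural (Neumann) condition,
  whereas the last difference of \<open>dx\<close> involves the boundary node
  \<open>N\<close>.\<close>

definition dxm :: "nat => (nat => 'b::real_vector) => nat => 'b" where
 "dxm N m i = (if Suc i < N then real N *R (m (Suc i) - m i) else 0)"

text \<open>Equal to \<open>lam * m $ 1 * m $ 2\<close>. Its gradient is
  \<open>lam *R Lam m\<close>, so it is at once the magnetic stress in the momentum equation and the
  potential of the coupling in the magnetization equation.\<close>

definition qf :: "real => real ^ 2 => real" where
 "qf lam m = lam / 2 * (Lam m <.> m)"

lemma Lam_inner: "Lam m <.> w = m $ 2 * w $ 1 + m $ 1 * w $ 2"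
 by (simp add: Lam_def inner_vec_def sum_2)

lemma qf_expand: "qf lam (m + s *R w) = qf lam m + s * (lam * (Lam m <.> w)) + s^2 * qf lam w"
 by (simp add: qf_def Lam_inner power2_eq_square field_simps)

lemma norm_Lam: "norm (Lam m) = norm m"
 by (simp add: norm_eq_sqrt_inner inner_vec_def Lam_def sum_2 add.commute)

lemma qf_bound: "\<bar>qf lam m\<bar> <= \<bar>lam\<bar> / 2 * (norm m)^2"
 using Cauchy_Schwarz_ineq2[of "Lam m" m]
 by (simp add: qf_def abs_mult norm_Lam power2_eq_square mult_left_mono)

lemma continuous_on_coord: "continuous_on S (%x :: nat => 'a::topological_space. x i)"
 by (rule continuous_on_subset[OF continuous_on_product_coordinates]) simp

lemma continuous_on_qf [continuous_intros]:
 "continuous_on S f ==> continuous_on S (%x. qf lam (f x))"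
 unfolding qf_def Lam_inner by (intro continuous_intros)

text \<open>The discrete homogeneous Dirichlet condition; the free values are those at the nodes in
  \<open>{1..<N}\<close>.\<close>

definition supp0 :: "nat => (nat => real) => bool" where
 "supp0 N ph \<longleftrightarrow> ph 0 = 0 & (\<forall>i\<ge>N. ph i = 0)"

text \<open>The Euler-Lagrange equation of the quadratic functional \<open>J\<close>. Here
  \<open>b\<close> is the old displacement, \<open>g\<close> the kernel value at lag zero and thus
  the implicit part of the memory; \<open>S\<close> collects the older memory and the magnetic
  stress, \<open>R\<close> the data.\<close>

lemma u_step_exists:
 fixes b R S :: "nat => real"
 assumes tau: "tau > 0" and g: "g > 0"
 obtains u where "supp0 N u" "!!ph. supp0 N ph ==>
  (SUM i<N. (u i - b i) / tau * ph i) + (SUM i<N. (tau * g * dx N u i + S i) * dx N ph i) = (SUM i<N. R i * ph i)"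
proof -
 define J where "J u = (SUM i<N. (u i - b i)^2 / (2 * tau) - R i * u i) + (SUM i<N. tau * g / 2 * (dx N u i)^2 + S i * dx N u i)" for u
 have cont: "continuous_on UNIV J"
  unfolding J_def dx_def by (intro continuous_intros continuous_on_coord) (use tau in auto)
 define D where "D = (SUM i<N. (b i)^2 / (2 * tau) + 2 * tau * (R i)^2) + (SUM i<N. (S i)^2 / (2 * tau * g))"
 have coer: "J u \<ge> (\<Sum>i\<in>{1..<N}. 1 / (8 * tau) * (norm (u i))^2) - D" if "!!i. i \<notin> {1..<N} ==> u i = 0" for u
 proof -
  have 1: "(u i - b i)^2 / (2 * tau) - R i * u i \<ge> 1 / (8 * tau) * (u i)^2 - ((b i)^2 / (2 * tau) + 2 * tau * (R i)^2)" for i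
  proof -
  \<comment> \<open>Two complete squares; 1/(8 tau) is what remains of the coefficient 1/(2 tau)
    after they are split off.\<close>
  have "0 <= (u i - 2 * b i)^2 / (4 * tau) + (u i - 4 * tau * R i)^2 / (8 * tau)" using tau by simp
  then show ?thesis using tau by (simp add: field_simps power2_eq_square)
  qed
  have 2: "tau * g / 2 * (dx N u i)^2 + S i * dx N u i \<ge> - ((S i)^2 / (2 * tau * g))" for i
  proof -
  have "0 <= (tau * g * dx N u i + S i)^2 / (2 * tau * g)" using tau g by simp
  then show ?thesis using tau g by (simp add: field_simps power2_eq_square)
  qed
  have "(\<Sum>i\<in>{1..<N}. 1 / (8 * tau) * (norm (u i))^2) = (SUM i<N. 1 / (8 * tau) * (u i)^2)"
  by (rule sum.mono_neutral_cong_left) (use that in auto)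
  moreover have "(SUM i<N. 1 / (8 * tau) * (u i)^2) - D = (SUM i<N. 1 / (8 * tau) * (u i)^2 - ((b i)^2 / (2 * tau) + 2 * tau * (R i)^2)) + (SUM i<N. - ((S i)^2 / (2 * tau * g)))"
  unfolding D_def sum_subtractf sum_negf by simp
  moreover have "... <= J u" unfolding J_def by (intro add_mono sum_mono 1 2)
  ultimately show ?thesis by simp
 qed
 obtain u where u: "!!i. i \<notin> {1..<N} ==> u i = 0" "!!y. (!!i. i \<notin> {1..<N} ==> y i = 0) ==> J u <= J y"
  by (rule finite_dim_minimizer[OF cont _ _ coer]) (use tau in auto)
 have su: "supp0 N u" using u(1) by (simp add: supp0_def)
 show thesis
 proof (rule that[OF su])
  fix ph assume ph: "supp0 N ph"
  define A where "A = (SUM i<N. (u i - b i) / tau * ph i - R i * ph i) + (SUM i<N. (tau * g * dx N u i + S i) * dx N ph i)"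
  define B where "B = (SUM i<N. (ph i)^2 / (2 * tau)) + (SUM i<N. tau * g / 2 * (dx N ph i)^2)"
  have ex: "J (%i. u i + s * ph i) = J u + s * A + s^2 * B" for s
  proof -
  have 1: "(u i + s * ph i - b i)^2 / (2 * tau) - R i * (u i + s * ph i)
  = ((u i - b i)^2 / (2 * tau) - R i * u i) + s * ((u i - b i) / tau * ph i - R i * ph i) + s^2 * ((ph i)^2 / (2 * tau))" for i
  using tau by (simp add: field_simps power2_eq_square)
  have "dx N (%i. u i + s * ph i) i = dx N u i + s * dx N ph i" for i by (simp add: dx_def algebra_simps)
  then have 2: "tau * g / 2 * (dx N (%i. u i + s * ph i) i)^2 + S i * dx N (%i. u i + s * ph i) i
  = (tau * g / 2 * (dx N u i)^2 + S i * dx N u i) + s * ((tau * g * dx N u i + S i) * dx N ph i) + s^2 * (tau * g / 2 * (dx N ph i)^2)" for i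
  by (simp add: field_simps power2_eq_square)
  show ?thesis unfolding J_def 1 2 A_def B_def by (simp only: sum.distrib distrib_left sum_distrib_left add_ac)
  qed
  have "0 <= s * A + s^2 * B + s^3 * 0 + s^4 * 0" for s
  proof -
  have "u i + s * ph i = 0" if "i \<notin> {1..<N}" for i
  proof -
  have "i = 0 \<or> i \<ge> N" using that by auto
  then show ?thesis using su ph by (auto simp: supp0_def)
  qed
  then show ?thesis using u(2)[of "%i. u i + s * ph i"] ex[of s] by simp
  qed
  then have "A = 0" by (rule min_quartic_zero)
  then show "(SUM i<N. (u i - b i) / tau * ph i) + (SUM i<N. (tau * g * dx N u i + S i) * dx N ph i) = (SUM i<N. R i * ph i)"
  unfolding A_def sum_subtractf by simp
 qed
qed

text \<open>Double well plus exchange energy, summed over cells without the mesh weight 1/N; this is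
  why the energy bounds below carry a factor \<open>real N\<close>.\<close>

definition pot :: "real => nat => (nat => real ^ 2) => real" where
 "pot dl N m = (SUM i<N. ((norm (m i))^2 - 1)^2 / (4 * dl)) + (SUM i<N. (norm (dxm N m i))^2) / 2"

lemma quartic_expand:
 fixes t d :: real
 assumes "t > 0" "d > 0"
 shows "(X + 2 * s * Y + s^2 * Z) / (2 * t) + ((P + 2 * s * Q + s^2 * Z) - 1)^2 / (4 * d) + (q + s * (l * L) + s^2 * r) * p
  = (X / (2 * t) + (P - 1)^2 / (4 * d) + q * p) + s * ((1 / t) * Y + (P - 1) / d * Q + l * p * L)
  + s^2 * (Z / (2 * t) + (4 * Q^2 + 2 * (P - 1) * Z) / (4 * d) + r * p) + s ^ 3 * (4 * Q * Z / (4 * d)) + s ^ 4 * (Z^2 / (4 * d))"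
proof -
 \<comment> \<open>With the reciprocals as new variables the claim is a polynomial identity.\<close>
 define b where "b = 1 / (2 * t)"
 define c where "c = 1 / (4 * d)"
 have e: "1 / t = 2 * b" "x / (2 * t) = x * b" "x / (4 * d) = x * c" "x / d = 4 * x * c" for x
  using assms by (auto simp: b_def c_def)
 show ?thesis unfolding e by algebra
qed

text \<open>The double well is not convex, so the Euler-Lagrange equation alone does not control the
  energy for large \<open>tau\<close>. Comparison of the minimiser with the old state
  \<open>a\<close> does, whatever the step size.\<close>

lemma m_step_exists:
 fixes a :: "nat => real ^ 2" and p :: "nat => real"
 assumes tau: "tau > 0" and dl: "dl > 0"
 obtains m where
  "(SUM i<N. (norm (m i - a i))^2) / (2 * tau) + pot dl N m + (SUM i<N. qf lam (m i) * p i) <= pot dl N a + (SUM i<N. qf lam (a i) * p i)"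
  "!!ps. (SUM i<N. (1 / tau) *R (m i - a i) <.> ps i + ((norm (m i))^2 - 1) / dl * (m i <.> ps i) + lam * p i * (Lam (m i) <.> ps i))
  + (SUM i<N. dxm N m i <.> dxm N ps i) = 0"
proof -
 define J where "J m = (SUM i<N. (norm (m i - a i))^2 / (2 * tau)) + pot dl N m + (SUM i<N. qf lam (m i) * p i)" for m
 have cont: "continuous_on UNIV J"
 proof -
  have "continuous_on UNIV (%m :: nat => real ^ 2. dxm N m i)" for i
  unfolding dxm_def by (cases "Suc i < N") (auto intro!: continuous_intros continuous_on_coord)
  then show ?thesis
  unfolding J_def pot_def by (intro continuous_intros continuous_on_coord) (use tau dl in auto)
 qed
 \<comment> \<open>The summand 1/(2 dl) cancels the cross term of (s - 1)^2 / (4 dl), where s is the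
   squared length; what remains is the complete square (s - 2 dl e)^2 / (4 dl) and constants, hence
   \<open>dl * (e i)^2\<close> in \<open>D\<close>.\<close>
 define e where "e i = \<bar>lam\<bar> / 2 * \<bar>p i\<bar> + 1 / (2 * dl)" for i
 define D where "D = (SUM i<N. (norm (a i))^2 / (2 * tau) + dl * (e i)^2)"
 have coer: "J m \<ge> (\<Sum>i\<in>{..<N}. 1 / (4 * tau) * (norm (m i))^2) - D" for m
 proof -
  have 1: "(norm (m i - a i))^2 / (2 * tau) + ((norm (m i))^2 - 1)^2 / (4 * dl) + qf lam (m i) * p i
  \<ge> 1 / (4 * tau) * (norm (m i))^2 - ((norm (a i))^2 / (2 * tau) + dl * (e i)^2)" for i
  proof -
  have "(norm (m i))^2 + (norm (m i - 2 *R a i))^2 = 2 * (norm (m i - a i))^2 + 2 * (norm (a i))^2"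
  by (simp add: power2_norm_eq_inner inner_simps inner_commute)
  then have "(norm (m i))^2 <= 2 * (norm (m i - a i))^2 + 2 * (norm (a i))^2" by (smt (verit) zero_le_power2)
  then have a: "1 / (4 * tau) * (norm (m i))^2 - (norm (a i))^2 / (2 * tau) <= (norm (m i - a i))^2 / (2 * tau)"
  proof -
  have "(norm (m i))^2 / (4 * tau) <= (2 * (norm (m i - a i))^2 + 2 * (norm (a i))^2) / (4 * tau)"
  using \<open>(norm (m i))\<^sup>2 <= _\<close> tau by (intro divide_right_mono) auto
  then show ?thesis by (simp add: add_divide_distrib)
  qed
  define s where "s = (norm (m i))^2"
  have "\<bar>qf lam (m i) * p i\<bar> <= (\<bar>lam\<bar> / 2 * s) * \<bar>p i\<bar>"
  unfolding abs_mult s_def by (intro mult_right_mono qf_bound) auto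
  then have b: "qf lam (m i) * p i \<ge> - (e i - 1 / (2 * dl)) * s" by (simp add: e_def algebra_simps)
  have "0 <= (s - 2 * dl * e i)^2 / (4 * dl) + 1 / (4 * dl)" using dl by simp
  then have c: "- (dl * (e i)^2) <= (s - 1)^2 / (4 * dl) - (e i - 1 / (2 * dl)) * s"
  proof -
  have "(s - 1)^2 / (4 * dl) - (e i - 1 / (2 * dl)) * s + dl * (e i)^2 = (s - 2 * dl * e i)^2 / (4 * dl) + 1 / (4 * dl)"
  using dl by (simp add: field_simps power2_eq_square)
  then show ?thesis using \<open>0 <= (s - 2 * dl * e i)^2 / (4 * dl) + 1 / (4 * dl)\<close> by linarith
  qed
  show ?thesis using a b c unfolding s_def[symmetric] by linarith
  qed
  have "(SUM i<N. 1 / (4 * tau) * (norm (m i))^2) - D <= (SUM i<N. (norm (m i - a i))^2 / (2 * tau) + ((norm (m i))^2 - 1)^2 / (4 * dl) + qf lam (m i) * p i)"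
  unfolding D_def sum_subtractf[symmetric] by (intro sum_mono 1)
  also have "... <= J m" unfolding J_def pot_def sum.distrib by (simp add: sum_nonneg)
  finally show ?thesis .
 qed
 obtain m where m: "!!i. i \<notin> {..<N} ==> m i = 0" "!!y. (!!i. i \<notin> {..<N} ==> y i = 0) ==> J m <= J y"
  by (rule finite_dim_minimizer[OF cont _ _ coer]) (use tau in auto)
 have dxm_cong: "dxm N y i = dxm N z i" if "!!j. j < N ==> y j = z j" for y z :: "nat => real ^ 2" and i
  using that by (auto simp: dxm_def)
 have Jcong: "J y = J z" if "!!j. j < N ==> y j = z j" for y z
  unfolding J_def pot_def using that dxm_cong[of y z] by (auto intro!: arg_cong2[where f = "(+)"] sum.cong)
 \<comment> \<open>\<open>J\<close> sees the entries below \<open>N\<close> only, so minimality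
   under the support constraint is minimality among all sequences and arbitrary variations
   \<open>ps\<close> are admissible.\<close>
 have mmin: "J m <= J y" for y
  using m(2)[of "%i. if i < N then y i else 0"] Jcong[of "%i. if i < N then y i else 0" y] by simp
 show thesis
 proof (rule that)
  show "(SUM i<N. (norm (m i - a i))^2) / (2 * tau) + pot dl N m + (SUM i<N. qf lam (m i) * p i) <= pot dl N a + (SUM i<N. qf lam (a i) * p i)"
  using mmin[of a] by (simp add: J_def sum_divide_distrib)
  fix ps :: "nat => real ^ 2"
  define A where "A = (SUM i<N. (1 / tau) *R (m i - a i) <.> ps i + ((norm (m i))^2 - 1) / dl * (m i <.> ps i) + lam * p i * (Lam (m i) <.> ps i))
  + (SUM i<N. dxm N m i <.> dxm N ps i)"
  define B where "B = (SUM i<N. (norm (ps i))^2 / (2 * tau) + (4 * (m i <.> ps i)^2 + 2 * ((norm (m i))^2 - 1) * (norm (ps i))^2) / (4 * dl) + qf lam (ps i) * p i)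
  + (SUM i<N. (norm (dxm N ps i))^2 / 2)"
  define C where "C = (SUM i<N. 4 * (m i <.> ps i) * (norm (ps i))^2 / (4 * dl))"
  define E where "E = (SUM i<N. ((norm (ps i))^2)^2 / (4 * dl))"
  have ex: "J (%i. m i + s *R ps i) = J m + s * A + s^2 * B + s^3 * C + s^4 * E" for s
  proof -
  have 1: "(norm (m i + s *R ps i - a i))^2 / (2 * tau) + ((norm (m i + s *R ps i))^2 - 1)^2 / (4 * dl) + qf lam (m i + s *R ps i) * p i
  = ((norm (m i - a i))^2 / (2 * tau) + ((norm (m i))^2 - 1)^2 / (4 * dl) + qf lam (m i) * p i)
  + s * ((1 / tau) *R (m i - a i) <.> ps i + ((norm (m i))^2 - 1) / dl * (m i <.> ps i) + lam * p i * (Lam (m i) <.> ps i))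
  + s^2 * ((norm (ps i))^2 / (2 * tau) + (4 * (m i <.> ps i)^2 + 2 * ((norm (m i))^2 - 1) * (norm (ps i))^2) / (4 * dl) + qf lam (ps i) * p i)
  + s^3 * (4 * (m i <.> ps i) * (norm (ps i))^2 / (4 * dl)) + s^4 * (((norm (ps i))^2)^2 / (4 * dl))" for i
  proof -
  have n1: "(norm (m i + s *R ps i - a i))^2 = (norm (m i - a i))^2 + 2 * s * ((m i - a i) <.> ps i) + s^2 * (norm (ps i))^2"
  unfolding power2_norm_eq_inner by (simp add: inner_simps inner_commute algebra_simps power2_eq_square)
  have n2: "(norm (m i + s *R ps i))^2 = (norm (m i))^2 + 2 * s * (m i <.> ps i) + s^2 * (norm (ps i))^2"
  unfolding power2_norm_eq_inner by (simp add: inner_simps inner_commute algebra_simps power2_eq_square)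
  show ?thesis unfolding n1 n2 qf_expand inner_scaleR_left using quartic_expand[OF tau dl] .
  qed
  have "dxm N (%i. m i + s *R ps i) i = dxm N m i + s *R dxm N ps i" for i by (simp add: dxm_def algebra_simps)
  then have 2: "(norm (dxm N (%i. m i + s *R ps i) i))^2 / 2 = (norm (dxm N m i))^2 / 2 + s * (dxm N m i <.> dxm N ps i) + s^2 * ((norm (dxm N ps i))^2 / 2)" for i
  unfolding power2_norm_eq_inner by (simp add: inner_simps inner_commute algebra_simps power2_eq_square)
  have J': "J m = (SUM i<N. (norm (m i - a i))^2 / (2 * tau) + ((norm (m i))^2 - 1)^2 / (4 * dl) + qf lam (m i) * p i)
  + (SUM i<N. (norm (dxm N m i))^2 / 2)" for m
  unfolding J_def pot_def by (simp add: sum.distrib sum_divide_distrib)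
  show ?thesis unfolding J' 1 2 A_def B_def C_def E_def by (simp only: sum.distrib distrib_left sum_distrib_left add_ac)
  qed
  have "0 <= s * A + s^2 * B + s^3 * C + s^4 * E" for s
  using mmin[of "%i. m i + s *R ps i"] ex[of s] by simp
  then show "A = 0" by (rule min_quartic_zero)
 qed
qed

text \<open>The value \<open>U1\<close> at level 0 agrees with the momentum equation there, in which
  all memory and coupling terms are zero.\<close>

definition vel :: "real => (nat => real) => (nat => nat => real) => nat => nat => real" where
 "vel tau U1 u k i = (if k = 0 then U1 i else (u k i - u (k - 1) i) / tau)"

text \<open>The momentum equation stays in time-integrated form. Its memory sum contains lag zero
  and is implicit in \<open>u k\<close>; the coupling uses \<open>m j\<close> with
  \<open>j < k\<close>, while the magnetization step sees the new \<open>u (Suc k)\<close>. This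
  staggering separates the two minimisations and lets the coupling energy telescope. The energy
  inequality is recorded as well because it comes from minimality and not from the Euler-Lagrange
  equation.\<close>

definition scheme where
 "scheme N tau lam dl Gd U1 F M0 u m \<longleftrightarrow>
  u 0 = (%i. 0) & m 0 = M0 & (\<forall>k. supp0 N (u k)) &
  (\<forall>k ph. supp0 N ph -->
  (SUM i<N. vel tau U1 u k i * ph i)
  + (SUM i<N. (tau * dconv Gd (%j. dx N (u j) i) k + tau * (SUM j<k. qf lam (m j i))) * dx N ph i)
  = (SUM i<N. (U1 i + tau * (\<Sum>j=1..k. F j i)) * ph i)) &
  (\<forall>k. (SUM i<N. (norm (m (Suc k) i - m k i))^2) / (2 * tau) + pot dl N (m (Suc k))
  + (SUM i<N. qf lam (m (Suc k) i) * dx N (u (Suc k)) i)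
  <= pot dl N (m k) + (SUM i<N. qf lam (m k i) * dx N (u (Suc k)) i)) &
  (\<forall>k ps. (SUM i<N. (1 / tau) *R (m (Suc k) i - m k i) <.> ps i
  + ((norm (m (Suc k) i))^2 - 1) / dl * (m (Suc k) i <.> ps i)
  + lam * dx N (u (Suc k)) i * (Lam (m (Suc k) i) <.> ps i))
  + (SUM i<N. dxm N (m (Suc k)) i <.> dxm N ps i) = 0)"

text \<open>Each step depends on the whole history, so the sequence is built by choice along a
  well-order: \<open>P f k r\<close> says that \<open>r\<close> is admissible at level
  \<open>k\<close> given the earlier values of \<open>f\<close>.\<close>

lemma scheme_exists:
 assumes tau: "tau > 0" and dl: "dl > 0" and G0: "Gd 0 > 0"
 shows "\<exists>u m. scheme N tau lam dl Gd U1 F M0 u m"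
proof -
 define P where "P f k r \<longleftrightarrow> (case k of 0 => r = ((%i. 0), M0) | Suc k' =>
  supp0 N (fst r) &
  (\<forall>ph. supp0 N ph --> (SUM i<N. (fst r i - fst (f k') i) / tau * ph i)
  + (SUM i<N. (tau * Gd 0 * dx N (fst r) i + (tau * (\<Sum>j\<le>k'. Gd (Suc k' - j) * dx N (fst (f j)) i) + tau * (SUM j<Suc k'. qf lam (snd (f j) i)))) * dx N ph i)
  = (SUM i<N. (U1 i + tau * (\<Sum>j=1..Suc k'. F j i)) * ph i)) &
  ((SUM i<N. (norm (snd r i - snd (f k') i))^2) / (2 * tau) + pot dl N (snd r) + (SUM i<N. qf lam (snd r i) * dx N (fst r) i)
  <= pot dl N (snd (f k')) + (SUM i<N. qf lam (snd (f k') i) * dx N (fst r) i)) &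
  (\<forall>ps. (SUM i<N. (1 / tau) *R (snd r i - snd (f k') i) <.> ps i + ((norm (snd r i))^2 - 1) / dl * (snd r i <.> ps i)
  + lam * dx N (fst r) i * (Lam (snd r i) <.> ps i))
  + (SUM i<N. dxm N (snd r) i <.> dxm N ps i) = 0))" for f :: "nat => (nat => real) \<times> (nat => real ^ 2)" and k r
 have "\<exists>f. \<forall>k. P f k (f k)"
 proof (rule dependent_wellorder_choice)
  fix r and f g :: "nat => (nat => real) \<times> (nat => real ^ 2)" and k :: nat assume fg: "!!y. y < k ==> f y = g y"
  show "P f k r = P g k r"
  proof (cases k)
  case (Suc k')
  have 1: "f k' = g k'" using fg Suc by simp
  have 2: "(\<Sum>j\<le>k'. Gd (Suc k' - j) * dx N (fst (f j)) i) = (\<Sum>j\<le>k'. Gd (Suc k' - j) * dx N (fst (g j)) i)" for i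
  by (rule sum.cong) (use fg Suc in auto)
  have 3: "(SUM j<Suc k'. qf lam (snd (f j) i)) = (SUM j<Suc k'. qf lam (snd (g j) i))" for i
  by (rule sum.cong) (use fg Suc in auto)
  show ?thesis unfolding P_def Suc nat.case 1 2 3 ..
  qed (simp add: P_def)
 next
  fix k :: nat and f :: "nat => (nat => real) \<times> (nat => real ^ 2)" assume "!!y. y < k ==> P f y (f y)"
  show "\<exists>r. P f k r"
  proof (cases k)
  case (Suc k')
  obtain u where u: "supp0 N u" "!!ph. supp0 N ph ==> (SUM i<N. (u i - fst (f k') i) / tau * ph i)
  + (SUM i<N. (tau * Gd 0 * dx N u i + (tau * (\<Sum>j\<le>k'. Gd (Suc k' - j) * dx N (fst (f j)) i) + tau * (SUM j<Suc k'. qf lam (snd (f j) i)))) * dx N ph i)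
  = (SUM i<N. (U1 i + tau * (\<Sum>j=1..Suc k'. F j i)) * ph i)"
  by (rule u_step_exists[OF tau G0, where N = N and b = "fst (f k')" and R = "%i. U1 i + tau * (\<Sum>j=1..Suc k'. F j i)"
  and S = "%i. tau * (\<Sum>j\<le>k'. Gd (Suc k' - j) * dx N (fst (f j)) i) + tau * (SUM j<Suc k'. qf lam (snd (f j) i))"]) (rule that)
  obtain m where m: "(SUM i<N. (norm (m i - snd (f k') i))^2) / (2 * tau) + pot dl N m + (SUM i<N. qf lam (m i) * dx N u i)
  <= pot dl N (snd (f k')) + (SUM i<N. qf lam (snd (f k') i) * dx N u i)"
  "!!ps. (SUM i<N. (1 / tau) *R (m i - snd (f k') i) <.> ps i + ((norm (m i))^2 - 1) / dl * (m i <.> ps i)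
  + lam * dx N u i * (Lam (m i) <.> ps i))
  + (SUM i<N. dxm N m i <.> dxm N ps i) = 0"
  by (rule m_step_exists[OF tau dl, where N = N and a = "snd (f k')" and p = "dx N u" and lam = lam]) (rule that)
  have "P f k (u, m)" unfolding P_def Suc nat.case fst_conv snd_conv using u m by blast
  then show ?thesis ..
  qed (simp add: P_def)
 qed
 then obtain f where f: "!!k. P f k (f k)" by blast
 have f0: "f 0 = ((%i. 0), M0)" using f[of 0] by (simp add: P_def)
 have fS: "supp0 N (fst (f (Suc k)))"
  "!!ph. supp0 N ph ==> (SUM i<N. (fst (f (Suc k)) i - fst (f k) i) / tau * ph i)
  + (SUM i<N. (tau * Gd 0 * dx N (fst (f (Suc k))) i + (tau * (\<Sum>j\<le>k. Gd (Suc k - j) * dx N (fst (f j)) i) + tau * (SUM j<Suc k. qf lam (snd (f j) i)))) * dx N ph i)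
  = (SUM i<N. (U1 i + tau * (\<Sum>j=1..Suc k. F j i)) * ph i)"
  "(SUM i<N. (norm (snd (f (Suc k)) i - snd (f k) i))^2) / (2 * tau) + pot dl N (snd (f (Suc k))) + (SUM i<N. qf lam (snd (f (Suc k)) i) * dx N (fst (f (Suc k))) i)
  <= pot dl N (snd (f k)) + (SUM i<N. qf lam (snd (f k) i) * dx N (fst (f (Suc k))) i)"
  "!!ps. (SUM i<N. (1 / tau) *R (snd (f (Suc k)) i - snd (f k) i) <.> ps i + ((norm (snd (f (Suc k)) i))^2 - 1) / dl * (snd (f (Suc k)) i <.> ps i)
  + lam * dx N (fst (f (Suc k))) i * (Lam (snd (f (Suc k)) i) <.> ps i))
  + (SUM i<N. dxm N (snd (f (Suc k))) i <.> dxm N ps i) = 0" for k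
  using f[of "Suc k"] unfolding P_def nat.case by blast+
 have "scheme N tau lam dl Gd U1 F M0 (%k. fst (f k)) (%k. snd (f k))"
  unfolding scheme_def
 proof (intro conjI allI impI fS(3,4))
  show "supp0 N (fst (f k))" for k by (cases k) (use fS(1) in \<open>auto simp: f0 supp0_def\<close>)
  fix k ph assume ph: "supp0 N ph"
  show "(SUM i<N. vel tau U1 (%k. fst (f k)) k i * ph i)
  + (SUM i<N. (tau * dconv Gd (%j. dx N (fst (f j)) i) k + tau * (SUM j<k. qf lam (snd (f j) i))) * dx N ph i)
  = (SUM i<N. (U1 i + tau * (\<Sum>j=1..k. F j i)) * ph i)"
  proof (cases k)
  case 0
  then show ?thesis by (simp add: vel_def dconv_def f0 dx_def)
  next
  case (Suc k')
  have eq: "tau * Gd 0 * dx N (fst (f (Suc k'))) i + (tau * (\<Sum>j\<le>k'. Gd (Suc k' - j) * dx N (fst (f j)) i) + Q)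
  = tau * dconv Gd (%j. dx N (fst (f j)) i) (Suc k') + Q" for i Q
  unfolding dconv_def by (simp add: algebra_simps)
  show ?thesis using fS(2)[OF ph, of k'] unfolding eq vel_def Suc
  by (simp del: sum.lessThan_Suc sum.cl_ivl_Suc)
  qed
 qed (simp_all add: f0)
 then show ?thesis by blast
qed

section \<open>A priori estimates for the scheme\<close>

definition total_energy where
 "total_energy N tau lam dl Gd U1 u m k =
  (SUM i<N. (vel tau U1 u k i)^2 / 2) + (SUM i<N. mem_energy Gd (%j. dx N (u j) i) k)
  + pot dl N (m k) + (SUM i<N. qf lam (m k i) * dx N (u k) i)"

text \<open>The momentum equations of consecutive levels are subtracted and tested with the discrete
  velocity, whose difference quotient is the strain increment over \<open>tau\<close>. With q the
  magnetic stress and p the strain, the coupling contributes q_k (p_{k+1} - p_k) here and (q_{k+1} -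
  q_k) p_{k+1} in the magnetization step; together they telescope.\<close>

lemma scheme_energy_step:
 assumes s: "scheme N tau lam dl Gd U1 F M0 u m" and tau: "tau > 0"
  and G: "!!n. 0 <= Gd n" "!!n. Gd (Suc n) <= Gd n" "!!n. Gd (Suc n) - Gd (Suc (Suc n)) <= Gd n - Gd (Suc n)"
 shows "total_energy N tau lam dl Gd U1 u m (Suc k) + (SUM i<N. (norm (m (Suc k) i - m k i))^2) / (2 * tau)
  <= total_energy N tau lam dl Gd U1 u m k + tau * (SUM i<N. F (Suc k) i * vel tau U1 u (Suc k) i)"
proof -
 have ueq: "(SUM i<N. vel tau U1 u k i * ph i)
  + (SUM i<N. (tau * dconv Gd (%j. dx N (u j) i) k + tau * (SUM j<k. qf lam (m j i))) * dx N ph i)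
  = (SUM i<N. (U1 i + tau * (\<Sum>j=1..k. F j i)) * ph i)" if "supp0 N ph" for k ph
  using s that unfolding scheme_def by blast
 have su: "supp0 N (u k)" for k using s unfolding scheme_def by blast
 define w where "w i = vel tau U1 u (Suc k) i" for i
 have w: "u (Suc k) i - u k i = tau * w i" for i using tau by (simp add: w_def vel_def)
 have sw: "supp0 N w" using su[of k] su[of "Suc k"] by (simp add: w_def vel_def supp0_def)
 have dw: "tau * dx N w i = dx N (u (Suc k)) i - dx N (u k) i" for i
 proof -
  have "tau * dx N w i = real N * (tau * w (Suc i) - tau * w i)" by (simp add: dx_def algebra_simps)
  also have "... = dx N (u (Suc k)) i - dx N (u k) i" unfolding w[symmetric] by (simp add: dx_def algebra_simps)
  finally show ?thesis .
 qed
 let ?D = "%i. dconv Gd (%j. dx N (u j) i) (Suc k) - dconv Gd (%j. dx N (u j) i) k"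
 have "(SUM i<N. (w i - vel tau U1 u k i) * w i) + (SUM i<N. (?D i + qf lam (m k i)) * (tau * dx N w i))
  = tau * (SUM i<N. F (Suc k) i * w i)"
 proof -
  have "(SUM i<N. w i * w i) - (SUM i<N. vel tau U1 u k i * w i)
  + ((SUM i<N. (tau * dconv Gd (%j. dx N (u j) i) (Suc k) + tau * (SUM j<Suc k. qf lam (m j i))) * dx N w i)
  - (SUM i<N. (tau * dconv Gd (%j. dx N (u j) i) k + tau * (SUM j<k. qf lam (m j i))) * dx N w i))
  = (SUM i<N. (U1 i + tau * (\<Sum>j=1..Suc k. F j i)) * w i) - (SUM i<N. (U1 i + tau * (\<Sum>j=1..k. F j i)) * w i)"
  using ueq[OF sw, of k] ueq[OF sw, of "Suc k"] by (simp add: w_def)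
  moreover have "(SUM i<N. w i * w i) - (SUM i<N. vel tau U1 u k i * w i) = (SUM i<N. (w i - vel tau U1 u k i) * w i)"
  unfolding sum_subtractf[symmetric] by (intro sum.cong refl) (simp add: algebra_simps)
  moreover have "(SUM i<N. (tau * dconv Gd (%j. dx N (u j) i) (Suc k) + tau * (SUM j<Suc k. qf lam (m j i))) * dx N w i)
  - (SUM i<N. (tau * dconv Gd (%j. dx N (u j) i) k + tau * (SUM j<k. qf lam (m j i))) * dx N w i)
  = (SUM i<N. (?D i + qf lam (m k i)) * (tau * dx N w i))"
  unfolding sum_subtractf[symmetric] by (intro sum.cong refl) (simp add: algebra_simps)
  moreover have "(SUM i<N. (U1 i + tau * (\<Sum>j=1..Suc k. F j i)) * w i) - (SUM i<N. (U1 i + tau * (\<Sum>j=1..k. F j i)) * w i)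
  = tau * (SUM i<N. F (Suc k) i * w i)"
  unfolding sum_subtractf[symmetric] sum_distrib_left by (intro sum.cong refl) (simp add: algebra_simps)
  ultimately show ?thesis by linarith
 qed
 then have A: "(SUM i<N. (w i - vel tau U1 u k i) * w i) + (SUM i<N. ?D i * (dx N (u (Suc k)) i - dx N (u k) i))
  + (SUM i<N. qf lam (m k i) * (dx N (u (Suc k)) i - dx N (u k) i)) = tau * (SUM i<N. F (Suc k) i * w i)"
  unfolding dw by (simp add: distrib_right sum.distrib)
 have 1: "(SUM i<N. (w i)^2 / 2) - (SUM i<N. (vel tau U1 u k i)^2 / 2) <= (SUM i<N. (w i - vel tau U1 u k i) * w i)"
  unfolding sum_subtractf[symmetric]
 proof (rule sum_mono)
  fix i
  have "0 <= (w i - vel tau U1 u k i)^2" by simp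
  then show "(w i)^2 / 2 - (vel tau U1 u k i)^2 / 2 <= (w i - vel tau U1 u k i) * w i"
  by (simp add: power2_eq_square field_simps)
 qed
 have 2: "(SUM i<N. mem_energy Gd (%j. dx N (u j) i) (Suc k)) - (SUM i<N. mem_energy Gd (%j. dx N (u j) i) k)
  <= (SUM i<N. ?D i * (dx N (u (Suc k)) i - dx N (u k) i))"
  unfolding sum_subtractf[symmetric]
 proof (rule sum_mono)
  fix i
  show "mem_energy Gd (%j. dx N (u j) i) (Suc k) - mem_energy Gd (%j. dx N (u j) i) k <= ?D i * (dx N (u (Suc k)) i - dx N (u k) i)"
  using mem_energy_step[of Gd "%j. dx N (u j) i" k] G by (simp add: mult.commute)
 qed
 have 3: "(SUM i<N. (norm (m (Suc k) i - m k i))^2) / (2 * tau) + pot dl N (m (Suc k))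
  + (SUM i<N. qf lam (m (Suc k) i) * dx N (u (Suc k)) i)
  <= pot dl N (m k) + (SUM i<N. qf lam (m k i) * dx N (u (Suc k)) i)"
  using s unfolding scheme_def by blast
 have 4: "(SUM i<N. qf lam (m k i) * (dx N (u (Suc k)) i - dx N (u k) i))
  = (SUM i<N. qf lam (m k i) * dx N (u (Suc k)) i) - (SUM i<N. qf lam (m k i) * dx N (u k) i)"
  by (simp add: right_diff_distrib sum_subtractf)
 show ?thesis unfolding total_energy_def w_def[symmetric] using A 1 2 3 4 by linarith
qed

text \<open>Per cell, with p the strain, q the stress and s = |m|^2: Young gives q p >= - gm p^2 / 4
  - q^2 / gm. From q^2 <= lam^2 s^2 / 4 and s^2 <= 2 (s - 1)^2 + 2 the last term is at most ((s -
  1)^2 + 1) / (8 dl) as soon as 4 lam^2 dl <= gm. Half of the memory term and half of the double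
  well survive; 1/(8 dl) per cell is the additive loss.\<close>

lemma total_energy_lower:
 assumes dl: "dl > 0" "dl * (4 * lam^2) <= gm" and gm: "gm > 0" "gm <= Gd k" and G: "!!n. Gd (Suc n) <= Gd n"
 shows "(SUM i<N. (vel tau U1 u k i)^2 / 2) + (SUM i<N. gm / 4 * (dx N (u k) i)^2)
  + (SUM i<N. ((norm (m k i))^2 - 1)^2 / (8 * dl)) + (SUM i<N. (norm (dxm N (m k) i))^2) / 2
  <= total_energy N tau lam dl Gd U1 u m k + real N / (8 * dl)"
proof -
 have cell: "gm / 4 * (dx N (u k) i)^2 + ((norm (m k i))^2 - 1)^2 / (8 * dl)
  <= mem_energy Gd (%j. dx N (u j) i) k + ((norm (m k i))^2 - 1)^2 / (4 * dl) + qf lam (m k i) * dx N (u k) i + 1 / (8 * dl)" for i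
 proof -
  define p where "p = dx N (u k) i"
  define q where "q = qf lam (m k i)"
  define s where "s = (norm (m k i))^2"
  have "gm * p^2 / 2 <= Gd k * p^2 / 2" using gm by (intro divide_right_mono mult_right_mono) auto
  also have "... <= mem_energy Gd (%j. dx N (u j) i) k" using mem_energy_ge[of Gd k "%j. dx N (u j) i"] G by (simp add: p_def)
  finally have a: "gm * p^2 / 2 <= mem_energy Gd (%j. dx N (u j) i) k" .
  have "\<bar>q\<bar> <= \<bar>lam\<bar> / 2 * s" unfolding q_def s_def by (rule qf_bound)
  then have "q^2 <= (\<bar>lam\<bar> / 2 * s)^2" by (metis abs_ge_zero power2_abs power_mono)
  then have "q^2 <= lam^2 * s^2 / 4" by (simp add: power_mult_distrib power_divide)
  also have "... <= lam^2 * (2 * (s - 1)^2 + 2) / 4"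
  proof -
  have "0 <= (s - 2)^2" by simp
  then have "s^2 <= 2 * (s - 1)^2 + 2" by (simp add: power2_eq_square algebra_simps)
  then show ?thesis by (intro divide_right_mono mult_left_mono) auto
  qed
  also have "... = lam^2 * ((s - 1)^2 + 1) / 2" by (simp add: algebra_simps)
  finally have q2: "q^2 <= lam^2 * ((s - 1)^2 + 1) / 2" .
  have "8 * dl * q^2 <= 8 * dl * (lam^2 * ((s - 1)^2 + 1) / 2)" using dl(1) by (intro mult_left_mono[OF q2]) auto
  also have "... = dl * (4 * lam^2) * ((s - 1)^2 + 1)" by simp
  also have "... <= gm * ((s - 1)^2 + 1)" by (intro mult_right_mono dl(2)) auto
  finally have q3: "q^2 / gm <= ((s - 1)^2 + 1) / (8 * dl)" using gm(1) dl(1) by (simp add: field_simps)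
  have "0 <= (gm * p + 2 * q)^2 / (4 * gm)" using gm(1) by simp
  also have "... = gm * p^2 / 4 + q * p + q^2 / gm" using gm(1) by (simp add: field_simps power2_eq_square)
  finally have b: "- (gm * p^2 / 4) - q^2 / gm <= q * p" by linarith
  have "(s - 1)^2 / (4 * dl) = (s - 1)^2 / (8 * dl) + (s - 1)^2 / (8 * dl)" using dl(1) by (simp add: field_simps)
  then show ?thesis unfolding p_def[symmetric] q_def[symmetric] s_def[symmetric]
  using a b q3 by (simp add: add_divide_distrib)
 qed
 have "(SUM i<N. gm / 4 * (dx N (u k) i)^2 + ((norm (m k i))^2 - 1)^2 / (8 * dl))
  <= (SUM i<N. mem_energy Gd (%j. dx N (u j) i) k + ((norm (m k i))^2 - 1)^2 / (4 * dl) + qf lam (m k i) * dx N (u k) i + 1 / (8 * dl))"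
  by (rule sum_mono) (rule cell)
 then show ?thesis unfolding total_energy_def pot_def by (simp add: sum.distrib)
qed

text \<open>The force is absorbed without a Gronwall argument: per unit time it costs at most T F^2
  + V / (4 T), and with V replaced by its maximum \<open>Vm\<close> over the levels the total is
  \<open>Vm / 4\<close>, less than the \<open>Vm / 2\<close> contained in the energy at the
  maximising level.\<close>

lemma scheme_energy_bound:
 assumes s: "scheme N tau lam dl Gd U1 F M0 u m" and tau: "tau > 0" and N: "N > 0" and T: "real N * tau = T"
  and G: "!!n. 0 <= Gd n" "!!n. Gd (Suc n) <= Gd n" "!!n. Gd (Suc n) - Gd (Suc (Suc n)) <= Gd n - Gd (Suc n)"
  and dl: "dl > 0" "dl * (4 * lam^2) <= gm" and gm: "gm > 0" "!!k. k <= N ==> gm <= Gd k"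
  and U1: "(SUM i<N. (U1 i)^2) <= real N * A1" and F: "tau * (\<Sum>k=1..N. SUM i<N. (F k i)^2) <= real N * A2"
  and M0: "!!i. i < N ==> norm (M0 i) <= 1" and dM0: "(SUM i<N. (norm (dxm N M0 i))^2) <= real N * A3"
  and K: "K = A1 + A3 + 1 / dl + 2 * T * A2"
 shows "k <= N ==> (SUM i<N. (vel tau U1 u k i)^2) <= real N * (2 * K)"
  "k <= N ==> (SUM i<N. (dx N (u k) i)^2) <= real N * (4 * K / gm)"
  "k <= N ==> (SUM i<N. ((norm (m k i))^2 - 1)^2) <= real N * (8 * dl * K)"
  "k <= N ==> (SUM i<N. (norm (dxm N (m k) i))^2) <= real N * (2 * K)"
  "(SUM k<N. SUM i<N. (norm (m (Suc k) i - m k i))^2) <= tau * (real N * (2 * K))"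
proof -
 define E where "E k = total_energy N tau lam dl Gd U1 u m k" for k
 define V where "V k = (SUM i<N. (vel tau U1 u k i)^2)" for k
 define W where "W k = (SUM i<N. (norm (m (Suc k) i - m k i))^2) / (2 * tau)" for k
 define B where "B = real N * (A1 / 2 + A3 / 2 + 1 / (2 * dl))"
 have T0: "T > 0" using T tau N by (metis mult_pos_pos of_nat_0_less_iff)
 have u0: "u 0 = (%i. 0)" and m0: "m 0 = M0" using s by (auto simp: scheme_def)
 have W0: "0 <= W k" for k unfolding W_def using tau by (intro divide_nonneg_nonneg sum_nonneg) auto
 have E0: "E 0 + real N / (8 * dl) <= B"
 proof -
  have "(SUM i<N. ((norm (M0 i))^2 - 1)^2 / (4 * dl)) <= (SUM i<N. 1 / (4 * dl))"
  proof (rule sum_mono)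
  fix i assume "i \<in> {..<N}"
  then have "norm (M0 i) <= 1" using M0 by simp
  then have "(norm (M0 i))^2 <= 1" by (simp add: power_le_one)
  then have "\<bar>(norm (M0 i))\<^sup>2 - 1\<bar> <= 1" by simp
  then have "((norm (M0 i))^2 - 1)^2 <= 1" using abs_square_le_1 by blast
  then show "((norm (M0 i))^2 - 1)^2 / (4 * dl) <= 1 / (4 * dl)" using dl(1) by (intro divide_right_mono) auto
  qed
  then have 1: "pot dl N M0 <= real N / (4 * dl) + real N * A3 / 2" using dM0 by (simp add: pot_def)
  have "E 0 = (SUM i<N. (U1 i)^2 / 2) + pot dl N M0"
  by (simp add: E_def total_energy_def vel_def u0 m0 mem_energy_def dx_def)
  then have "E 0 <= real N * A1 / 2 + real N / (4 * dl) + real N * A3 / 2"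
  using 1 U1 by (simp flip: sum_divide_distrib)
  then have "E 0 + real N / (8 * dl) <= real N * A1 / 2 + real N * A3 / 2 + (real N / (4 * dl) + real N / (8 * dl))" by simp
  also have "real N / (4 * dl) + real N / (8 * dl) <= real N / (2 * dl)" using dl(1) by (simp add: field_simps)
  finally show ?thesis by (simp add: B_def algebra_simps add_divide_distrib)
 qed
 have step: "E (Suc k) + W k <= E k + tau * (SUM i<N. F (Suc k) i * vel tau U1 u (Suc k) i)" for k
  unfolding E_def W_def by (rule scheme_energy_step[OF s tau G])
 have low: "V k / 2 + (SUM i<N. gm / 4 * (dx N (u k) i)^2)
  + (SUM i<N. ((norm (m k i))^2 - 1)^2 / (8 * dl)) + (SUM i<N. (norm (dxm N (m k) i))^2) / 2
  <= E k + real N / (8 * dl)" if "k <= N" for k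
  using total_energy_lower[where N = N and tau = tau and ?U1.0 = U1 and u = u and m = m and Gd = Gd and k = k, OF dl gm(1) gm(2)[OF that] G(2)] by (simp add: E_def V_def sum_divide_distrib)
 define Vm where "Vm = Max (V ` {..N})"
 have VVm: "V k <= Vm" if "k <= N" for k unfolding Vm_def using that by (intro Max_ge) auto
 have V0: "0 <= V k" for k by (simp add: V_def sum_nonneg)
 have force: "tau * (SUM i<N. F (Suc k) i * vel tau U1 u (Suc k) i) <= tau * T * (SUM i<N. (F (Suc k) i)^2) + tau / (4 * T) * Vm" if "k < N" for k
 proof -
  have "(SUM i<N. F (Suc k) i * vel tau U1 u (Suc k) i) <= (SUM i<N. T * (F (Suc k) i)^2 + (vel tau U1 u (Suc k) i)^2 / (4 * T))"
  proof (rule sum_mono)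
  fix i
  have "0 <= (2 * T * F (Suc k) i - vel tau U1 u (Suc k) i)^2 / (4 * T)" using T0 by simp
  then show "F (Suc k) i * vel tau U1 u (Suc k) i <= T * (F (Suc k) i)^2 + (vel tau U1 u (Suc k) i)^2 / (4 * T)"
  using T0 by (simp add: power2_eq_square field_simps)
  qed
  also have "... = T * (SUM i<N. (F (Suc k) i)^2) + V (Suc k) / (4 * T)"
  by (simp add: V_def sum.distrib sum_distrib_left sum_divide_distrib)
  also have "... <= T * (SUM i<N. (F (Suc k) i)^2) + Vm / (4 * T)"
  using T0 that by (intro add_left_mono divide_right_mono VVm) auto
  finally have "tau * (SUM i<N. F (Suc k) i * vel tau U1 u (Suc k) i) <= tau * (T * (SUM i<N. (F (Suc k) i)^2) + Vm / (4 * T))"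
  using tau by (intro mult_left_mono) auto
  then show ?thesis by (simp add: algebra_simps)
 qed
 have main: "E k + (SUM j<k. W j) <= E 0 + T * (tau * (\<Sum>j=1..k. SUM i<N. (F j i)^2)) + real k * (tau / (4 * T) * Vm)" if "k <= N" for k
  using that
 proof (induction k)
  case (Suc k)
  then have "E (Suc k) + (SUM j<Suc k. W j) <= E k + (SUM j<k. W j) + (tau * T * (SUM i<N. (F (Suc k) i)^2) + tau / (4 * T) * Vm)"
  using step[of k] force[of k] by simp
  also have "... <= E 0 + T * (tau * (\<Sum>j=1..k. SUM i<N. (F j i)^2)) + real k * (tau / (4 * T) * Vm) + (tau * T * (SUM i<N. (F (Suc k) i)^2) + tau / (4 * T) * Vm)"
  using Suc by simp
  also have "... = E 0 + T * (tau * (\<Sum>j=1..Suc k. SUM i<N. (F j i)^2)) + real (Suc k) * (tau / (4 * T) * Vm)"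
  by (simp add: algebra_simps add_divide_distrib)
  finally show ?case .
 qed simp
 have Vm0: "0 <= Vm" using V0[of 0] VVm[of 0] by simp
 have main2: "E k + real N / (8 * dl) + (SUM j<k. W j) <= B + T * (real N * A2) + Vm / 4" if "k <= N" for k
 proof -
  have "tau * (\<Sum>j=1..k. SUM i<N. (F j i)^2) <= tau * (\<Sum>j=1..N. SUM i<N. (F j i)^2)"
  using tau that by (intro mult_left_mono sum_mono2) (auto intro: sum_nonneg)
  also note F
  finally have 1: "T * (tau * (\<Sum>j=1..k. SUM i<N. (F j i)^2)) <= T * (real N * A2)" using T0 by (intro mult_left_mono) auto
  have "real k * (tau / (4 * T) * Vm) <= real N * (tau / (4 * T) * Vm)"
  using that tau T0 Vm0 by (intro mult_right_mono) auto
  also have "... = real N * tau / (4 * T) * Vm" by simp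
  also have "... = Vm / 4" unfolding T using T0 by simp
  finally show ?thesis using main[OF that] 1 E0 by linarith
 qed
 have Vhalf: "V k / 2 <= B + T * (real N * A2) + Vm / 4" if "k <= N" for k
 proof -
  have "0 <= (SUM i<N. gm / 4 * (dx N (u k) i)^2)" "0 <= (SUM i<N. ((norm (m k i))^2 - 1)^2 / (8 * dl))"
  "0 <= (SUM i<N. (norm (dxm N (m k) i))^2) / 2" "0 <= (SUM j<k. W j)"
  using gm(1) dl(1) W0 by (auto intro!: sum_nonneg)
  then show ?thesis using low[OF that] main2[OF that] by linarith
 qed
 have "Vm \<in> V ` {..N}" unfolding Vm_def by (rule Max_in) auto
 then obtain k0 where k0: "k0 <= N" "Vm = V k0" by auto
 have "V k0 / 2 <= X + V k0 / 4 ==> V k0 <= 4 * X" for X by simp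
 then have "Vm <= 4 * (B + T * (real N * A2))" using Vhalf[OF k0(1)] unfolding k0(2) by blast
 moreover have "Vm <= 4 * X ==> X + Vm / 4 <= 2 * X" for X by simp
 ultimately have "B + T * (real N * A2) + Vm / 4 <= 2 * (B + T * (real N * A2))" by blast
 \<comment> \<open>Origin of \<open>K\<close>: twice the data bound
   \<open>B + T * (real N * A2)\<close>, the factor two being the price of absorbing
   \<open>Vm\<close>.\<close>
 also have "... = real N * K" unfolding B_def K using dl(1) by (simp add: field_simps)
 finally have fin: "B + T * (real N * A2) + Vm / 4 <= real N * K" .
 have all: "V k / 2 + (SUM i<N. gm / 4 * (dx N (u k) i)^2)
  + (SUM i<N. ((norm (m k i))^2 - 1)^2 / (8 * dl)) + (SUM i<N. (norm (dxm N (m k) i))^2) / 2 + (SUM j<k. W j) <= real N * K" if "k <= N" for k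
  using low[OF that] main2[OF that] fin by linarith
 have nn: "0 <= (SUM i<N. gm / 4 * (dx N (u k) i)^2)" "0 <= (SUM i<N. ((norm (m k i))^2 - 1)^2 / (8 * dl))"
  "0 <= (SUM i<N. (norm (dxm N (m k) i))^2) / 2" "0 <= (SUM j<k. W j)" for k
  using gm(1) dl(1) W0 by (auto intro!: sum_nonneg)
 show "k <= N ==> (SUM i<N. (vel tau U1 u k i)^2) <= real N * (2 * K)"
  using all[of k] nn[of k] by (simp add: V_def)
 show "(SUM i<N. (dx N (u k) i)^2) <= real N * (4 * K / gm)" if "k <= N"
 proof -
  have "gm / 4 * (SUM i<N. (dx N (u k) i)^2) <= real N * K" using all[OF that] nn[of k] V0[of k] unfolding sum_distrib_left by linarith
  then show ?thesis using gm(1) by (simp add: field_simps)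
 qed
 show "(SUM i<N. ((norm (m k i))^2 - 1)^2) <= real N * (8 * dl * K)" if "k <= N"
 proof -
  have "(SUM i<N. ((norm (m k i))^2 - 1)^2) / (8 * dl) <= real N * K" using all[OF that] nn[of k] V0[of k] unfolding sum_divide_distrib by linarith
  then show ?thesis using dl(1) by (simp add: field_simps)
 qed
 show "(SUM i<N. (norm (dxm N (m k) i))^2) <= real N * (2 * K)" if "k <= N"
  using all[OF that] nn[of k] V0[of k] by linarith
 show "(SUM k<N. SUM i<N. (norm (m (Suc k) i - m k i))^2) <= tau * (real N * (2 * K))"
 proof -
  have "(SUM k<N. W k) <= real N * K" using all[of N] nn[of N] V0[of N] by linarith
  then have "(SUM k<N. SUM i<N. (norm (m (Suc k) i - m k i))^2) / (2 * tau) <= real N * K"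
  by (simp add: W_def sum_divide_distrib)
  then show ?thesis using tau by (simp add: field_simps)
 qed
qed

section \<open>The cylinder as a product, cells and step functions\<close>

text \<open>The equality of the sigma-algebras is the point: a Borel subset of the rectangle is its
  own preimage under the measurable inclusion of the product. The measures then agree on
  rectangles.\<close>

lemma lbo_prod:
 fixes A :: "'a::euclidean_space set" and B :: "'b::euclidean_space set"
 assumes A: "A \<in> sets borel" and B: "B \<in> sets borel"
 shows "lbo A OX lbo B = lbo (A \<times> B)"
proof (rule pair_measure_eqI)
 show "sigma_finite_measure (lbo A)" "sigma_finite_measure (lbo B)"
  unfolding lbo_def using A B by (auto intro!: sigma_finite_measure_restrict_space sigma_finite_lborel)
 have AB: "A \<times> B \<in> sets borel" using A B by (simp add: borel_prod[symmetric])
 have sA: "X \<in> sets (lbo A) \<longleftrightarrow> X \<in> sets borel & X \<subseteq> A" for X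
  unfolding lbo_def using A by (subst sets_restrict_space_iff) auto
 have sB: "X \<in> sets (lbo B) \<longleftrightarrow> X \<in> sets borel & X \<subseteq> B" for X
  unfolding lbo_def using B by (subst sets_restrict_space_iff) auto
 have sAB: "X \<in> sets (lbo (A \<times> B)) \<longleftrightarrow> X \<in> sets borel & X \<subseteq> A \<times> B" for X
  unfolding lbo_def using AB by (subst sets_restrict_space_iff) auto
 show "sets (lbo A OX lbo B) = sets (lbo (A \<times> B))"
 proof
  have "{a \<times> b |a b. a \<in> sets (lbo A) & b \<in> sets (lbo B)} \<subseteq> sets (lbo (A \<times> B))"
  by (auto simp: sA sB sAB borel_prod[symmetric])
  then show "sets (lbo A OX lbo B) \<subseteq> sets (lbo (A \<times> B))"
  using sets.sigma_sets_subset[of _ "lbo (A \<times> B)"] by (simp add: sets_pair_measure)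
  show "sets (lbo (A \<times> B)) \<subseteq> sets (lbo A OX lbo B)"
  proof
  fix X assume X: "X \<in> sets (lbo (A \<times> B))"
  have "(%p. (fst p, snd p)) \<in> (lbo A OX lbo B) \<rightarrow>\<^sub>M (borel OX borel)"
  by (intro measurable_Pair measurable_compose[OF measurable_fst] measurable_compose[OF measurable_snd] borel_imp_lbo) auto
  moreover have "X \<in> sets (borel OX borel)" using X unfolding sAB borel_prod by blast
  ultimately have "(%p. (fst p, snd p)) -` X \<inter> space (lbo A OX lbo B) \<in> sets (lbo A OX lbo B)"
  by (rule measurable_sets)
  moreover have "(%p. (fst p, snd p)) -` X \<inter> space (lbo A OX lbo B) = X"
  using X by (auto simp: sAB space_pair_measure)
  ultimately show "X \<in> sets (lbo A OX lbo B)" by simp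
  qed
 qed
 fix a b assume ab: "a \<in> sets (lbo A)" "b \<in> sets (lbo B)"
 have "emeasure (lbo A) a = emeasure lborel a" "emeasure (lbo B) b = emeasure lborel b"
  unfolding lbo_def using ab A B by (auto simp: emeasure_restrict_space sA sB)
 moreover have "emeasure (lbo (A \<times> B)) (a \<times> b) = emeasure lborel (a \<times> b)"
  unfolding lbo_def using ab AB by (subst emeasure_restrict_space) (auto simp: sA sB)
 moreover have "emeasure lborel (a \<times> b) = emeasure (lborel OX lborel) (a \<times> b)" by (simp add: lborel_prod)
 moreover have "... = emeasure lborel a * emeasure lborel b"
  using ab by (intro lborel.emeasure_pair_measure_Times) (auto simp: sA sB)
 ultimately show "emeasure (lbo A) a * emeasure (lbo B) b = emeasure (lbo (A \<times> B)) (a \<times> b)" by simp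
qed

declare Omega_borel [measurable]

lemma Cyl_borel [simp, measurable]: "Cyl T \<in> sets borel"
 by (simp add: Cyl_def borel_prod[symmetric])

lemma Cyl_eq: "lC T = lO OX lbo {0<..<T}"
 by (simp add: lbo_prod Cyl_def)

lemma finite_measure_Cyl: "finite_measure (lC T)"
proof -
 interpret A: finite_measure "lbo {0<..<T}" by (rule finite_measure_lbo_Ioo)
 interpret pair_sigma_finite "lO" "lbo {0<..<T}" by unfold_locales
 show ?thesis unfolding Cyl_eq
  by (rule finite_measureI) (simp add: space_pair_measure A.emeasure_pair_measure_Times ennreal_mult_eq_top_iff
  sets.top[of "lO", simplified] sets.top[of "lbo {0<..<T}", simplified] Om.emeasure_finite A.emeasure_finite)
qed

definition ix :: "nat => real => nat" where
 "ix N x = nat \<lfloor>real N * x\<rfloor>"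

text \<open>A time cell carries the value at its right end level, a space cell the value with its
  left index. This convention is the source of the shifts \<open>Suc k\<close> and
  \<open>k - 1\<close> below.\<close>

definition stp :: "nat => real => (nat => nat => 'b) => real*real => 'b" where
 "stp N T a p = a (Suc (ix N (snd p / T))) (ix N (fst p))"

lemma ix_bounds:
 assumes "0 <= x" shows "real (ix N x) <= real N * x" "real N * x < real (ix N x) + 1"
 using assms by (auto simp: ix_def floor_le_iff) 

lemma ix_less: "x < 1 ==> 0 < N ==> ix N x < N"
proof -
 assume "x < 1" "0 < N"
 then have "real N * x < real N" by simp
 then have "\<lfloor>real N * x\<rfloor> < int N" by (simp add: floor_less_iff)
 then show ?thesis using \<open>0 < N\<close> unfolding ix_def by linarith
qed

lemma ix_measurable [measurable]: "ix N \<in> borel \<rightarrow>\<^sub>M count_space UNIV"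
 unfolding ix_def[abs_def] by measurable

lemma stp_measurable:
 fixes a :: "nat => nat => 'b::euclidean_space"
 shows "stp N T a \<in> bms borel"
proof -
 have 1: "(%p :: real*real. (Suc (ix N (snd p / T)), ix N (fst p))) \<in> borel \<rightarrow>\<^sub>M count_space UNIV"
 proof -
  have "(%p :: real*real. (Suc (ix N (snd p / T)), ix N (fst p))) \<in> (borel OX borel) \<rightarrow>\<^sub>M (count_space UNIV OX count_space UNIV)"
  by measurable
  then show ?thesis by (simp add: borel_prod pair_measure_countable)
 qed
 have "(%q. a (fst q) (snd q)) \<in> count_space UNIV \<rightarrow>\<^sub>M borel" by simp
 from measurable_compose[OF 1 this] show ?thesis by (simp add: stp_def[abs_def])
qed

text \<open>A set of reals and not a part of \<open>Omega\<close>: truncation by \<open>nat\<close>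
  puts all negative reals into \<open>cell N 0\<close>, so statements about measure go through the
  intersection with \<open>Omega\<close>.\<close>

definition cell :: "nat => nat => real set" where
 "cell N i = {x. ix N x = i}"

lemma cell_borel [measurable]: "cell N i \<in> sets borel"
proof -
 have "ix N -` {i} \<inter> space borel \<in> sets borel" by (rule measurable_sets[OF ix_measurable]) simp
 then show ?thesis by (simp add: cell_def vimage_def)
qed

lemma cell_eq:
 assumes "N > 0" "i < N"
 shows "x \<in> Omega ==> x \<in> cell N i \<longleftrightarrow> real i / real N <= x & x < real (Suc i) / real N"
 using assms unfolding cell_def ix_def Omega_def
 by (auto simp: nat_eq_iff floor_eq_iff field_simps)

lemma sum_cell_indicator:
 fixes a :: "nat => 'b::real_vector"
 assumes "0 < N" "x < 1"
 shows "(SUM i<N. ind (cell N i) x *R a i) = a (ix N x)"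
proof -
 have "(SUM i<N. ind (cell N i) x *R a i) = (\<Sum>i\<in>{ix N x}. ind (cell N i) x *R a i)"
  using ix_less[OF assms(2,1)] by (intro sum.mono_neutral_right) (auto simp: cell_def)
 then show ?thesis by (simp add: cell_def)
qed

lemma integral_cell: "i < N ==> (LINT x|lO. rind (cell N i) x) = 1 / real N"
proof -
 assume i: "i < N"
 then have N: "0 < N" by simp
 have "(LINT x|lO. rind (cell N i) x) = (LINT x|lborel. ind Omega x *R rind (cell N i) x)"
  by (rule integral_lbo) simp
 also have "... = (LINT x|lborel. rind {real i / real N..<real (Suc i) / real N} x)"
 proof (rule integral_cong_AE)
  have "AE x in lborel. x ~= (0::real)" using AE_lborel_singleton by auto
  then show "AE x in lborel. ind Omega x *R ind (cell N i) x = (ind {real i / real N..<real (Suc i) / real N} x :: real)"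
  proof eventually_elim
  case (elim x)
  have "real (Suc i) / real N <= 1" using i by simp
  moreover have "0 <= real i / real N" by simp
  ultimately have "x \<in> Omega" if "x \<in> {real i / real N..<real (Suc i) / real N}"
  using elim that unfolding Omega_def atLeastLessThan_iff greaterThanLessThan_iff by linarith
  then show ?case using cell_eq[OF N i, of x] by (auto simp: indicator_def)
  qed
 qed auto
 also have "... = measure lborel {real i / real N..<real (Suc i) / real N}" by simp
 also have "... = 1 / real N" using N by (subst measure_lborel_Ico) (auto simp: field_simps)
 finally show ?thesis .
qed

lemma integral_step1:
 fixes a :: "nat => 'b::euclidean_space"
 assumes N: "0 < N"
 shows "integrable lO (%x. a (ix N x))" "(LINT x|lO. a (ix N x)) = (1 / real N) *R (SUM i<N. a i)"
proof -
 have [measurable]: "ind (cell N i) \<in> bms lO" for i by (rule borel_imp_lbo) simp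
 have i: "integrable lO (ind (cell N i) :: real => real)" for i
  by (rule Om.sq_int_integrable[OF Om.sq_int_bounded[where C = 1]]) (auto simp: indicator_def)
 have eq: "a (ix N x) = (SUM i<N. ind (cell N i) x *R a i)" if "x \<in> space lO" for x
  using that N by (intro sum_cell_indicator[symmetric]) (auto simp: Omega_def)
 have "integrable lO (%x. SUM i<N. ind (cell N i) x *R a i)"
  by (intro Bochner_Integration.integrable_sum integrable_scaleR_left i)
 then show "integrable lO (%x. a (ix N x))"
  by (subst Bitg_cong[OF refl eq])
 have "(LINT x|lO. a (ix N x)) = (LINT x|lO. (SUM i<N. ind (cell N i) x *R a i))"
  by (rule Bint_cong[OF refl eq])
 also have "... = (SUM i<N. (LINT x|lO. ind (cell N i) x *R a i))"
  by (rule Bint_sum) (intro integrable_scaleR_left i)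
 also have "... = (SUM i<N. (1 / real N) *R a i)"
 proof (rule sum.cong[OF refl])
  fix j assume "j \<in> {..<N}"
  have "(LINT x|lO. ind (cell N j) x *R a j) = (LINT x|lO. rind (cell N j) x) *R a j"
  by (rule integral_scaleR_left) (rule i)
  then show "(LINT x|lO. ind (cell N j) x *R a j) = (1 / real N) *R a j"
  using \<open>j \<in> {..<N}\<close> by (simp only: integral_cell lessThan_iff)
 qed
 finally show "(LINT x|lO. a (ix N x)) = (1 / real N) *R (SUM i<N. a i)" by (simp add: scaleR_sum_right)
qed

lemma nsq_step1:
 fixes a :: "nat => 'b::euclidean_space"
 assumes "0 < N"
 shows "nsq lO (%x. a (ix N x)) = (1 / real N) * (SUM i<N. (norm (a i))^2)"
  "sq_int lO (%x. a (ix N x))"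
proof -
 show "nsq lO (%x. a (ix N x)) = (1 / real N) * (SUM i<N. (norm (a i))^2)"
  unfolding nsq_def using integral_step1(2)[OF assms, of "%i. (norm (a i))^2"] by simp
 show "sq_int lO (%x. a (ix N x))"
  unfolding sq_int_def using integral_step1(1)[OF assms, of "%i. (norm (a i))^2"] integral_step1(1)[OF assms, of a] by auto
qed

section \<open>Compactness in the uniform topology\<close>

text \<open>Step functions jump, so equicontinuity can hold at each scale for large \<open>n\<close>
  only. The classical argument survives: diagonal selection on a countable dense set, finitely many
  balls centred in that set that cover the compact closure of \<open>S\<close>, and a three-term
  estimate for large \<open>n\<close>. The limit is uniformly continuous although its approximants
  are not continuous.\<close>

lemma asymptotic_Arzela_Ascoli:
 fixes f :: "nat => 'a::euclidean_space => 'b::euclidean_space"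
 assumes S: "bounded S" and M: "!!n x. x \<in> S ==> norm (f n x) <= M"
  and eq: "!!e. e > 0 ==> \<exists>d>0. \<exists>n0. \<forall>n\<ge>n0. \<forall>x\<in>S. \<forall>y\<in>S. dist x y < d --> dist (f n x) (f n y) < e"
 obtains r g where "strict_mono (r :: nat => nat)" "uniformly_continuous_on S g"
  "!!e. e > 0 ==> \<exists>n0. \<forall>n\<ge>n0. \<forall>x\<in>S. dist (f (r n) x) (g x) < e"
proof -
 obtain D where D: "countable D" "D \<subseteq> S" "S \<subseteq> closure D" by (rule separable)
 obtain r where r: "strict_mono (r :: nat => nat)" "!!x. x \<in> D ==> \<exists>l. (%n. f (r n) x) ----> l"
  by (rule function_convergent_subsequence[of D f M]) (use D M in auto)
 have rge: "n <= r n" for n by (rule seq_suble[OF r(1)])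
 have uC: "\<exists>n0. \<forall>n\<ge>n0. \<forall>m\<ge>n0. \<forall>x\<in>S. dist (f (r n) x) (f (r m) x) < e" if e: "e > 0" for e
 proof -
  obtain d n1 where d: "d > 0" "\<forall>n\<ge>n1. \<forall>x\<in>S. \<forall>y\<in>S. dist x y < d --> dist (f n x) (f n y) < e / 3"
  using eq[of "e / 3"] e by auto
  have cS: "compact (closure S)" using S by simp
  have sub: "closure S \<subseteq> (\<Union>y\<in>D. ball y d)"
  proof
  fix x assume "x \<in> closure S"
  then have "x \<in> closure D" using D(3) closure_minimal closed_closure by blast
  then obtain y where "y \<in> D" "dist y x < d" using d(1) by (auto simp: closure_approachable)
  then show "x \<in> (\<Union>y\<in>D. ball y d)" by auto
  qed
  obtain F where F: "F \<subseteq> D" "finite F" "closure S \<subseteq> (\<Union>y\<in>F. ball y d)"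
  by (rule compactE_image[OF cS _ sub]) auto
  have "\<exists>n0. \<forall>n\<ge>n0. \<forall>m\<ge>n0. dist (f (r n) y) (f (r m) y) < e / 3" if "y \<in> D" for y
  proof -
  have "Cauchy (%n. f (r n) y)" using r(2)[OF that] LIMSEQ_imp_Cauchy by blast
  then show ?thesis using e unfolding Cauchy_def by (meson zero_less_divide_iff zero_less_numeral)
  qed
  then obtain nn where nn: "!!y n m. y \<in> D ==> n \<ge> nn y ==> m \<ge> nn y ==> dist (f (r n) y) (f (r m) y) < e / 3" by metis
  define n0 where "n0 = max n1 (Max (insert 0 (nn ` F)))"
  have "dist (f (r n) x) (f (r m) x) < e" if n: "n \<ge> n0" "m \<ge> n0" and x: "x \<in> S" for n m x
  proof -
  obtain y where y: "y \<in> F" "dist y x < d" using F(3) x closure_subset by force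
  have "nn y <= Max (insert 0 (nn ` F))" using F(2) y(1) by (intro Max_ge) auto
  then have ny: "n \<ge> nn y" "m \<ge> nn y" "n \<ge> n1" "m \<ge> n1" using n by (auto simp: n0_def)
  have yS: "y \<in> S" "y \<in> D" using y F(1) D(2) by auto
  have "dist (f (r n) y) (f (r n) x) < e / 3" "dist (f (r m) y) (f (r m) x) < e / 3"
  using d(2) y(2) yS(1) x ny(3,4) rge le_trans by blast+
  moreover have "dist (f (r n) y) (f (r m) y) < e / 3" by (rule nn[OF yS(2) ny(1,2)])
  ultimately show ?thesis
  using dist_triangle[of "f (r n) x" "f (r m) x" "f (r n) y"] dist_triangle[of "f (r n) y" "f (r m) x" "f (r m) y"]
  by (simp add: dist_commute)
  qed
  then show ?thesis by blast
 qed
 define g where "g x = lim (%n. f (r n) x)" for x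
 have lim: "(%n. f (r n) x) ----> g x" if x: "x \<in> S" for x
 proof -
  have "Cauchy (%n. f (r n) x)" unfolding Cauchy_def using uC x by meson
  then show ?thesis by (simp add: g_def Cauchy_convergent_iff convergent_LIMSEQ_iff)
 qed
 have unif: "\<exists>n0. \<forall>n\<ge>n0. \<forall>x\<in>S. dist (f (r n) x) (g x) < e" if e: "e > 0" for e
 proof -
  obtain n0 where n0: "\<forall>n\<ge>n0. \<forall>m\<ge>n0. \<forall>x\<in>S. dist (f (r n) x) (f (r m) x) < e / 2" using uC[of "e / 2"] e by auto
  have "dist (f (r n) x) (g x) < e" if "n \<ge> n0" "x \<in> S" for n x
  proof -
  have "(%m. dist (f (r n) x) (f (r m) x)) ----> dist (f (r n) x) (g x)"
  by (intro tendsto_dist tendsto_const lim that)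
  then have "dist (f (r n) x) (g x) <= e / 2"
  by (rule LIMSEQ_le_const2) (use n0 that in \<open>auto intro!: exI[of _ n0] less_imp_le\<close>)
  then show ?thesis using e by simp
  qed
  then show ?thesis by blast
 qed
 have "uniformly_continuous_on S g"
  unfolding uniformly_continuous_on_def
 proof (intro allI impI)
  fix e :: real assume e: "e > 0"
  obtain d n1 where d: "d > 0" "\<forall>n\<ge>n1. \<forall>x\<in>S. \<forall>y\<in>S. dist x y < d --> dist (f n x) (f n y) < e / 3"
  using eq[of "e / 3"] e by auto
  obtain n0 where n0: "\<forall>n\<ge>n0. \<forall>x\<in>S. dist (f (r n) x) (g x) < e / 3" using unif[of "e / 3"] e by auto
  define n where "n = max n0 n1"
  have rn: "r n \<ge> n1" using rge[of n] by (simp add: n_def)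
  have "dist (g x') (g x) < e" if "x \<in> S" "x' \<in> S" "dist x' x < d" for x x'
  proof -
  have "dist (f (r n) x) (g x) < e / 3" "dist (f (r n) x') (g x') < e / 3" using n0 that by (auto simp: n_def)
  moreover have "dist (f (r n) x') (f (r n) x) < e / 3" using d(2) rn that by blast
  ultimately show ?thesis
  using dist_triangle[of "g x'" "g x" "f (r n) x'"] dist_triangle[of "f (r n) x'" "g x" "f (r n) x"]
  by (simp add: dist_commute)
  qed
  then show "\<exists>d>0. \<forall>x\<in>S. \<forall>x'\<in>S. dist x' x < d --> dist (g x') (g x) < e" using d(1) by blast
 qed
 then show thesis using that[OF r(1) _ unif] by blast
qed

section \<open>Sobolev norms of primitives and membership in \<open>H1_0\<close>\<close>

lemma lebesgue_on_measurable_AE: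
 fixes f g :: "'a::euclidean_space => 'b::euclidean_space"
 assumes S: "S \<in> sets borel" and g: "g \<in> bms (lebesgue_on S)" and ae: "AE x in lebesgue_on S. f x = g x"
 shows "f \<in> bms (lebesgue_on S)"
proof -
 have SL: "S \<inter> space lebesgue \<in> sets lebesgue" using S by simp
 have "(%x. ind S x *R g x) \<in> bms lebesgue"
  using g by (subst (asm) borel_measurable_restrict_space_iff[OF SL])
 moreover have "AE x in lebesgue. ind S x *R g x = ind S x *R f x"
  using ae unfolding AE_restrict_space_iff[OF SL] by eventually_elim (auto simp: indicator_def)
 ultimately have "(%x. ind S x *R f x) \<in> bms lebesgue" by (rule borel_measurable_AE)
 then show ?thesis by (subst borel_measurable_restrict_space_iff[OF SL])
qed

lemma weak_deriv_unique:
 fixes f :: "real => 'b::euclidean_space"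
 assumes "has_weak_deriv Omega 1 f g" "has_weak_deriv Omega 1 f g'"
 shows "AE x in lebesgue_on Omega. g x = g' x"
proof -
 have loc: "locally_integrable Omega g" "locally_integrable Omega g'" using assms by (auto simp: has_weak_deriv_def)
 have "AE x in lebesgue_on Omega. g x - g' x = 0"
 proof (rule fundamental_lemma)
  show "locally_integrable Omega (%x. g x - g' x)" using loc by (auto simp: locally_integrable_def)
  fix ph :: "real => real" assume t: "test_function Omega ph"
  have "(LINT x|lebesgue_on Omega. ph x *R (g x - g' x)) = (LINT x|lebesgue_on Omega. ph x *R g x) - (LINT x|lebesgue_on Omega. ph x *R g' x)"
  using test_mult_integrable[OF t loc(1) Omega_borel] test_mult_integrable[OF t loc(2) Omega_borel]
  by (simp add: scaleR_diff_right)
  then show "(LINT x|lebesgue_on Omega. ph x *R (g x - g' x)) = 0"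
  using assms t unfolding has_weak_deriv_def by (metis (no_types, lifting) add.inverse_inverse diff_self)
 qed
 then show ?thesis by eventually_elim simp
qed

text \<open>Pairs a function with a concrete derivative, because \<open>weak_deriv\<close> is a
  choice; \<open>H1_norm_W1\<close> evaluates the norm on such pairs by uniqueness up to null
  sets.\<close>

definition W1 :: "(real => 'b::euclidean_space) => (real => 'b) => bool" where
 "W1 w g \<longleftrightarrow> has_weak_deriv Omega 1 w g & sq_int lO w & sq_int lO g"

lemma W1_H1: "W1 w g ==> H1 Omega w"
 unfolding W1_def H1_def using L2_lbo(1)[OF Omega_borel] sq_intD(1) by metis

lemma H1_norm_W1:
 assumes "W1 w g"
 shows "H1_norm Omega w = sqrt (nsq lO w + nsq lO g)"
proof -
 have wd: "has_weak_deriv Omega 1 w (weak_deriv Omega 1 w)"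
  unfolding weak_deriv_def by (rule someI[of _ g]) (use assms in \<open>simp add: W1_def\<close>)
 have ae: "AE x in lebesgue_on Omega. weak_deriv Omega 1 w x = g x"
  by (rule weak_deriv_unique[OF wd]) (use assms in \<open>simp add: W1_def\<close>)
 have g: "g \<in> bms (lebesgue_on Omega)"
  using assms by (intro lebesgue_on_measurable) (auto simp: W1_def sq_int_def)
 have [measurable]: "weak_deriv Omega 1 w \<in> bms (lebesgue_on Omega)"
  by (rule lebesgue_on_measurable_AE[OF _ g ae]) simp
 note g[measurable]
 have "(LINT x|lebesgue_on Omega. (norm (weak_deriv Omega 1 w x))^2) = (LINT x|lebesgue_on Omega. (norm (g x))^2)"
  by (rule integral_cong_AE) (use ae in auto)
 then have "L2_norm Omega (weak_deriv Omega 1 w) = L2_norm Omega g" by (simp add: L2_norm_def)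
 then show ?thesis
  using assms L2_lbo(2)[OF Omega_borel, of w] L2_lbo(2)[OF Omega_borel, of g]
  by (simp add: H1_norm_def W1_def sq_int_def nsq_nonneg)
qed

lemma W1_prim: "sq_int lO g ==> W1 (prim c g) g"
 unfolding W1_def using has_weak_deriv_prim integrable_prim Om.sq_int_integrable by blast

lemma prim_diff:
 assumes "integrable lO g" "integrable lO g'"
 shows "prim c g x - prim c' g' x = prim (c - c') (%y. g y - g' y) x"
 using indicator_integrable_lbo[OF assms(1)] indicator_integrable_lbo[OF assms(2)]
 unfolding prim_def by (simp add: scaleR_diff_right)

lemma prim_lincomb:
 assumes "!!k. k \<in> A ==> integrable lO (g k)"
 shows "(\<Sum>k\<in>A. c k *R prim (b k) (g k) x) = prim (\<Sum>k\<in>A. c k *R b k) (%y. \<Sum>k\<in>A. c k *R g k y) x"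
proof -
 have "(LINT y|lO. (\<Sum>k\<in>A. c k *R (ind {..<x} y *R g k y))) = (\<Sum>k\<in>A. c k *R (LINT y|lO. ind {..<x} y *R g k y))"
  by (subst Bint_sum) (auto intro!: integrable_scaleR_right indicator_integrable_lbo assms simp del: scaleR_scaleR)
 moreover have "(LINT y|lO. (\<Sum>k\<in>A. c k *R (ind {..<x} y *R g k y))) = (LINT y|lO. ind {..<x} y *R (\<Sum>k\<in>A. c k *R g k y))"
  by (intro Bint_cong refl) (simp add: scaleR_sum_right mult.commute)
 ultimately show ?thesis by (simp add: prim_def scaleR_add_right sum.distrib)
qed

text \<open>A sup bound by the L1 norm of \<open>g\<close>, Cauchy-Schwarz, and the fact that
  \<open>Omega\<close> has measure one.\<close>

lemma nsq_prim_le: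
 assumes g: "sq_int lO g"
 shows "nsq lO (prim c g) <= 2 * (norm c)^2 + 2 * nsq lO g"
proof -
 let ?I = "LINT y|lO. norm (g y)"
 have "(norm (prim c g x))^2 <= 2 * (norm c)^2 + 2 * nsq lO g" for x
 proof -
  have "(norm (prim c g x))^2 <= (norm c + ?I)^2"
  by (intro power_mono prim_norm_le Om.sq_int_integrable g) auto
  also have "... <= 2 * (norm c)^2 + 2 * ?I^2" using norm_add_sq_le[of "norm c" ?I] by simp
  also have "?I^2 <= nsq lO g" using Om.L1_le_nsq[OF g] by (simp add: measure_Omega)
  finally show ?thesis by simp
 qed
 then have "nsq lO (prim c g) <= (LINT x|lO. 2 * (norm c)^2 + 2 * nsq lO g)"
  unfolding nsq_def[of _ "prim c g"]
  by (intro integral_mono sq_intD(2) integrable_prim Om.sq_int_integrable g) (auto simp: Om.sq_int_const)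
 then show ?thesis by (simp add: measure_Omega)
qed

text \<open>The constant 3 is the 2 of \<open>nsq_prim_le\<close> plus 1 for the derivative
  itself.\<close>

lemma W1_diff_prim:
 assumes "sq_int lO g" "sq_int lO g'"
 shows "W1 (%x. prim c g x - prim c' g' x) (%x. g x - g' x)"
  "H1_norm Omega (%x. prim c g x - prim c' g' x) <= sqrt (2 * (norm (c - c'))^2 + 3 * nsq lO (%x. g x - g' x))"
proof -
 have eq: "(%x. prim c g x - prim c' g' x) = prim (c - c') (%y. g y - g' y)"
  using assms by (intro ext prim_diff Om.sq_int_integrable)
 show *: "W1 (%x. prim c g x - prim c' g' x) (%x. g x - g' x)"
  unfolding eq by (rule W1_prim[OF sq_int_diff[OF assms]])
 show "H1_norm Omega (%x. prim c g x - prim c' g' x) <= sqrt (2 * (norm (c - c'))^2 + 3 * nsq lO (%x. g x - g' x))"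
  unfolding H1_norm_W1[OF *] unfolding eq using nsq_prim_le[OF sq_int_diff[OF assms], of "c - c'"] by simp
qed

lemma bump_at_cell:
 assumes "0 < N" "x < 1" "!!i::nat. real N * x ~= real i" "0 < x"
 shows "(%n. bump (Suc n) (real N * x - real i)) ----> ind (cell N i) x"
proof -
 have "0 <= real N * x" using assms by simp
 then have "x \<in> cell N i \<longleftrightarrow> real i <= real N * x & real N * x < real i + 1"
  by (auto simp: cell_def ix_def nat_eq_iff floor_eq_iff)
 moreover have "real i <= real N * x \<longleftrightarrow> real i < real N * x" using assms(3)[of i] by linarith
 ultimately have "ind {0<..<1} (real N * x - real i) = (ind (cell N i) x :: real)"
  by (auto simp: indicator_def)
 then show ?thesis using LIMSEQ_Suc[OF bump_tendsto[of "real N * x - real i"]] by simp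
qed

lemma AE_off_grid: "0 < N ==> AE x in lO. \<forall>i::nat. real N * x ~= real i"
proof -
 assume N: "0 < N"
 have "AE x in lborel. x ~= real i / real N" for i :: nat using AE_lborel_singleton by auto
 then have "AE x in lborel. \<forall>i::nat. x ~= real i / real N" by (subst AE_all_countable) auto
 then have "AE x in lborel. x \<in> Omega --> (\<forall>i::nat. real N * x ~= real i)"
  by eventually_elim (use N in \<open>auto simp: field_simps\<close>)
 then show ?thesis unfolding lbo_def by (subst AE_restrict_space_iff) auto
qed

text \<open>The step derivative is approximated by bumps and its primitive by ramps. These are flat
  near the grid nodes, so the approximants are zero near 0 and a multiple of the sum of
  \<open>p\<close> near 1; the zero mean makes them test functions.\<close>

lemma H1_0_step:
 assumes N: "0 < N" and p: "(SUM i<N. p i) = 0"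
 shows "H1_0 Omega (prim 0 (%y. p (ix N y) :: real))"
proof -
 let ?g = "%y. p (ix N y)"
 define ph where "ph n x = (SUM i<N. (p i / real N) * bumpint (Suc n) (real N * x - real i))" for n x
 define ph' where "ph' n x = (SUM i<N. p i * bump (Suc n) (real N * x - real i))" for n x
 have dph: "(ph n has_real_derivative ph' n x) (at x)" for n x
 proof -
  have "((%x. (p i / real N) * bumpint (Suc n) (real N * x - real i)) has_real_derivative p i * bump (Suc n) (real N * x - real i)) (at x)" for i
  using N by (auto intro!: derivative_eq_intros DERIV_chain2[OF bumpint_deriv])
  then show ?thesis unfolding ph_def[abs_def] ph'_def by (intro DERIV_sum)
 qed
 have Dkph: "Dk k (ph n)" for k n
 proof -
  have "Dk k (%x. bumpint (Suc n) (real N * x + (- real i)))" for i by (intro Dk_affine Dk_bumpint) simp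
  then have "Dk k (%x. SUM i<N. (p i / real N) * bumpint (Suc n) (real N * x + (- real i)))"
  by (intro Dk_sum Dk_mult Dk_const)
  then show ?thesis by (simp add: ph_def[abs_def])
 qed
 have Dkph': "Dk k (ph' n)" for k n
 proof -
  have "Dk k (%x. bump (Suc n) (real N * x + (- real i)))" for i by (intro Dk_affine Dk_bump)
  then have "Dk k (%x. SUM i<N. p i * bump (Suc n) (real N * x + (- real i)))"
  by (intro Dk_sum Dk_mult Dk_const)
  then show ?thesis by (simp add: ph'_def[abs_def])
 qed
 \<comment> \<open>The flat margin 1/(n+1) of the unit ramp, scaled to cells of length 1/N.\<close>
 define e where "e n = 1 / ((rS n) * real N)" for n
 have e0: "e n > 0" for n using N by (simp add: e_def)
 have Ne: "real N * e n = 1 / (rS n)" for n using N by (simp add: e_def)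
 have zl: "ph n x = 0" if "x <= e n" for n x
 proof -
  have "bumpint (Suc n) (real N * x - real i) = 0" for i
  proof (rule bumpint_nonpos)
  have "real N * x <= real N * e n" using that N by (intro mult_left_mono) auto
  then show "real N * x - real i <= 1 / (rS n)" unfolding Ne by linarith
  qed simp
  then show ?thesis by (simp add: ph_def)
 qed
 have zr: "ph n x = 0" if "x \<ge> 1 - e n" for n x
 proof -
  have "bumpint (Suc n) (real N * x - real i) = bumpint (Suc n) 1" if "i < N" for i
  proof (rule bumpint_const)
  have "real N * (1 - e n) <= real N * x" using \<open>x \<ge> 1 - e n\<close> N by (intro mult_left_mono) auto
  then have "real N - 1 / (rS n) <= real N * x" unfolding Ne[symmetric] by (simp add: right_diff_distrib)
  moreover have "real i + 1 <= real N" using that by simp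
  ultimately show "1 - 1 / (rS n) <= real N * x - real i" by linarith
  qed simp
  then have "ph n x = (SUM i<N. (p i / real N) * bumpint (Suc n) 1)" by (simp add: ph_def)
  also have "... = 0" using p by (simp flip: sum_distrib_right sum_divide_distrib)
  finally show ?thesis .
 qed
 have test: "test_function Omega (ph n)" for n
 proof (rule Dk_test_function[where K = "{e n..1 - e n}"])
  show "ph n x = 0" if "x \<notin> {e n..1 - e n}" for x using that zl zr by force
  show "{e n..1 - e n} \<subseteq> Omega" using e0[of n] by (auto simp: Omega_def)
 qed (auto simp: Dkph)
 have cph': "continuous_on S (ph' n)" for n S using Dk_continuous[OF Dkph'[of 0 n]] continuous_on_subset by blast
 have mph': "ph' n \<in> bms lO" for n by (intro borel_imp_lbo borel_measurable_continuous_onI cph')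
 have eq: "ph n x = prim 0 (ph' n) x" for n x
 proof -
  consider "x <= 0" | "0 <= x" "x <= 1" | "1 <= x" by linarith
  then show ?thesis
  proof cases
  case 1
  then show ?thesis using zl[of x n] e0[of n] by (simp add: prim_le0)
  next
  case 2
  have "(LINT y|lO. ind {..<x} y *R ph' n y) = (LINT y|lO. ind {0<..<x} y * ph' n y)"
  by (intro Bint_cong) (auto simp: Omega_def indicator_def)
  also have "... = ph n x - ph n 0"
  by (rule FTC_lbo[OF _ cph']) (use 2 dph in \<open>auto intro: has_field_derivative_at_within\<close>)
  finally show ?thesis using zl[of 0 n] e0[of n] by (simp add: prim_def)
  next
  case 3
  have "(LINT y|lO. ph' n y) = (LINT y|lO. ind {0<..<1} y * ph' n y)"
  by (intro Bint_cong) (auto simp: Omega_def indicator_def)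
  also have "... = ph n 1 - ph n 0"
  by (rule FTC_lbo[OF _ cph']) (use dph in \<open>auto intro: has_field_derivative_at_within\<close>)
  finally show ?thesis using 3 zl[of 0 n] zr[of n 1] zr[of n x] e0[of n] by (simp add: prim_ge1)
  qed
 qed
 define C where "C = (SUM i<N. \<bar>p i\<bar>)"
 have bph': "norm (ph' n x) <= C" for n x
  unfolding ph'_def C_def
  by (rule sum_norm_le) (use bump_bounds in \<open>auto simp: abs_mult intro!: mult_left_le\<close>)
 have sqph': "sq_int lO (ph' n)" for n by (rule Om.sq_int_bounded[OF mph' bph'])
 have sqg: "sq_int lO ?g" by (rule nsq_step1(2)[OF N])
 have lim: "(%n. nsq lO (%x. ph' n x - ?g x)) ----> 0"
 proof -
  have [measurable]: "ph' n \<in> bms lO" "?g \<in> bms lO" for n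
  using mph' sqg by (auto simp: sq_int_def)
  have "(%n. LINT x|lO. (norm (ph' n x - ?g x))^2) ----> (LINT x|lO. 0)"
  proof (rule integral_dominated_convergence[where w = "%x. (2 * C)^2"])
  show "AE x in lO. (%n. (norm (ph' n x - ?g x))^2) ----> 0"
  using AE_off_grid[OF N] AE_space
  proof eventually_elim
  case (elim x)
  then have x: "0 < x" "x < 1" by (auto simp: Omega_def)
  have "(%n. ph' n x) ----> (SUM i<N. p i * ind (cell N i) x)"
  unfolding ph'_def by (intro tendsto_sum tendsto_mult tendsto_const bump_at_cell N) (use elim x in auto)
  also have "(SUM i<N. p i * ind (cell N i) x) = ?g x"
  using sum_cell_indicator[OF N x(2), of p] by (simp add: mult.commute)
  finally have "(%n. (norm (ph' n x - ?g x))^2) ----> (norm (?g x - ?g x))^2"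
  by (intro tendsto_intros)
  then show ?case by simp
  qed
  show "AE x in lO. norm ((norm (ph' n x - ?g x))^2) <= (2 * C)^2" for n
  proof (rule AE_I2)
  fix x assume "x \<in> space lO"
  then have "ix N x < N" using N by (intro ix_less) (auto simp: Omega_def)
  then have "\<bar>p (ix N x)\<bar> <= C" unfolding C_def by (intro member_le_sum) auto
  then have "norm (ph' n x - ?g x) <= 2 * C" using bph'[of n x] norm_triangle_ineq4[of "ph' n x" "?g x"] by simp
  then have "(norm (ph' n x - ?g x))^2 <= (2 * C)^2" by (rule power_mono) simp
  then show "norm ((norm (ph' n x - ?g x))^2) <= (2 * C)^2" by simp
  qed
  qed auto
  then show ?thesis by (simp add: nsq_def)
 qed
 show ?thesis
  unfolding H1_0_def
 proof (intro conjI exI allI)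
  show "H1 Omega (prim 0 ?g)" by (rule W1_H1[OF W1_prim[OF sqg]])
  show "test_function Omega (ph n)" for n by (rule test)
  show "(%n. H1_norm Omega (%x. ph n x - prim 0 ?g x)) ----> 0"
  proof (rule tendsto_sandwich[OF _ _ tendsto_const])
  have "(%n. sqrt (3 * nsq lO (%x. ph' n x - ?g x))) ----> sqrt (3 * 0)"
  by (intro tendsto_intros lim)
  then show "(%n. sqrt (3 * nsq lO (%x. ph' n x - ?g x))) ----> 0" by simp
  show "eventually (%n. 0 <= H1_norm Omega (%x. ph n x - prim 0 ?g x)) sequentially" by (simp add: H1_norm_def)
  show "eventually (%n. H1_norm Omega (%x. ph n x - prim 0 ?g x) <= sqrt (3 * nsq lO (%x. ph' n x - ?g x))) sequentially"
  unfolding eq using W1_diff_prim(2)[OF sqph' sqg, of 0 _ 0] by simp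
  qed
 qed
qed

text \<open>A test function vanishes outside \<open>Omega\<close>, so it is its own primitive with
  left trace zero; this brings test functions under \<open>W1_diff_prim\<close>.\<close>

lemma W1_test_function:
 assumes t: "test_function Omega (ph :: real => real)"
 shows "ph = prim 0 (dir_deriv 1 ph)" "sq_int lO (dir_deriv 1 ph)"
proof -
 let ?d = "dir_deriv 1 ph"
 have d: "(ph has_real_derivative ?d x) (at x)" for x by (rule test_function_deriv(1)[OF t])
 have c: "continuous_on S ?d" for S using test_function_deriv(2)[OF t] continuous_on_subset by blast
 have z: "ph x = 0" if "x \<notin> Omega" for x using t that unfolding test_function_def by blast
 have "compact (?d ` {0..1})" using c by (intro compact_continuous_image) auto
 then obtain C where C: "!!x. x \<in> {0..1} ==> norm (?d x) <= C" by (meson bounded_iff compact_imp_bounded imageI)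
 show "sq_int lO ?d"
  by (rule Om.sq_int_bounded[where C = C]) (use C in \<open>auto simp: Omega_def intro!: borel_imp_lbo borel_measurable_continuous_onI c\<close>)
 show "ph = prim 0 ?d"
 proof
  fix x :: real
  have *: "(LINT y|lO. ind {..<x} y *R ?d y) = ph x" if "0 <= x" "x <= 1" for x
  proof -
  have "(LINT y|lO. ind {..<x} y *R ?d y) = (LINT y|lO. ind {0<..<x} y * ?d y)"
  by (intro Bint_cong) (auto simp: Omega_def indicator_def)
  also have "... = ph x - ph 0"
  by (rule FTC_lbo[OF _ c]) (use that d in \<open>auto intro: has_field_derivative_at_within\<close>)
  finally show ?thesis using z[of 0] by (simp add: Omega_def)
  qed
  consider "x <= 0" | "0 <= x" "x <= 1" | "1 <= x" by linarith
  then show "ph x = prim 0 ?d x"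
  proof cases
  case 1
  then show ?thesis using z[of x] by (simp add: prim_le0 Omega_def)
  next
  case 2
  then show ?thesis using * by (simp add: prim_def)
  next
  case 3
  have "prim 0 ?d x = prim 0 ?d 1" using 3 by (simp add: prim_ge1)
  also have "... = ph 1" using *[of 1] by (simp add: prim_def)
  finally show ?thesis using z[of x] z[of 1] 3 by (simp add: Omega_def)
  qed
 qed
qed

lemma sqrt_less_imp: "sqrt a < c ==> 0 <= a ==> a < c^2"
 using power_strict_mono[of "sqrt a" c 2] by simp

text \<open>Closedness of \<open>H1_0\<close> for primitives: each approximant is replaced by a test
  function at distance below 1/(n+1), and the two errors in the derivative add up.\<close>

lemma H1_0_limit:
 fixes g :: "real => real"
 assumes g: "sq_int lO g" and gn: "!!n. sq_int lO (gn n)" and h: "!!n. H1_0 Omega (prim 0 (gn n))"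
  and lim: "(%n. nsq lO (%x. gn n x - g x)) ----> 0"
 shows "H1_0 Omega (prim 0 g)"
proof -
 have "\<exists>ps. test_function Omega ps & H1_norm Omega (%x. ps x - prim 0 (gn n) x) < inverse (rS n)" for n
 proof -
  obtain ph where ph: "\<forall>k. test_function Omega (ph k)" "(%k. H1_norm Omega (%x. ph k x - prim 0 (gn n) x)) ----> 0"
  using h[of n] by (auto simp: H1_0_def)
  then have "eventually (%k. H1_norm Omega (%x. ph k x - prim 0 (gn n) x) < inverse (rS n)) sequentially"
  by (intro order_tendstoD(2)[OF ph(2)]) simp
  then show ?thesis using ph(1) by (auto simp: eventually_sequentially)
 qed
 then obtain ps where ps: "!!n. test_function Omega (ps n)" "!!n. H1_norm Omega (%x. ps n x - prim 0 (gn n) x) < inverse (rS n)" by metis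
 let ?d = "%n. dir_deriv 1 (ps n)"
 have sd: "sq_int lO (?d n)" for n by (rule W1_test_function(2)[OF ps(1)])
 have eq: "ps n = prim 0 (?d n)" for n by (rule W1_test_function(1)[OF ps(1)])
 have b: "H1_norm Omega (%x. ps n x - prim 0 g x) <= sqrt (6 * ((inverse (rS n))^2 + nsq lO (%x. gn n x - g x)))" for n
 proof -
  have "H1_norm Omega (%x. prim 0 (?d n) x - prim 0 (gn n) x) < inverse (rS n)"
  using ps(2)[of n] eq[of n] by simp
  then have "sqrt (nsq lO (%x. prim 0 (?d n) x - prim 0 (gn n) x) + nsq lO (%x. ?d n x - gn n x)) < inverse (rS n)"
  unfolding H1_norm_W1[OF W1_diff_prim(1)[OF sd gn]] .
  then have "nsq lO (%x. prim 0 (?d n) x - prim 0 (gn n) x) + nsq lO (%x. ?d n x - gn n x) < (inverse (rS n))^2"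
  by (rule sqrt_less_imp) (auto intro: add_nonneg_nonneg nsq_nonneg)
  then have 1: "nsq lO (%x. ?d n x - gn n x) <= (inverse (rS n))^2"
  using nsq_nonneg[of "lO" "%x. prim 0 (?d n) x - prim 0 (gn n) x"] by linarith
  have "nsq lO (%x. ?d n x - g x) <= 2 * nsq lO (%x. ?d n x - gn n x) + 2 * nsq lO (%x. gn n x - g x)"
  using nsq_add_le[OF sq_int_diff[OF sd gn] sq_int_diff[OF gn g], of n n n] by simp
  then have "3 * nsq lO (%x. ?d n x - g x) <= 6 * ((inverse (rS n))^2 + nsq lO (%x. gn n x - g x))"
  proof -
  have "a <= 2 * b + 2 * c ==> b <= d ==> 3 * a <= 6 * (d + c)" for a b c d :: real by simp
  then show ?thesis using 1 \<open>nsq lO (%x. ?d n x - g x) <= _\<close> by blast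
  qed
  then have "sqrt (3 * nsq lO (%x. ?d n x - g x)) <= sqrt (6 * ((inverse (rS n))^2 + nsq lO (%x. gn n x - g x)))"
  by (rule real_sqrt_le_mono)
  moreover have "H1_norm Omega (%x. ps n x - prim 0 g x) <= sqrt (3 * nsq lO (%x. ?d n x - g x))"
  using W1_diff_prim(2)[OF sd[of n] g, of 0 0] eq[of n] by simp
  ultimately show ?thesis by linarith
 qed
 show ?thesis
  unfolding H1_0_def
 proof (intro conjI exI allI)
  show "H1 Omega (prim 0 g)" by (rule W1_H1[OF W1_prim[OF g]])
  show "test_function Omega (ps n)" for n by (rule ps(1))
  show "(%n. H1_norm Omega (%x. ps n x - prim 0 g x)) ----> 0"
  proof (rule tendsto_sandwich[OF _ _ tendsto_const])
  have "(%n. sqrt (6 * ((inverse (rS n))^2 + nsq lO (%x. gn n x - g x)))) ----> sqrt (6 * (0^2 + 0))"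
  by (intro tendsto_intros lim LIMSEQ_inverse_real_of_nat)
  then show "(%n. sqrt (6 * ((inverse (rS n))^2 + nsq lO (%x. gn n x - g x)))) ----> 0" by simp
  qed (use b in \<open>auto simp: H1_norm_def\<close>)
 qed
qed

section \<open>Discretisation of the data by cell averages\<close>

lemma indicator_sq_int:
 fixes g :: "'a => 'b::euclidean_space"
 assumes g: "sq_int M g" and A: "A \<in> sets M"
 shows "sq_int M (%x. ind A x *R g x)"
proof (rule sq_int_bound[OF g])
 have [measurable]: "g \<in> bms M" "A \<in> sets M" using g A by (auto simp: sq_int_def)
 show "(%x. ind A x *R g x) \<in> bms M" by measurable
qed (simp add: indicator_def)

lemma (in finite_measure) integral_indicator_sq:
 fixes g :: "'a => 'b::euclidean_space"
 assumes g: "sq_int M g" and A: "A \<in> sets M"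
 shows "(LINT x|M. ind A x * norm (g x))^2 <= measure M A * (LINT x|M. ind A x * (norm (g x))^2)"
  "(norm (LINT x|M. ind A x *R g x))^2 <= measure M A * (LINT x|M. ind A x * (norm (g x))^2)"
proof -
 have s1: "sq_int M (%x. ind A x *R (1::real))" by (rule indicator_sq_int[OF sq_int_const A])
 have s2: "sq_int M (%x. ind A x *R g x)" by (rule indicator_sq_int[OF g A])
 have "nsq M (%x. ind A x *R (1::real)) = (LINT x|M. ind A x)"
  unfolding nsq_def by (rule Bint_cong) (auto simp: indicator_def)
 also have "... = measure M A" using A by (simp add: Int_absorb2 sets.sets_into_space)
 finally have n1: "nsq M (%x. ind A x *R (1::real)) = measure M A" .
 have n2: "nsq M (%x. ind A x *R g x) = (LINT x|M. ind A x * (norm (g x))^2)"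
  unfolding nsq_def by (rule Bint_cong) (auto simp: indicator_def)
 have "(LINT x|M. norm (ind A x *R (1::real)) * norm (ind A x *R g x)) = (LINT x|M. ind A x * norm (g x))"
  by (rule Bint_cong) (auto simp: indicator_def)
 then show 1: "(LINT x|M. ind A x * norm (g x))^2 <= measure M A * (LINT x|M. ind A x * (norm (g x))^2)"
  using Cauchy_Schwarz_integral[OF s1 s2] by (simp only: n1 n2)
 have "norm (LINT x|M. ind A x *R g x) <= (LINT x|M. norm (ind A x *R g x))" by (rule integral_norm_bound)
 also have "... = (LINT x|M. ind A x * norm (g x))"
  by (rule Bint_cong) auto
 finally have 2: "(norm (LINT x|M. ind A x *R g x))^2 <= (LINT x|M. ind A x * norm (g x))^2"
  by (rule power_mono) simp
 show "(norm (LINT x|M. ind A x *R g x))^2 <= measure M A * (LINT x|M. ind A x * (norm (g x))^2)" by (rule order_trans[OF 2 1])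
qed

lemma cell_in_sets: "cell N i \<inter> Omega \<in> sets lO"
 unfolding lbo_def by (subst sets_restrict_space_iff) auto

lemma measure_cell: "i < N ==> measure lO (cell N i \<inter> Omega) = 1 / real N"
 using integral_cell[of i N] by simp

lemma integral_cell_cong:
 "(LINT x|lO. ind (cell N i \<inter> Omega) x *R g x) = (LINT x|lO. ind (cell N i) x *R (g x :: 'b::euclidean_space))"
 by (rule Bint_cong) (auto simp: indicator_def)

lemma integral_cell_sq:
 fixes g :: "real => 'b::euclidean_space"
 assumes g: "sq_int lO g" and i: "i < N"
 shows "(LINT x|lO. ind (cell N i) x * norm (g x))^2 <= 1 / real N * (LINT x|lO. ind (cell N i) x * (norm (g x))^2)"
  "(norm (LINT x|lO. ind (cell N i) x *R g x))\<^sup>2 <= 1 / real N * (LINT x|lO. ind (cell N i) x * (norm (g x))^2)"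
proof -
 have e: "(LINT x|lO. ind (cell N i \<inter> Omega) x * h x) = (LINT x|lO. ind (cell N i) x * h x)" for h :: "real => real"
  by (rule Bint_cong) (auto simp: indicator_def)
 show "(LINT x|lO. ind (cell N i) x * norm (g x))^2 <= 1 / real N * (LINT x|lO. ind (cell N i) x * (norm (g x))^2)"
  "(norm (LINT x|lO. ind (cell N i) x *R g x))\<^sup>2 <= 1 / real N * (LINT x|lO. ind (cell N i) x * (norm (g x))^2)"
  using Om.integral_indicator_sq[OF g cell_in_sets[of N i]] unfolding e integral_cell_cong measure_cell[OF i] by blast+
qed

lemma cell_mult_integrable:
 fixes g :: "real => 'b::euclidean_space"
 assumes "integrable lO g"
 shows "integrable lO (%x. ind (cell N i) x *R g x)"
proof -
 have [measurable]: "g \<in> bms lO" using assms by auto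
 have [measurable]: "ind (cell N i) \<in> bms lO" by (rule borel_imp_lbo) simp
 show ?thesis
 proof (rule Bitg_bound[OF assms])
  show "AE x in lO. norm (ind (cell N i) x *R g x) <= norm (g x)"
  by (intro AE_I2 norm_scaleR_le_one) (auto simp: indicator_def)
 qed measurable
qed

lemma sum_integral_cell:
 fixes g :: "real => 'b::euclidean_space"
 assumes "0 < N" "integrable lO g"
 shows "(SUM i<N. LINT x|lO. ind (cell N i) x *R g x) = (LINT x|lO. g x)"
proof -
 have "(SUM i<N. LINT x|lO. ind (cell N i) x *R g x) = (LINT x|lO. (SUM i<N. ind (cell N i) x *R g x))"
  by (rule Bint_sum[symmetric]) (rule cell_mult_integrable[OF assms(2)])
 also have "... = (LINT x|lO. g x)"
  using sum_cell_indicator[OF assms(1), of _ "%_. g _"] assms(1) by (intro Bint_cong) (auto simp: Omega_def)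
 finally show ?thesis .
qed

text \<open>Cauchy-Schwarz on every cell: averaging does not increase the L2 norm, which is written
  here with the mesh factor \<open>real N\<close>.\<close>

lemma cell_average_sq:
 fixes g :: "real => 'b::euclidean_space"
 assumes N: "0 < N" and g: "sq_int lO g"
 shows "(SUM i<N. (norm (real N *R (LINT x|lO. ind (cell N i) x *R g x)))\<^sup>2) <= real N * nsq lO g"
proof -
 have "(SUM i<N. (norm (real N *R (LINT x|lO. ind (cell N i) x *R g x)))\<^sup>2)
  <= (SUM i<N. real N * (LINT x|lO. ind (cell N i) x *R (norm (g x))^2))"
 proof (rule sum_mono)
  fix i assume "i \<in> {..<N}"
  then have "(real N)^2 * (norm (LINT x|lO. ind (cell N i) x *R g x))\<^sup>2
  <= (real N)^2 * (1 / real N * (LINT x|lO. ind (cell N i) x * (norm (g x))^2))"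
  by (intro mult_left_mono integral_cell_sq(2)[OF g]) auto
  then show "(norm (real N *R (LINT x|lO. ind (cell N i) x *R g x)))\<^sup>2
  <= real N * (LINT x|lO. ind (cell N i) x *R (norm (g x))^2)"
  using N by (simp add: power_mult_distrib power2_eq_square mult_ac)
 qed
 also have "... = real N * nsq lO g"
  unfolding sum_distrib_left[symmetric] using sum_integral_cell[OF N sq_intD(2)[OF g]] by (simp add: nsq_def)
 finally show ?thesis .
qed

text \<open>The weak derivative is tested with a smoothed hat over two neighbouring cells, with
  limit slopes 1 and -1. One side tends to the difference of the two cell integrals, the other is
  \<open>g\<close> against a function of size at most 1/N that lives on these cells. The datum thus
  enters through its weak derivative directly, without a continuous representative.\<close>

lemma H1_cell_average_diff:
 fixes w w' :: "real => 'b::euclidean_space"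
 assumes wd: "has_weak_deriv Omega 1 w0 g0" and w: "integrable lO w" "AE x in lebesgue_on Omega. w0 x = w x"
  and g: "integrable lO g" "AE x in lebesgue_on Omega. g0 x = g x"
  and i: "Suc i < N"
 shows "norm ((LINT x|lO. ind (cell N (Suc i)) x *R w x) - (LINT x|lO. ind (cell N i) x *R w x))
  <= 1 / real N * ((LINT x|lO. ind (cell N i) x * norm (g x)) + (LINT x|lO. ind (cell N (Suc i)) x * norm (g x)))"
proof -
 have N: "0 < N" using i by simp
 have [measurable]: "w \<in> bms lO" "g \<in> bms lO" using w g by auto
 have [measurable]: "ind (cell N i) \<in> bms lO" for i by (rule borel_imp_lbo) simp
 define ph where "ph n x = 1 / real N * (bumpint (Suc n) (real N * x - real i) - bumpint (Suc n) (real N * x - real (Suc i)))" for n x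
 define ph' where "ph' n x = bump (Suc n) (real N * x - real i) - bump (Suc n) (real N * x - real (Suc i))" for n x
 have dph: "(ph n has_real_derivative ph' n x) (at x)" for n x
  unfolding ph_def[abs_def] ph'_def using N
  by (auto intro!: derivative_eq_intros DERIV_chain2[OF bumpint_deriv] simp: field_simps)
 have Dkph: "Dk k (ph n)" for k n
 proof -
  have "Dk k (%x. 1 / real N * (bumpint (Suc n) (real N * x + (- real i)) + (-1) * bumpint (Suc n) (real N * x + (- real (Suc i)))))"
  by (intro Dk_mult Dk_const Dk_add Dk_affine Dk_bumpint) auto
  moreover have "ph n = (%x. 1 / real N * (bumpint (Suc n) (real N * x + (- real i)) + (-1) * bumpint (Suc n) (real N * x + (- real (Suc i)))))"
  unfolding ph_def by (intro ext) (simp only: diff_conv_add_uminus mult_minus1)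
  ultimately show ?thesis by (simp only:)
 qed
 have low: "bumpint (Suc n) (real N * x - c) = 0" if "real N * x <= c + 1 / (rS n)" for n x c
  using that by (intro bumpint_nonpos) auto
 have up: "bumpint (Suc n) (real N * x - c) = bumpint (Suc n) 1" if "real N * x \<ge> c + 1 - 1 / (rS n)" for n x c
  using that by (intro bumpint_const) auto
 have z: "ph n x = 0" if "real N * x <= real i + 1 / (rS n) \<or> real N * x \<ge> real i + 2 - 1 / (rS n)" for n x
  using that
 proof
  assume "real N * x <= real i + 1 / (rS n)"
  then have "bumpint (Suc n) (real N * x - real i) = 0" "bumpint (Suc n) (real N * x - real (Suc i)) = 0"
  by (auto intro!: low)
  then show ?thesis unfolding ph_def by simp
 next
  assume *: "real N * x \<ge> real i + 2 - 1 / (rS n)"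
  have "bumpint (Suc n) (real N * x - real i) = bumpint (Suc n) 1" "bumpint (Suc n) (real N * x - real (Suc i)) = bumpint (Suc n) 1"
  by (intro up; use * in simp)+
  then show ?thesis unfolding ph_def by simp
 qed
 have test: "test_function Omega (ph n)" for n
 proof (rule Dk_test_function[where K = "{(real i + 1 / (rS n)) / real N..(real i + 2 - 1 / (rS n)) / real N}"])
  show "ph n x = 0" if "x \<notin> {(real i + 1 / (rS n)) / real N..(real i + 2 - 1 / (rS n)) / real N}" for x
  proof (rule z)
  from that have "x < (real i + 1 / (rS n)) / real N \<or> x > (real i + 2 - 1 / (rS n)) / real N" by auto
  then show "real N * x <= real i + 1 / (rS n) \<or> real N * x \<ge> real i + 2 - 1 / (rS n)"
  using N by (auto simp: pos_less_divide_eq pos_divide_less_eq mult.commute)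
  qed
  have "0 < 1 / (rS n)" by simp
  then have "0 < (real i + 1 / (rS n)) / real N" using N by (intro divide_pos_pos add_nonneg_pos) auto
  moreover have "(real i + 2 - 1 / (rS n)) / real N < 1"
  proof -
  have "real i + 2 <= real N" using i by linarith
  then have "real i + 2 - 1 / (rS n) < real N" using \<open>0 < 1 / (rS n)\<close> by linarith
  then show ?thesis using N by simp
  qed
  ultimately show "{(real i + 1 / (rS n)) / real N..(real i + 2 - 1 / (rS n)) / real N} \<subseteq> Omega"
  unfolding Omega_def by (intro subsetI) (simp add: less_le_trans le_less_trans)
 qed (auto simp: Dkph)
 have dd: "dir_deriv 1 (ph n) x = ph' n x" for n x using dir_deriv_real[OF dph, of 1] by simp
 have mph': "ph' n \<in> bms borel" for n
  unfolding ph'_def[abs_def]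
  by (intro borel_measurable_diff borel_measurable_continuous_onI continuous_on_compose2[OF continuous_bump[of UNIV]] continuous_intros) auto
 have mph: "ph n \<in> bms borel" for n
  using test_function_continuous[OF test] by (rule borel_measurable_continuous_onI)
 have [measurable]: "ph n \<in> bms lO" "ph' n \<in> bms lO" for n
  using mph mph' by (auto intro: borel_imp_lbo)
 have swap: "(LINT x|lebesgue_on Omega. h x *R v0 x) = (LINT x|lO. h x *R v x)"
  if h: "h \<in> bms lO" and v: "v \<in> bms lO" "AE x in lebesgue_on Omega. v0 x = v x"
  for h :: "real => real" and v0 v :: "real => 'b"
 proof -
  have m: "(%x. h x *R v x) \<in> bms lO" using h v(1) by measurable
  have ae: "AE x in lebesgue_on Omega. h x *R v0 x = h x *R v x" using v(2) by eventually_elim simp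
  have ml: "(%x. h x *R v x) \<in> bms (lebesgue_on Omega)" by (rule lebesgue_on_measurable[OF Omega_borel m])
  have "(LINT x|lebesgue_on Omega. h x *R v0 x) = (LINT x|lebesgue_on Omega. h x *R v x)"
  by (rule integral_cong_AE[OF lebesgue_on_measurable_AE[OF Omega_borel ml ae] ml ae])
  then show ?thesis using integral_lebesgue_on[OF Omega_borel m] by simp
 qed
 have "(LINT x|lO. ph' n x *R w x) = - (LINT x|lO. ph n x *R g x)" for n
 proof -
  have "(LINT x|lebesgue_on Omega. dir_deriv 1 (ph n) x *R w0 x) = - (LINT x|lebesgue_on Omega. ph n x *R g0 x)"
  using wd test unfolding has_weak_deriv_def by blast
  then show ?thesis unfolding dd using swap[of "ph' n" w w0] swap[of "ph n" g g0] w(2) g(2) by simp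
 qed
 moreover have "norm (LINT x|lO. ph n x *R g x) <= 1 / real N * ((LINT x|lO. ind (cell N i) x * norm (g x)) + (LINT x|lO. ind (cell N (Suc i)) x * norm (g x)))" for n
 proof -
  have ci: "integrable lO (%x. ind (cell N j) x * norm (g x))" for j
  using cell_mult_integrable[OF integrable_norm[OF g(1)], of N j] by simp
  have le: "norm (ph n x *R g x) <= 1 / real N * (ind (cell N i) x * norm (g x) + ind (cell N (Suc i)) x * norm (g x))" if x: "x \<in> Omega" for x
  proof (cases "ix N x = i \<or> ix N x = Suc i")
  case True
  have "\<bar>bumpint (Suc n) a - bumpint (Suc n) b\<bar> <= 1" for a b
  using bumpint_bounds[of "Suc n" a] bumpint_bounds[of "Suc n" b] by linarith
  then have "\<bar>ph n x\<bar> <= 1 / real N * 1" unfolding ph_def abs_mult using N by (intro mult_mono) auto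
  then have "\<bar>ph n x\<bar> * norm (g x) <= 1 / real N * norm (g x)" by (intro mult_right_mono) auto
  then show ?thesis using True by (auto simp: cell_def)
  next
  case False
  have b: "real (ix N x) <= real N * x" "real N * x < real (ix N x) + 1" using ix_bounds[of x N] x by (auto simp: Omega_def)
  from False consider "ix N x < i" | "ix N x \<ge> i + 2" by linarith
  then have "ph n x = 0"
  proof cases
  case 1
  then have "real (ix N x) + 1 <= real i" by linarith
  then show ?thesis using b by (intro z disjI1) (smt (verit) divide_nonneg_nonneg of_nat_0_le_iff)
  next
  case 2
  then have "real i + 2 <= real (ix N x)" by linarith
  then show ?thesis using b by (intro z disjI2) (smt (verit) divide_nonneg_nonneg of_nat_0_le_iff)
  qed
  then show ?thesis using N by simp
  qed
  have "norm (LINT x|lO. ph n x *R g x) <= (LINT x|lO. 1 / real N * (ind (cell N i) x * norm (g x) + ind (cell N (Suc i)) x * norm (g x)))"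
  proof (rule Bochner_Integration.integral_norm_bound_integral)
  show ii: "integrable lO (%x. 1 / real N * (ind (cell N i) x * norm (g x) + ind (cell N (Suc i)) x * norm (g x)))"
  using ci by (intro integrable_mult_right Bitg_add)
  show "integrable lO (%x. ph n x *R g x)"
  proof (rule Bitg_bound[OF ii])
  show "AE x in lO. norm (ph n x *R g x) <= norm (1 / real N * (ind (cell N i) x * norm (g x) + ind (cell N (Suc i)) x * norm (g x)))"
  by (intro AE_I2 order_trans[OF le]) auto
  qed measurable
  show "norm (ph n x *R g x) <= 1 / real N * (ind (cell N i) x * norm (g x) + ind (cell N (Suc i)) x * norm (g x))"
  if "x \<in> space lO" for x using le that by simp
  qed
  also have "... = 1 / real N * ((LINT x|lO. ind (cell N i) x * norm (g x)) + (LINT x|lO. ind (cell N (Suc i)) x * norm (g x)))"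
  using ci by simp
  finally show ?thesis .
 qed
 ultimately have le: "norm (LINT x|lO. ph' n x *R w x) <= 1 / real N * ((LINT x|lO. ind (cell N i) x * norm (g x)) + (LINT x|lO. ind (cell N (Suc i)) x * norm (g x)))" for n
  by simp
 have "(%n. LINT x|lO. ph' n x *R w x) ----> (LINT x|lO. (ind (cell N i) x - ind (cell N (Suc i)) x) *R w x)"
 proof (rule integral_dominated_convergence[where w = "%x. norm (w x)"])
  show "AE x in lO. (%n. ph' n x *R w x) ----> (ind (cell N i) x - ind (cell N (Suc i)) x) *R w x"
  using AE_off_grid[OF N] AE_space
  proof eventually_elim
  case (elim x)
  then show ?case unfolding ph'_def
  by (intro tendsto_scaleR tendsto_diff tendsto_const bump_at_cell N) (auto simp: Omega_def)
  qed
  show "AE x in lO. norm (ph' n x *R w x) <= norm (w x)" for n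
  proof (rule AE_I2)
  fix x
  have "\<bar>ph' n x\<bar> <= 1" unfolding ph'_def
  using bump_bounds[of "Suc n" "real N * x - real i"] bump_bounds[of "Suc n" "real N * x - real (Suc i)"] by linarith
  then show "norm (ph' n x *R w x) <= norm (w x)" by (simp add: mult_left_le_one_le)
  qed
  show "integrable lO (%x. norm (w x))" using w(1) by (rule integrable_norm)
 qed measurable
 then have "norm (LINT x|lO. (ind (cell N i) x - ind (cell N (Suc i)) x) *R w x) <= 1 / real N * ((LINT x|lO. ind (cell N i) x * norm (g x)) + (LINT x|lO. ind (cell N (Suc i)) x * norm (g x)))"
  by (intro LIMSEQ_le_const2[OF tendsto_norm]) (use le in auto)
 moreover have "(LINT x|lO. (ind (cell N i) x - ind (cell N (Suc i)) x) *R w x)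
  = (LINT x|lO. ind (cell N i) x *R w x) - (LINT x|lO. ind (cell N (Suc i)) x *R w x)"
  unfolding scaleR_diff_left by (intro Bint_diff cell_mult_integrable w)
 ultimately show ?thesis by (simp add: norm_minus_commute)
qed

text \<open>Each cell occurs in two consecutive differences, and each square of a sum costs a factor
  two; hence the 4.\<close>

lemma H1_cell_average_energy:
 fixes w :: "real => 'b::euclidean_space"
 assumes wd: "has_weak_deriv Omega 1 w0 g0" and w: "integrable lO w" "AE x in lebesgue_on Omega. w0 x = w x"
  and g: "sq_int lO g" "AE x in lebesgue_on Omega. g0 x = g x" and N: "0 < N"
 shows "(SUM i<N. (norm (dxm N (%i. real N *R (LINT x|lO. ind (cell N i) x *R w x)) i))\<^sup>2) <= real N * (4 * nsq lO g)"
proof -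
 define c where "c i = (LINT x|lO. ind (cell N i) x * (norm (g x))^2)" for i
 have c0: "0 <= c i" for i unfolding c_def by (rule integral_nonneg_AE) auto
 have cs: "(SUM i<N. c i) = nsq lO g"
  using sum_integral_cell[OF N sq_intD(2)[OF g(1)]] by (simp add: c_def nsq_def)
 have b: "(norm (dxm N (%i. real N *R (LINT x|lO. ind (cell N i) x *R w x)) i))\<^sup>2 <= real N * (2 * c i + (if Suc i < N then 2 * c (Suc i) else 0))"
  if "i < N" for i
 proof (cases "Suc i < N")
  case True
  let ?a = "LINT x|lO. ind (cell N i) x * norm (g x)"
  let ?b = "LINT x|lO. ind (cell N (Suc i)) x * norm (g x)"
  have "norm (dxm N (%i. real N *R (LINT x|lO. ind (cell N i) x *R w x)) i)
  = real N * (real N * norm ((LINT x|lO. ind (cell N (Suc i)) x *R w x) - (LINT x|lO. ind (cell N i) x *R w x)))"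
  using True by (simp add: dxm_def flip: scaleR_diff_right)
  also have "... <= real N * (real N * (1 / real N * (?a + ?b)))"
  using N by (intro mult_left_mono H1_cell_average_diff[OF wd w Om.sq_int_integrable[OF g(1)] g(2) True]) auto
  also have "... = real N * (?a + ?b)" using N by simp
  finally have "(norm (dxm N (%i. real N *R (LINT x|lO. ind (cell N i) x *R w x)) i))\<^sup>2 <= (real N * (?a + ?b))^2"
  by (rule power_mono) simp
  also have "... = (real N)^2 * (?a + ?b)^2" by (simp add: power_mult_distrib)
  also have "... <= (real N)^2 * (2 * ?a^2 + 2 * ?b^2)"
  using norm_add_sq_le[of ?a ?b] by (intro mult_left_mono) auto
  also have "... <= (real N)^2 * (2 * (1 / real N * c i) + 2 * (1 / real N * c (Suc i)))"
  unfolding c_def using True by (intro mult_left_mono add_mono integral_cell_sq(1)[OF g(1)]) auto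
  also have "... = real N * (2 * c i + 2 * c (Suc i))" using N by (simp add: power2_eq_square field_simps)
  finally show ?thesis using True by simp
 next
  case False
  then show ?thesis using c0[of i] by (simp add: dxm_def)
 qed
 have "(SUM i<N. (norm (dxm N (%i. real N *R (LINT x|lO. ind (cell N i) x *R w x)) i))\<^sup>2) <= (SUM i<N. real N * (2 * c i + (if Suc i < N then 2 * c (Suc i) else 0)))"
  by (intro sum_mono b) simp
 also have "... = real N * (2 * (SUM i<N. c i) + (SUM i<N. if Suc i < N then 2 * c (Suc i) else 0))"
  by (simp add: sum.distrib flip: sum_distrib_left)
 also have "(SUM i<N. if Suc i < N then 2 * c (Suc i) else 0) = (SUM i<N - 1. 2 * c (Suc i))"
  by (rule sum.mono_neutral_cong_right) auto
 also have "... = 2 * (SUM i<N - 1. c (Suc i))" by (simp add: sum_distrib_left)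
 also have "(SUM i<N - 1. c (Suc i)) <= c 0 + (SUM i<N - 1. c (Suc i))" using c0 by simp
 also have "... = (SUM i<N. c i)" using N sum.lessThan_Suc_shift[of c "N - 1"] by simp
 finally show ?thesis using N by (simp add: cs)
qed

section \<open>Discrete embeddings and equicontinuity of the magnetization\<close>

lemma abs_diff_le_variation:
 fixes f :: "nat => real"
 assumes "i < N" "j < N"
 shows "\<bar>f i - f j\<bar> <= (SUM l<N - 1. \<bar>f (Suc l) - f l\<bar>)"
proof -
 have *: "\<bar>f i - f j\<bar> <= (SUM l<N - 1. \<bar>f (Suc l) - f l\<bar>)" if "j <= i" "i < N" for i j
 proof -
  have "f i - f j = (\<Sum>l=j..<i. f (Suc l) - f l)" using that(1) by (simp add: sum_Suc_diff')
  then have "\<bar>f i - f j\<bar> <= (\<Sum>l=j..<i. \<bar>f (Suc l) - f l\<bar>)" by (metis sum_abs)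
  also have "... <= (SUM l<N - 1. \<bar>f (Suc l) - f l\<bar>)" using that by (intro sum_mono2) auto
  finally show ?thesis .
 qed
 show ?thesis using *[of i j] *[of j i] assms by (cases "i <= j") (auto simp: abs_minus_commute)
qed

text \<open>|w_i|^2 exceeds its mean by at most the total variation of |w|^2 over the grid, and each
  increment of |w|^2 is bounded by Young's inequality. The weight \<open>e\<close> stays free in
  order to interpolate between the two norms.\<close>

lemma discrete_Sobolev:
 fixes w :: "nat => 'b::euclidean_space"
 assumes i: "i < N" and B: "(SUM j<N. (norm (w j))^2) <= real N * B"
  and A: "(SUM j<N. (norm (dxm N w j))^2) <= real N * A" and e: "e > 0"
 shows "(norm (w i))^2 <= B + e * A + B / e"
proof -
 have N: "0 < N" using i by simp
 define V where "V = (SUM l<N - 1. \<bar>(norm (w (Suc l)))\<^sup>2 - (norm (w l))^2\<bar>)"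
 have "real N * (norm (w i))^2 = (SUM j<N. (norm (w i))^2)" by simp
 also have "... <= (SUM j<N. (norm (w j))^2 + V)"
 proof (rule sum_mono)
  fix j assume "j \<in> {..<N}"
  then show "(norm (w i))^2 <= (norm (w j))^2 + V"
  using abs_diff_le_variation[of i N j "%l. (norm (w l))^2"] i unfolding V_def by (simp add: abs_le_iff)
 qed
 also have "... <= real N * (B + V)" using B by (simp add: sum.distrib distrib_left)
 finally have 1: "(norm (w i))^2 <= B + V" using N by simp
 have "V <= (SUM l<N - 1. 1 / real N * (e * (norm (dxm N w l))^2 + ((norm (w (Suc l)))^2 + (norm (w l))^2) / (2 * e)))"
  unfolding V_def
 proof (rule sum_mono)
  fix l assume "l \<in> {..<N - 1}"
  then have l: "Suc l < N" by auto
  let ?x = "norm (w (Suc l))" and ?y = "norm (w l)" and ?d = "norm (dxm N w l)"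
  have d: "?d = real N * norm (w (Suc l) - w l)" using l by (simp add: dxm_def)
  have "\<bar>?x^2 - ?y^2\<bar> = \<bar>?x - ?y\<bar> * (?x + ?y)" by (simp add: power2_eq_square square_diff_square_factored abs_mult mult.commute)
  also have "... <= norm (w (Suc l) - w l) * (?x + ?y)" by (intro mult_right_mono norm_triangle_ineq3) auto
  also have "... = 1 / real N * (?d * (?x + ?y))" using N by (simp add: d)
  also have "... <= 1 / real N * (e * ?d^2 + (?x^2 + ?y^2) / (2 * e))"
  proof (intro mult_left_mono)
  \<comment> \<open>Two squares; the second one turns (x + y)^2 into 2 x^2 + 2 y^2.\<close>
  have "0 <= (2 * e * ?d - (?x + ?y))^2 / (4 * e) + (?x - ?y)^2 / (4 * e)" using e by simp
  also have "... = e * ?d^2 + (?x^2 + ?y^2) / (2 * e) - ?d * (?x + ?y)"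
  using e by (simp add: power2_eq_square field_simps)
  finally show "?d * (?x + ?y) <= e * ?d^2 + (?x^2 + ?y^2) / (2 * e)" by simp
  qed simp
  finally show "\<bar>?x^2 - ?y^2\<bar> <= 1 / real N * (e * ?d^2 + (?x^2 + ?y^2) / (2 * e))" .
 qed
 also have "... = 1 / real N * (e * (SUM l<N - 1. (norm (dxm N w l))^2) + ((SUM l<N - 1. (norm (w (Suc l)))^2) + (SUM l<N - 1. (norm (w l))^2)) / (2 * e))"
  by (simp add: sum_distrib_left sum.distrib distrib_left add_divide_distrib sum_divide_distrib)
 also have "... <= 1 / real N * (e * (real N * A) + (real N * B + real N * B) / (2 * e))"
 proof (intro mult_left_mono add_mono divide_right_mono)
  have "(SUM l<N - 1. (norm (dxm N w l))^2) <= (SUM j<N. (norm (dxm N w j))^2)" by (intro sum_mono2) auto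
  then show "(SUM l<N - 1. (norm (dxm N w l))^2) <= real N * A" using A by simp
  have "(SUM l<N - 1. (norm (w l))^2) <= (SUM j<N. (norm (w j))^2)" by (intro sum_mono2) auto
  then show "(SUM l<N - 1. (norm (w l))^2) <= real N * B" using B by simp
  have "(SUM l<N - 1. (norm (w (Suc l)))^2) <= (norm (w 0))^2 + (SUM l<N - 1. (norm (w (Suc l)))^2)" by simp
  also have "... = (SUM j<N. (norm (w j))^2)" using N sum.lessThan_Suc_shift[of "%j. (norm (w j))^2" "N - 1"] by simp
  finally show "(SUM l<N - 1. (norm (w (Suc l)))^2) <= real N * B" using B by simp
 qed (use e in auto)
 also have "... = e * A + B / e" using N e by (simp add: field_simps)
 finally show ?thesis using 1 by simp
qed

lemma norm_sum_sq_le: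
 fixes f :: "'a => 'b::euclidean_space"
 shows "(norm (\<Sum>l\<in>S. f l))^2 <= real (card S) * (\<Sum>l\<in>S. (norm (f l))^2)"
proof -
 have "(norm (\<Sum>l\<in>S. f l))^2 <= (\<Sum>l\<in>S. norm (f l))^2" by (intro power_mono norm_sum) auto
 also have "... <= real (card S) * (\<Sum>l\<in>S. (norm (f l))^2)"
  using sum_squared_le_sum_of_squares[of "%l. norm (f l)" S] by (simp add: mult.commute)
 finally show ?thesis .
qed

text \<open>Cauchy-Schwarz along the grid, that is, Hoelder exponent 1/2 in space.\<close>

lemma discrete_Holder_space:
 fixes w :: "nat => 'b::euclidean_space"
 assumes "i < N" "j <= i" and A: "(SUM j<N. (norm (dxm N w j))^2) <= real N * A"
 shows "(norm (w i - w j))^2 <= real (i - j) / real N * A"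
proof -
 have N: "0 < N" using assms by simp
 have "w i - w j = (\<Sum>l=j..<i. w (Suc l) - w l)" using assms(2) by (simp add: sum_Suc_diff')
 also have "... = (\<Sum>l=j..<i. (1 / real N) *R dxm N w l)"
  using assms N by (intro sum.cong) (auto simp: dxm_def)
 finally have "(norm (w i - w j))^2 <= real (i - j) * (\<Sum>l=j..<i. (norm ((1 / real N) *R dxm N w l))^2)"
  using norm_sum_sq_le[of "%l. (1 / real N) *R dxm N w l" "{j..<i}"] by simp
 also have "... <= real (i - j) * ((1 / (real N)^2) * (real N * A))"
 proof (rule mult_left_mono)
  have "(\<Sum>l=j..<i. (norm ((1 / real N) *R dxm N w l))^2) = (1 / (real N)^2) * (\<Sum>l=j..<i. (norm (dxm N w l))^2)"
  by (simp add: sum_divide_distrib power_divide)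
  also have "(\<Sum>l=j..<i. (norm (dxm N w l))^2) <= (SUM l<N. (norm (dxm N w l))^2)" using assms by (intro sum_mono2) auto
  finally show "(\<Sum>l=j..<i. (norm ((1 / real N) *R dxm N w l))^2) <= (1 / (real N)^2) * (real N * A)"
  using A by (smt (verit, best) divide_nonneg_nonneg mult_left_mono zero_le_power2)
 qed simp
 also have "... = real (i - j) / real N * A" using N by (simp add: power2_eq_square)
 finally show ?thesis .
qed

text \<open>Interpolation: over a time span s the difference of two levels is O(s) in squared L2
  norm and bounded in H1. The choice \<open>e = sqrt s\<close> in \<open>discrete_Sobolev\<close>
  gives a squared sup norm of order sqrt s, hence Hoelder exponent 1/4. The upper bound
  \<open>S\<close> leaves room for rounding the time span to the grid.\<close>

lemma discrete_Holder_time: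
 fixes m :: "nat => nat => 'b::euclidean_space"
 assumes i: "i < N" and kl: "l <= k" "k <= N" and T: "T > 0"
  and A: "!!k. k <= N ==> (SUM j<N. (norm (dxm N (m k) j))^2) <= real N * A"
  and B: "(SUM k<N. SUM i<N. (norm (m (Suc k) i - m k i))^2) <= T / real N * (real N * B)"
  and S: "real (k - l) * (T / real N) <= S"
 shows "(norm (m k i - m l i))^2 <= S * B + (4 * A + B) * sqrt S"
proof -
 define s where "s = real (k - l) * (T / real N)"
 define w where "w i = m k i - m l i" for i
 have N: "0 < N" using i by simp
 have AB0: "0 <= A" "0 <= B"
 proof -
  have "0 <= (SUM j<N. (norm (dxm N (m k) j))^2)" by (intro sum_nonneg) auto
  then have "0 <= real N * A" using A[OF kl(2)] by linarith
  then show "0 <= A" using N by (simp add: zero_le_mult_iff)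
  have "0 <= (SUM k<N. SUM i<N. (norm (m (Suc k) i - m k i))^2)" by (intro sum_nonneg) auto
  then have "0 <= T * B" using B N by simp
  then show "0 <= B" using T by (simp add: zero_le_mult_iff)
 qed
 have mono: "s * B + (4 * A + B) * sqrt s <= S * B + (4 * A + B) * sqrt S"
  using AB0 S by (intro add_mono mult_left_mono mult_right_mono) (auto simp: s_def)
 show ?thesis
 proof (cases "s = 0")
  case True
  then have "k = l" using N T kl by (simp add: s_def)
  then show ?thesis using mono True AB0 by simp
 next
  case False
  have "s \<ge> 0" using T by (simp add: s_def)
  with False have s: "s > 0" by simp
  have 1: "(SUM i<N. (norm (w i))^2) <= real N * (s * B)"
  proof -
  have "(norm (w i))^2 <= real (k - l) * (\<Sum>j=l..<k. (norm (m (Suc j) i - m j i))^2)" for i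
  using norm_sum_sq_le[of "%j. m (Suc j) i - m j i" "{l..<k}"] kl(1)
  by (simp add: w_def sum_Suc_diff'[of l k "%j. m j i"])
  then have "(SUM i<N. (norm (w i))^2) <= (SUM i<N. real (k - l) * (\<Sum>j=l..<k. (norm (m (Suc j) i - m j i))^2))" by (rule sum_mono)
  also have "... = real (k - l) * (\<Sum>j=l..<k. SUM i<N. (norm (m (Suc j) i - m j i))^2)"
  unfolding sum_distrib_left[symmetric] by (subst sum.swap) simp
  also have "... <= real (k - l) * (SUM j<N. SUM i<N. (norm (m (Suc j) i - m j i))^2)"
  using kl by (intro mult_left_mono sum_mono2) (auto intro: sum_nonneg)
  also have "... <= real (k - l) * (T / real N * (real N * B))" by (intro mult_left_mono B) auto
  also have "... = real N * (s * B)" by (simp add: s_def)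
  finally show ?thesis .
  qed
  have 2: "(SUM j<N. (norm (dxm N w j))^2) <= real N * (4 * A)"
  proof -
  have "dxm N w j = dxm N (m k) j + (- dxm N (m l) j)" for j by (simp add: dxm_def w_def algebra_simps)
  then have "(norm (dxm N w j))^2 <= 2 * (norm (dxm N (m k) j))^2 + 2 * (norm (dxm N (m l) j))^2" for j
  using norm_add_sq_le[of "dxm N (m k) j" "- dxm N (m l) j"] by simp
  then have "(SUM j<N. (norm (dxm N w j))^2) <= (SUM j<N. 2 * (norm (dxm N (m k) j))^2 + 2 * (norm (dxm N (m l) j))^2)" by (rule sum_mono)
  also have "... <= 2 * (real N * A) + 2 * (real N * A)"
  unfolding sum.distrib sum_distrib_left[symmetric] using A[OF kl(2)] A[of l] kl by (intro add_mono mult_left_mono) auto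
  finally show ?thesis by (simp add: mult_ac)
  qed
  have "(norm (w i))^2 <= s * B + sqrt s * (4 * A) + s * B / sqrt s"
  using discrete_Sobolev[OF i 1 2, of "sqrt s"] s by simp
  also have "s * B / sqrt s = sqrt s * B"
  using s by (simp add: field_simps)
  finally show ?thesis using mono by (simp add: w_def algebra_simps)
 qed
qed

lemma ix_dist:
 assumes "0 <= x" "x <= y"
 shows "ix N x <= ix N y" "real (ix N y - ix N x) <= real N * (y - x) + 1"
proof -
 have "real N * x <= real N * y" using assms by (intro mult_left_mono) auto
 then show le: "ix N x <= ix N y" unfolding ix_def by (intro nat_mono floor_mono)
 have "real (ix N y) <= real N * y" "real N * x < real (ix N x) + 1" using ix_bounds assms by auto
 then show "real (ix N y - ix N x) <= real N * (y - x) + 1" using le by (simp add: algebra_simps of_nat_diff)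
qed

text \<open>The term (1 + T)/N is the rounding error: points closer than one cell may still have
  indices that differ by one. It fades only as N grows, which is why equicontinuity is
  asymptotic.\<close>

lemma stp_modulus:
 fixes m :: "nat => nat => 'b::euclidean_space"
 assumes N: "0 < N" and T: "T > 0"
  and A: "!!k. k <= N ==> (SUM j<N. (norm (dxm N (m k) j))^2) <= real N * A"
  and B: "(SUM k<N. SUM i<N. (norm (m (Suc k) i - m k i))^2) <= T / real N * (real N * B)"
  and z: "z \<in> Cyl T" "z' \<in> Cyl T" and S: "dist z z' + (1 + T) / real N <= S"
 shows "dist (stp N T m z) (stp N T m z') <= sqrt (A * S) + sqrt (S * B + (4 * A + B) * sqrt S)"
proof -
 obtain x t y s where zz: "z = (x, t)" "z' = (y, s)" by (cases z, cases z')
 have xy: "0 < x" "x < 1" "0 < y" "y < 1" "0 < t" "t < T" "0 < s" "s < T"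
  using z by (auto simp: zz Cyl_def Omega_def)
 have dx: "\<bar>x - y\<bar> <= dist z z'" "\<bar>t - s\<bar> <= dist z z'"
  using dist_fst_le[of z z'] dist_snd_le[of z z'] by (auto simp: zz dist_real_def)
 define k l where "k = Suc (ix N (t / T))" and "l = Suc (ix N (s / T))"
 have kN: "k <= N" "l <= N" using ix_less[of "t / T" N] ix_less[of "s / T" N] xy T N by (auto simp: k_def l_def Suc_le_eq)
 have ij: "ix N x < N" "ix N y < N" using ix_less xy N by auto
 have A0: "0 <= A"
 proof -
  have "0 <= (SUM j<N. (norm (dxm N (m k) j))^2)" by (intro sum_nonneg) auto
  then have "0 <= real N * A" using A[OF kN(1)] by linarith
  then show "0 <= A" using N by (simp add: zero_le_mult_iff)
 qed
 have sp: "(norm (m k (ix N a) - m k (ix N b)))^2 <= A * S" if ab: "0 <= b" "b <= a" "a < 1" "a - b <= dist z z'" for a b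
 proof -
  have "(norm (m k (ix N a) - m k (ix N b)))^2 <= real (ix N a - ix N b) / real N * A"
  by (rule discrete_Holder_space[OF _ _ A[OF kN(1)]]) (use ab ix_less N ix_dist in auto)
  also have "... <= S * A"
  proof (rule mult_right_mono[OF _ A0])
  have "real (ix N a - ix N b) / real N <= (real N * (a - b) + 1) / real N"
  using ix_dist[OF ab(1,2)] by (intro divide_right_mono) auto
  also have "... = (a - b) + 1 / real N" using N by (simp add: field_simps)
  also have "... <= dist z z' + (1 + T) / real N" using ab T by (intro add_mono divide_right_mono) auto
  finally show "real (ix N a - ix N b) / real N <= S" using S by simp
  qed
  finally show ?thesis by (simp add: mult.commute)
 qed
 have ti: "(norm (m (Suc (ix N (a / T))) (ix N y) - m (Suc (ix N (b / T))) (ix N y)))\<^sup>2 <= S * B + (4 * A + B) * sqrt S"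
  if ab: "0 <= b" "b <= a" "a < T" "a - b <= dist z z'" for a b
 proof (rule discrete_Holder_time[OF ij(2) _ _ T A B])
  have 1: "0 <= b / T" "b / T <= a / T" using ab T by (auto intro: divide_right_mono)
  show "Suc (ix N (b / T)) <= Suc (ix N (a / T))" using ix_dist[OF 1] by simp
  show "Suc (ix N (a / T)) <= N" using ix_less[of "a / T" N] ab T N by (simp add: Suc_le_eq)
  have "real (Suc (ix N (a / T)) - Suc (ix N (b / T))) * (T / real N) <= (real N * (a / T - b / T) + 1) * (T / real N)"
  using ix_dist[OF 1] T by (intro mult_right_mono) auto
  also have "... = (a - b) + T / real N" using N T by (simp add: field_simps)
  also have "... <= dist z z' + (1 + T) / real N" using ab by (intro add_mono divide_right_mono) auto
  finally show "real (Suc (ix N (a / T)) - Suc (ix N (b / T))) * (T / real N) <= S" using S by simp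
 qed auto
 have 1: "(norm (m k (ix N x) - m k (ix N y)))^2 <= A * S"
  using sp[of y x] sp[of x y] dx xy by (cases "y <= x") (auto simp: norm_minus_commute)
 have 2: "(norm (m k (ix N y) - m l (ix N y)))^2 <= S * B + (4 * A + B) * sqrt S"
  unfolding k_def l_def using ti[of s t] ti[of t s] dx xy by (cases "s <= t") (auto simp: norm_minus_commute)
 have "dist (stp N T m z) (stp N T m z') <= norm (m k (ix N x) - m k (ix N y)) + norm (m k (ix N y) - m l (ix N y))"
  using norm_triangle_ineq[of "m k (ix N x) - m k (ix N y)" "m k (ix N y) - m l (ix N y)"]
  by (simp add: dist_norm stp_def zz k_def l_def)
 also have "... <= sqrt (A * S) + sqrt (S * B + (4 * A + B) * sqrt S)"
  using 1 2 by (intro add_mono real_le_rsqrt)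
 finally show ?thesis .
qed

section \<open>Space-time cells and integrals of step functions\<close>

definition tcell :: "nat => real => nat => real set" where
 "tcell N T k = {t. ix N (t / T) = k}"

definition cell2 :: "nat => real => nat => nat => (real*real) set" where
 "cell2 N T k i = cell N i \<times> tcell N T k"

lemma tcell_borel [measurable, simp]: "tcell N T k \<in> sets borel"
proof -
 have "(%t. ix N (t / T)) \<in> borel \<rightarrow>\<^sub>M count_space UNIV" by measurable
 then have "(%t. ix N (t / T)) -` {k} \<inter> space borel \<in> sets borel" by (rule measurable_sets) simp
 then show ?thesis by (simp add: tcell_def vimage_def)
qed

lemma cell2_borel [measurable, simp]: "cell2 N T k i \<in> sets borel"
 unfolding cell2_def borel_prod[symmetric] by (rule pair_measureI) auto

lemma measure_tcell:
 assumes T: "T > 0" and k: "k < N"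
 shows "measure (lbo {0<..<T}) (tcell N T k \<inter> {0<..<T}) = T / real N"
proof -
 have N: "0 < N" using k by simp
 have eq: "tcell N T k \<inter> {0<..<T} = {real k * T / real N..<real (Suc k) * T / real N} - {0}"
 proof (rule set_eqI)
  fix t
  have top: "real (Suc k) * T / real N <= T" using k T by (simp add: pos_divide_le_eq)
  have "0 <= real k * T / real N" using T by simp
  moreover have "t \<in> tcell N T k \<longleftrightarrow> real k * T / real N <= t & t < real (Suc k) * T / real N" if "0 < t"
  using that T N unfolding tcell_def ix_def by (auto simp: nat_eq_iff floor_eq_iff field_simps)
  ultimately show "t \<in> tcell N T k \<inter> {0<..<T} \<longleftrightarrow> t \<in> {real k * T / real N..<real (Suc k) * T / real N} - {0}"
  using top by (cases "0 < t") auto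
 qed
 have "measure (lbo {0<..<T}) (tcell N T k \<inter> {0<..<T}) = measure lborel (tcell N T k \<inter> {0<..<T})"
  unfolding lbo_def by (subst measure_restrict_space) auto
 also have "... = measure lborel {real k * T / real N..<real (Suc k) * T / real N}"
  unfolding eq by (rule measure_Diff_null_set) (auto simp: null_sets_def)
 also have "... = real (Suc k) * T / real N - real k * T / real N"
  using T N by (subst measure_lborel_Ico) (auto intro!: divide_right_mono mult_right_mono)
 also have "... = T / real N" by (simp add: field_simps add_divide_distrib)
 finally show ?thesis .
qed

lemma cell2_in_sets: "cell2 N T k i \<inter> Cyl T \<in> sets (lC T)"
 unfolding lbo_def by (subst sets_restrict_space_iff) auto

lemma measure_cell2:
 assumes T: "T > 0" and k: "k < N" and i: "i < N"
 shows "measure (lC T) (cell2 N T k i \<inter> Cyl T) = T / (real N)^2"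
proof -
 interpret I: finite_measure "lbo {0<..<T}" by (rule finite_measure_lbo_Ioo)
 have a: "cell N i \<inter> Omega \<in> sets lO" by (rule cell_in_sets)
 have b: "tcell N T k \<inter> {0<..<T} \<in> sets (lbo {0<..<T})"
  unfolding lbo_def by (subst sets_restrict_space_iff) auto
 have "cell2 N T k i \<inter> Cyl T = (cell N i \<inter> Omega) \<times> (tcell N T k \<inter> {0<..<T})"
  by (auto simp: cell2_def Cyl_def)
 then have "measure (lC T) (cell2 N T k i \<inter> Cyl T) = measure lO (cell N i \<inter> Omega) * measure (lbo {0<..<T}) (tcell N T k \<inter> {0<..<T})"
  unfolding Cyl_eq using I.emeasure_pair_measure_Times[OF a b] by (simp add: measure_def enn2real_mult)
 then show ?thesis using measure_cell[OF i] measure_tcell[OF T k] by (simp add: power2_eq_square)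
qed

lemma stp_sum_indicator:
 fixes a :: "nat => nat => 'b::real_vector"
 assumes T: "T > 0" and N: "0 < N" and p: "p \<in> Cyl T"
 shows "(SUM k<N. SUM i<N. ind (cell2 N T k i) p *R a (Suc k) i) = stp N T a p"
proof -
 have p': "0 < fst p" "fst p < 1" "0 < snd p" "snd p < T" using p by (auto simp: Cyl_def Omega_def)
 have k: "ix N (snd p / T) < N" using p' T N by (intro ix_less) auto
 have "(SUM k<N. SUM i<N. ind (cell2 N T k i) p *R a (Suc k) i)
  = (SUM k<N. ind (tcell N T k) (snd p) *R (SUM i<N. ind (cell N i) (fst p) *R a (Suc k) i))"
  unfolding scaleR_sum_right
  by (intro sum.cong refl) (auto simp: cell2_def indicator_def mem_Times_iff)
 also have "... = (SUM k<N. ind (tcell N T k) (snd p) *R a (Suc k) (ix N (fst p)))"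
  by (simp only: sum_cell_indicator[OF N p'(2)])
 also have "... = (\<Sum>k\<in>{ix N (snd p / T)}. ind (tcell N T k) (snd p) *R a (Suc k) (ix N (fst p)))"
  using k by (intro sum.mono_neutral_right) (auto simp: tcell_def)
 also have "... = stp N T a p" by (simp add: stp_def tcell_def)
 finally show ?thesis .
qed

lemma cell2_mult_integrable:
 fixes g :: "real*real => 'b::euclidean_space"
 assumes "integrable (lC T) g"
 shows "integrable (lC T) (%p. ind (cell2 N T k i) p *R g p)"
proof -
 have [measurable]: "g \<in> bms (lC T)" using assms by auto
 have [measurable]: "ind (cell2 N T k i) \<in> bms (lC T)" by (rule borel_imp_lbo) simp
 show ?thesis
 proof (rule Bitg_bound[OF assms])
  show "AE x in lC T. norm (ind (cell2 N T k i) x *R g x) <= norm (g x)"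
  by (intro AE_I2 norm_scaleR_le_one) (auto simp: indicator_def)
 qed measurable
qed

lemma integral_stp_inner:
 fixes g :: "real*real => 'b::euclidean_space"
 assumes T: "T > 0" and N: "0 < N" and g: "integrable (lC T) g"
 shows "integrable (lC T) (%p. stp N T a p <.> g p)"
  "(LINT p|lC T. stp N T a p <.> g p) = (SUM k<N. SUM i<N. a (Suc k) i <.> (LINT p|lC T. ind (cell2 N T k i) p *R g p))"
proof -
 have eq: "stp N T a p <.> g p = (SUM k<N. SUM i<N. a (Suc k) i <.> (ind (cell2 N T k i) p *R g p))" if "p \<in> space (lC T)" for p
  using stp_sum_indicator[OF T N, of p a] that by (simp add: inner_sum_left[symmetric] flip: inner_sum_left)
 have i: "integrable (lC T) (%p. a (Suc k) i <.> (ind (cell2 N T k i) p *R g p))" for k i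
  by (intro integrable_inner_right cell2_mult_integrable g)
 have "integrable (lC T) (%p. SUM k<N. SUM i<N. a (Suc k) i <.> (ind (cell2 N T k i) p *R g p))"
  by (intro Bochner_Integration.integrable_sum i)
 then show "integrable (lC T) (%p. stp N T a p <.> g p)"
  by (subst Bitg_cong[OF refl eq])
 have "(LINT p|lC T. stp N T a p <.> g p) = (LINT p|lC T. (SUM k<N. SUM i<N. a (Suc k) i <.> (ind (cell2 N T k i) p *R g p)))"
  by (rule Bint_cong[OF refl eq])
 also have "... = (SUM k<N. LINT p|lC T. (SUM i<N. a (Suc k) i <.> (ind (cell2 N T k i) p *R g p)))"
  by (rule Bint_sum) (intro Bochner_Integration.integrable_sum i)
 also have "... = (SUM k<N. SUM i<N. LINT p|lC T. a (Suc k) i <.> (ind (cell2 N T k i) p *R g p))"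
  by (intro sum.cong refl Bint_sum i)
 also have "... = (SUM k<N. SUM i<N. a (Suc k) i <.> (LINT p|lC T. ind (cell2 N T k i) p *R g p))"
  by (intro sum.cong refl integral_inner_right cell2_mult_integrable g)
 finally show "(LINT p|lC T. stp N T a p <.> g p) = (SUM k<N. SUM i<N. a (Suc k) i <.> (LINT p|lC T. ind (cell2 N T k i) p *R g p))" .
qed

lemma integral_cell2_one:
 assumes "T > 0" "k < N" "i < N"
 shows "(LINT p|lC T. ind (cell2 N T k i) p *R (1::real)) = T / (real N)^2"
 using measure_cell2[OF assms] by simp

lemma integral_stp:
 fixes a :: "nat => nat => real"
 assumes T: "T > 0" and N: "0 < N"
 shows "integrable (lC T) (stp N T a)" "(LINT p|lC T. stp N T a p) = T / (real N)^2 * (SUM k<N. SUM i<N. a (Suc k) i)"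
proof -
 interpret Q: finite_measure "lC T" by (rule finite_measure_Cyl)
 have i1: "integrable (lC T) (%_. 1::real)" by simp
 show "integrable (lC T) (stp N T a)" using integral_stp_inner(1)[OF T N i1, of a] by simp
 have "(LINT p|lC T. stp N T a p) = (SUM k<N. SUM i<N. a (Suc k) i * (LINT p|lC T. ind (cell2 N T k i) p *R (1::real)))"
  using integral_stp_inner(2)[OF T N i1, of a] by simp
 also have "... = (SUM k<N. SUM i<N. a (Suc k) i * (T / (real N)^2))"
  by (intro sum.cong refl arg_cong2[where f = "(*)"] integral_cell2_one T) auto
 finally show "(LINT p|lC T. stp N T a p) = T / (real N)^2 * (SUM k<N. SUM i<N. a (Suc k) i)"
  by (simp add: sum_distrib_left sum_divide_distrib mult.commute)
qed

lemma integral_stp_stp: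
 fixes a b :: "nat => nat => 'b::euclidean_space"
 assumes T: "T > 0" and N: "0 < N"
 shows "(LINT p|lC T. stp N T a p <.> stp N T b p) = T / (real N)^2 * (SUM k<N. SUM i<N. a (Suc k) i <.> b (Suc k) i)"
 using integral_stp(2)[OF T N, of "%k i. a k i <.> b k i"] by (simp add: stp_def[abs_def])

lemma nsq_stp:
 fixes a :: "nat => nat => 'b::euclidean_space"
 assumes T: "T > 0" and N: "0 < N"
 shows "sq_int (lC T) (stp N T a)"
  "nsq (lC T) (stp N T a) = T / (real N)^2 * (SUM k<N. SUM i<N. (norm (a (Suc k) i))^2)"
 using integral_stp[OF T N, of "%k i. (norm (a k i))^2"] borel_imp_lbo[OF stp_measurable]
 by (simp_all add: sq_int_def nsq_def stp_def[abs_def])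

lemma cell2_average_sq:
 fixes g :: "real*real => real"
 assumes T: "T > 0" and N: "0 < N" and g: "sq_int (lC T) g"
 shows "(SUM k<N. SUM i<N. ((real N)^2 / T * (LINT p|lC T. ind (cell2 N T k i) p * g p))\<^sup>2) <= (real N)^2 / T * nsq (lC T) g"
proof -
 interpret Q: finite_measure "lC T" by (rule finite_measure_Cyl)
 let ?c = "%k i. LINT p|lC T. ind (cell2 N T k i) p * (norm (g p))^2"
 have e: "(LINT p|lC T. ind (cell2 N T k i \<inter> Cyl T) p * h p) = (LINT p|lC T. ind (cell2 N T k i) p * h p)" for h :: "real*real => real" and k i
  by (rule Bint_cong) (auto simp: indicator_def)
 have b: "(LINT p|lC T. ind (cell2 N T k i) p * g p)^2 <= T / (real N)^2 * ?c k i" if "k < N" "i < N" for k i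
  using Q.integral_indicator_sq(2)[OF g cell2_in_sets[of N T k i]] unfolding real_scaleR_def e measure_cell2[OF T that] by simp
 have "(SUM k<N. SUM i<N. ((real N)^2 / T * (LINT p|lC T. ind (cell2 N T k i) p * g p))\<^sup>2) <= (SUM k<N. SUM i<N. (real N)^2 / T * ?c k i)"
 proof (intro sum_mono)
  fix k i assume "k \<in> {..<N}" "i \<in> {..<N}"
  then have "((real N)^2 / T)^2 * (LINT p|lC T. ind (cell2 N T k i) p * g p)^2 <= ((real N)^2 / T)^2 * (T / (real N)^2 * ?c k i)"
  by (intro mult_left_mono b) auto
  also have "... = (real N)^2 / T * ?c k i" using T N by (simp add: power2_eq_square)
  finally show "((real N)^2 / T * (LINT p|lC T. ind (cell2 N T k i) p * g p))\<^sup>2 <= (real N)^2 / T * ?c k i"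
  by (simp only: power_mult_distrib)
 qed
 also have "... = (real N)^2 / T * (SUM k<N. SUM i<N. ?c k i)" by (simp add: sum_distrib_left)
 also have "(SUM k<N. SUM i<N. ?c k i) = (LINT p|lC T. stp N T (%k i. 1::real) p <.> (norm (g p))^2)"
  using integral_stp_inner(2)[OF T N sq_intD(2)[OF g], of "%k i. 1"] by simp
 also have "... = nsq (lC T) g" by (simp add: stp_def nsq_def)
 finally show ?thesis .
qed

section \<open>Limits of integrals of products\<close>

lemma norm_integral_le:
 fixes f :: "'a => 'b::{banach, second_countable_topology}"
 assumes f: "integrable M f" and g: "integrable M g" and le: "!!x. x \<in> space M ==> norm (f x) <= g x"
 shows "norm (LINT x|M. f x) <= (LINT x|M. g x)"
 by (rule order_trans[OF integral_norm_bound integral_mono[OF integrable_norm[OF f] g le]])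

text \<open>\<open>h\<close> is merely bounded in L2 and its integrals may fail to converge, so the
  conclusion is that the two integrals differ by a null sequence.\<close>

lemma (in finite_measure) integral_inner_uniform_conv:
 fixes h X :: "nat => 'a => 'b::euclidean_space"
 assumes h: "!!n. sq_int M (h n)" "!!n. nsq M (h n) <= C"
  and X: "!!n. sq_int M (X n)" "sq_int M Y" and lim: "uniform_limit (space M) X Y sequentially"
 shows "(%n. (LINT x|M. h n x <.> X n x) - (LINT x|M. h n x <.> Y x)) ----> 0"
proof (rule LIMSEQ_I)
 fix e :: real assume e: "e > 0"
 \<comment> \<open>The summand 1 makes \<open>D\<close> positive for the division below.\<close>
 define D where "D = sqrt (max 0 C * measure M (space M)) + 1"
 have D: "D > 0" unfolding D_def by (smt (verit) max.cobounded1 measure_nonneg mult_nonneg_nonneg real_sqrt_ge_zero)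
 have L1: "(LINT x|M. norm (h n x)) <= D" for n
 proof -
  have "(LINT x|M. norm (h n x))^2 <= nsq M (h n) * measure M (space M)" by (rule L1_le_nsq[OF h(1)])
  also have "... <= max 0 C * measure M (space M)" using h(2)[of n] by (intro mult_right_mono) auto
  finally have "(LINT x|M. norm (h n x)) <= sqrt (max 0 C * measure M (space M))" by (rule real_le_rsqrt)
  then show ?thesis by (simp add: D_def)
 qed
 obtain n0 where n0: "!!n x. n \<ge> n0 ==> x \<in> space M ==> dist (X n x) (Y x) < e / (2 * D)"
  using lim e D unfolding uniform_limit_sequentially_iff by (meson divide_pos_pos mult_pos_pos zero_less_numeral)
 show "\<exists>no. \<forall>n\<ge>no. norm ((LINT x|M. h n x <.> X n x) - (LINT x|M. h n x <.> Y x) - 0) < e"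
 proof (intro exI[of _ n0] allI impI)
  fix n assume n: "n \<ge> n0"
  have i: "integrable M (%x. h n x <.> (X n x - Y x))" by (rule sq_int_inner_integrable[OF h(1) sq_int_diff[OF X]])
  have "(LINT x|M. h n x <.> X n x) - (LINT x|M. h n x <.> Y x) = (LINT x|M. h n x <.> (X n x - Y x))"
  unfolding inner_diff_right by (rule Bint_diff[symmetric]) (intro sq_int_inner_integrable h X)+
  also have "norm ... <= (LINT x|M. norm (h n x) * (e / (2 * D)))"
  proof (rule norm_integral_le[OF i])
  show "integrable M (%x. norm (h n x) * (e / (2 * D)))"
  by (intro integrable_mult_left integrable_norm sq_int_integrable h)
  fix x assume x: "x \<in> space M"
  have "norm (h n x <.> (X n x - Y x)) <= norm (h n x) * norm (X n x - Y x)" by (simp add: Cauchy_Schwarz_ineq2)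
  also have "... <= norm (h n x) * (e / (2 * D))"
  using n0[OF n x] by (intro mult_left_mono) (auto simp: dist_norm)
  finally show "norm (h n x <.> (X n x - Y x)) <= norm (h n x) * (e / (2 * D))" .
  qed
  also have "... = (LINT x|M. norm (h n x)) * (e / (2 * D))"
  by (rule integral_mult_left_zero)
  also have "... <= D * (e / (2 * D))" using L1 e D by (intro mult_right_mono) auto
  also have "... < e" using e D by simp
  finally show "norm ((LINT x|M. h n x <.> X n x) - (LINT x|M. h n x <.> Y x) - 0) < e" by simp
 qed
qed

text \<open>Linearity moves the weights out of the integral; Cauchy-Schwarz bounds the remaining
  difference by the L2 distance from the combination to \<open>zl\<close>.\<close>

lemma weighted_inner_tendsto:
 fixes z :: "nat => 'a => 'b::euclidean_space"
 assumes zn: "!!n. sq_int M (z n)" and zl: "sq_int M zl"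
  and conv: "(%n. nsq M (%x. (\<Sum>k\<in>A n. c n k *R z k x) - zl x)) ----> 0"
  and xi: "sq_int M xi"
 shows "(%n. \<Sum>k\<in>A n. c n k *R (LINT x|M. z k x <.> xi x)) ----> (LINT x|M. zl x <.> xi x)"
proof -
 let ?y = "%n x. \<Sum>k\<in>A n. c n k *R z k x"
 have y: "sq_int M (?y n)" for n by (rule sq_int_sum[OF zn])
 have 1: "(LINT x|M. ?y n x <.> xi x) = (\<Sum>k\<in>A n. c n k *R (LINT x|M. z k x <.> xi x))" for n
 proof -
  have "(LINT x|M. ?y n x <.> xi x) = (LINT x|M. (\<Sum>k\<in>A n. c n k *R (z k x <.> xi x)))"
  by (simp add: inner_sum_left)
  also have "... = (\<Sum>k\<in>A n. LINT x|M. c n k *R (z k x <.> xi x))"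
  by (intro Bint_sum integrable_scaleR_right sq_int_inner_integrable zn xi)
  finally show ?thesis by simp
 qed
 have "(%n. (LINT x|M. ?y n x <.> xi x) - (LINT x|M. zl x <.> xi x)) ----> 0"
 proof (rule Lim_null_comparison)
  show "eventually (%n. norm ((LINT x|M. ?y n x <.> xi x) - (LINT x|M. zl x <.> xi x)) <= sqrt (nsq M (%x. ?y n x - zl x) * nsq M xi)) sequentially"
  proof (rule always_eventually, rule allI)
  fix n
  have d: "sq_int M (%x. ?y n x - zl x)" by (rule sq_int_diff[OF y zl])
  have "(LINT x|M. ?y n x <.> xi x) - (LINT x|M. zl x <.> xi x) = (LINT x|M. (?y n x - zl x) <.> xi x)"
  unfolding inner_diff_left by (rule Bint_diff[symmetric]) (intro sq_int_inner_integrable y zl xi)+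
  also have "norm ... <= (LINT x|M. norm (?y n x - zl x) * norm (xi x))"
  by (rule norm_integral_le)
  (auto intro!: sq_int_inner_integrable sq_int_mult_integrable d xi simp: Cauchy_Schwarz_ineq2)
  also have "... <= sqrt (nsq M (%x. ?y n x - zl x) * nsq M xi)"
  by (rule real_le_rsqrt[OF Cauchy_Schwarz_integral[OF d xi]])
  finally show "norm ((LINT x|M. ?y n x <.> xi x) - (LINT x|M. zl x <.> xi x)) <= sqrt (nsq M (%x. ?y n x - zl x) * nsq M xi)" .
  qed
  have "(%n. sqrt (nsq M (%x. ?y n x - zl x) * nsq M xi)) ----> sqrt (0 * nsq M xi)"
  by (intro tendsto_intros conv)
  then show "(%n. sqrt (nsq M (%x. ?y n x - zl x) * nsq M xi)) ----> 0" by simp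
 qed
 then have "(%n. LINT x|M. ?y n x <.> xi x) ----> (LINT x|M. zl x <.> xi x)" by (simp add: LIM_zero_iff)
 then show ?thesis unfolding 1 .
qed

section \<open>Time slices and spatial primitives on the cylinder\<close>

abbreviation tint :: "real => real measure" where "tint T \<equiv> lbo {0<..<T}"

lemma pair_sf: "pair_sigma_finite lO (tint T)"
proof -
 interpret I: finite_measure "tint T" by (rule finite_measure_lbo_Ioo)
 show ?thesis by unfold_locales
qed

lemma slice_measurable:
 fixes g :: "real*real => 'b::euclidean_space"
 assumes g: "g \<in> bms (lC T)" and t: "t \<in> {0<..<T}"
 shows "(%x. g (x, t)) \<in> bms lO"
proof -
 have "t \<in> space (tint T)" using t by simp
 then have "(%x. (x, t)) \<in> lO \<rightarrow>\<^sub>M lO OX tint T" by measurable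
 then show ?thesis using g unfolding Cyl_eq by (rule measurable_compose)
qed

lemma slice_sq_int:
 fixes g :: "real*real => 'b::euclidean_space"
 assumes g: "sq_int (lC T) g"
 shows "AE t in tint T. sq_int lO (%x. g (x, t))"
  "integrable (tint T) (%t. nsq lO (%x. g (x, t)))"
  "(LINT t|tint T. nsq lO (%x. g (x, t))) = nsq (lC T) g"
proof -
 interpret P: pair_sigma_finite "lO" "tint T" by (rule pair_sf)
 have i: "integrable (lO OX tint T) (case_prod (%x t. (norm (g (x, t)))^2))"
  using sq_intD(2)[OF g] unfolding Cyl_eq by (simp add: case_prod_beta')
 have "AE t in tint T. integrable lO (%x. (norm (g (x, t)))^2)"
  by (rule P.AE_integrable_snd[OF i])
 then show "AE t in tint T. sq_int lO (%x. g (x, t))"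
  using AE_space
 proof eventually_elim
  case (elim t)
  then show ?case using slice_measurable[OF sq_intD(1)[OF g], of t] by (simp add: sq_int_def)
 qed
 show "integrable (tint T) (%t. nsq lO (%x. g (x, t)))"
  unfolding nsq_def by (rule P.integrable_snd[OF i])
 show "(LINT t|tint T. nsq lO (%x. g (x, t))) = nsq (lC T) g"
  unfolding nsq_def using P.integral_snd[OF i] by (simp add: Cyl_eq case_prod_beta')
qed

lemma integral_Cyl_iterated:
 fixes F :: "real*real => 'b::euclidean_space"
 assumes "integrable (lC T) F"
 shows "(LINT p|lC T. F p) = (LINT t|tint T. LINT x|lO. F (x, t))"
  "(LINT p|lC T. F p) = (LINT x|lO. LINT t|tint T. F (x, t))"
  "AE t in tint T. integrable lO (%x. F (x, t))"
  "AE x in lO. integrable (tint T) (%t. F (x, t))"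
proof -
 interpret P: pair_sigma_finite "lO" "tint T" by (rule pair_sf)
 have i: "integrable (lO OX tint T) (case_prod (%x t. F (x, t)))"
  using assms unfolding Cyl_eq by (simp add: case_prod_beta')
 show "(LINT p|lC T. F p) = (LINT t|tint T. LINT x|lO. F (x, t))"
  using P.integral_snd[OF i] by (simp add: Cyl_eq case_prod_beta')
 show "(LINT p|lC T. F p) = (LINT x|lO. LINT t|tint T. F (x, t))"
  using P.integral_fst[OF i] by (simp add: Cyl_eq case_prod_beta')
 show "AE t in tint T. integrable lO (%x. F (x, t))" by (rule P.AE_integrable_snd[OF i])
 show "AE x in lO. integrable (tint T) (%t. F (x, t))" by (rule P.AE_integrable_fst[OF i])
qed

text \<open>By Fubini the squared L2 norms of the slices tend to zero in L1 over time, and a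
  sequence null in L1 has a subsequence null almost everywhere.\<close>

lemma slice_subsequence:
 fixes y :: "nat => real*real => 'b::euclidean_space"
 assumes y: "!!n. sq_int (lC T) (y n)" and z: "sq_int (lC T) z"
  and conv: "(%n. nsq (lC T) (%p. y n p - z p)) ----> 0"
 shows "\<exists>r. strict_mono (r :: nat => nat) & (AE t in tint T. (%n. nsq lO (%x. y (r n) (x, t) - z (x, t))) ----> 0)"
proof (rule tendsto_L1_AE_subseq)
 have d: "sq_int (lC T) (%p. y n p - z p)" for n by (rule sq_int_diff[OF y z])
 show "integrable (tint T) (%t. nsq lO (%x. y n (x, t) - z (x, t)))" for n
  using slice_sq_int(2)[OF d[of n]] by simp
 have "(LINT t|tint T. norm (nsq lO (%x. y n (x, t) - z (x, t)))) = nsq (lC T) (%p. y n p - z p)" for n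
  using slice_sq_int(3)[OF d[of n]] by (simp add: nsq_nonneg)
 then show "(%n. LINT t|tint T. norm (nsq lO (%x. y n (x, t) - z (x, t)))) ----> 0" using conv by simp
qed

text \<open>The displacement of the solution will be \<open>prim2 ux\<close>, the primitive on every
  time slice with left trace zero; its spatial derivative is then \<open>ux\<close> by
  construction.\<close>

definition prim2 :: "(real*real => 'b::euclidean_space) => real*real => 'b" where
 "prim2 g p = prim 0 (%y. g (y, snd p)) (fst p)"

lemma prim2_measurable:
 fixes g :: "real*real => 'b::euclidean_space"
 assumes g: "g \<in> bms (lC T)"
 shows "prim2 g \<in> bms (lC T)"
proof -
 have [measurable]: "(%q. snd (fst q)) \<in> lC T OX lO \<rightarrow>\<^sub>M tint T"
  unfolding Cyl_eq by measurable
 have [measurable]: "(%q. fst (fst q)) \<in> bms (lC T OX lO)"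
  by (rule measurable_compose[OF measurable_fst borel_imp_lbo]) (simp add: borel_measurable_continuous_onI continuous_on_fst)
 have [measurable]: "(%q. snd q :: real) \<in> bms (lC T OX lO)"
  by (rule measurable_compose[OF measurable_snd borel_imp_lbo]) simp
 have "(%q. (snd q, snd (fst q))) \<in> lC T OX lO \<rightarrow>\<^sub>M lO OX tint T"
  by measurable
 then have [measurable]: "(%q. g (snd q, snd (fst q))) \<in> bms (lC T OX lO)"
  using g unfolding Cyl_eq by (rule measurable_compose)
 have "(%q. ind {q. snd q < fst (fst q)} q *R g (snd q, snd (fst q))) \<in> bms (lC T OX lO)"
  by measurable
 then have "(%(p, y). ind {..<fst p} y *R g (y, snd p)) \<in> bms (lC T OX lO)"
  by (simp add: indicator_def case_prod_beta')
 then have "(%p. LINT y|lO. ind {..<fst p} y *R g (y, snd p)) \<in> bms (lC T)"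
  by (rule Om.borel_measurable_lebesgue_integral)
 then show ?thesis by (simp add: prim2_def[abs_def] prim_def)
qed

text \<open>The bound is available slice by slice for almost every time, so Fubini is applied with
  time as the outer variable; hence the product with swapped factors.\<close>

lemma prim2_sq_int:
 fixes g :: "real*real => 'b::euclidean_space"
 assumes g: "sq_int (lC T) g"
 shows "sq_int (lC T) (prim2 g)" "nsq (lC T) (prim2 g) <= 2 * nsq (lC T) g"
proof -
 interpret P: pair_sigma_finite "lO" "tint T" by (rule pair_sf)
 interpret P': pair_sigma_finite "tint T" "lO" by (rule pair_sigma_finite.intro) (unfold_locales)
 have m: "prim2 g \<in> bms (lC T)" by (rule prim2_measurable[OF sq_intD(1)[OF g]])
 have s: "AE t in tint T. sq_int lO (%x. prim2 g (x, t)) & nsq lO (%x. prim2 g (x, t)) <= 2 * nsq lO (%x. g (x, t))"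
  using slice_sq_int(1)[OF g]
 proof eventually_elim
  case (elim t)
  then show ?case
  using integrable_prim[OF Om.sq_int_integrable[OF elim], of 0] nsq_prim_le[OF elim, of 0] by (simp add: prim2_def)
 qed
 have m2: "(%p. (norm (prim2 g p))^2) \<in> bms (lO OX tint T)" using m unfolding Cyl_eq by measurable
 then have m3: "(%(t, x). (norm (prim2 g (x, t)))^2) \<in> bms (tint T OX lO)"
  using measurable_pair_swap[OF m2] by (simp add: case_prod_beta')
 have "integrable (tint T OX lO) (%(t, x). (norm (prim2 g (x, t)))^2)"
 proof (rule P'.Fubini_integrable[OF m3])
  have "(%t. LINT x|lO. norm ((norm (prim2 g (x, t)))^2)) \<in> bms (tint T)"
  using m3 by (intro Om.borel_measurable_lebesgue_integral) (simp add: case_prod_beta')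
  then have "integrable (tint T) (%t. LINT x|lO. norm ((norm (prim2 g (x, t)))^2))"
  proof (rule Bitg_bound[OF integrable_mult_right[OF slice_sq_int(2)[OF g], of 2]])
  show "AE t in tint T. norm (LINT x|lO. norm ((norm (prim2 g (x, t)))^2)) <= norm (2 * nsq lO (%x. g (x, t)))"
  using s by eventually_elim (simp add: nsq_def[symmetric] nsq_nonneg)
  qed
  then show "integrable (tint T) (%t. LINT x|lO. norm (case (t, x) of (t, x) => (norm (prim2 g (x, t)))^2))" by simp
  show "AE t in tint T. integrable lO (%x. case (t, x) of (t, x) => (norm (prim2 g (x, t)))^2)"
  using s by eventually_elim (simp add: sq_int_def)
 qed
 then have "integrable (lO OX tint T) (%p. (norm (prim2 g p))^2)"
  using P.integrable_product_swap_iff[of "%p. (norm (prim2 g p))^2"] by simp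
 then show sq: "sq_int (lC T) (prim2 g)" using m by (simp add: sq_int_def Cyl_eq)
 have "nsq (lC T) (prim2 g) = (LINT t|tint T. nsq lO (%x. prim2 g (x, t)))" by (rule slice_sq_int(3)[OF sq, symmetric])
 also have "... <= (LINT t|tint T. 2 * nsq lO (%x. g (x, t)))"
  using s by (intro integral_mono_AE slice_sq_int(2)[OF sq] integrable_mult_right slice_sq_int(2)[OF g]) auto
 also have "... = 2 * nsq (lC T) g" using slice_sq_int(3)[OF g] by simp
 finally show "nsq (lC T) (prim2 g) <= 2 * nsq (lC T) g" .
qed

section \<open>Volterra convolutions and their transposes\<close>

lemma shift_integral:
 fixes F ps :: "real => real"
 assumes s: "0 < s"
 shows "(LINT t|tint T. ind {s<..} t * F (t - s) * ps t) = (LINT r|tint T. F r * (if s + r < T then ps (s + r) else 0))"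
  "integrable (tint T) (%r. F r * (if s + r < T then ps (s + r) else 0)) ==> integrable (tint T) (%t. ind {s<..} t * F (t - s) * ps t)"
proof -
 define f where "f t = ind {0<..<T} t *R (ind {s<..} t * F (t - s) * ps t)" for t
 define g where "g r = ind {0<..<T} r *R (F r * (if s + r < T then ps (s + r) else 0))" for r
 have fg: "f (s + 1 * r) = g r" for r using s by (auto simp: f_def g_def indicator_def)
 have "(LINT t|tint T. ind {s<..} t * F (t - s) * ps t) = (\<integral>t. f t \<partial>lborel)"
  unfolding f_def by (rule integral_lbo) simp
 also have "... = (\<integral>r. g r \<partial>lborel)" using lborel_integral_real_affine[of 1 f s] by (simp add: fg[simplified])
 also have "... = (LINT r|tint T. F r * (if s + r < T then ps (s + r) else 0))"
  unfolding g_def by (rule integral_lbo[symmetric]) simp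
 finally show "(LINT t|tint T. ind {s<..} t * F (t - s) * ps t) = (LINT r|tint T. F r * (if s + r < T then ps (s + r) else 0))" .
 assume "integrable (tint T) (%r. F r * (if s + r < T then ps (s + r) else 0))"
 then have "integrable lborel g" unfolding g_def by (subst (asm) integrable_lbo) auto
 moreover have "(%r. f (s + 1 * r)) = g" using fg by (rule ext)
 ultimately have "integrable lborel (%r. f (s + 1 * r))" by (simp only:)
 then have "integrable lborel (%t. f (s + 1 * ((- s) + 1 * t)))"
  by (intro lborel_integrable_real_affine[where f = "%r. f (s + 1 * r)"]) auto
 then have "integrable lborel f" by simp
 then show "integrable (tint T) (%t. ind {s<..} t * F (t - s) * ps t)"
  unfolding f_def by (subst integrable_lbo) auto
qed

text \<open>Fubini on s < t, followed by the shift t = s + r, transposes the convolution onto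
  \<open>xi\<close>. The kernel is only integrable, so its L1 norm is paired with the sup bound of
  \<open>xi\<close>. As \<open>xi\<close> vanishes outside the cylinder, r may run over all of (0,
  T).\<close>

lemma volterra_swap:
 fixes k :: "real => real" and g xi :: "real*real => real"
 assumes T: "T > 0" and k[measurable]: "k \<in> bms borel" and ik: "integrable (tint T) k"
  and g[measurable]: "g \<in> bms borel" and ig: "integrable (lC T) g"
  and xi[measurable]: "xi \<in> bms borel" and C: "!!p. \<bar>xi p\<bar> <= C" and z: "!!p. p \<notin> Cyl T ==> xi p = 0"
 defines "\<Phi> \<equiv> %p. LINT r|tint T. k r * xi (fst p, snd p + r)"
 shows "\<Phi> \<in> bms borel" "!!p. \<bar>\<Phi> p\<bar> <= C * (LINT r|tint T. \<bar>k r\<bar>)"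
  "(LINT p|lC T. LINT s|tint (snd p). k (snd p - s) * g (fst p, s) * xi p) = (LINT p|lC T. g p * \<Phi> p)"
  "integrable (lC T) (%p. LINT s|tint (snd p). k (snd p - s) * g (fst p, s) * xi p)"
proof -
 interpret I: finite_measure "tint T" by (rule finite_measure_lbo_Ioo)
 interpret P: pair_sigma_finite "lO" "tint T" by (rule pair_sf)
 interpret S: pair_sigma_finite "tint T" "tint T" by (rule pair_sigma_finite.intro) unfold_locales
 define K where "K = (LINT r|tint T. \<bar>k r\<bar>)"
 have C0: "0 <= C" using C[of "(0,0)"] by (meson abs_ge_zero order_trans)
 have K0: "0 <= K" unfolding K_def by (rule integral_nonneg_AE) auto
 have mk: "f \<in> bms (tint T)" if "f \<in> bms borel" for f :: "real => real" using that by (rule borel_imp_lbo)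
 have [measurable]: "(%q. snd q :: real) \<in> bms (borel OX tint T)"
  by (rule measurable_compose[OF measurable_snd]) (rule borel_imp_lbo, simp)
 have [measurable]: "k \<in> bms (tint T)" by (rule mk) simp
 have pair: "(%q. f (a q, b q)) \<in> bms M"
  if "f \<in> bms borel" "a \<in> bms M" "b \<in> bms M"
  for f :: "real*real => real" and a b :: "'m => real" and M
 proof -
  have "(%q. (a q, b q)) \<in> M \<rightarrow>\<^sub>M borel OX borel" using that(2,3) by measurable
  then show ?thesis using that(1) unfolding borel_prod by (rule measurable_compose)
 qed
 have [measurable]: "(%q. fst (fst q) :: real) \<in> bms ((borel :: (real*real) measure) OX tint T)"
  "(%q. snd (fst q) :: real) \<in> bms ((borel :: (real*real) measure) OX tint T)"
  by (rule measurable_compose[OF measurable_fst borel_measurable_continuous_onI[OF continuous_on_fst[OF continuous_on_id]]],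
  rule measurable_compose[OF measurable_fst borel_measurable_continuous_onI[OF continuous_on_snd[OF continuous_on_id]]])
 have mxi2: "(%q. xi (fst (fst q), snd (fst q) + snd q)) \<in> bms ((borel :: (real*real) measure) OX tint T)"
  by (rule pair[OF xi]) measurable
 have mxi3: "(%q. xi (fst (fst q), snd (fst q))) \<in> bms ((borel :: (real*real) measure) OX tint T)"
  by (rule pair[OF xi]) measurable
 have mxi4: "(%q. g (fst (fst q), snd q)) \<in> bms ((borel :: (real*real) measure) OX tint T)"
  by (rule pair[OF g]) measurable
 have mxi1: "(%q. xi (x, snd q)) \<in> bms (borel OX borel)" for x
  by (rule pair[OF xi]) measurable
 have mxi5: "(%q. g (x, fst q)) \<in> bms (borel OX borel)" for x
  by (rule pair[OF g]) measurable
 note mxi1[measurable] mxi2[measurable] mxi3[measurable] mxi4[measurable] mxi5[measurable]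
 have ixi: "integrable (tint T) (%r. k r * xi (x, s + r))" "\<bar>LINT r|tint T. k r * xi (x, s + r)\<bar> <= C * K"
  "(LINT r|tint T. \<bar>k r\<bar> * \<bar>xi (x, s + r)\<bar>) <= C * K" "integrable (tint T) (%r. \<bar>k r\<bar> * \<bar>xi (x, s + r)\<bar>)" for x s
 proof -
  have m: "(%r. xi (x, s + r)) \<in> bms (tint T)" by (rule mk) measurable
  note m[measurable]
  have iC: "integrable (tint T) (%r. C * \<bar>k r\<bar>)" using ik by auto
  have le: "\<bar>k r\<bar> * \<bar>xi (x, s + r)\<bar> <= C * \<bar>k r\<bar>" for r using mult_right_mono[OF C[of "(x, s + r)"], of "\<bar>k r\<bar>"] by (simp add: mult.commute)
  show 1: "integrable (tint T) (%r. k r * xi (x, s + r))"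
  proof (rule Bitg_bound[OF iC])
  show "AE r in tint T. norm (k r * xi (x, s + r)) <= norm (C * \<bar>k r\<bar>)"
  using le C0 by (intro AE_I2) (simp add: abs_mult)
  qed measurable
  show 2: "integrable (tint T) (%r. \<bar>k r\<bar> * \<bar>xi (x, s + r)\<bar>)" using integrable_abs[OF 1] by (simp add: abs_mult)
  show 3: "(LINT r|tint T. \<bar>k r\<bar> * \<bar>xi (x, s + r)\<bar>) <= C * K"
  using integral_mono[OF 2 iC le] by (simp add: K_def)
  show "\<bar>LINT r|tint T. k r * xi (x, s + r)\<bar> <= C * K"
  using integral_abs_bound[of "tint T" "%r. k r * xi (x, s + r)"] 3 by (simp add: abs_mult)
 qed
 show m\<Phi>: "\<Phi> \<in> bms borel"
  unfolding \<Phi>_def by (rule I.borel_measurable_lebesgue_integral) measurable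
 show b\<Phi>: "\<bar>\<Phi> p\<bar> <= C * (LINT r|tint T. \<bar>k r\<bar>)" for p
  unfolding \<Phi>_def using ixi(2)[of "fst p" "snd p"] by (simp add: K_def)
 have ifz: "(if s + r < T then xi (x, s + r) else 0) = xi (x, s + r)" for x s r
  using z[of "(x, s + r)"] by (auto simp: Cyl_def)
 have inner_t: "(LINT t|tint T. ind {s<..} t * k (t - s) * xi (x, t)) = \<Phi> (x, s)"
  "integrable (tint T) (%t. ind {s<..} t * k (t - s) * xi (x, t))"
  "(LINT t|tint T. ind {s<..} t * \<bar>k (t - s)\<bar> * \<bar>xi (x, t)\<bar>) <= C * K" if s: "0 < s" for x s
 proof -
  show "(LINT t|tint T. ind {s<..} t * k (t - s) * xi (x, t)) = \<Phi> (x, s)"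
  unfolding shift_integral(1)[OF s, of T k "%t. xi (x, t)"] \<Phi>_def by (simp add: ifz)
  show "integrable (tint T) (%t. ind {s<..} t * k (t - s) * xi (x, t))"
  by (rule shift_integral(2)[OF s]) (simp add: ifz ixi)
  have "(if s + r < T then \<bar>xi (x, s + r)\<bar> else 0) = \<bar>xi (x, s + r)\<bar>" for r
  using z[of "(x, s + r)"] by (auto simp: Cyl_def)
  then show "(LINT t|tint T. ind {s<..} t * \<bar>k (t - s)\<bar> * \<bar>xi (x, t)\<bar>) <= C * K"
  using ixi(3)[of x s] shift_integral(1)[OF s, of T "%r. \<bar>k r\<bar>" "%t. \<bar>xi (x, t)\<bar>"] by simp
 qed
 \<comment> \<open>The indicator fixes the inner domain: integration over s < t becomes integration
   over a square that does not depend on t.\<close>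
 define f where "f x s t = ind {s<..} t * k (t - s) * xi (x, t) * g (x, s)" for x s t
 define h where "h p = (LINT s|tint T. f (fst p) s (snd p))" for p
 have mf: "(%q. f x (fst q) (snd q)) \<in> bms borel" for x
 proof -
  have "(%q. ind {q. fst q < snd q} q * k (snd q - fst q) * xi (x, snd q) * g (x, fst q)) \<in> bms (borel OX borel)"
  by measurable
  moreover have "(%q. ind {q. fst q < snd q} q * k (snd q - fst q) * xi (x, snd q) * g (x, fst q)) = (%q. f x (fst q) (snd q))"
  by (auto simp: f_def fun_eq_iff indicator_def)
  ultimately show ?thesis by (simp add: borel_prod)
 qed
 have mf2: "(%q. f x (fst q) (snd q)) \<in> bms (tint T OX tint T)" for x
  using borel_imp_lbo[OF mf[of x]] by (simp add: lbo_prod)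
 have mh: "h \<in> bms borel"
 proof -
  have m1: "(%q. ind {q. snd q < snd (fst q)} q * k (snd (fst q) - snd q) * xi (fst (fst q), snd (fst q)) * g (fst (fst q), snd q)) \<in> bms ((borel :: (real*real) measure) OX tint T)"
  by measurable
  have eq: "(%q. ind {q. snd q < snd (fst q)} q * k (snd (fst q) - snd q) * xi (fst (fst q), snd (fst q)) * g (fst (fst q), snd q)) = (%(p, s). f (fst p) s (snd p))"
  by (auto simp: f_def fun_eq_iff indicator_def)
  from m1 have "(%(p, s). f (fst p) s (snd p)) \<in> bms ((borel :: (real*real) measure) OX tint T)"
  unfolding eq .
  then show ?thesis unfolding h_def by (rule I.borel_measurable_lebesgue_integral)
 qed
 have slice: "integrable (tint T OX tint T) (%q. f x (fst q) (snd q))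
  & (LINT s|tint T. LINT t|tint T. \<bar>f x s t\<bar>) <= (LINT s|tint T. C * K * \<bar>g (x, s)\<bar>)" if gx: "integrable (tint T) (%s. g (x, s))" for x
 proof -
  have it: "integrable (tint T) (%t. f x s t)" if "0 < s" for s
  unfolding f_def by (intro integrable_mult_left inner_t(2) that)
  have bt: "(LINT t|tint T. \<bar>f x s t\<bar>) <= C * K * \<bar>g (x, s)\<bar>" if "0 < s" for s
  proof -
  have "(LINT t|tint T. \<bar>f x s t\<bar>) = (LINT t|tint T. ind {s<..} t * \<bar>k (t - s)\<bar> * \<bar>xi (x, t)\<bar>) * \<bar>g (x, s)\<bar>"
  by (simp add: f_def abs_mult)
  also have "... <= C * K * \<bar>g (x, s)\<bar>" by (intro mult_right_mono inner_t(3) that) auto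
  finally show ?thesis .
  qed
  have igx: "integrable (tint T) (%s. C * K * \<bar>g (x, s)\<bar>)" using gx by auto
  have iabs: "integrable (tint T) (%s. LINT t|tint T. \<bar>f x s t\<bar>)"
  proof (rule Bitg_bound[OF igx])
  show "(%s. LINT t|tint T. \<bar>f x s t\<bar>) \<in> bms (tint T)"
  using mf2[of x] by (intro I.borel_measurable_lebesgue_integral) (simp add: case_prod_beta')
  show "AE s in tint T. norm (LINT t|tint T. \<bar>f x s t\<bar>) <= norm (C * K * \<bar>g (x, s)\<bar>)"
  proof (rule AE_I2)
  fix s assume "s \<in> space (tint T)"
  then have "(LINT t|tint T. \<bar>f x s t\<bar>) <= C * K * \<bar>g (x, s)\<bar>" by (intro bt) simp
  moreover have "0 <= (LINT t|tint T. \<bar>f x s t\<bar>)" by (rule integral_nonneg_AE) simp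
  ultimately show "norm (LINT t|tint T. \<bar>f x s t\<bar>) <= norm (C * K * \<bar>g (x, s)\<bar>)" by simp
  qed
  qed
  have "integrable (tint T OX tint T) (%q. f x (fst q) (snd q))"
  proof (rule S.Fubini_integrable[OF mf2])
  show "AE s in tint T. integrable (tint T) (%t. f x (fst (s, t)) (snd (s, t)))"
  by (rule AE_I2) (simp add: it)
  qed (use iabs in simp)
  moreover have "(LINT s|tint T. LINT t|tint T. \<bar>f x s t\<bar>) <= (LINT s|tint T. C * K * \<bar>g (x, s)\<bar>)"
  by (intro integral_mono iabs igx bt) simp
  ultimately show ?thesis ..
 qed
 have aex: "AE x in lO. integrable (tint T) (%s. g (x, s))" by (rule integral_Cyl_iterated(4)[OF ig])
 have swap: "(LINT t|tint T. h (x, t)) = (LINT s|tint T. g (x, s) * \<Phi> (x, s)) & integrable (tint T) (%t. h (x, t))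
  & (LINT t|tint T. \<bar>h (x, t)\<bar>) <= (LINT s|tint T. C * K * \<bar>g (x, s)\<bar>)"
  if gx: "integrable (tint T) (%s. g (x, s))" for x
 proof -
  have i: "integrable (tint T OX tint T) (case_prod (f x))"
  using slice[OF gx] by (simp add: case_prod_beta')
  then have i': "integrable (tint T OX tint T) (case_prod (%s t. \<bar>f x s t\<bar>))"
  using integrable_abs[OF i] by (simp add: case_prod_beta')
  have 1: "(LINT t|tint T. h (x, t)) = (LINT s|tint T. LINT t|tint T. f x s t)"
  unfolding h_def using S.Fubini_integral[OF i] by simp
  have 2: "(LINT s|tint T. LINT t|tint T. f x s t) = (LINT s|tint T. g (x, s) * \<Phi> (x, s))"
  proof (rule Bint_cong[OF refl])
  fix s assume "s \<in> space (tint T)"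
  then have "(LINT t|tint T. ind {s<..} t * k (t - s) * xi (x, t)) = \<Phi> (x, s)" by (intro inner_t(1)) simp
  then show "(LINT t|tint T. f x s t) = g (x, s) * \<Phi> (x, s)" by (simp add: f_def mult.commute)
  qed
  have 3: "integrable (tint T) (%t. h (x, t))" unfolding h_def using S.integrable_snd[OF i] by simp
  have "(LINT t|tint T. \<bar>h (x, t)\<bar>) <= (LINT t|tint T. LINT s|tint T. \<bar>f x s t\<bar>)"
  by (intro integral_mono integrable_abs 3 S.integrable_snd[OF i']) (simp add: h_def)
  also have "... = (LINT s|tint T. LINT t|tint T. \<bar>f x s t\<bar>)" by (rule S.Fubini_integral[OF i'])
  also have "... <= (LINT s|tint T. C * K * \<bar>g (x, s)\<bar>)" using slice[OF gx] by simp
  finally show ?thesis using 1 2 3 by simp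
 qed
 have ih: "integrable (lC T) h"
 proof -
  have mh': "h \<in> bms (lO OX tint T)" using borel_imp_lbo[OF mh, of "Cyl T"] by (simp add: Cyl_eq)
  have ib: "integrable lO (%x. LINT s|tint T. C * K * \<bar>g (x, s)\<bar>)"
  proof -
  have "integrable (lO OX tint T) (%p. C * K * \<bar>g p\<bar>)" using ig unfolding Cyl_eq by auto
  then show ?thesis using P.integrable_fst[of "%x s. C * K * \<bar>g (x, s)\<bar>"] by (simp add: case_prod_beta')
  qed
  have "integrable (lO OX tint T) h"
  proof (rule P.Fubini_integrable[OF mh'])
  show "AE x in lO. integrable (tint T) (%t. h (x, t))" using aex by eventually_elim (simp add: swap)
  show "integrable lO (%x. LINT t|tint T. norm (h (x, t)))"
  proof (rule Bitg_bound[OF ib])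
  show "(%x. LINT t|tint T. norm (h (x, t))) \<in> bms lO"
  using mh' by (intro I.borel_measurable_lebesgue_integral) (simp add: case_prod_beta')
  show "AE x in lO. norm (LINT t|tint T. norm (h (x, t))) <= norm (LINT s|tint T. C * K * \<bar>g (x, s)\<bar>)"
  using aex
  proof eventually_elim
  case (elim x)
  have "0 <= (LINT t|tint T. norm (h (x, t)))" by (rule integral_nonneg_AE) simp
  moreover have "(LINT t|tint T. norm (h (x, t))) <= (LINT s|tint T. C * K * \<bar>g (x, s)\<bar>)"
  using swap[OF elim] unfolding real_norm_def by blast
  ultimately show ?case unfolding real_norm_def[of "integral\<^sup>L _ _"] by linarith
  qed
  qed
  qed
  then show ?thesis by (simp add: Cyl_eq)
 qed
 have ig\<Phi>: "integrable (lC T) (%p. g p * \<Phi> p)"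
 proof (rule Bitg_bound[OF integrable_mult_right[OF ig, of "C * K"]])
  show "(%p. g p * \<Phi> p) \<in> bms (lC T)" by (rule borel_imp_lbo) (use m\<Phi> in measurable)
  show "AE p in lC T. norm (g p * \<Phi> p) <= norm (C * K * g p)"
  proof (rule AE_I2)
  fix p
  have "\<bar>\<Phi> p\<bar> * \<bar>g p\<bar> <= C * K * \<bar>g p\<bar>" using b\<Phi>[of p] by (intro mult_right_mono) (auto simp: K_def)
  then show "norm (g p * \<Phi> p) <= norm (C * K * g p)" using C0 K0 by (simp add: abs_mult mult.commute)
  qed
 qed
 have hp: "(LINT s|tint (snd p). k (snd p - s) * g (fst p, s) * xi p) = h p" if "p \<in> space (lC T)" for p
 proof -
  have p: "snd p < T" using that by (auto simp: Cyl_def)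
  have "(LINT s|tint (snd p). k (snd p - s) * g (fst p, s) * xi p) = (\<integral>s. ind {0<..<snd p} s *R (k (snd p - s) * g (fst p, s) * xi p) \<partial>lborel)"
  by (rule integral_lbo) simp
  also have "... = (\<integral>s. ind {0<..<T} s *R f (fst p) s (snd p) \<partial>lborel)"
  by (rule Bint_cong) (use p in \<open>auto simp: f_def indicator_def\<close>)
  also have "... = h p" unfolding h_def by (rule integral_lbo[symmetric]) simp
  finally show "(LINT s|tint (snd p). k (snd p - s) * g (fst p, s) * xi p) = h p" .
 qed
 show "integrable (lC T) (%p. LINT s|tint (snd p). k (snd p - s) * g (fst p, s) * xi p)"
  by (rule Bitg_cong[THEN iffD2, OF refl hp ih])
 have "(LINT p|lC T. LINT s|tint (snd p). k (snd p - s) * g (fst p, s) * xi p) = (LINT p|lC T. h p)"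
  by (rule Bint_cong[OF refl hp])
 also have "... = (LINT x|lO. LINT t|tint T. h (x, t))" by (rule integral_Cyl_iterated(2)[OF ih])
 also have "... = (LINT x|lO. LINT s|tint T. g (x, s) * \<Phi> (x, s))"
 proof (rule integral_cong_AE)
  have "h \<in> bms (lO OX tint T)" using borel_imp_lbo[OF mh, of "Cyl T"] by (simp add: Cyl_eq)
  then show "(%x. LINT t|tint T. h (x, t)) \<in> bms lO"
  by (intro I.borel_measurable_lebesgue_integral) (simp add: case_prod_beta')
  have "(%p. g p * \<Phi> p) \<in> bms borel" using m\<Phi> by measurable
  then have "(%p. g p * \<Phi> p) \<in> bms (lO OX tint T)" using borel_imp_lbo[of _ "Cyl T"] by (simp add: Cyl_eq)
  then show "(%x. LINT s|tint T. g (x, s) * \<Phi> (x, s)) \<in> bms lO"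
  by (intro I.borel_measurable_lebesgue_integral) (simp add: case_prod_beta')
  show "AE x in lO. (LINT t|tint T. h (x, t)) = (LINT s|tint T. g (x, s) * \<Phi> (x, s))"
  using aex by eventually_elim (simp add: swap)
 qed
 also have "... = (LINT p|lC T. g p * \<Phi> p)" by (rule integral_Cyl_iterated(2)[OF ig\<Phi>, symmetric])
 finally show "(LINT p|lC T. LINT s|tint (snd p). k (snd p - s) * g (fst p, s) * xi p) = (LINT p|lC T. g p * \<Phi> p)" .
qed

section \<open>Test functions on the grid\<close>

text \<open>Uniform closeness at the nodes (i/N, k T/N) with N = n + 1, for exactly the indices that
  \<open>stp\<close> reads: time levels start at 1, and the space node i = N is excluded.\<close>

definition gconv :: "real => (nat => nat => nat => 'b) => (real*real => 'b::euclidean_space) => bool" where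
 "gconv T D ph \<longleftrightarrow> (\<forall>e>0. \<exists>n0. \<forall>n\<ge>n0. \<forall>i<Suc n. \<forall>k. 1 <= k --> k <= Suc n -->
  norm (D n k i - ph (real i / (rS n), real k * (T / (rS n)))) < e)"

definition smp :: "real => (real*real => 'b) => nat => nat => nat => 'b" where
 "smp T ph n k i = ph (real i / (rS n), real k * (T / (rS n)))"

lemma gconv_smp: "gconv T (smp T ph) ph"
 by (simp add: gconv_def smp_def)

abbreviation CB :: "real => (real*real) set" where "CB T \<equiv> {0..1} \<times> {0..T}"

lemma compact_CB: "compact (CB T)"
 by (intro compact_Times) auto

lemma grid_in_CB: "i <= N ==> k <= N ==> 0 < N ==> T > 0 ==> (real i / real N, real k * (T / real N)) \<in> CB T"
proof -
 assume a: "i <= N" "k <= N" "0 < N" "T > 0"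
 have "real k * (T / real N) <= real N * (T / real N)" using a by (intro mult_right_mono) auto
 then show ?thesis using a by simp
qed

lemma dist_Pair_le: "dist (a, b) (c, d) <= \<bar>a - c\<bar> + \<bar>b - d :: real\<bar>"
 for a c :: real
 unfolding dist_Pair_Pair using sqrt_sum_squares_le_sum_abs[of "dist a c" "dist b d"] by (simp add: dist_real_def)

lemma ix_div_dist:
 assumes "0 <= x" "0 < N" shows "\<bar>real (ix N x) / real N - x\<bar> <= 1 / real N"
proof -
 have "real (ix N x) / real N <= x" "x < (real (ix N x) + 1) / real N"
  using ix_bounds[OF assms(1), of N] assms(2) by (auto simp: field_simps)
 then show ?thesis by (simp add: add_divide_distrib abs_le_iff)
qed

lemma ix_time_dist:
 assumes "0 <= t" "0 < N" "T > 0" shows "\<bar>real (ix N (t / T)) * (T / real N) - t\<bar> <= T / real N"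
proof -
 have "\<bar>real (ix N (t / T)) / real N - t / T\<bar> * T <= 1 / real N * T"
  using assms by (intro mult_right_mono ix_div_dist) auto
 moreover have "\<bar>real (ix N (t / T)) / real N - t / T\<bar> * T = \<bar>real (ix N (t / T)) * (T / real N) - t\<bar>"
 proof -
  have "\<bar>real (ix N (t / T)) / real N - t / T\<bar> * T = \<bar>(real (ix N (t / T)) / real N - t / T) * T\<bar>"
  using assms by (simp add: abs_mult)
  also have "(real (ix N (t / T)) / real N - t / T) * T = real (ix N (t / T)) * (T / real N) - t"
  using assms by (simp add: field_simps)
  finally show ?thesis .
 qed
 ultimately show ?thesis by simp
qed

lemma tendsto_over_Suc: "eventually (%n. c / (rS n) < e) sequentially" if "e > 0"
proof -
 have "(%n. c * inverse (rS n)) ----> c * 0" by (intro tendsto_intros LIMSEQ_inverse_real_of_nat)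
 then have "eventually (%n. c * inverse (rS n) < e) sequentially" using that by (intro order_tendstoD(2)) auto
 then show ?thesis by (simp add: divide_inverse)
qed

lemma gconv_uniform:
 assumes D: "gconv T D ph" and c: "continuous_on (CB T) ph" and T: "T > 0"
 shows "uniform_limit (Cyl T) (%n. stp (Suc n) T (D n)) ph sequentially"
 unfolding uniform_limit_sequentially_iff
proof (intro allI impI)
 fix e :: real assume e: "e > 0"
 have "uniformly_continuous_on (CB T) ph" by (rule compact_uniformly_continuous[OF c compact_CB])
 then obtain d where d: "d > 0" "!!p q. p \<in> CB T ==> q \<in> CB T ==> dist q p < d ==> dist (ph q) (ph p) < e / 2"
  unfolding uniformly_continuous_on_def using e by (meson half_gt_zero)
 obtain n1 where n1: "!!n i k. n \<ge> n1 ==> i < Suc n ==> 1 <= k ==> k <= Suc n ==> norm (D n k i - ph (real i / (rS n), real k * (T / (rS n)))) < e / 2"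
  using D e unfolding gconv_def by (meson half_gt_zero)
 \<comment> \<open>A point and its node differ by at most 1/N in space and 2 T/N in time: T/N for
   rounding and T/N for the right end convention of \<open>stp\<close>.\<close>
 obtain n2 where n2: "!!n. n \<ge> n2 ==> (1 + 2 * T) / (rS n) < d"
  using tendsto_over_Suc[OF d(1), of "1 + 2 * T"] by (auto simp: eventually_sequentially)
 show "\<exists>N. \<forall>n\<ge>N. \<forall>x\<in>Cyl T. dist (stp (Suc n) T (D n) x) (ph x) < e"
 proof (intro exI[of _ "max n1 n2"] allI impI ballI)
  fix n p assume n: "max n1 n2 <= n" and p: "p \<in> Cyl T"
  obtain x t where xt: "p = (x, t)" by (cases p)
  have x: "0 < x" "x < 1" "0 < t" "t < T" using p by (auto simp: xt Cyl_def Omega_def)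
  define i where "i = ix (Suc n) x"
  define k where "k = Suc (ix (Suc n) (t / T))"
  have ik: "i < Suc n" "k <= Suc n" "1 <= k"
  using ix_less[of x "Suc n"] ix_less[of "t / T" "Suc n"] x T by (auto simp: i_def k_def Suc_le_eq)
  let ?q = "(real i / (rS n), real k * (T / (rS n)))"
  have "dist ?q p <= \<bar>real i / (rS n) - x\<bar> + \<bar>real k * (T / (rS n)) - t\<bar>" unfolding xt by (rule dist_Pair_le)
  also have "real k * (T / (rS n)) - t = (real (ix (Suc n) (t / T)) * (T / (rS n)) - t) + T / (rS n)"
  by (simp add: k_def distrib_right add_divide_distrib)
  also have "\<bar>real i / (rS n) - x\<bar> + \<bar>...\<bar> <= 1 / (rS n) + (T / (rS n) + T / (rS n))"
  unfolding i_def using x T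
  by (intro add_mono order_trans[OF abs_triangle_ineq] ix_div_dist ix_time_dist) auto
  also have "... = (1 + 2 * T) / (rS n)" by (simp add: add_divide_distrib)
  also have "... < d" using n by (intro n2) simp
  finally have "dist (ph ?q) (ph p) < e / 2"
  using d(2)[of p ?q] grid_in_CB[of i "Suc n" k T] ik T x by (auto simp: xt)
  moreover have "dist (D n k i) (ph ?q) < e / 2" using n1[of n i k] n ik by (simp add: dist_norm)
  ultimately have "dist (D n k i) (ph p) < e" by (metis dist_commute dist_triangle_half_r)
  then show "dist (stp (Suc n) T (D n) p) (ph p) < e" by (simp add: stp_def xt i_def k_def)
 qed
qed

text \<open>The mean value inequality for \<open>f x - x *R v\<close>, which measures the deviation
  of the difference quotient from the prescribed vector \<open>v\<close>.\<close>

lemma vector_mean_value_bound: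
 fixes f f' :: "real => 'b::euclidean_space"
 assumes ab: "a < b" and d: "!!x. x \<in> {a..b} ==> (f has_vector_derivative f' x) (at x within {a..b})"
  and e: "!!x. x \<in> {a..b} ==> norm (f' x - v) <= e"
 shows "norm ((1 / (b - a)) *R (f b - f a) - v) <= e"
proof -
 have "norm ((f b - b *R v) - (f a - a *R v)) <= e * norm (b - a)"
 proof (rule differentiable_bound[where S = "{a..b}" and f = "%x. f x - x *R v" and f' = "%x h. h *R (f' x - v)"])
  fix x assume x: "x \<in> {a..b}"
  have "((%x. f x - x *R v) has_vector_derivative f' x - v) (at x within {a..b})"
  using d[OF x] by (auto intro!: derivative_eq_intros)
  then show "((%x. f x - x *R v) has_derivative (%h. h *R (f' x - v))) (at x within {a..b})"
  by (simp add: has_vector_derivative_def)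
  have "norm (h *R (f' x - v)) <= e * norm h" for h using mult_left_mono[OF e[OF x], of "norm h"] by (simp add: mult.commute)
  then show "onorm (%h. h *R (f' x - v)) <= e" by (intro onorm_le)
 qed (use ab in auto)
 also have "(f b - b *R v) - (f a - a *R v) = (b - a) *R ((1 / (b - a)) *R (f b - f a) - v)"
  using ab by (simp add: scaleR_diff_right scaleR_diff_left)
 finally show ?thesis using ab by (simp add: mult.commute)
qed

lemma gconv_dx:
 fixes ph phx :: "real*real => 'b::euclidean_space"
 assumes T: "T > 0" and c: "continuous_on (CB T) phx"
  and d: "!!x t. x \<in> {0..1} ==> t \<in> {0..T} ==> ((%y. ph (y, t)) has_vector_derivative phx (x, t)) (at x within {0..1})"
 shows "gconv T (%n k i. (rS n) *R (smp T ph n k (Suc i) - smp T ph n k i)) phx"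
 unfolding gconv_def
proof (intro allI impI)
 fix e :: real assume e: "e > 0"
 have "uniformly_continuous_on (CB T) phx" by (rule compact_uniformly_continuous[OF c compact_CB])
 then obtain dd where dd: "dd > 0" "!!p q. p \<in> CB T ==> q \<in> CB T ==> dist q p < dd ==> dist (phx q) (phx p) < e / 2"
  unfolding uniformly_continuous_on_def using e by (meson half_gt_zero)
 obtain n2 where n2: "!!n. n \<ge> n2 ==> 1 / (rS n) < dd"
  using tendsto_over_Suc[OF dd(1), of 1] by (auto simp: eventually_sequentially)
 show "\<exists>n0. \<forall>n\<ge>n0. \<forall>i<Suc n. \<forall>k\<ge>1. k <= Suc n --> norm ((rS n) *R (smp T ph n k (Suc i) - smp T ph n k i) - phx (real i / (rS n), real k * (T / (rS n)))) < e"
 proof (intro exI[of _ n2] allI impI)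
  fix n i k assume n: "n \<ge> n2" and i: "i < Suc n" and k: "1 <= k" "k <= Suc n"
  let ?a = "real i / (rS n)" and ?b = "real (Suc i) / (rS n)" and ?t = "real k * (T / (rS n))"
  have ab: "?a < ?b" "?b - ?a = 1 / (rS n)" by (auto simp: divide_strict_right_mono simp flip: diff_divide_distrib)
  have in01: "{?a..?b} \<subseteq> {0..1}" and t: "?t \<in> {0..T}"
  using grid_in_CB[of "Suc i" "Suc n" k T] grid_in_CB[of i "Suc n" k T] i k T by auto
  have "norm ((1 / (?b - ?a)) *R (ph (?b, ?t) - ph (?a, ?t)) - phx (?a, ?t)) <= e / 2"
  proof (rule vector_mean_value_bound[OF ab(1)])
  fix x assume x: "x \<in> {?a..?b}"
  show "((%y. ph (y, ?t)) has_vector_derivative phx (x, ?t)) (at x within {?a..?b})"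
  using d[of x ?t] x in01 t by (meson has_vector_derivative_within_subset subsetD)
  have "dist (x, ?t) (?a, ?t) <= \<bar>x - ?a\<bar> + \<bar>?t - ?t\<bar>" by (rule dist_Pair_le)
  also have "... <= ?b - ?a" using x by simp
  also have "... < dd" unfolding ab(2) using n by (rule n2)
  finally have ds: "dist (x, ?t) (?a, ?t) < dd" .
  have "?a \<in> {?a..?b}" using ab(1) by (intro atLeastAtMost_iff[THEN iffD2] conjI order_refl less_imp_le)
  then have "(?a, ?t) \<in> CB T" "(x, ?t) \<in> CB T" using x in01 t by (blast intro: SigmaI)+
  then show "norm (phx (x, ?t) - phx (?a, ?t)) <= e / 2"
  unfolding dist_norm[symmetric] by (intro less_imp_le dd(2) ds)
  qed
  then show "norm ((rS n) *R (smp T ph n k (Suc i) - smp T ph n k i) - phx (?a, ?t)) < e"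
  unfolding ab(2) smp_def using e by simp
 qed
qed

text \<open>The quotient looks back in time, so it is compared with the derivative at the right end
  of the step, the level at which \<open>stp\<close> reads.\<close>

lemma gconv_dt:
 fixes ph pht :: "real*real => 'b::euclidean_space"
 assumes T: "T > 0" and c: "continuous_on (CB T) pht"
  and d: "!!x t. x \<in> {0..1} ==> t \<in> {0..T} ==> ((%s. ph (x, s)) has_vector_derivative pht (x, t)) (at t within {0..T})"
 shows "gconv T (%n k i. ((rS n) / T) *R (smp T ph n k i - smp T ph n (k - 1) i)) pht"
 unfolding gconv_def
proof (intro allI impI)
 fix e :: real assume e: "e > 0"
 have "uniformly_continuous_on (CB T) pht" by (rule compact_uniformly_continuous[OF c compact_CB])
 then obtain dd where dd: "dd > 0" "!!p q. p \<in> CB T ==> q \<in> CB T ==> dist q p < dd ==> dist (pht q) (pht p) < e / 2"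
  unfolding uniformly_continuous_on_def using e by (meson half_gt_zero)
 obtain n2 where n2: "!!n. n \<ge> n2 ==> T / (rS n) < dd"
  using tendsto_over_Suc[OF dd(1), of T] by (auto simp: eventually_sequentially)
 show "\<exists>n0. \<forall>n\<ge>n0. \<forall>i<Suc n. \<forall>k\<ge>1. k <= Suc n --> norm (((rS n) / T) *R (smp T ph n k i - smp T ph n (k - 1) i) - pht (real i / (rS n), real k * (T / (rS n)))) < e"
 proof (intro exI[of _ n2] allI impI)
  fix n i k assume n: "n \<ge> n2" and i: "i < Suc n" and k: "1 <= k" "k <= Suc n"
  let ?x = "real i / (rS n)" and ?a = "real (k - 1) * (T / (rS n))" and ?b = "real k * (T / (rS n))"
  have "?b - ?a = (real k - real (k - 1)) * (T / (rS n))" by (simp only: left_diff_distrib)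
  also have "real k - real (k - 1) = 1" using k by simp
  finally have ba: "?b - ?a = T / (rS n)" by simp
  moreover have "0 < T / (rS n)" using T by simp
  ultimately have ab: "?a < ?b" by linarith
  have "k - 1 <= Suc n" using k by simp
  then have in0T: "{?a..?b} \<subseteq> {0..T}" and x: "?x \<in> {0..1}"
  using grid_in_CB[of i "Suc n" k T] grid_in_CB[of i "Suc n" "k - 1" T] i k T by auto
  have "norm ((1 / (?b - ?a)) *R (ph (?x, ?b) - ph (?x, ?a)) - pht (?x, ?b)) <= e / 2"
  proof (rule vector_mean_value_bound[OF ab])
  fix t assume t: "t \<in> {?a..?b}"
  show "((%s. ph (?x, s)) has_vector_derivative pht (?x, t)) (at t within {?a..?b})"
  using d[of ?x t] t in0T x by (meson has_vector_derivative_within_subset subsetD)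
  have "dist (?x, t) (?x, ?b) <= \<bar>?x - ?x\<bar> + \<bar>t - ?b\<bar>" by (rule dist_Pair_le)
  also have "... <= ?b - ?a" using t by simp
  also have "... < dd" unfolding ba using n by (rule n2)
  finally have ds: "dist (?x, t) (?x, ?b) < dd" .
  have "?b \<in> {?a..?b}" using ab by (intro atLeastAtMost_iff[THEN iffD2] conjI order_refl less_imp_le)
  then have "(?x, ?b) \<in> CB T" "(?x, t) \<in> CB T" using t in0T x by (blast intro: SigmaI)+
  then show "norm (pht (?x, t) - pht (?x, ?b)) <= e / 2"
  unfolding dist_norm[symmetric] by (intro less_imp_le dd(2) ds)
  qed
  then show "norm (((rS n) / T) *R (smp T ph n k i - smp T ph n (k - 1) i) - pht (?x, ?b)) < e"
  unfolding ba smp_def using e by simp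
 qed
qed

lemma integral_tcells:
 fixes k :: "real => real"
 assumes T: "T > 0" and N: "0 < N" and ik: "integrable (tint T) k"
 shows "(LINT r|tint T. k r * b (ix N (r / T))) = (SUM l<N. (LINT r|tint T. ind (tcell N T l) r * k r) * b l)"
  "integrable (tint T) (%r. k r * b (ix N (r / T)))"
proof -
 have [measurable]: "k \<in> bms (tint T)" "ind (tcell N T l) \<in> bms (tint T)" for l
  using ik by (auto intro: borel_imp_lbo)
 have i: "integrable (tint T) (%r. ind (tcell N T l) r * k r)" for l
 proof (rule Bitg_bound[OF ik])
  show "AE r in tint T. norm (ind (tcell N T l) r * k r) <= norm (k r)" by (intro AE_I2) (auto simp: indicator_def)
 qed measurable
 have eq: "k r * b (ix N (r / T)) = (SUM l<N. (ind (tcell N T l) r * k r) * b l)" if "r \<in> space (tint T)" for r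
 proof -
  have "ix N (r / T) < N" using that T N by (intro ix_less) auto
  then have "(SUM l<N. (ind (tcell N T l) r * k r) * b l) = (\<Sum>l\<in>{ix N (r / T)}. (ind (tcell N T l) r * k r) * b l)"
  by (intro sum.mono_neutral_right) (auto simp: tcell_def)
  then show ?thesis by (simp add: tcell_def)
 qed
 show "integrable (tint T) (%r. k r * b (ix N (r / T)))"
  by (subst Bitg_cong[OF refl eq]) (auto intro!: Bochner_Integration.integrable_sum integrable_mult_left i)
 have "(LINT r|tint T. k r * b (ix N (r / T))) = (LINT r|tint T. (SUM l<N. (ind (tcell N T l) r * k r) * b l))"
  by (rule Bint_cong[OF refl eq])
 also have "... = (SUM l<N. LINT r|tint T. (ind (tcell N T l) r * k r) * b l)"
  by (rule Bint_sum) (intro integrable_mult_left i)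
 also have "... = (SUM l<N. (LINT r|tint T. ind (tcell N T l) r * k r) * b l)"
  by (intro sum.cong refl integral_mult_left_zero)
 finally show "(LINT r|tint T. k r * b (ix N (r / T))) = (SUM l<N. (LINT r|tint T. ind (tcell N T l) r * k r) * b l)" .
qed

text \<open>Both sides extend the test function by zero beyond time T. Because \<open>ph\<close>
  vanishes at T this extension is continuous there, so rounding s and r to the grid changes it
  uniformly little even where s + r crosses T. The kernel itself is not discretised; only its L1
  norm enters the error.\<close>

lemma kernel_uniform:
 fixes k :: "real => real" and ph :: "real*real => real"
 assumes D: "gconv T D ph" and c: "continuous_on (CB T) ph" and T: "T > 0" and z: "!!x. x \<in> {0..1} ==> ph (x, T) = 0"
  and ik: "integrable (tint T) k" and mk[measurable]: "k \<in> bms borel"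
 shows "uniform_limit (Cyl T)
  (%n. stp (Suc n) T (%j i. LINT r|tint T. k r * (if j + ix (Suc n) (r / T) <= Suc n then D n (j + ix (Suc n) (r / T)) i else 0)))
  (%p. LINT r|tint T. k r * (ind (Cyl T) (fst p, snd p + r) * ph (fst p, snd p + r))) sequentially"
 unfolding uniform_limit_sequentially_iff
proof (intro allI impI)
 fix e :: real assume e: "e > 0"
 define K where "K = (LINT r|tint T. \<bar>k r\<bar>) + 1"
 have K: "K > 0" unfolding K_def by (smt (verit) integral_nonneg_AE AE_I2 abs_ge_zero)
 define e' where "e' = e / (4 * K)"
 have e': "e' > 0" using e K by (simp add: e'_def)
 \<comment> \<open>Freezing the time at T is the same as extension by zero, since \<open>ph\<close>
   is zero at T, and it keeps continuity. Times up to 3 T cover every sum of a rounded s and a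
   rounded r.\<close>
 define ps where "ps p = ph (fst p, min (snd p) T)" for p
 have cps: "continuous_on ({0..1} \<times> {0..3 * T}) ps"
  unfolding ps_def
 proof (rule continuous_on_compose2[OF c])
  show "continuous_on ({0..1} \<times> {0..3 * T}) (%p. (fst p, min (snd p) T))" by (intro continuous_intros)
 qed (use T in auto)
 have "uniformly_continuous_on ({0..1} \<times> {0..3 * T}) ps"
  by (rule compact_uniformly_continuous[OF cps]) (intro compact_Times, auto)
 then obtain d where d: "d > 0" "!!p q. p \<in> {0..1} \<times> {0..3 * T} ==> q \<in> {0..1} \<times> {0..3 * T} ==> dist q p < d ==> dist (ps q) (ps p) < e'"
  unfolding uniformly_continuous_on_def using e' by meson
 obtain n1 where n1: "!!n i k. n \<ge> n1 ==> i < Suc n ==> 1 <= k ==> k <= Suc n ==> norm (D n k i - ph (real i / (rS n), real k * (T / (rS n)))) < e'"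
  using D e' unfolding gconv_def by meson
 \<comment> \<open>Rounding costs 1/N in space and, in time, T/N each for s, for r and for the right
   end convention.\<close>
 obtain n2 where n2: "!!n. n \<ge> n2 ==> (1 + 3 * T) / (rS n) < d"
  using tendsto_over_Suc[OF d(1), of "1 + 3 * T"] by (auto simp: eventually_sequentially)
 show "\<exists>N. \<forall>n\<ge>N. \<forall>p\<in>Cyl T. dist (stp (Suc n) T (%j i. LINT r|tint T. k r * (if j + ix (Suc n) (r / T) <= Suc n then D n (j + ix (Suc n) (r / T)) i else 0)) p)
  (LINT r|tint T. k r * (ind (Cyl T) (fst p, snd p + r) * ph (fst p, snd p + r))) < e"
 proof (intro exI[of _ "max n1 n2"] allI impI ballI)
  fix n p assume n: "max n1 n2 <= n" and p: "p \<in> Cyl T"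
  obtain x s where xs: "p = (x, s)" by (cases p)
  have x: "0 < x" "x < 1" "0 < s" "s < T" using p by (auto simp: xs Cyl_def Omega_def)
  define N where "N = Suc n"
  have N: "0 < N" by (simp add: N_def)
  define i where "i = ix N x"
  define j where "j = Suc (ix N (s / T))"
  have ij: "i < N" "j <= N" "1 <= j"
  using ix_less[of x N] ix_less[of "s / T" N] x T N by (auto simp: i_def j_def Suc_le_eq)
  let ?A = "%r. if j + ix N (r / T) <= N then D n (j + ix N (r / T)) i else 0"
  let ?B = "%r. ind (Cyl T) (x, s + r) * ph (x, s + r)"
  have close: "\<bar>?A r - ?B r\<bar> <= 2 * e'" if r: "r \<in> {0<..<T}" for r
  proof -
  define l where "l = ix N (r / T)"
  have l: "l < N" using ix_less[of "r / T" N] r T N by (simp add: l_def)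
  let ?q = "(real i / real N, real (j + l) * (T / real N))"
  have B: "?B r = ps (x, s + r)"
  using x r z[of x] by (auto simp: ps_def indicator_def Cyl_def Omega_def min_def)
  have A: "\<bar>?A r - ps ?q\<bar> <= e'"
  proof (cases "j + l <= N")
  case True
  have "real (j + l) * (T / real N) <= T" using grid_in_CB[of i N "j + l" T] True ij N T by auto
  then have e2: "ps ?q = ph ?q" by (simp add: ps_def)
  have e1: "?A r = D n (j + l) i" using True by (simp add: l_def)
  have "norm (D n (j + l) i - ph ?q) < e'"
  unfolding N_def by (rule n1) (use n ij True in \<open>auto simp: N_def\<close>)
  then show ?thesis unfolding e1 e2 by simp
  next
  case False
  then have "real N * (T / real N) <= real (j + l) * (T / real N)" using T by (intro mult_right_mono) auto
  then have "T <= real (j + l) * (T / real N)" using N by simp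
  then have "ps ?q = ph (real i / real N, T)" by (simp add: ps_def min_def)
  also have "... = 0" using ij N by (intro z) auto
  finally have "ps ?q = 0" .
  moreover have "?A r = 0" using False by (simp add: l_def)
  ultimately show ?thesis using e' by simp
  qed
  have "dist (ps ?q) (ps (x, s + r)) < e'"
  proof (rule d(2))
  show "(x, s + r) \<in> {0..1} \<times> {0..3 * T}" using x r by auto
  have "real (j + l) * (T / real N) <= real (3 * N) * (T / real N)" using T ij l by (intro mult_right_mono) auto
  also have "... = 3 * T" using N by simp
  finally show "?q \<in> {0..1} \<times> {0..3 * T}" using ij N T by auto
  have "dist ?q (x, s + r) <= \<bar>real i / real N - x\<bar> + \<bar>real (j + l) * (T / real N) - (s + r)\<bar>" by (rule dist_Pair_le)
  also have "real (j + l) * (T / real N) - (s + r) = (real (ix N (s / T)) * (T / real N) - s) + ((real l * (T / real N) - r) + T / real N)"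
  by (simp add: j_def algebra_simps add_divide_distrib)
  also have "\<bar>real i / real N - x\<bar> + \<bar>...\<bar> <= 1 / real N + (T / real N + (T / real N + T / real N))"
  unfolding i_def l_def using x r T N
  by (intro add_mono order_trans[OF abs_triangle_ineq] ix_div_dist ix_time_dist) auto
  also have "... = (1 + 3 * T) / real N" by (simp add: add_divide_distrib)
  also have "... < d" unfolding N_def using n by (intro n2) simp
  finally show "dist ?q (x, s + r) < d" .
  qed
  then show ?thesis using A unfolding B dist_real_def by linarith
  qed
  have iA: "integrable (tint T) (%r. k r * ?A r)"
  by (rule integral_tcells(2)[OF T N ik, of "%l. if j + l <= N then D n (j + l) i else 0"])
  have mB: "?B \<in> bms (tint T)"
  proof -
  have cB: "continuous_on {0..T - s} (%r. ph (x, s + r))"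
  proof (rule continuous_on_compose2[OF c])
  show "continuous_on {0..T - s} (%r. (x, s + r))" by (intro continuous_intros)
  qed (use x in auto)
  have "(%r. ind {0..T - s} r *R ph (x, s + r)) \<in> bms borel"
  by (rule borel_measurable_continuous_on_indicator[OF _ cB]) simp
  then have "(%r. ind {0..T - s} r *R ph (x, s + r)) \<in> bms (tint T)" by (rule borel_imp_lbo)
  moreover have "?B r = ind {0..T - s} r *R ph (x, s + r)" if "r \<in> space (tint T)" for r
  proof (cases "s + r = T")
  case True
  then show ?thesis using x z[of x] by (simp add: indicator_def Cyl_def)
  next
  case False
  then show ?thesis using that x by (auto simp: indicator_def Cyl_def Omega_def)
  qed
  ultimately show ?thesis by (subst measurable_cong) auto
  qed
  obtain M where M: "!!q. q \<in> CB T ==> norm (ph q) <= M"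
  using compact_imp_bounded[OF compact_continuous_image[OF c compact_CB]] by (auto simp: bounded_iff)
  have "norm (ph (0, 0)) <= M" by (rule M) (use T in auto)
  then have M0: "0 <= M" using norm_ge_zero order_trans by blast
  have bB: "\<bar>?B r\<bar> <= M" if "r \<in> {0<..<T}" for r
  using M[of "(x, s + r)"] x that M0 by (auto simp: indicator_def Cyl_def Omega_def)
  have [measurable]: "k \<in> bms (tint T)" by (rule borel_imp_lbo) simp
  have iB: "integrable (tint T) (%r. k r * ?B r)"
  proof (rule Bitg_bound[OF integrable_mult_right[OF ik, of M]])
  show "(%r. k r * ?B r) \<in> bms (tint T)" using mB by measurable
  show "AE r in tint T. norm (k r * ?B r) <= norm (M * k r)"
  proof (rule AE_I2)
  fix r assume "r \<in> space (tint T)"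
  then have "\<bar>?B r\<bar> * \<bar>k r\<bar> <= M * \<bar>k r\<bar>" by (intro mult_right_mono bB) auto
  then show "norm (k r * ?B r) <= norm (M * k r)" using M0 by (simp add: abs_mult mult.commute)
  qed
  qed
  have "norm ((LINT r|tint T. k r * ?A r) - (LINT r|tint T. k r * ?B r)) = norm (LINT r|tint T. k r * ?A r - k r * ?B r)"
  using Bint_diff[OF iA iB] by simp
  also have "... <= (LINT r|tint T. \<bar>k r\<bar> * (2 * e'))"
  proof (rule norm_integral_le)
  show "integrable (tint T) (%r. k r * ?A r - k r * ?B r)" using iA iB by (rule Bochner_Integration.integrable_diff)
  show "integrable (tint T) (%r. \<bar>k r\<bar> * (2 * e'))" using ik by auto
  fix r assume "r \<in> space (tint T)"
  then have "\<bar>k r\<bar> * \<bar>?A r - ?B r\<bar> <= \<bar>k r\<bar> * (2 * e')" by (intro mult_left_mono close) auto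
  then show "norm (k r * ?A r - k r * ?B r) <= \<bar>k r\<bar> * (2 * e')" by (simp only: real_norm_def abs_mult flip: right_diff_distrib)
  qed
  also have "... = (LINT r|tint T. \<bar>k r\<bar>) * (2 * e')" by simp
  also have "... <= K * (2 * e')" using e' by (intro mult_right_mono) (auto simp: K_def)
  also have "... < e" using e K by (simp add: e'_def)
  finally have fin: "norm ((LINT r|tint T. k r * ?A r) - (LINT r|tint T. k r * ?B r)) < e" .
  then show "dist (stp (Suc n) T (%j i. LINT r|tint T. k r * (if j + ix (Suc n) (r / T) <= Suc n then D n (j + ix (Suc n) (r / T)) i else 0)) p)
  (LINT r|tint T. k r * (ind (Cyl T) (fst p, snd p + r) * ph (fst p, snd p + r))) < e"
  unfolding dist_norm stp_def xs fst_conv snd_conv N_def[symmetric] i_def[symmetric] j_def[symmetric] .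
 qed
qed

section \<open>The relaxation function and its cell means\<close>

text \<open>The regularity assumption concerns bounded intervals; t lies in {0<..<t + 1}, where
  \<open>dir_deriv 1 G\<close> coincides with \<open>deriv G\<close>, and that local equality
  identifies the second derivatives.\<close>

lemma relaxation_deriv:
 assumes G: "relaxation_function G" and t: "t > 0"
 shows "(G has_real_derivative deriv G t) (at t)" "(deriv G has_real_derivative deriv (deriv G) t) (at t)"
proof -
 have "0 < t + 1" using t by simp
 then have "Ck 2 {0<..<t + 1} G" using G unfolding relaxation_function_def by blast
 then have "Ck (Suc (Suc 0)) {0<..<t + 1} G" by (simp only: numeral_2_eq_2)
 then have d: "!!p. p \<in> {0<..<t + 1} ==> G differentiable (at p)" "!!p. p \<in> {0<..<t + 1} ==> dir_deriv 1 G differentiable (at p)"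
  by auto
 have D: "(G has_real_derivative deriv G p) (at p)" if "p \<in> {0<..<t + 1}" for p
  using d(1)[OF that] DERIV_imp_deriv real_differentiable_def by metis
 then show "(G has_real_derivative deriv G t) (at t)" using t by simp
 obtain D2 where D2: "(dir_deriv 1 G has_real_derivative D2) (at t)" using d(2)[of t] t real_differentiable_def by auto
 have "(deriv G has_real_derivative D2) (at t)"
  by (rule has_field_derivative_transform_within_open[OF D2, of "{0<..<t + 1}"]) (use t dir_deriv_real[OF D] in auto)
 then show "(deriv G has_real_derivative deriv (deriv G) t) (at t)" using DERIV_imp_deriv by metis
qed

lemma relaxation_decreasing:
 assumes G: "relaxation_function G" and "0 < a" "a <= b"
 shows "G b <= G a"
proof (rule DERIV_nonpos_imp_nonincreasing[OF assms(3)])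
 fix x assume "a <= x" "x <= b"
 then show "\<exists>y. (G has_real_derivative y) (at x) & y <= 0"
  using relaxation_deriv(1)[OF G, of x] G assms(2) by (intro exI[of _ "deriv G x"]) (auto simp: relaxation_function_def)
qed

text \<open>The mean value theorem on two adjacent intervals, together with monotonicity of
  \<open>deriv G\<close>.\<close>

lemma relaxation_convex:
 assumes G: "relaxation_function G" and "0 < r" "0 < h"
 shows "G (r + h) - G (r + 2 * h) <= G r - G (r + h)"
proof -
 have mono: "deriv G a <= deriv G b" if "0 < a" "a <= b" for a b
 proof (rule DERIV_nonneg_imp_nondecreasing[OF that(2)])
  fix x assume "a <= x" "x <= b"
  then show "\<exists>y. (deriv G has_real_derivative y) (at x) & 0 <= y"
  using relaxation_deriv(2)[OF G, of x] G that(1) by (intro exI[of _ "deriv (deriv G) x"]) (auto simp: relaxation_function_def)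
 qed
 obtain z1 where z1: "r < z1" "z1 < r + h" "G (r + h) - G r = (r + h - r) * deriv G z1"
  using MVT2[of r "r + h" G "deriv G"] relaxation_deriv(1)[OF G] assms by force
 obtain z2 where z2: "r + h < z2" "z2 < r + 2 * h" "G (r + 2 * h) - G (r + h) = (r + 2 * h - (r + h)) * deriv G z2"
  using MVT2[of "r + h" "r + 2 * h" G "deriv G"] relaxation_deriv(1)[OF G] assms by force
 have "h * deriv G z1 <= h * deriv G z2" using z1 z2 assms by (intro mult_left_mono mono) auto
 then show ?thesis using z1(3) z2(3) by simp
qed

lemma relaxation_borel:
 assumes G: "relaxation_function G"
 shows "(%r. ind {0<..} r *R G r) \<in> bms borel"
proof (rule borel_measurable_continuous_on_indicator)
 show "continuous_on {0<..} G"
  using relaxation_deriv(1)[OF G] by (intro continuous_at_imp_continuous_on) (auto intro: DERIV_isCont)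
qed simp

text \<open>\<open>G\<close> is unconstrained on nonpositive arguments; cutting it there makes it
  Borel on the whole line.\<close>

definition Gz :: "(real => real) => real => real" where
 "Gz G r = ind {0<..} r *R G r"

lemma Gz_pos: "r > 0 ==> Gz G r = G r" by (simp add: Gz_def)

lemma Gz_integrable:
 assumes G: "relaxation_function G" and T: "T > 0"
 shows "integrable (tint T) (Gz G)"
proof -
 have m: "Gz G \<in> bms borel" using relaxation_borel[OF G] by (simp add: Gz_def[abs_def])
 have "integrable (lebesgue_on {0<..<T}) G" using G T by (simp add: relaxation_function_def)
 then have "integrable (lebesgue_on {0<..<T}) (Gz G)"
  by (rule Bitg_cong[THEN iffD1, rotated 2]) (auto simp: Gz_pos)
 then show ?thesis using borel_imp_lbo[OF m] by (simp add: integrable_lebesgue_on)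
qed

text \<open>The mean of the kernel over one lag cell. Over the first cell it is finite by
  integrability even if \<open>G\<close> is unbounded at zero, so it can stand for G(0) in the
  implicit step.\<close>

definition Gavg :: "(real => real) => real => nat => real" where
 "Gavg G tau l = (LINT r|tint tau. Gz G (real l * tau + r)) / tau"

lemma Gz_shift_integrable:
 assumes G: "relaxation_function G" and tau: "tau > 0"
 shows "integrable (tint tau) (%r. Gz G (real l * tau + r))"
proof -
 have m: "Gz G \<in> bms borel" using relaxation_borel[OF G] by (simp add: Gz_def[abs_def])
 define S where "S = real (Suc l) * tau"
 have "S > 0" using tau by (simp add: S_def)
 then have "integrable lborel (%r. ind {0<..<S} r *R Gz G r)"
  using Gz_integrable[OF G] by (subst (asm) integrable_lbo) auto
 then have "integrable lborel (%r. ind {0<..<S} (real l * tau + 1 * r) *R Gz G (real l * tau + 1 * r))"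
  by (rule lborel_integrable_real_affine) simp
 then have "integrable lborel (%r. ind {0<..<tau} r *R (ind {0<..<S} (real l * tau + 1 * r) *R Gz G (real l * tau + 1 * r)))"
  by (rule integrable_mult_indicator[rotated]) simp
 moreover have "(%r. ind {0<..<tau} r *R (ind {0<..<S} (real l * tau + 1 * r) *R Gz G (real l * tau + 1 * r)))
  = (%r. ind {0<..<tau} r *R Gz G (real l * tau + r))"
 proof
  fix r
  show "ind {0<..<tau} r *R (ind {0<..<S} (real l * tau + 1 * r) *R Gz G (real l * tau + 1 * r)) = ind {0<..<tau} r *R Gz G (real l * tau + r)"
  proof (cases "r \<in> {0<..<tau}")
  case True
  moreover have "0 <= real l * tau" using tau by simp
  ultimately have "real l * tau + r \<in> {0<..<S}" by (auto simp: S_def algebra_simps add_pos_nonneg)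
  then show ?thesis by simp
  qed simp
 qed
 ultimately show ?thesis by (subst integrable_lbo) simp_all
qed

text \<open>Each inequality holds pointwise under the integral, after shifts by \<open>tau\<close>.
  For the last one the whole lag cell lies to the left of \<open>S\<close>, where \<open>G\<close>
  is at least \<open>G S\<close>.\<close>

lemma Gavg_props:
 assumes G: "relaxation_function G" and tau: "tau > 0"
 shows "0 <= Gavg G tau l" "Gavg G tau (Suc l) <= Gavg G tau l"
  "Gavg G tau (Suc l) - Gavg G tau (Suc (Suc l)) <= Gavg G tau l - Gavg G tau (Suc l)"
  "real (Suc l) * tau <= S ==> G S <= Gavg G tau l"
proof -
 let ?g = "%l r. Gz G (real l * tau + r)"
 have i: "integrable (tint tau) (?g l)" for l by (rule Gz_shift_integrable[OF G tau])
 have pos: "0 < real l * tau + r" if "r \<in> {0<..<tau}" for l r using that tau by (auto intro: add_nonneg_pos)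
 have g: "?g l r = G (real l * tau + r)" if "r \<in> {0<..<tau}" for l r using pos[OF that] by (simp add: Gz_pos)
 have "0 <= (LINT r|tint tau. ?g l r)"
  by (rule integral_nonneg_AE, rule AE_I2) (use g pos G in \<open>auto simp: relaxation_function_def less_imp_le\<close>)
 then show "0 <= Gavg G tau l" using tau by (simp add: Gavg_def)
 have "(LINT r|tint tau. ?g (Suc l) r) <= (LINT r|tint tau. ?g l r)"
 proof (rule integral_mono[OF i i])
  fix r assume "r \<in> space (tint tau)"
  then have r: "r \<in> {0<..<tau}" by simp
  have "G (real (Suc l) * tau + r) <= G (real l * tau + r)"
  using tau by (intro relaxation_decreasing[OF G pos[OF r]]) (simp add: algebra_simps)
  then show "?g (Suc l) r <= ?g l r" by (simp only: g[OF r])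
 qed
 then show "Gavg G tau (Suc l) <= Gavg G tau l" using tau unfolding Gavg_def by (intro divide_right_mono) auto
 have "(LINT r|tint tau. ?g (Suc l) r) - (LINT r|tint tau. ?g (Suc (Suc l)) r) <= (LINT r|tint tau. ?g l r) - (LINT r|tint tau. ?g (Suc l) r)"
  unfolding Bint_diff[OF i i, symmetric]
 proof (rule integral_mono[OF Bochner_Integration.integrable_diff[OF i i] Bochner_Integration.integrable_diff[OF i i]])
  fix r assume "r \<in> space (tint tau)"
  then have r: "r \<in> {0<..<tau}" by simp
  have e: "real (Suc l) * tau + r = (real l * tau + r) + tau" "real (Suc (Suc l)) * tau + r = (real l * tau + r) + 2 * tau"
  by (auto simp: algebra_simps)
  show "?g (Suc l) r - ?g (Suc (Suc l)) r <= ?g l r - ?g (Suc l) r"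
  unfolding g[OF r] unfolding e by (rule relaxation_convex[OF G pos[OF r] tau])
 qed
 then show "Gavg G tau (Suc l) - Gavg G tau (Suc (Suc l)) <= Gavg G tau l - Gavg G tau (Suc l)"
  using tau unfolding Gavg_def diff_divide_distrib[symmetric] by (intro divide_right_mono) auto
 assume S: "real (Suc l) * tau <= S"
 interpret I: finite_measure "tint tau" by (rule finite_measure_lbo_Ioo)
 have "(LINT r|tint tau. G S) <= (LINT r|tint tau. ?g l r)"
 proof (rule integral_mono[OF _ i])
  fix r assume "r \<in> space (tint tau)"
  then have r: "r \<in> {0<..<tau}" by simp
  have "real l * tau + r <= S" using S r by (simp add: algebra_simps)
  then show "G S <= ?g l r" unfolding g[OF r] by (rule relaxation_decreasing[OF G pos[OF r]])
 qed simp
 moreover have "(LINT r|tint tau. G S) = tau * G S"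
  using tau by (simp add: measure_def measure_lbo)
 ultimately have "tau * G S <= (LINT r|tint tau. ?g l r)" by (simp only:)
 then show "G S <= Gavg G tau l" using tau by (simp add: Gavg_def pos_le_divide_eq mult.commute)
qed

text \<open>Identifies the weights of the discrete convolution with exact kernel integrals over time
  cells, as \<open>convolution_integral\<close> requires.\<close>

lemma Gavg_tcell:
 assumes G: "relaxation_function G" and T: "T > 0" and l: "l < N"
 shows "(LINT r|tint T. ind (tcell N T l) r * Gz G r) = T / real N * Gavg G (T / real N) l"
proof -
 have N: "0 < N" using l by simp
 define tau where "tau = T / real N"
 have tau: "tau > 0" "real N * tau = T" using T N by (auto simp: tau_def)
 have m: "Gz G \<in> bms borel" using relaxation_borel[OF G] by (simp add: Gz_def[abs_def])
 note m[measurable]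
 define F where "F s = ind {0<..<tau} (s - real l * tau) *R Gz G s" for s
 have "(LINT r|tint T. ind (tcell N T l) r * Gz G r) = (\<integral>r. ind {0<..<T} r *R (ind (tcell N T l) r * Gz G r) \<partial>lborel)"
  by (rule integral_lbo) simp
 also have "... = (\<integral>r. F r \<partial>lborel)"
 proof (rule integral_cong_AE)
  have "AE r in lborel. r ~= real l * tau" using AE_lborel_singleton by auto
  then show "AE r in lborel. ind {0<..<T} r *R (ind (tcell N T l) r * Gz G r) = F r"
  proof eventually_elim
  case (elim r)
  have top: "real (Suc l) * tau <= T"
  unfolding tau(2)[symmetric] using l tau(1) by (intro mult_right_mono) auto
  show ?case
  proof (cases "0 < r")
  case True
  have "r \<in> tcell N T l \<longleftrightarrow> real l * tau <= r & r < real (Suc l) * tau"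
  using True T N unfolding tcell_def ix_def tau_def by (auto simp: nat_eq_iff floor_eq_iff field_simps)
  then have "r \<in> {0<..<T} & r \<in> tcell N T l \<longleftrightarrow> r - real l * tau \<in> {0<..<tau}"
  using elim True top by (auto simp: algebra_simps)
  then show ?thesis by (auto simp: F_def indicator_def)
  qed (simp add: F_def Gz_def)
  qed
 qed (auto simp: F_def)
 also have "... = (\<integral>r. F (real l * tau + 1 * r) \<partial>lborel)"
  using lborel_integral_real_affine[of 1 F "real l * tau"] by simp
 also have "... = (LINT r|tint tau. Gz G (real l * tau + r))"
  by (subst integral_lbo) (auto simp: F_def)
 also have "... = tau * Gavg G tau l" using tau by (simp add: Gavg_def)
 finally show ?thesis by (simp add: tau_def)
qed

section \<open>Uniform bounds for the discrete solutions\<close>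

lemma norm_sq_le_double_well: "(norm x)^2 <= ((norm x)^2 - 1)^2 + 2"
proof -
 have "0 <= ((norm x)^2 - 3 / 2)^2 + 3 / 4" by simp
 then show ?thesis by (simp add: power2_eq_square algebra_simps)
qed

text \<open>The energy bound on every grid with \<open>Suc n\<close> cells, an offset that excludes
  the empty grid. The data are replaced by cell averages, and one constant \<open>K\<close>, a sum
  of the separate constants, dominates all bounds.\<close>

lemma discrete_solutions:
 fixes u1 :: "real => real" and f :: "real*real => real" and w0 g0 w g :: "real => real ^ 2"
 assumes T: "T > 0" and G: "relaxation_function G" and dl: "dl > 0" "dl * (4 * lam^2) <= G (2 * T)"
  and u1: "sq_int lO u1" and f: "sq_int (lC T) f"
  and wd: "has_weak_deriv Omega 1 w0 g0" and w: "integrable lO w" "AE x in lebesgue_on Omega. w0 x = w x"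
  and g: "sq_int lO g" "AE x in lebesgue_on Omega. g0 x = g x"
  and w1: "AE x in lO. norm (w x) <= 1"
 shows "\<exists>K u m. K > 0 & (\<forall>n. scheme (Suc n) (T / (rS n)) lam dl (Gavg G (T / (rS n)))
  (%i. (rS n) * (LINT x|lO. ind (cell (Suc n) i) x * u1 x))
  (%k i. (rS n)^2 / T * (LINT p|lC T. ind (cell2 (Suc n) T (k - 1) i) p * f p))
  (%i. (rS n) *R (LINT x|lO. ind (cell (Suc n) i) x *R w x)) (u n) (m n)
  & (\<forall>k<Suc n. (SUM i<Suc n. (((rS n) / T) * (u n (Suc k) i - u n k i))^2) <= (rS n) * K)
  & (\<forall>k\<le>Suc n. (SUM i<Suc n. (dx (Suc n) (u n k) i)^2) <= (rS n) * K)
  & (\<forall>k\<le>Suc n. (SUM i<Suc n. (norm (m n k i))^2) <= (rS n) * K)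
  & (\<forall>k\<le>Suc n. (SUM i<Suc n. (norm (dxm (Suc n) (m n k) i))^2) <= (rS n) * K)
  & (SUM k<Suc n. SUM i<Suc n. (norm (m n (Suc k) i - m n k i))^2) <= T / (rS n) * ((rS n) * K))"
proof -
 define U1 where "U1 n i = (rS n) * (LINT x|lO. ind (cell (Suc n) i) x * u1 x)" for n i
 define F where "F n k i = (rS n)^2 / T * (LINT p|lC T. ind (cell2 (Suc n) T (k - 1) i) p * f p)" for n k i
 define M0 where "M0 n i = (rS n) *R (LINT x|lO. ind (cell (Suc n) i) x *R w x)" for n i
 define K0 where "K0 = nsq lO u1 + 4 * nsq lO g + 1 / dl + 2 * T * nsq (lC T) f"
 define gm where "gm = G (2 * T)"
 have gm: "gm > 0" using G T by (simp add: gm_def relaxation_function_def)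
 have K0: "K0 > 0" unfolding K0_def using nsq_nonneg[of "lO" u1] nsq_nonneg[of "lO" g] nsq_nonneg[of "lC T" f] dl T
  by (smt (verit) divide_pos_pos mult_nonneg_nonneg)
 have tau: "T / (rS n) > 0" for n using T by simp
 have "\<exists>u m. scheme (Suc n) (T / (rS n)) lam dl (Gavg G (T / (rS n))) (U1 n) (F n) (M0 n) u m" for n
 proof (rule scheme_exists[OF tau dl(1)])
  have "real (Suc 0) * (T / (rS n)) <= 2 * T" using T by (simp add: pos_divide_le_eq)
  then have "gm <= Gavg G (T / (rS n)) 0" unfolding gm_def by (rule Gavg_props(4)[OF G tau])
  then show "Gavg G (T / (rS n)) 0 > 0" using gm by linarith
 qed
 then obtain u m where sch: "!!n. scheme (Suc n) (T / (rS n)) lam dl (Gavg G (T / (rS n))) (U1 n) (F n) (M0 n) (u n) (m n)" by metis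
 define K where "K = 2 * K0 + 4 * K0 / gm + 8 * dl * K0 + 2"
 have Kge: "2 * K0 <= K" "4 * K0 / gm <= K" "8 * dl * K0 + 2 <= K" "K > 0"
 proof -
  have "0 <= 4 * K0 / gm" "0 <= 8 * dl * K0" using K0 gm dl by auto
  then show "2 * K0 <= K" "4 * K0 / gm <= K" "8 * dl * K0 + 2 <= K" "K > 0" using K0 unfolding K_def by linarith+
 qed
 have b: "(\<forall>k<Suc n. (SUM i<Suc n. (((rS n) / T) * (u n (Suc k) i - u n k i))^2) <= (rS n) * K)
  & (\<forall>k\<le>Suc n. (SUM i<Suc n. (dx (Suc n) (u n k) i)^2) <= (rS n) * K)
  & (\<forall>k\<le>Suc n. (SUM i<Suc n. (norm (m n k i))^2) <= (rS n) * K)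
  & (\<forall>k\<le>Suc n. (SUM i<Suc n. (norm (dxm (Suc n) (m n k) i))^2) <= (rS n) * K)
  & (SUM k<Suc n. SUM i<Suc n. (norm (m n (Suc k) i - m n k i))^2) <= T / (rS n) * ((rS n) * K)" for n
 proof -
  let ?N = "Suc n" and ?tau = "T / (rS n)"
  have NT: "real ?N * ?tau = T" by simp
  have N: "0 < ?N" by simp
  \<comment> \<open>Level \<open>N\<close> involves the kernel mean over lags from T to T + T/N, so
    lags up to 2 T occur on the coarsest grid.\<close>
  have low: "gm <= Gavg G ?tau k" if "k <= ?N" for k
  proof -
  have "real (Suc k) * ?tau <= (2 * real ?N) * ?tau" using that T by (intro mult_right_mono) auto
  also have "... = 2 * T" by (simp del: of_nat_Suc)
  finally show ?thesis unfolding gm_def by (rule Gavg_props(4)[OF G tau])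
  qed
  have bU1: "(SUM i<?N. (U1 n i)^2) <= real ?N * nsq lO u1"
  using cell_average_sq[OF N u1] by (simp add: U1_def del: of_nat_Suc sum.lessThan_Suc)
  have bF: "?tau * (\<Sum>k=1..?N. SUM i<?N. (F n k i)^2) <= real ?N * nsq (lC T) f"
  proof -
  have "(\<Sum>k=1..?N. SUM i<?N. (F n k i)^2) = (SUM k<?N. SUM i<?N. (F n (Suc k) i)^2)"
  by (rule sum.reindex_bij_witness[where i = Suc and j = "%k. k - 1"]) auto
  also have "... <= (real ?N)^2 / T * nsq (lC T) f"
  using cell2_average_sq[OF T N f] by (simp add: F_def del: of_nat_Suc sum.lessThan_Suc)
  finally have "?tau * (\<Sum>k=1..?N. SUM i<?N. (F n k i)^2) <= ?tau * ((real ?N)^2 / T * nsq (lC T) f)"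
  using tau by (intro mult_left_mono) (auto simp: less_imp_le simp del: of_nat_Suc)
  also have "... = real ?N * nsq (lC T) f" using T by (simp add: power2_eq_square del: of_nat_Suc)
  finally show ?thesis .
  qed
  \<comment> \<open>Averages of unit vectors may be shorter than one, so the discrete initial double
    well energy does not vanish; it is at most 1/(4 dl) per cell.\<close>
  have bM0: "norm (M0 n i) <= 1" if "i < ?N" for i
  proof -
  have [measurable]: "w \<in> bms lO" "ind (cell ?N i) \<in> bms lO"
  using w(1) by (auto intro: borel_imp_lbo)
  have "norm (LINT x|lO. ind (cell ?N i) x *R w x) <= (LINT x|lO. norm (ind (cell ?N i) x *R w x))"
  by (rule integral_norm_bound)
  also have "... <= (LINT x|lO. rind (cell ?N i) x)"
  proof (rule integral_mono_AE)
  show "integrable lO (%x. norm (ind (cell ?N i) x *R w x))"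
  by (rule integrable_norm[OF cell_mult_integrable[OF w(1)]])
  show "integrable lO (rind (cell ?N i))"
  by (rule Om.sq_int_integrable[OF Om.sq_int_bounded[where C = 1]]) (auto simp: indicator_def)
  show "AE x in lO. norm (ind (cell ?N i) x *R w x) <= rind (cell ?N i) x"
  using w1 by eventually_elim (auto simp: indicator_def)
  qed
  also have "... = 1 / real ?N" by (rule integral_cell[OF that])
  finally have "real ?N * norm (LINT x|lO. ind (cell ?N i) x *R w x) <= real ?N * (1 / real ?N)"
  by (rule mult_left_mono) simp
  then show ?thesis by (simp add: M0_def del: of_nat_Suc)
  qed
  have bdM0: "(SUM i<?N. (norm (dxm ?N (M0 n) i))^2) <= real ?N * (4 * nsq lO g)"
  using H1_cell_average_energy[OF wd w g N] by (simp only: M0_def[abs_def])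
  note E = scheme_energy_bound[OF sch tau N NT Gavg_props(1)[OF G tau] Gavg_props(2)[OF G tau] Gavg_props(3)[OF G tau]
  dl(1) _ gm low bU1 bF bM0 bdM0 K0_def]
  have dl2: "dl * (4 * lam^2) <= gm" using dl(2) by (simp add: gm_def)
  have E1: "(SUM i<?N. (vel ?tau (U1 n) (u n) k i)^2) <= real ?N * (2 * K0)"
  and E2: "(SUM i<?N. (dx ?N (u n k) i)^2) <= real ?N * (4 * K0 / gm)"
  and E3: "(SUM i<?N. ((norm (m n k i))^2 - 1)^2) <= real ?N * (8 * dl * K0)"
  and E4: "(SUM i<?N. (norm (dxm ?N (m n k) i))^2) <= real ?N * (2 * K0)" if "k <= ?N" for k
  using E(1-4)[OF dl2 _ _ that] by blast+
  have E5: "(SUM k<?N. SUM i<?N. (norm (m n (Suc k) i - m n k i))^2) <= ?tau * (real ?N * (2 * K0))"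
  using E(5)[OF dl2] by blast
  have up: "real ?N * c <= real ?N * K" if "c <= K" for c using that by (intro mult_left_mono) auto
  show ?thesis
  proof (intro conjI allI impI)
  show "(SUM i<?N. ((real ?N / T) * (u n (Suc k) i - u n k i))^2) <= real ?N * K" if "k < ?N" for k
  proof -
  have ve: "vel ?tau (U1 n) (u n) (Suc k) i = (real ?N / T) * (u n (Suc k) i - u n k i)" for i
  by (simp add: vel_def)
  have "(SUM i<?N. ((real ?N / T) * (u n (Suc k) i - u n k i))^2) <= real ?N * (2 * K0)"
  using E1[OF Suc_leI[OF that]] unfolding ve .
  then show ?thesis using up[OF Kge(1)] by (rule order_trans)
  qed
  show "(SUM i<?N. (dx ?N (u n k) i)^2) <= real ?N * K" if "k <= ?N" for k
  using E2[OF that] up[OF Kge(2)] by linarith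
  show "(SUM i<?N. (norm (dxm ?N (m n k) i))^2) <= real ?N * K" if "k <= ?N" for k
  using E4[OF that] up[OF Kge(1)] by linarith
  show "(SUM i<?N. (norm (m n k i))^2) <= real ?N * K" if "k <= ?N" for k
  proof -
  have "(SUM i<?N. (norm (m n k i))^2) <= (SUM i<?N. ((norm (m n k i))^2 - 1)^2 + 2)"
  by (rule sum_mono) (rule norm_sq_le_double_well)
  also have "... = (SUM i<?N. ((norm (m n k i))^2 - 1)^2) + real ?N * 2" by (simp add: sum.distrib del: sum.lessThan_Suc)
  also have "... <= real ?N * (8 * dl * K0) + real ?N * 2" using E3[OF that] by simp
  also have "... = real ?N * (8 * dl * K0 + 2)" by (simp only: distrib_left)
  also have "... <= real ?N * K" by (rule up[OF Kge(3)])
  finally show ?thesis .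
  qed
  have "?tau * (real ?N * (2 * K0)) <= ?tau * (real ?N * K)" using tau[of n] up[OF Kge(1)] by (intro mult_left_mono) auto
  then show "(SUM k<?N. SUM i<?N. (norm (m n (Suc k) i - m n k i))^2) <= ?tau * (real ?N * K)" using E5 by linarith
  qed
 qed
 show ?thesis
  using Kge(4) sch b unfolding U1_def[abs_def] F_def[abs_def] M0_def[abs_def] by blast
qed

section \<open>The discrete equations as integral identities\<close>

text \<open>Abel summation in time, with levels as in the discrete product rule: increments of
  \<open>w\<close> meet the new level of \<open>ps\<close>, increments of \<open>ps\<close> meet the
  old level of \<open>w\<close>.\<close>

lemma summation_by_parts_stp:
 fixes w ps :: "nat => nat => 'b::euclidean_space"
 assumes T: "T > 0" and N: "0 < N"
 shows "(LINT p|lC T. stp N T (%k i. (real N / T) *R (w k i - w (k - 1) i)) p <.> stp N T ps p)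
  + (LINT p|lC T. stp N T (%k i. w (k - 1) i) p <.> stp N T (%k i. (real N / T) *R (ps k i - ps (k - 1) i)) p)
  = 1 / real N * (SUM i<N. w N i <.> ps N i - w 0 i <.> ps 0 i)"
proof -
 have "(SUM k<N. SUM i<N. (w (Suc k) i - w k i) <.> ps (Suc k) i + w k i <.> (ps (Suc k) i - ps k i)) = (SUM k<N. SUM i<N. w (Suc k) i <.> ps (Suc k) i - w k i <.> ps k i)"
  by (intro sum.cong refl) (simp add: inner_diff_left inner_diff_right)
 also have "... = (SUM i<N. SUM k<N. w (Suc k) i <.> ps (Suc k) i - w k i <.> ps k i)" by (rule sum.swap)
 also have "... = (SUM i<N. w N i <.> ps N i - w 0 i <.> ps 0 i)"
  by (intro sum.cong refl sum_lessThan_telescope)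
 finally have tel: "(SUM k<N. SUM i<N. (w (Suc k) i - w k i) <.> ps (Suc k) i + w k i <.> (ps (Suc k) i - ps k i)) = (SUM i<N. w N i <.> ps N i - w 0 i <.> ps 0 i)" .
 have "T / (real N)^2 * (SUM k<N. SUM i<N. ((real N / T) *R (w (Suc k) i - w k i)) <.> ps (Suc k) i)
  + T / (real N)^2 * (SUM k<N. SUM i<N. w k i <.> ((real N / T) *R (ps (Suc k) i - ps k i)))
  = T / (real N)^2 * (real N / T * (SUM k<N. SUM i<N. (w (Suc k) i - w k i) <.> ps (Suc k) i + w k i <.> (ps (Suc k) i - ps k i)))"
  by (simp add: sum.distrib sum_distrib_left distrib_left)
 also have "... = 1 / real N * (SUM i<N. w N i <.> ps N i - w 0 i <.> ps 0 i)"
  unfolding tel using T N by (simp add: power2_eq_square)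
 finally show ?thesis unfolding integral_stp_stp[OF T N] by simp
qed

text \<open>Discrete transposition of a convolution, the counterpart of
  \<open>volterra_swap\<close>; the condition \<open>Suc j + l <= N\<close> extends \<open>D\<close>
  by zero beyond the final level.\<close>

lemma convolution_exchange:
 fixes A P D :: "nat => real"
 shows "(SUM k<N. (\<Sum>j\<le>k. A (k - j) * P (Suc j)) * D (Suc k)) = (SUM j<N. P (Suc j) * (SUM l<N. A l * (if Suc j + l <= N then D (Suc j + l) else 0)))"
proof -
 have "(SUM k<N. (\<Sum>j\<le>k. A (k - j) * P (Suc j)) * D (Suc k)) = (SUM k<N. SUM j<N. if j <= k then A (k - j) * P (Suc j) * D (Suc k) else 0)"
 proof (intro sum.cong refl)
  fix k assume "k \<in> {..<N}"
  then have "(SUM j<N. if j <= k then A (k - j) * P (Suc j) * D (Suc k) else 0) = (\<Sum>j\<le>k. A (k - j) * P (Suc j) * D (Suc k))"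
  by (intro sum.mono_neutral_cong_right) auto
  then show "(\<Sum>j\<le>k. A (k - j) * P (Suc j)) * D (Suc k) = (SUM j<N. if j <= k then A (k - j) * P (Suc j) * D (Suc k) else 0)"
  by (simp add: sum_distrib_right)
 qed
 also have "... = (SUM j<N. SUM k<N. if j <= k then A (k - j) * P (Suc j) * D (Suc k) else 0)" by (rule sum.swap)
 also have "... = (SUM j<N. P (Suc j) * (SUM l<N. A l * (if Suc j + l <= N then D (Suc j + l) else 0)))"
 proof (intro sum.cong refl)
  fix j assume j: "j \<in> {..<N}"
  have "(SUM k<N. if j <= k then A (k - j) * P (Suc j) * D (Suc k) else 0) = (\<Sum>k\<in>{j..<N}. A (k - j) * P (Suc j) * D (Suc k))"
  by (intro sum.mono_neutral_cong_right) auto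
  also have "... = (\<Sum>l\<in>{..<N - j}. A l * P (Suc j) * D (Suc j + l))"
  by (rule sum.reindex_bij_witness[where i = "%l. l + j" and j = "%k. k - j"]) (use j in auto)
  also have "... = (SUM l<N. A l * P (Suc j) * (if Suc j + l <= N then D (Suc j + l) else 0))"
  by (rule sum.mono_neutral_cong_left) (use j in auto)
  also have "... = P (Suc j) * (SUM l<N. A l * (if Suc j + l <= N then D (Suc j + l) else 0))"
  by (simp add: sum_distrib_left mult_ac)
  finally show "(SUM k<N. if j <= k then A (k - j) * P (Suc j) * D (Suc k) else 0) = P (Suc j) * (SUM l<N. A l * (if Suc j + l <= N then D (Suc j + l) else 0))" .
 qed
 finally show ?thesis .
qed

text \<open>The transposed Volterra operator on grid functions: the lag is rounded to the grid, the
  kernel is left as it is. With \<open>Gz G\<close> it reproduces the kernel means, with the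
  constant kernel 1 plain time integration.\<close>

definition kstp :: "nat => real => (real => real) => (nat => nat => real) => nat => nat => real" where
 "kstp N T kr D j i = (LINT r|tint T. kr r * (if j + ix N (r / T) <= N then D (j + ix N (r / T)) i else 0))"

lemma convolution_integral:
 fixes kr :: "real => real" and P D :: "nat => nat => real"
 assumes T: "T > 0" and N: "0 < N" and ik: "integrable (tint T) kr"
  and A: "!!l. l < N ==> (LINT r|tint T. ind (tcell N T l) r * kr r) = A l"
 shows "T / (real N)^2 * (SUM k<N. SUM i<N. (\<Sum>j\<le>k. A (k - j) * P (Suc j) i) * D (Suc k) i)
  = (LINT p|lC T. stp N T P p <.> stp N T (kstp N T kr D) p)"
proof -
 have k: "kstp N T kr D j i = (SUM l<N. A l * (if j + l <= N then D (j + l) i else 0))" for j i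
  unfolding kstp_def integral_tcells(1)[OF T N ik, of "%l. if j + l <= N then D (j + l) i else 0"]
  by (intro sum.cong refl) (simp add: A)
 have "(SUM k<N. SUM i<N. (\<Sum>j\<le>k. A (k - j) * P (Suc j) i) * D (Suc k) i) = (SUM i<N. SUM k<N. (\<Sum>j\<le>k. A (k - j) * P (Suc j) i) * D (Suc k) i)"
  by (rule sum.swap)
 also have "... = (SUM i<N. SUM j<N. P (Suc j) i * kstp N T kr D (Suc j) i)"
 proof (rule sum.cong[OF refl])
  fix i assume "i \<in> {..<N}"
  show "(SUM k<N. (\<Sum>j\<le>k. A (k - j) * P (Suc j) i) * D (Suc k) i) = (SUM j<N. P (Suc j) i * kstp N T kr D (Suc j) i)"
  unfolding k by (rule convolution_exchange[where P = "%j. P j i" and D = "%j. D j i"])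
 qed
 also have "... = (SUM j<N. SUM i<N. P (Suc j) i * kstp N T kr D (Suc j) i)" by (rule sum.swap)
 finally show ?thesis unfolding integral_stp_stp[OF T N] by simp
qed

lemma integral_tcell_one:
 assumes "T > 0" "l < N"
 shows "(LINT r|tint T. ind (tcell N T l) r * (1::real)) = T / real N"
 using measure_tcell[OF assms] by simp

lemma integral_cell2_fst:
 fixes u :: "real => 'b::euclidean_space"
 assumes T: "T > 0" and k: "k < N" and u: "integrable lO u"
 shows "integrable (lC T) (%p. u (fst p))"
  "(LINT p|lC T. ind (cell2 N T k i) p *R u (fst p)) = (T / real N) *R (LINT x|lO. ind (cell N i) x *R u x)"
proof -
 interpret I: finite_measure "tint T" by (rule finite_measure_lbo_Ioo)
 interpret P: pair_sigma_finite "lO" "tint T" by (rule pair_sf)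
 have [measurable]: "u \<in> bms lO" using u by auto
 have "integrable (lO OX tint T) (%p. u (fst p))"
  by (rule P.Fubini_integrable) (use u in \<open>auto intro!: integrable_mult_left\<close>)
 then show i: "integrable (lC T) (%p. u (fst p))" by (simp add: Cyl_eq)
 have i2: "integrable (lC T) (%p. ind (cell2 N T k i) p *R u (fst p))"
  using cell2_mult_integrable[OF i, of N k i] by simp
 have i1: "integrable (tint T) (rind (tcell N T k))"
  by (rule I.sq_int_integrable[OF I.sq_int_bounded[where C = 1]]) (auto simp: indicator_def intro: borel_imp_lbo)
 have "(LINT p|lC T. ind (cell2 N T k i) p *R u (fst p)) = (LINT t|tint T. LINT x|lO. ind (cell2 N T k i) (x, t) *R u (fst (x, t)))"
  by (rule integral_Cyl_iterated(1)[OF i2])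
 also have "... = (LINT t|tint T. rind (tcell N T k) t *R (LINT x|lO. ind (cell N i) x *R u x))"
 proof (rule Bint_cong[OF refl])
  fix t
  have "(%x. rind (cell2 N T k i) (x, t) *R u (fst (x, t))) = (%x. rind (tcell N T k) t *R (ind (cell N i) x *R u x))"
  by (auto simp: cell2_def indicator_def)
  then show "(LINT x|lO. rind (cell2 N T k i) (x, t) *R u (fst (x, t))) = rind (tcell N T k) t *R (LINT x|lO. ind (cell N i) x *R u x)"
  by (simp only: integral_scaleR_right)
 qed
 also have "... = (LINT t|tint T. rind (tcell N T k) t) *R (LINT x|lO. ind (cell N i) x *R u x)"
  by (rule integral_scaleR_left[OF i1])
 also have "... = (T / real N) *R (LINT x|lO. ind (cell N i) x *R u x)"
  using integral_tcell_one[OF T k] by simp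
 finally show "(LINT p|lC T. ind (cell2 N T k i) p *R u (fst p)) = (T / real N) *R (LINT x|lO. ind (cell N i) x *R u x)" .
qed

text \<open>The primitive of the difference quotients is the piecewise linear interpolant, which
  differs from its left nodal value by at most the increment over one cell. The slope in the current
  cell is left open, which covers the last cell, where \<open>dxm\<close> is zero.\<close>

lemma prim_step:
 fixes w :: "nat => 'b::euclidean_space" and a :: "nat => 'b"
 assumes N: "0 < N" and x: "0 < x" "x < 1" and a: "!!j. j < ix N x ==> a j = real N *R (w (Suc j) - w j)"
 shows "norm (prim (w 0) (%y. a (ix N y)) x - w (ix N x)) <= 1 / real N * norm (a (ix N x))"
proof -
 define i where "i = ix N x"
 have iN: "i < N" using ix_less[OF x(2) N] by (simp add: i_def)
 define c :: "nat => real" where "c j = (LINT y|lO. ind (cell N j) y * ind {..<x} y)" for j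
 have [measurable]: "ind (cell N j) \<in> bms lO" "ind {..<x} \<in> bms lO" for j
  by (auto intro: borel_imp_lbo)
 have ic: "integrable lO (%y. rind (cell N j) y * ind {..<x} y)" for j
  by (rule Om.sq_int_integrable[OF Om.sq_int_bounded[where C = 1]]) (measurable, auto simp: indicator_def)
 have ic1: "integrable lO (rind (cell N j))" for j
  by (rule Om.sq_int_integrable[OF Om.sq_int_bounded[where C = 1]]) (auto simp: indicator_def)
 have lt: "y < x" if "y \<in> cell N j" "j < i" for y j
 proof (rule ccontr)
  assume "\<not> y < x"
  then have "ix N x <= ix N y" using x by (intro ix_dist(1)) auto
  then show False using that by (simp add: i_def cell_def)
 qed
 have ge: "\<not> y < x" if "y \<in> cell N j" "i < j" "0 < y" for y j
 proof
  assume "y < x"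
  then have "ix N y <= ix N x" using that by (intro ix_dist(1)) auto
  then show False using that by (simp add: i_def cell_def)
 qed
 have c1: "c j = 1 / real N" if "j < i" for j
 proof -
  have "c j = (LINT y|lO. rind (cell N j) y)"
  unfolding c_def by (intro Bint_cong refl) (use lt[OF _ that] in \<open>auto simp: indicator_def\<close>)
  then show ?thesis using integral_cell[of j N] that iN by simp
 qed
 have c0: "c j = 0" if "i < j" for j
 proof -
  have "c j = (LINT y|lO. 0)"
  unfolding c_def by (intro Bint_cong refl) (use ge[OF _ that] in \<open>auto simp: indicator_def Omega_def\<close>)
  then show ?thesis by simp
 qed
 have ci: "0 <= c i" "c i <= 1 / real N"
 proof -
  show "0 <= c i" unfolding c_def by (rule integral_nonneg_AE) auto
  have "c i <= (LINT y|lO. rind (cell N i) y)"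
  unfolding c_def by (rule integral_mono[OF ic ic1]) (auto simp: indicator_def)
  then show "c i <= 1 / real N" using integral_cell[OF iN] by simp
 qed
 have "(LINT y|lO. ind {..<x} y *R a (ix N y)) = (LINT y|lO. (SUM j<N. (rind (cell N j) y * ind {..<x} y) *R a j))"
 proof (rule Bint_cong[OF refl])
  fix y assume "y \<in> space lO"
  then have sm: "(SUM j<N. ind (cell N j) y *R a j) = a (ix N y)" using N by (intro sum_cell_indicator) (auto simp: Omega_def)
  show "ind {..<x} y *R a (ix N y) = (SUM j<N. (rind (cell N j) y * ind {..<x} y) *R a j)"
  unfolding sm[symmetric] by (simp only: scaleR_sum_right scaleR_scaleR mult.commute)
 qed
 also have "... = (SUM j<N. LINT y|lO. (rind (cell N j) y * ind {..<x} y) *R a j)"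
  by (rule Bint_sum) (intro integrable_scaleR_left ic)
 also have "... = (SUM j<N. c j *R a j)"
  unfolding c_def by (intro sum.cong refl integral_scaleR_left ic)
 also have "... = (\<Sum>j\<in>{..i}. c j *R a j)"
  by (rule sum.mono_neutral_right) (use iN c0 in auto)
 also have "... = (SUM j<i. c j *R a j) + c i *R a i"
  by (simp add: lessThan_Suc_atMost[symmetric])
 also have "(SUM j<i. c j *R a j) = (SUM j<i. w (Suc j) - w j)"
  by (intro sum.cong refl) (use c1 a N in \<open>auto simp: i_def\<close>)
 also have "... = w i - w 0" by (rule sum_lessThan_telescope)
 finally have "prim (w 0) (%y. a (ix N y)) x - w i = c i *R a i" by (simp add: prim_def)
 then show ?thesis using ci(1) mult_right_mono[OF ci(2) norm_ge_zero[of "a i"]] by (simp add: i_def[symmetric])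
qed

lemma closure_Cyl: "T > 0 ==> closure (Cyl T) = CB T"
 by (simp add: Cyl_def Omega_def closure_Times)

lemma smooth_on_CB:
 fixes ph :: "real*real => 'b::euclidean_space"
 assumes s: "smooth_on (closure (Cyl T)) ph" and T: "T > 0"
 shows "continuous_on (CB T) ph" "continuous_on (CB T) (dir_deriv v ph)"
  "p \<in> CB T ==> (ph has_derivative (%v. dir_deriv v ph p)) (at p)"
  "x \<in> {0..1} ==> t \<in> {0..T} ==> ((%y. ph (y, t)) has_vector_derivative dir_deriv (1, 0) ph (x, t)) (at x within S)"
  "x \<in> {0..1} ==> t \<in> {0..T} ==> ((%s. ph (x, s)) has_vector_derivative dir_deriv (0, 1) ph (x, t)) (at t within S')"
proof -
 obtain U where U: "CB T \<subseteq> U" "!!k. Ck k U ph"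
  using s unfolding smooth_on_def closure_Cyl[OF T] by blast
 show "continuous_on (CB T) ph" using U(2)[of 0] U(1) continuous_on_subset by auto
 have "continuous_on U (dir_deriv v ph)" using U(2)[of "Suc 0"] unfolding Ck.simps by blast
 then show "continuous_on (CB T) (dir_deriv v ph)" using U(1) continuous_on_subset by blast
 have d: "(ph has_derivative (%v. dir_deriv v ph p)) (at p)" if "p \<in> CB T" for p
 proof -
  have "ph differentiable (at p)" using U(2)[of "Suc 0"] U(1) that unfolding Ck.simps by blast
  then show ?thesis unfolding dir_deriv_def by (simp add: frechet_derivative_works[symmetric])
 qed
 then show "p \<in> CB T ==> (ph has_derivative (%v. dir_deriv v ph p)) (at p)" by simp
 have *: "(ph \<circ> c has_vector_derivative dir_deriv e ph (c y)) (at y within S)"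
  if c: "(c has_vector_derivative e) (at y within S)" and "c y \<in> CB T" for c :: "real => real*real" and e y S
  unfolding has_vector_derivative_def
 proof -
  have l: "linear (%v. dir_deriv v ph (c y))" using has_derivative_linear[OF d[OF that(2)]] .
  have "(ph \<circ> c has_derivative (%v. dir_deriv v ph (c y)) \<circ> (%h. h *R e)) (at y within S)"
  by (rule diff_chain_within) (use c d[OF that(2)] in \<open>auto simp: has_vector_derivative_def intro: has_derivative_at_withinI\<close>)
  moreover have "(%v. dir_deriv v ph (c y)) \<circ> (%h. h *R e) = (%h. h *R dir_deriv e ph (c y))"
  using linear_cmul[OF l] by (auto simp: fun_eq_iff)
  ultimately show "(ph \<circ> c has_derivative (%h. h *R dir_deriv e ph (c y))) (at y within S)" by simp
 qed
 show "((%y. ph (y, t)) has_vector_derivative dir_deriv (1, 0) ph (x, t)) (at x within S)" if "x \<in> {0..1}" "t \<in> {0..T}"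
 proof -
  have "((%y. (y, t)) has_vector_derivative (1, 0)) (at x within S)"
  unfolding has_vector_derivative_def by (rule has_derivative_eq_rhs[OF has_derivative_Pair[OF has_derivative_ident has_derivative_const]]) auto
  from *[OF this] that show ?thesis by (simp add: o_def)
 qed
 show "((%s. ph (x, s)) has_vector_derivative dir_deriv (0, 1) ph (x, t)) (at t within S')" if "x \<in> {0..1}" "t \<in> {0..T}"
 proof -
  have "((%s. (x, s)) has_vector_derivative (0, 1)) (at t within S')"
  unfolding has_vector_derivative_def by (rule has_derivative_eq_rhs[OF has_derivative_Pair[OF has_derivative_const has_derivative_ident]]) auto
  from *[OF this] that show ?thesis by (simp add: o_def)
 qed
qed

locale discrete_family =
 fixes T lam dl K :: real and G u1 :: "real => real" and f :: "real*real => real"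
  and w :: "real => real ^ 2" and u :: "nat => nat => nat => real" and m :: "nat => nat => nat => real ^ 2"
 assumes T: "T > 0" and G: "relaxation_function G" and dl: "dl > 0" and K: "K > 0"
  and u1: "sq_int lO u1" and f: "sq_int (lC T) f" and w: "sq_int lO w"
  and sch: "!!n. scheme (Suc n) (T / (rS n)) lam dl (Gavg G (T / (rS n)))
  (%i. (rS n) * (LINT x|lO. ind (cell (Suc n) i) x * u1 x))
  (%k i. (rS n)^2 / T * (LINT p|lC T. ind (cell2 (Suc n) T (k - 1) i) p * f p))
  (%i. (rS n) *R (LINT x|lO. ind (cell (Suc n) i) x *R w x)) (u n) (m n)"
  and bv: "!!n k. k < Suc n ==> (SUM i<Suc n. (((rS n) / T) * (u n (Suc k) i - u n k i))^2) <= (rS n) * K"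
  and bp: "!!n k. k <= Suc n ==> (SUM i<Suc n. (dx (Suc n) (u n k) i)^2) <= (rS n) * K"
  and bm: "!!n k. k <= Suc n ==> (SUM i<Suc n. (norm (m n k i))^2) <= (rS n) * K"
  and bd: "!!n k. k <= Suc n ==> (SUM i<Suc n. (norm (dxm (Suc n) (m n k) i))^2) <= (rS n) * K"
  and bt: "!!n. (SUM k<Suc n. SUM i<Suc n. (norm (m n (Suc k) i - m n k i))^2) <= T / (rS n) * ((rS n) * K)"
begin

definition "V n k i = ((rS n) / T) *R (u n k i - u n (k - 1) i)"
definition "P n k = dx (Suc n) (u n k)"
definition "Dm n k = dxm (Suc n) (m n k)"
definition "Tm n k i = ((rS n) / T) *R (m n k i - m n (k - 1) i)"

lemma initial: "u n 0 = (%i. 0)" "m n 0 = (%i. (rS n) *R (LINT x|lO. ind (cell (Suc n) i) x *R w x))"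
 "supp0 (Suc n) (u n k)"
 using sch[of n] unfolding scheme_def by blast+

lemma magnetization_identity:
 "(LINT p|lC T. stp (Suc n) T (Tm n) p <.> stp (Suc n) T ps p)
 + (LINT p|lC T. stp (Suc n) T (%k i. (((norm (m n k i))^2 - 1) / dl) *R m n k i) p <.> stp (Suc n) T ps p)
 + (LINT p|lC T. stp (Suc n) T (P n) p <.> stp (Suc n) T (%k i. lam * (Lam (m n k i) <.> ps k i)) p)
 + (LINT p|lC T. stp (Suc n) T (Dm n) p <.> stp (Suc n) T (%k. dxm (Suc n) (ps k)) p) = 0"
proof -
 let ?N = "Suc n"
 have e: "(SUM i<?N. (1 / (T / real ?N)) *R (m n (Suc k) i - m n k i) <.> ps (Suc k) i
  + ((norm (m n (Suc k) i))^2 - 1) / dl * (m n (Suc k) i <.> ps (Suc k) i)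
  + lam * dx ?N (u n (Suc k)) i * (Lam (m n (Suc k) i) <.> ps (Suc k) i))
  + (SUM i<?N. dxm ?N (m n (Suc k)) i <.> dxm ?N (ps (Suc k)) i) = 0" for k
  using sch[of n] unfolding scheme_def by blast
 have N: "0 < ?N" by simp
 have "(SUM k<?N. SUM i<?N. Tm n (Suc k) i <.> ps (Suc k) i) + (SUM k<?N. SUM i<?N. ((((norm (m n (Suc k) i))^2 - 1) / dl) *R m n (Suc k) i) <.> ps (Suc k) i)
  + (SUM k<?N. SUM i<?N. P n (Suc k) i <.> (lam * (Lam (m n (Suc k) i) <.> ps (Suc k) i))) + (SUM k<?N. SUM i<?N. Dm n (Suc k) i <.> dxm ?N (ps (Suc k)) i)
  = (SUM k<?N. (SUM i<?N. (1 / (T / real ?N)) *R (m n (Suc k) i - m n k i) <.> ps (Suc k) i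
  + ((norm (m n (Suc k) i))^2 - 1) / dl * (m n (Suc k) i <.> ps (Suc k) i)
  + lam * dx ?N (u n (Suc k)) i * (Lam (m n (Suc k) i) <.> ps (Suc k) i))
  + (SUM i<?N. dxm ?N (m n (Suc k)) i <.> dxm ?N (ps (Suc k)) i))"
  unfolding sum.distrib
  by (simp add: Tm_def P_def Dm_def mult_ac del: sum.lessThan_Suc of_nat_Suc)
 also have "... = 0" unfolding e by simp
 finally show ?thesis
  unfolding integral_stp_stp[OF T N] distrib_left[symmetric] by simp
qed

text \<open>The equation at level \<open>Suc k\<close> is tested with \<open>ph (Suc k)\<close> and
  summed over the levels; the convolutions are then moved onto \<open>ph\<close>. All terms become
  integrals over the cylinder, without any error.\<close>

lemma momentum_identity:
 assumes ph: "!!k. k <= Suc n ==> supp0 (Suc n) (ph k)"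
 shows "(LINT p|lC T. stp (Suc n) T (V n) p <.> stp (Suc n) T ph p)
 + (LINT p|lC T. stp (Suc n) T (P n) p <.> stp (Suc n) T (kstp (Suc n) T (Gz G) (%k. dx (Suc n) (ph k))) p)
 + (LINT p|lC T. stp (Suc n) T (%k i. qf lam (m n (k - 1) i)) p <.> stp (Suc n) T (kstp (Suc n) T (%r. 1) (%k. dx (Suc n) (ph k))) p)
 = (LINT p|lC T. stp (Suc n) T ph p <.> u1 (fst p))
 + (LINT p|lC T. stp (Suc n) T (kstp (Suc n) T (%r. 1) ph) p <.> f p)"
proof -
 let ?N = "Suc n"
 let ?tau = "T / real ?N"
 let ?U = "%i. real ?N * (LINT x|lO. ind (cell ?N i) x * u1 x)"
 let ?F = "%k i. (real ?N)^2 / T * (LINT p|lC T. ind (cell2 ?N T (k - 1) i) p * f p)"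
 let ?q = "%k i. qf lam (m n (k - 1) i)"
 interpret Q: finite_measure "lC T" by (rule finite_measure_Cyl)
 interpret I: finite_measure "tint T" by (rule finite_measure_lbo_Ioo)
 have N: "0 < ?N" by simp
 have if': "integrable (lC T) f" by (rule Q.sq_int_integrable[OF f])
 have iu: "integrable lO u1" by (rule Om.sq_int_integrable[OF u1])
 have i1: "integrable (tint T) (%r. 1::real)" by simp
 \<comment> \<open>The initial strain is zero, so the memory sum loses its term \<open>j = 0\<close>
   and can be reindexed from level 1, where \<open>stp\<close> starts.\<close>
 have P0: "P n 0 i = 0" for i by (simp add: P_def initial dx_def)
 have e: "(SUM i<?N. V n (Suc k) i * ph (Suc k) i)
  + (SUM i<?N. ((\<Sum>j\<le>k. (?tau * Gavg G ?tau (k - j)) * P n (Suc j) i) + (\<Sum>j\<le>k. ?tau * ?q (Suc j) i)) * dx ?N (ph (Suc k)) i)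
  = (SUM i<?N. ?U i * ph (Suc k) i) + (SUM i<?N. (\<Sum>j\<le>k. ?tau * ?F (Suc j) i) * ph (Suc k) i)" if k: "k < ?N" for k
 proof -
  have sp: "supp0 ?N (ph (Suc k))" using ph[of "Suc k"] k by simp
  have "(SUM i<?N. vel ?tau ?U (u n) (Suc k) i * ph (Suc k) i)
  + (SUM i<?N. (?tau * dconv (Gavg G ?tau) (%j. dx ?N (u n j) i) (Suc k) + ?tau * (SUM j<Suc k. qf lam (m n j i))) * dx ?N (ph (Suc k)) i)
  = (SUM i<?N. (?U i + ?tau * (\<Sum>j=1..Suc k. ?F j i)) * ph (Suc k) i)"
  using sch[of n] sp unfolding scheme_def by blast
  moreover have "vel ?tau ?U (u n) (Suc k) i = V n (Suc k) i" for i by (simp add: vel_def V_def field_simps)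
  moreover have "?tau * dconv (Gavg G ?tau) (%j. dx ?N (u n j) i) (Suc k) = (\<Sum>j\<le>k. (?tau * Gavg G ?tau (k - j)) * P n (Suc j) i)" for i
  proof -
  have "dconv (Gavg G ?tau) (%j. dx ?N (u n j) i) (Suc k) = (\<Sum>j\<le>Suc k. Gavg G ?tau (Suc k - j) * P n j i)" by (simp add: dconv_def P_def)
  also have "... = (\<Sum>j\<le>k. Gavg G ?tau (k - j) * P n (Suc j) i)" unfolding sum.atMost_Suc_shift by (simp add: P0)
  finally show ?thesis by (simp only: sum_distrib_left mult.assoc)
  qed
  moreover have "?tau * (SUM j<Suc k. qf lam (m n j i)) = (\<Sum>j\<le>k. ?tau * ?q (Suc j) i)" for i
  by (simp only: sum_distrib_left lessThan_Suc_atMost diff_Suc_1)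
  moreover have "?tau * (\<Sum>j=1..Suc k. ?F j i) = (\<Sum>j\<le>k. ?tau * ?F (Suc j) i)" for i
  unfolding One_nat_def sum.atLeast_Suc_atMost_Suc_shift o_def atLeast0AtMost by (simp only: sum_distrib_left)
  ultimately show ?thesis by (simp only: distrib_right sum.distrib)
 qed
 have c1: "(LINT p|lC T. stp ?N T (P n) p <.> stp ?N T (kstp ?N T (Gz G) (%k. dx ?N (ph k))) p)
  = T / (real ?N)^2 * (SUM k<?N. SUM i<?N. (\<Sum>j\<le>k. (?tau * Gavg G ?tau (k - j)) * P n (Suc j) i) * dx ?N (ph (Suc k)) i)"
  by (rule convolution_integral[OF T N Gz_integrable[OF G T], where A = "%l. ?tau * Gavg G ?tau l" and P = "P n" and D = "%k. dx ?N (ph k)", symmetric])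
  (rule Gavg_tcell[OF G T])
 have c2: "(LINT p|lC T. stp ?N T X p <.> stp ?N T (kstp ?N T (%r. 1) Y) p)
  = T / (real ?N)^2 * (SUM k<?N. SUM i<?N. (\<Sum>j\<le>k. ?tau * X (Suc j) i) * Y (Suc k) i)" for X Y :: "nat => nat => real"
  by (rule convolution_integral[OF T N i1, where A = "%l. ?tau" and P = X and D = Y, symmetric])
  (rule integral_tcell_one[OF T])
 have c3: "(LINT p|lC T. stp ?N T ph p <.> u1 (fst p)) = T / (real ?N)^2 * (SUM k<?N. SUM i<?N. ?U i * ph (Suc k) i)"
 proof -
  have "(LINT p|lC T. stp ?N T ph p <.> u1 (fst p)) = (SUM k<?N. SUM i<?N. ph (Suc k) i <.> (LINT p|lC T. ind (cell2 ?N T k i) p *R u1 (fst p)))"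
  by (rule integral_stp_inner(2)[OF T N integral_cell2_fst(1)[OF T N iu]])
  also have "... = (SUM k<?N. SUM i<?N. T / (real ?N)^2 * (?U i * ph (Suc k) i))"
  proof (intro sum.cong refl)
  fix k i assume "k \<in> {..<?N}"
  then show "ph (Suc k) i <.> (LINT p|lC T. ind (cell2 ?N T k i) p *R u1 (fst p)) = T / (real ?N)^2 * (?U i * ph (Suc k) i)"
  using integral_cell2_fst(2)[OF T _ iu, of k ?N i] by (simp add: power2_eq_square del: of_nat_Suc)
  qed
  finally show ?thesis by (simp only: sum_distrib_left)
 qed
 have c4: "(LINT p|lC T. stp ?N T X p <.> f p) = T / (real ?N)^2 * (SUM k<?N. SUM i<?N. ?F (Suc k) i * X (Suc k) i)" for X :: "nat => nat => real"
 proof -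
  have "(LINT p|lC T. stp ?N T X p <.> f p) = (SUM k<?N. SUM i<?N. T / (real ?N)^2 * (?F (Suc k) i * X (Suc k) i))"
  unfolding integral_stp_inner(2)[OF T N if'] using T by (intro sum.cong refl) (simp add: field_simps del: of_nat_Suc)
  then show ?thesis by (simp only: sum_distrib_left)
 qed
 have c5: "T / (real ?N)^2 * (SUM k<?N. SUM i<?N. (\<Sum>j\<le>k. ?tau * ?F (Suc j) i) * ph (Suc k) i) = (LINT p|lC T. stp ?N T (kstp ?N T (%r. 1) ph) p <.> f p)"
  unfolding c4 c2[where X = ?F and Y = ph, symmetric] integral_stp_stp[OF T N] by (simp only: inner_real_def)
 have "(SUM k<?N. (SUM i<?N. V n (Suc k) i * ph (Suc k) i)
  + (SUM i<?N. ((\<Sum>j\<le>k. (?tau * Gavg G ?tau (k - j)) * P n (Suc j) i) + (\<Sum>j\<le>k. ?tau * ?q (Suc j) i)) * dx ?N (ph (Suc k)) i))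
  = (SUM k<?N. (SUM i<?N. ?U i * ph (Suc k) i) + (SUM i<?N. (\<Sum>j\<le>k. ?tau * ?F (Suc j) i) * ph (Suc k) i))"
  by (rule sum.cong[OF refl]) (rule e, simp)
 then have "(SUM k<?N. SUM i<?N. V n (Suc k) i * ph (Suc k) i)
  + ((SUM k<?N. SUM i<?N. (\<Sum>j\<le>k. (?tau * Gavg G ?tau (k - j)) * P n (Suc j) i) * dx ?N (ph (Suc k)) i)
  + (SUM k<?N. SUM i<?N. (\<Sum>j\<le>k. ?tau * ?q (Suc j) i) * dx ?N (ph (Suc k)) i))
  = (SUM k<?N. SUM i<?N. ?U i * ph (Suc k) i) + (SUM k<?N. SUM i<?N. (\<Sum>j\<le>k. ?tau * ?F (Suc j) i) * ph (Suc k) i)" (is "?L = ?R")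
  by (simp only: sum.distrib distrib_right)
 then have "T / (real ?N)^2 * ?L = T / (real ?N)^2 * ?R" by (rule arg_cong)
 moreover have "(LINT p|lC T. stp ?N T (V n) p <.> stp ?N T ph p) = T / (real ?N)^2 * (SUM k<?N. SUM i<?N. V n (Suc k) i * ph (Suc k) i)"
  unfolding integral_stp_stp[OF T N] by (simp only: inner_real_def)
 ultimately show ?thesis
  unfolding c1 c2[where X = ?q and Y = "%k. dx ?N (ph k)"] c3 c5[symmetric] by (simp only: distrib_left add.assoc)
qed

end

section \<open>Compactness of the discrete solutions\<close>

lemma nsq_stp_le:
 fixes a :: "nat => nat => 'b::euclidean_space"
 assumes T: "T > 0" and N: "0 < N" and b: "!!k. k < N ==> (SUM i<N. (norm (a (Suc k) i))^2) <= real N * K"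
 shows "nsq (lC T) (stp N T a) <= T * K"
  "t \<in> {0<..<T} ==> nsq lO (%x. stp N T a (x, t)) <= K"
proof -
 have "(SUM k<N. SUM i<N. (norm (a (Suc k) i))^2) <= (SUM k<N. real N * K)" by (intro sum_mono b) simp
 then have "T / (real N)^2 * (SUM k<N. SUM i<N. (norm (a (Suc k) i))^2) <= T / (real N)^2 * (SUM k<N. real N * K)"
  using T by (intro mult_left_mono) auto
 also have "... = T * K" using N by (simp add: power2_eq_square)
 finally show "nsq (lC T) (stp N T a) <= T * K" by (simp add: nsq_stp(2)[OF T N])
 assume t: "t \<in> {0<..<T}"
 then have k: "ix N (t / T) < N" using T N by (intro ix_less) auto
 have "nsq lO (%x. stp N T a (x, t)) = 1 / real N * (SUM i<N. (norm (a (Suc (ix N (t / T))) i))^2)"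
  using nsq_step1(1)[OF N, of "a (Suc (ix N (t / T)))"] by (simp add: stp_def)
 also have "... <= 1 / real N * (real N * K)" by (intro mult_left_mono b k) simp
 finally show "nsq lO (%x. stp N T a (x, t)) <= K" using N by simp
qed

lemma stp_slice_sq_int:
 fixes a :: "nat => nat => 'b::euclidean_space"
 assumes "0 < N" shows "sq_int lO (%x. stp N T a (x, t))"
 using nsq_step1(2)[OF assms, of "a (Suc (ix N (t / T)))"] by (simp add: stp_def)

lemma nsq_contraction_tendsto:
 fixes pr :: "'b::euclidean_space => 'c::euclidean_space"
 assumes h: "(%n. nsq M (h n)) ----> 0" "!!n. sq_int M (h n)" and pr: "!!a. norm (pr a) <= norm a"
 shows "(%n. nsq M (%x. pr (h n x))) ----> 0"
proof (rule tendsto_sandwich[OF _ _ tendsto_const h(1)])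
 have "nsq M (%x. pr (h n x)) <= nsq M (h n)" for n
  unfolding nsq_def by (rule integral_mono') (use pr sq_intD(2)[OF h(2)] in auto)
 then show "\<forall>\<^sub>F n in sequentially. nsq M (%x. pr (h n x)) <= nsq M (h n)" by simp
qed (simp add: nsq_nonneg)

context discrete_family
begin

definition "Ps n = stp (Suc n) T (P n)"
definition "Vs n = stp (Suc n) T (V n)"
definition "Ds n = stp (Suc n) T (Dm n)"
definition "Ts n = stp (Suc n) T (Tm n)"
definition "Ms n = stp (Suc n) T (m n)"
text \<open>The magnetization one level back. It occurs in the explicit coupling and in summation by
  parts; by \<open>Ls_uniform\<close> it has the same uniform limit as \<open>Ms\<close>.\<close>

definition "Ls n = stp (Suc n) T (%k. m n (k - 1))"

lemma steps_sq_int: "sq_int (lC T) (Ps n)" "sq_int (lC T) (Vs n)" "sq_int (lC T) (Ds n)"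
 "sq_int (lC T) (Ts n)" "sq_int (lC T) (Ms n)"
 unfolding Ps_def Vs_def Ds_def Ts_def Ms_def by (rule nsq_stp(1)[OF T]; simp)+

lemma steps_borel: "Ps n \<in> bms borel" "Vs n \<in> bms borel" "Ds n \<in> bms borel"
 "Ts n \<in> bms borel" "Ms n \<in> bms borel" "Ls n \<in> bms borel"
 unfolding Ps_def Vs_def Ds_def Ts_def Ms_def Ls_def by (rule stp_measurable)+

lemma steps_slice: "sq_int lO (%x. Ps n (x, t))" "sq_int lO (%x. Vs n (x, t))" "sq_int lO (%x. Ds n (x, t))"
 unfolding Ps_def Vs_def Ds_def by (rule stp_slice_sq_int; simp)+

lemma steps_nsq: "nsq (lC T) (Ps n) <= T * K" "nsq (lC T) (Vs n) <= T * K" "nsq (lC T) (Ds n) <= T * K"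
 "nsq (lC T) (Ts n) <= K"
 and steps_slice_nsq: "t \<in> {0<..<T} ==> nsq lO (%x. Ps n (x, t)) <= K"
 "t \<in> {0<..<T} ==> nsq lO (%x. Vs n (x, t)) <= K"
 "t \<in> {0<..<T} ==> nsq lO (%x. Ds n (x, t)) <= K"
proof -
 have N: "0 < Suc n" by simp
 have p: "(SUM i<Suc n. (norm (P n (Suc k) i))^2) <= (rS n) * K" if "k < Suc n" for k
  using bp[of "Suc k" n] that by (simp add: P_def del: of_nat_Suc sum.lessThan_Suc)
 have v: "(SUM i<Suc n. (norm (V n (Suc k) i))^2) <= (rS n) * K" if "k < Suc n" for k
  using bv[of k n] that by (simp only: V_def real_norm_def power2_abs real_scaleR_def diff_Suc_1)
 have d: "(SUM i<Suc n. (norm (Dm n (Suc k) i))^2) <= (rS n) * K" if "k < Suc n" for k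
  using bd[of "Suc k" n] that by (simp add: Dm_def del: of_nat_Suc sum.lessThan_Suc)
 show "nsq (lC T) (Ps n) <= T * K" "t \<in> {0<..<T} ==> nsq lO (%x. Ps n (x, t)) <= K"
  unfolding Ps_def using nsq_stp_le[OF T N, of "P n" K] p by auto
 show "nsq (lC T) (Vs n) <= T * K" "t \<in> {0<..<T} ==> nsq lO (%x. Vs n (x, t)) <= K"
  unfolding Vs_def using nsq_stp_le[OF T N, of "V n" K] v by auto
 show "nsq (lC T) (Ds n) <= T * K" "t \<in> {0<..<T} ==> nsq lO (%x. Ds n (x, t)) <= K"
  unfolding Ds_def using nsq_stp_le[OF T N, of "Dm n" K] d by auto
 have "nsq (lC T) (Ts n) = T / (rS n)^2 * (((rS n) / T)^2 * (SUM k<Suc n. SUM i<Suc n. (norm (m n (Suc k) i - m n k i))^2))"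
  unfolding Ts_def nsq_stp(2)[OF T N] sum_distrib_left using T
  by (simp add: Tm_def power_mult_distrib power_divide del: of_nat_Suc sum.lessThan_Suc)
 also have "... = 1 / T * (SUM k<Suc n. SUM i<Suc n. (norm (m n (Suc k) i - m n k i))^2)"
  using T by (simp add: power_divide power2_eq_square del: of_nat_Suc sum.lessThan_Suc)
 also have "... <= 1 / T * (T / (rS n) * ((rS n) * K))" using T bt[of n] by (intro mult_left_mono) auto
 also have "... = K" using T by (simp del: of_nat_Suc)
 finally show "nsq (lC T) (Ts n) <= K" .
qed

text \<open>From \<open>discrete_Sobolev\<close> with both bounds equal to \<open>K\<close> and
  \<open>e = 1\<close>.\<close>

definition "Mb = sqrt (3 * K)"

lemma m_bounded: "k <= Suc n ==> i < Suc n ==> norm (m n k i) <= Mb"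
 using discrete_Sobolev[of i "Suc n" "m n k" K K 1] bm[of k n] bd[of k n] K
 unfolding Mb_def by (intro real_le_rsqrt) auto

lemma grid_index:
 assumes "p \<in> Cyl T"
 shows "ix (Suc n) (snd p / T) < Suc n" "ix (Suc n) (fst p) < Suc n"
 using assms T by (auto simp: Cyl_def Omega_def intro!: ix_less)

lemma Ms_bounded: "p \<in> Cyl T ==> norm (Ms n p) <= Mb" "p \<in> Cyl T ==> norm (Ls n p) <= Mb"
 unfolding Ms_def Ls_def stp_def using grid_index[of p n] by (auto intro!: m_bounded)

lemma Ls_close:
 assumes p: "p \<in> Cyl T"
 shows "norm (Ms n p - Ls n p) <= sqrt (T / (rS n) * K + 5 * K * sqrt (T / (rS n)))"
proof -
 let ?k = "ix (Suc n) (snd p / T)"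
 have "(norm (m n (Suc ?k) (ix (Suc n) (fst p)) - m n ?k (ix (Suc n) (fst p))))\<^sup>2 <= T / (rS n) * K + (4 * K + K) * sqrt (T / (rS n))"
  by (rule discrete_Holder_time[OF _ _ _ T bd bt]) (use grid_index[OF p, of n] in auto)
 then show ?thesis unfolding Ms_def Ls_def stp_def by (intro real_le_rsqrt) simp
qed

lemma Ls_uniform: "uniform_limit (Cyl T) (%n. %p. Ms n p - Ls n p) (%p. 0) sequentially"
proof (rule uniform_limitI)
 fix e :: real assume e: "e > 0"
 have "(%n. sqrt (T / (rS n) * K + 5 * K * sqrt (T / (rS n)))) ----> sqrt (0 * K + 5 * K * sqrt 0)"
  by (intro tendsto_intros LIMSEQ_Suc[OF lim_const_over_n])
 then have "eventually (%n. sqrt (T / (rS n) * K + 5 * K * sqrt (T / (rS n))) < e) sequentially"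
  using e by (auto dest!: order_tendstoD(2))
 then show "\<forall>\<^sub>F n in sequentially. \<forall>p\<in>Cyl T. dist (Ms n p - Ls n p) 0 < e"
  by eventually_elim (use Ls_close in \<open>auto simp: dist_norm intro: le_less_trans\<close>)
qed

lemma Cyl_bounded: "bounded (Cyl T)"
 unfolding Cyl_def Omega_def by (intro bounded_Times) auto

lemma Ms_uniform_subsequence:
 "\<exists>r mu. strict_mono (r :: nat => nat) & mu \<in> bms borel & (\<forall>p. norm (mu p) <= Mb)
  & uniform_limit (Cyl T) (%n. Ms (r n)) mu sequentially"
proof -
 have eq: "\<exists>d>0. \<exists>n0. \<forall>n\<ge>n0. \<forall>z\<in>Cyl T. \<forall>z'\<in>Cyl T. dist z z' < d --> dist (Ms n z) (Ms n z') < e" if e: "e > 0" for e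
 proof -
  \<comment> \<open>The modulus of \<open>stp_modulus\<close> with both constants equal to
    \<open>K\<close>. Below, half of \<open>S\<close> is spent on the distance and half on the
    rounding term.\<close>
  have "((%S. sqrt (K * S) + sqrt (S * K + (4 * K + K) * sqrt S)) \<longlongrightarrow> sqrt (K * 0) + sqrt (0 * K + (4 * K + K) * sqrt 0)) (at_right 0)"
  by (intro tendsto_intros)
  then have "eventually (%S. sqrt (K * S) + sqrt (S * K + (4 * K + K) * sqrt S) < e) (at_right 0)"
  using e by (auto dest!: order_tendstoD(2))
  then obtain b where b: "b > 0" "!!S. 0 < S ==> S < b ==> sqrt (K * S) + sqrt (S * K + (4 * K + K) * sqrt S) < e"
  unfolding eventually_at_right_field by auto
  define S where "S = b / 2"
  have S: "S > 0" "sqrt (K * S) + sqrt (S * K + (4 * K + K) * sqrt S) < e" using b(1) b(2)[of "b / 2"] by (auto simp: S_def)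
  obtain n0 where n0: "!!n. n \<ge> n0 ==> (1 + T) / (rS n) < S / 2"
  using tendsto_over_Suc[of "S / 2" "1 + T"] S(1) unfolding eventually_sequentially by auto
  have "dist (Ms n z) (Ms n z') < e" if "n \<ge> n0" "z \<in> Cyl T" "z' \<in> Cyl T" "dist z z' < S / 2" for n z z'
  proof -
  have "dist z z' + (1 + T) / (rS n) <= S" using that(4) n0[OF that(1)] by linarith
  from stp_modulus[OF _ T bd bt that(2,3) this] S(2) show ?thesis unfolding Ms_def by simp
  qed
  then have "\<forall>n\<ge>n0. \<forall>z\<in>Cyl T. \<forall>z'\<in>Cyl T. dist z z' < S / 2 --> dist (Ms n z) (Ms n z') < e" by blast
  moreover have "S / 2 > 0" using S(1) by simp
  ultimately show ?thesis by blast
 qed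
 obtain r g where r: "strict_mono (r :: nat => nat)" and g: "uniformly_continuous_on (Cyl T) g"
  and lim: "!!e. e > 0 ==> \<exists>n0. \<forall>n\<ge>n0. \<forall>x\<in>Cyl T. dist (Ms (r n) x) (g x) < e"
  by (rule asymptotic_Arzela_Ascoli[of "Cyl T" Ms Mb, OF Cyl_bounded Ms_bounded(1) eq]) (assumption, assumption, rule that, assumption, assumption, blast)
 have ul: "uniform_limit (Cyl T) (%n. Ms (r n)) g sequentially"
  unfolding uniform_limit_iff eventually_sequentially using lim by blast
 \<comment> \<open>Extension by zero makes the limit Borel and bounded on the whole plane.\<close>
 let ?mu = "%p. ind (Cyl T) p *R g p"
 have 1: "?mu \<in> bms borel"
  by (rule borel_measurable_continuous_on_indicator[OF Cyl_borel uniformly_continuous_imp_continuous[OF g]])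
 have 2: "norm (?mu p) <= Mb" for p
 proof (cases "p \<in> Cyl T")
  case True
  have "norm (g p) <= Mb"
  by (rule Lim_norm_ubound[OF _ tendsto_uniform_limitI[OF ul True]]) (use Ms_bounded(1)[OF True] in auto)
  then show ?thesis using True by simp
 next
  case False
  then show ?thesis using K by (simp add: Mb_def)
 qed
 have 3: "uniform_limit (Cyl T) (%n. Ms (r n)) ?mu sequentially"
  by (rule uniform_limit_cong'[THEN iffD1, OF _ _ ul]) auto
 show ?thesis by (intro exI[of _ r] exI[of _ ?mu] conjI allI r 1 2 3)
qed

text \<open>The four sequences are treated as one sequence with values in a product space, so that
  Mazur's lemma yields common weights; the components inherit convergence because coordinate
  projections are contractions. Thinning out the combinations once more gives convergence on almost
  every time slice.\<close>

lemma Mazur_subsequence: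
 "\<exists>ux ut mx mt A c. ux \<in> bms borel & ut \<in> bms borel & mx \<in> bms borel & mt \<in> bms borel
  & sq_int (lC T) ux & sq_int (lC T) ut & sq_int (lC T) mx & sq_int (lC T) mt
  & (\<forall>n. conv_weights n (A n) (c n))
  & (%n. nsq (lC T) (%p. (\<Sum>k\<in>A n. c n k *R Ps (r k) p) - ux p)) ----> 0
  & (%n. nsq (lC T) (%p. (\<Sum>k\<in>A n. c n k *R Vs (r k) p) - ut p)) ----> 0
  & (%n. nsq (lC T) (%p. (\<Sum>k\<in>A n. c n k *R Ds (r k) p) - mx p)) ----> 0
  & (%n. nsq (lC T) (%p. (\<Sum>k\<in>A n. c n k *R Ts (r k) p) - mt p)) ----> 0
  & (AE t in tint T. (%n. nsq lO (%x. (\<Sum>k\<in>A n. c n k *R Ps (r k) (x, t)) - ux (x, t))) ----> 0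
  & (%n. nsq lO (%x. (\<Sum>k\<in>A n. c n k *R Vs (r k) (x, t)) - ut (x, t))) ----> 0
  & (%n. nsq lO (%x. (\<Sum>k\<in>A n. c n k *R Ds (r k) (x, t)) - mx (x, t))) ----> 0)"
proof -
 interpret Q: finite_measure "lC T" by (rule finite_measure_Cyl)
 define z where "z k p = (Ps (r k) p, Vs (r k) p, Ds (r k) p, Ts (r k) p)" for k p
 note [measurable] = steps_borel
 have zb: "z k \<in> bms borel" for k unfolding z_def[abs_def] by measurable
 have n4: "(norm (a, b, c, d))^2 = (norm a)^2 + (norm b)^2 + (norm c)^2 + (norm d)^2"
  for a b :: real and c d :: "real ^ 2" by (simp add: norm_Pair)
 have int4: "integrable (lC T) (%p. (norm (Ps n p))^2)" "integrable (lC T) (%p. (norm (Vs n p))^2)"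
  "integrable (lC T) (%p. (norm (Ds n p))^2)" "integrable (lC T) (%p. (norm (Ts n p))^2)" for n
  by (rule sq_intD(2)[OF steps_sq_int(1)] sq_intD(2)[OF steps_sq_int(2)] sq_intD(2)[OF steps_sq_int(3)] sq_intD(2)[OF steps_sq_int(4)])+
 have z: "sq_int (lC T) (z k)" for k
  unfolding sq_int_def
 proof
  show "z k \<in> bms (lC T)" by (rule borel_imp_lbo[OF zb])
  show "integrable (lC T) (%x. (norm (z k x))^2)"
  unfolding z_def n4 by (intro Bitg_add int4)
 qed
 have zC: "nsq (lC T) (z k) <= T * K + T * K + T * K + K" for k
 proof -
  have "nsq (lC T) (z k) = nsq (lC T) (Ps (r k)) + nsq (lC T) (Vs (r k)) + nsq (lC T) (Ds (r k)) + nsq (lC T) (Ts (r k))"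
  unfolding nsq_def z_def n4 using int4[of "r k"] by simp
  then show ?thesis using steps_nsq[of "r k"] by linarith
 qed
 obtain z0 A0 c0 where z0: "sq_int (lC T) z0" and cw0: "!!n. conv_weights n (A0 n) (c0 n)"
  and conv0: "(%n. nsq (lC T) (%p. (\<Sum>k\<in>A0 n. c0 n k *R z k p) - z0 p)) ----> 0"
  using Q.Mazur_L2[of z, OF z zC] by blast
 have zsum: "sq_int (lC T) (%p. \<Sum>k\<in>A0 n. c0 n k *R z k p)" for n by (rule sq_int_sum[OF z])
 obtain s where s: "strict_mono (s :: nat => nat)"
  and sl0: "AE t in tint T. (%n. nsq lO (%x. (\<Sum>k\<in>A0 (s n). c0 (s n) k *R z k (x, t)) - z0 (x, t))) ----> 0"
  using slice_subsequence[OF zsum z0 conv0] by blast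
 define A c where "A n = A0 (s n)" and "c n = c0 (s n)" for n
 define zl where "zl p = ind (Cyl T) p *R z0 p" for p
 \<comment> \<open>Thinning out keeps the tail condition, because \<open>s n\<close> is at least
   \<open>n\<close>.\<close>
 have cw: "conv_weights n (A n) (c n)" for n
  unfolding A_def c_def using cw0 by (rule conv_weights_mono) (use s seq_suble in auto)
 have zlb[measurable]: "zl \<in> bms borel"
  using sq_intD(1)[OF z0] unfolding zl_def[abs_def] lbo_measurable_iff[OF Cyl_borel] .
 have zlq: "sq_int (lC T) zl"
  by (rule sq_int_bound[OF z0 borel_imp_lbo[OF zlb]]) (simp add: zl_def)
 have "(%n. nsq (lC T) (%p. (\<Sum>k\<in>A n. c n k *R z k p) - z0 p)) ----> 0"
  using LIMSEQ_subseq_LIMSEQ[OF conv0 s] by (simp add: o_def A_def c_def)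
 moreover have "nsq (lC T) (%p. (\<Sum>k\<in>A n. c n k *R z k p) - z0 p) = nsq (lC T) (%p. (\<Sum>k\<in>A n. c n k *R z k p) - zl p)" for n
  unfolding nsq_def by (intro Bint_cong refl) (simp add: zl_def)
 ultimately have conv: "(%n. nsq (lC T) (%p. (\<Sum>k\<in>A n. c n k *R z k p) - zl p)) ----> 0" by simp
 have sl: "AE t in tint T. (%n. nsq lO (%x. (\<Sum>k\<in>A n. c n k *R z k (x, t)) - zl (x, t))) ----> 0"
  using sl0 AE_space
 proof eventually_elim
  case (elim t)
  then have "nsq lO (%x. (\<Sum>k\<in>A n. c n k *R z k (x, t)) - z0 (x, t)) = nsq lO (%x. (\<Sum>k\<in>A n. c n k *R z k (x, t)) - zl (x, t))" for n
  unfolding nsq_def by (intro Bint_cong refl) (simp add: zl_def Cyl_def indicator_def)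
  then show ?case using elim by (simp add: A_def c_def)
 qed
 define yq where "yq n p = (\<Sum>k\<in>A n. c n k *R z k p) - zl p" for n p
 have yb[measurable]: "yq n \<in> bms borel" for n
 proof -
  note [measurable] = zb
  show ?thesis unfolding yq_def[abs_def] by measurable
 qed
 have yqi: "sq_int (lC T) (yq n)" for n unfolding yq_def[abs_def] by (intro sq_int_diff sq_int_sum z zlq)
 have le: "norm (fst a) <= norm a" "norm (fst (snd a)) <= norm a" "norm (fst (snd (snd a))) <= norm a" "norm (snd (snd (snd a))) <= norm a"
  for a :: "real*real \<times> (real ^ 2) \<times> (real ^ 2)"
  by (cases a; auto simp: norm_Pair intro!: real_le_rsqrt)+
 have comp: "fst (yq n p) = (\<Sum>k\<in>A n. c n k *R Ps (r k) p) - fst (zl p)"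
  "fst (snd (yq n p)) = (\<Sum>k\<in>A n. c n k *R Vs (r k) p) - fst (snd (zl p))"
  "fst (snd (snd (yq n p))) = (\<Sum>k\<in>A n. c n k *R Ds (r k) p) - fst (snd (snd (zl p)))"
  "snd (snd (snd (yq n p))) = (\<Sum>k\<in>A n. c n k *R Ts (r k) p) - snd (snd (snd (zl p)))" for n p
  by (simp_all add: yq_def z_def fst_sum snd_sum)
 have convq: "(%n. nsq (lC T) (yq n)) ----> 0" using conv by (simp add: yq_def[abs_def])
 have slq: "AE t in tint T. (%n. nsq lO (%x. yq n (x, t))) ----> 0 & (\<forall>n. sq_int lO (%x. yq n (x, t)))"
 proof -
  have "AE t in tint T. \<forall>n. sq_int lO (%x. yq n (x, t))"
  unfolding AE_all_countable by (intro allI slice_sq_int(1) yqi)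
  with sl show ?thesis by eventually_elim (simp add: yq_def)
 qed
 have pm: "(%p. pr (zl p)) \<in> bms borel" if "continuous_on UNIV pr" for pr :: "_ => 'e::euclidean_space"
  by (rule measurable_compose[OF zlb borel_measurable_continuous_onI[OF that]])
 have b4: "(%p. fst (zl p)) \<in> bms borel" "(%p. fst (snd (zl p))) \<in> bms borel"
  "(%p. fst (snd (snd (zl p)))) \<in> bms borel" "(%p. snd (snd (snd (zl p)))) \<in> bms borel"
  by (rule pm, intro continuous_on_fst continuous_on_snd continuous_on_id)+
 have q4: "sq_int (lC T) (%p. fst (zl p))" "sq_int (lC T) (%p. fst (snd (zl p)))"
  "sq_int (lC T) (%p. fst (snd (snd (zl p))))" "sq_int (lC T) (%p. snd (snd (snd (zl p))))"
  using sq_int_bound[OF zlq borel_imp_lbo[OF b4(1)]] sq_int_bound[OF zlq borel_imp_lbo[OF b4(2)]]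
  sq_int_bound[OF zlq borel_imp_lbo[OF b4(3)]] sq_int_bound[OF zlq borel_imp_lbo[OF b4(4)]] le by blast+
 have tq: "(%n. nsq M (%x. fst (h n x))) ----> 0" "(%n. nsq M (%x. fst (snd (h n x)))) ----> 0"
  "(%n. nsq M (%x. fst (snd (snd (h n x))))) ----> 0" "(%n. nsq M (%x. snd (snd (snd (h n x))))) ----> 0"
  if "(%n. nsq M (h n)) ----> 0" "!!n. sq_int M (h n)"
  for M :: "'q measure" and h :: "nat => 'q => real*real \<times> (real ^ 2) \<times> (real ^ 2)"
  using nsq_contraction_tendsto[of M h fst] nsq_contraction_tendsto[of M h "%a. fst (snd a)"]
  nsq_contraction_tendsto[of M h "%a. fst (snd (snd a))"] nsq_contraction_tendsto[of M h "%a. snd (snd (snd a))"] that le by blast+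
 have c4: "(%n. nsq (lC T) (%p. (\<Sum>k\<in>A n. c n k *R Ps (r k) p) - fst (zl p))) ----> 0"
  "(%n. nsq (lC T) (%p. (\<Sum>k\<in>A n. c n k *R Vs (r k) p) - fst (snd (zl p)))) ----> 0"
  "(%n. nsq (lC T) (%p. (\<Sum>k\<in>A n. c n k *R Ds (r k) p) - fst (snd (snd (zl p))))) ----> 0"
  "(%n. nsq (lC T) (%p. (\<Sum>k\<in>A n. c n k *R Ts (r k) p) - snd (snd (snd (zl p))))) ----> 0"
  using tq[of "lC T" yq, OF convq yqi] unfolding comp .
 have ae: "AE t in tint T. (%n. nsq lO (%x. (\<Sum>k\<in>A n. c n k *R Ps (r k) (x, t)) - fst (zl (x, t)))) ----> 0
  & (%n. nsq lO (%x. (\<Sum>k\<in>A n. c n k *R Vs (r k) (x, t)) - fst (snd (zl (x, t))))) ----> 0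
  & (%n. nsq lO (%x. (\<Sum>k\<in>A n. c n k *R Ds (r k) (x, t)) - fst (snd (snd (zl (x, t)))))) ----> 0"
  using slq
 proof eventually_elim
  case (elim t)
  then have e: "(%n. nsq lO (%x. yq n (x, t))) ----> 0" "!!n. sq_int lO (%x. yq n (x, t))" by auto
  show ?case using tq(1-3)[of "lO" "%n x. yq n (x, t)", OF e] unfolding comp by (intro conjI)
 qed
 show ?thesis
  by (rule exI[of _ "%p. fst (zl p)"], rule exI[of _ "%p. fst (snd (zl p))"], rule exI[of _ "%p. fst (snd (snd (zl p)))"],
  rule exI[of _ "%p. snd (snd (snd (zl p)))"], rule exI[of _ A], rule exI[of _ c]) (intro conjI allI cw b4 q4 c4 ae)
qed

end

section \<open>Passage to the limit\<close>

lemma sq_int_norm: "sq_int M f ==> sq_int M (%x. norm (f x))"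
 by (auto simp: sq_int_def intro: borel_measurable_norm)

lemma prim2_diff_nsq:
 fixes g g' :: "real*real => 'b::euclidean_space"
 assumes g: "sq_int (lC T) g" and g': "sq_int (lC T) g'"
 shows "nsq (lC T) (%p. prim2 g p - prim2 g' p) <= 2 * nsq (lC T) (%p. g p - g' p)"
proof -
 have d: "sq_int (lC T) (%p. g p - g' p)" "sq_int (lC T) (%p. prim2 g p - prim2 g' p)"
  by (intro sq_int_diff g g' prim2_sq_int(1))+
 have "(LINT t|tint T. nsq lO (%x. prim2 g (x, t) - prim2 g' (x, t))) <= (LINT t|tint T. 2 * nsq lO (%x. g (x, t) - g' (x, t)))"
 proof (rule integral_mono_AE)
  show "integrable (tint T) (%t. nsq lO (%x. prim2 g (x, t) - prim2 g' (x, t)))"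
  "integrable (tint T) (%t. 2 * nsq lO (%x. g (x, t) - g' (x, t)))"
  using slice_sq_int(2)[OF d(2)] slice_sq_int(2)[OF d(1)] by auto
  show "AE t in tint T. nsq lO (%x. prim2 g (x, t) - prim2 g' (x, t)) <= 2 * nsq lO (%x. g (x, t) - g' (x, t))"
  using slice_sq_int(1)[OF g] slice_sq_int(1)[OF g']
  proof eventually_elim
  case (elim t)
  have "prim2 g (x, t) - prim2 g' (x, t) = prim (0 - 0) (%y. g (y, t) - g' (y, t)) x" for x
  unfolding prim2_def fst_conv snd_conv by (rule prim_diff) (intro Om.sq_int_integrable elim)+
  then show ?case using nsq_prim_le[OF sq_int_diff[OF elim], of 0] by simp
  qed
 qed
 then show ?thesis by (simp add: slice_sq_int(3)[OF d(1)] slice_sq_int(3)[OF d(2)])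
qed

lemma prim2_sum:
 fixes g :: "'k => real*real => 'b::euclidean_space"
 assumes "!!k t. sq_int lO (%x. g k (x, t))"
 shows "prim2 (%p. \<Sum>k\<in>A. c k *R g k p) = (%p. \<Sum>k\<in>A. c k *R prim2 (g k) p)"
proof
 fix p :: "real*real"
 have "integrable lO (%y. g k (y, snd p))" for k by (rule Om.sq_int_integrable[OF assms])
 then have "(\<Sum>k\<in>A. c k *R prim 0 (%y. g k (y, snd p)) (fst p)) = prim (\<Sum>k\<in>A. c k *R 0) (%y. \<Sum>k\<in>A. c k *R g k (y, snd p)) (fst p)"
  by (rule prim_lincomb)
 then show "prim2 (%p. \<Sum>k\<in>A. c k *R g k p) p = (\<Sum>k\<in>A. c k *R prim2 (g k) p)" by (simp add: prim2_def)
qed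

lemma inner_null:
 assumes h: "!!n. sq_int M (h n)" and lim: "(%n. nsq M (h n)) ----> 0" and xi: "sq_int M xi"
 shows "(%n. LINT x|M. h n x <.> xi x) ----> 0"
 using weighted_inner_tendsto[where M = M and z = h and zl = "%x. 0" and A = "%n. {n}" and c = "%_ _. 1", OF h sq_int_zero _ xi] lim by simp

lemma CB_sq_int:
 fixes xi :: "real*real => 'b::euclidean_space"
 assumes c: "continuous_on (CB T) xi"
 shows "sq_int (lC T) xi" "\<exists>C. \<forall>p\<in>CB T. norm (xi p) <= C"
  "(%p. ind (Cyl T) p *R xi p) \<in> bms borel"
proof -
 interpret Q: finite_measure "lC T" by (rule finite_measure_Cyl)
 have sub: "Cyl T \<subseteq> CB T" by (auto simp: Cyl_def Omega_def)
 have "compact (xi ` CB T)" by (rule compact_continuous_image[OF c compact_CB])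
 then obtain C where C: "!!p. p \<in> CB T ==> norm (xi p) <= C" using compact_imp_bounded bounded_iff by (metis imageI)
 then show "\<exists>C. \<forall>p\<in>CB T. norm (xi p) <= C" by blast
 show b: "(%p. ind (Cyl T) p *R xi p) \<in> bms borel"
  by (rule borel_measurable_continuous_on_indicator[OF Cyl_borel continuous_on_subset[OF c sub]])
 then have "xi \<in> bms (lC T)" unfolding lbo_measurable_iff[OF Cyl_borel] .
 then show "sq_int (lC T) xi" by (rule Q.sq_int_bounded[where C = C]) (use C sub in auto)
qed

lemma bounded_measurable_sq_int:
 "xi \<in> bms borel ==> (!!p. norm (xi p) <= C) ==> sq_int (lC T) (xi :: real*real => 'b::euclidean_space)"
 by (rule finite_measure.sq_int_bounded[OF finite_measure_Cyl]) (auto intro: borel_imp_lbo)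

text \<open>\<open>r\<close> fixes the uniformly convergent magnetizations; the weights act on the
  sequence already thinned by \<open>r\<close>.\<close>

locale limit_point = discrete_family +
 fixes r :: "nat => nat" and mu :: "real*real => real ^ 2" and ux ut :: "real*real => real" and mx mt :: "real*real => real ^ 2"
  and A :: "nat => nat set" and c :: "nat => nat => real"
 assumes r: "strict_mono r" and mub: "mu \<in> bms borel" and muM: "!!p. norm (mu p) <= Mb"
  and ul: "uniform_limit (Cyl T) (%n. Ms (r n)) mu sequentially"
  and lb: "ux \<in> bms borel" "ut \<in> bms borel" "mx \<in> bms borel" "mt \<in> bms borel"
  and lq: "sq_int (lC T) ux" "sq_int (lC T) ut" "sq_int (lC T) mx" "sq_int (lC T) mt"
  and cw: "!!n. conv_weights n (A n) (c n)"
  and cP: "(%n. nsq (lC T) (%p. (\<Sum>k\<in>A n. c n k *R Ps (r k) p) - ux p)) ----> 0"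
  and cV: "(%n. nsq (lC T) (%p. (\<Sum>k\<in>A n. c n k *R Vs (r k) p) - ut p)) ----> 0"
  and cD: "(%n. nsq (lC T) (%p. (\<Sum>k\<in>A n. c n k *R Ds (r k) p) - mx p)) ----> 0"
  and cT: "(%n. nsq (lC T) (%p. (\<Sum>k\<in>A n. c n k *R Ts (r k) p) - mt p)) ----> 0"
  and slices: "AE t in tint T. (%n. nsq lO (%x. (\<Sum>k\<in>A n. c n k *R Ps (r k) (x, t)) - ux (x, t))) ----> 0
  & (%n. nsq lO (%x. (\<Sum>k\<in>A n. c n k *R Vs (r k) (x, t)) - ut (x, t))) ----> 0
  & (%n. nsq lO (%x. (\<Sum>k\<in>A n. c n k *R Ds (r k) (x, t)) - mx (x, t))) ----> 0"

lemma (in discrete_family) limit_point_exists: "\<exists>r mu ux ut mx mt A c. limit_point T lam dl K G u1 f w u m r mu ux ut mx mt A c"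
proof -
 obtain r mu where 1: "strict_mono (r :: nat => nat)" "mu \<in> bms borel" "!!p. norm (mu p) <= Mb"
  "uniform_limit (Cyl T) (%n. Ms (r n)) mu sequentially"
  using Ms_uniform_subsequence by blast
 obtain ux ut mx mt A c where 2: "ux \<in> bms borel" "ut \<in> bms borel" "mx \<in> bms borel" "mt \<in> bms borel"
  "sq_int (lC T) ux" "sq_int (lC T) ut" "sq_int (lC T) mx" "sq_int (lC T) mt" "\<forall>n. conv_weights n (A n) (c n)"
  "(%n. nsq (lC T) (%p. (\<Sum>k\<in>A n. c n k *R Ps (r k) p) - ux p)) ----> 0"
  "(%n. nsq (lC T) (%p. (\<Sum>k\<in>A n. c n k *R Vs (r k) p) - ut p)) ----> 0"
  "(%n. nsq (lC T) (%p. (\<Sum>k\<in>A n. c n k *R Ds (r k) p) - mx p)) ----> 0"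
  "(%n. nsq (lC T) (%p. (\<Sum>k\<in>A n. c n k *R Ts (r k) p) - mt p)) ----> 0"
  "AE t in tint T. (%n. nsq lO (%x. (\<Sum>k\<in>A n. c n k *R Ps (r k) (x, t)) - ux (x, t))) ----> 0
  & (%n. nsq lO (%x. (\<Sum>k\<in>A n. c n k *R Vs (r k) (x, t)) - ut (x, t))) ----> 0
  & (%n. nsq lO (%x. (\<Sum>k\<in>A n. c n k *R Ds (r k) (x, t)) - mx (x, t))) ----> 0"
  using Mazur_subsequence[of r] by (elim exE conjE) (rule that)
 have "limit_point T lam dl K G u1 f w u m r mu ux ut mx mt A c"
  by (rule limit_point.intro[OF discrete_family_axioms], rule limit_point_axioms.intro) (rule 1 2(1-8) 2(10-14) spec[OF 2(9)])+
 then show ?thesis by blast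
qed

context limit_point
begin

text \<open>The mechanism of the limit passage. The discrete equation makes the scalars
  \<open>a\<close> converge, and tail combinations preserve that limit; strong convergence of the
  combinations computes the same limit in terms of the limit derivatives.\<close>

lemma transfer:
 fixes a :: "nat => real"
 assumes "a ----> l" "(%n. \<Sum>k\<in>A n. c n k *R a k) ----> l'"
 shows "l' = l"
 using LIMSEQ_unique[OF assms(2) conv_weights_tendsto[OF cw assms(1)]] .

lemma conv_ints:
 assumes "sq_int (lC T) xi" "sq_int (lC T) et"
 shows "(%n. \<Sum>k\<in>A n. c n k *R (LINT p|lC T. Ps (r k) p <.> xi p)) ----> (LINT p|lC T. ux p <.> xi p)"
  "(%n. \<Sum>k\<in>A n. c n k *R (LINT p|lC T. Vs (r k) p <.> xi p)) ----> (LINT p|lC T. ut p <.> xi p)"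
  "(%n. \<Sum>k\<in>A n. c n k *R (LINT p|lC T. Ds (r k) p <.> et p)) ----> (LINT p|lC T. mx p <.> et p)"
  "(%n. \<Sum>k\<in>A n. c n k *R (LINT p|lC T. Ts (r k) p <.> et p)) ----> (LINT p|lC T. mt p <.> et p)"
 by (rule weighted_inner_tendsto[OF steps_sq_int(1) lq(1) cP assms(1)] weighted_inner_tendsto[OF steps_sq_int(2) lq(2) cV assms(1)]
  weighted_inner_tendsto[OF steps_sq_int(3) lq(3) cD assms(2)] weighted_inner_tendsto[OF steps_sq_int(4) lq(4) cT assms(2)])+

lemma conv_prim2:
 assumes "sq_int (lC T) xi"
 shows "(%n. \<Sum>k\<in>A n. c n k *R (LINT p|lC T. prim2 (Ps (r k)) p <.> xi p)) ----> (LINT p|lC T. prim2 ux p <.> xi p)"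
proof (rule weighted_inner_tendsto[OF prim2_sq_int(1)[OF steps_sq_int(1)] prim2_sq_int(1)[OF lq(1)] _ assms])
 have le: "nsq (lC T) (%p. (\<Sum>k\<in>A n. c n k *R prim2 (Ps (r k)) p) - prim2 ux p)
  <= 2 * nsq (lC T) (%p. (\<Sum>k\<in>A n. c n k *R Ps (r k) p) - ux p)" for n
  using prim2_diff_nsq[OF sq_int_sum[OF steps_sq_int(1)] lq(1)] prim2_sum[of "%k. Ps (r k)" "c n" "A n", OF steps_slice(1)] by metis
 show "(%n. nsq (lC T) (%p. (\<Sum>k\<in>A n. c n k *R prim2 (Ps (r k)) p) - prim2 ux p)) ----> 0"
 proof (rule tendsto_sandwich[OF _ _ tendsto_const])
  show "(%n. 2 * nsq (lC T) (%p. (\<Sum>k\<in>A n. c n k *R Ps (r k) p) - ux p)) ----> 0"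
  using tendsto_mult_right_zero[OF cP, of 2] by simp
 qed (intro always_eventually allI nsq_nonneg le)+
qed

lemma uniform_inner:
 fixes h X :: "nat => real*real => 'b::euclidean_space"
 assumes h: "!!n. sq_int (lC T) (h n)" "!!n. nsq (lC T) (h n) <= C"
  and X: "!!n. sq_int (lC T) (X n)" "sq_int (lC T) Y" and lim: "uniform_limit (Cyl T) X Y sequentially"
 shows "(%n. (LINT x|lC T. h n x <.> X n x) - (LINT x|lC T. h n x <.> Y x)) ----> 0"
 using finite_measure.integral_inner_uniform_conv[OF finite_measure_Cyl h X] lim by simp

lemma along_r: "a ----> l ==> (%n. a (r n)) ----> (l :: real)"
 using LIMSEQ_subseq_LIMSEQ[OF _ r] by (auto simp: o_def)

lemma uniform_along_r: "uniform_limit S h l sequentially ==> uniform_limit S (%n. h (r n)) (l :: 'q => 'e::metric_space) sequentially"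
 by (rule filterlim_compose[OF _ filterlim_subseq[OF r]])

text \<open>Summation by parts involves nodal displacements of the previous level, whereas the limit
  is known for strains. The link is \<open>prim2 (Ps n)\<close>, whose L2 distance to these nodal
  values is of order 1/N: one cell increment in space and one step in time. Zero initial
  displacement and \<open>xi (x, T) = 0\<close> remove the boundary terms.\<close>

lemma time_by_parts_u:
 fixes xi xit :: "real*real => real"
 assumes c: "continuous_on (CB T) xi" "continuous_on (CB T) xit"
  and d: "!!x t. x \<in> {0..1} ==> t \<in> {0..T} ==> ((%s. xi (x, s)) has_vector_derivative xit (x, t)) (at t within {0..T})"
  and z: "!!x. x \<in> {0..1} ==> xi (x, T) = 0"
 shows "(LINT p|lC T. ut p <.> xi p) + (LINT p|lC T. prim2 ux p <.> xit p) = 0"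
proof -
 let ?Q = "lC T"
 let ?L = "%n. stp (Suc n) T (%k. u n (k - 1))"
 let ?X = "%n. stp (Suc n) T (smp T xi n)"
 let ?Xt = "%n. stp (Suc n) T (%k i. ((rS n) / T) *R (smp T xi n k i - smp T xi n (k - 1) i))"
 let ?h = "%n p. ?L n p - prim2 (Ps n) p"
 note sq = CB_sq_int(1)[OF c(1)] CB_sq_int(1)[OF c(2)]
 have stq: "sq_int ?Q (stp (Suc n) T a)" for n and a :: "nat => nat => real" by (rule nsq_stp(1)[OF T]) simp
 have p2: "sq_int ?Q (prim2 (Ps n))" "nsq ?Q (prim2 (Ps n)) <= 2 * (T * K)" for n
  using prim2_sq_int[OF steps_sq_int(1)[of n]] steps_nsq(1)[of n] by (simp, linarith)
 have hq: "sq_int ?Q (?h n)" for n by (rule sq_int_diff[OF stq p2(1)])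
 have hb: "nsq ?Q (?h n) <= (2 * (T * K) + 2 * T^2 * (T * K)) / (rS n)^2" for n
 proof -
  let ?N = "Suc n"
  have q: "sq_int ?Q (%p. (1 / real ?N) *R norm (Ps n p) + (T / real ?N) *R norm (Vs n p))"
  by (intro sq_int_add sq_int_scale sq_int_norm steps_sq_int)
  have "norm (?h n p) <= norm ((1 / real ?N) *R norm (Ps n p) + (T / real ?N) *R norm (Vs n p))" if p: "p \<in> Cyl T" for p
  proof -
  let ?k = "Suc (ix ?N (snd p / T))" and ?i = "ix ?N (fst p)"
  have x: "0 < fst p" "fst p < 1" using p by (auto simp: Cyl_def Omega_def)
  have "norm (prim (u n ?k 0) (%y. P n ?k (ix ?N y)) (fst p) - u n ?k ?i) <= 1 / real ?N * norm (P n ?k ?i)"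
  by (rule prim_step[OF _ x]) (auto simp: P_def dx_def)
  moreover have "u n ?k 0 = 0" using initial(3)[of n ?k] by (simp add: supp0_def)
  ultimately have 1: "norm (prim2 (Ps n) p - u n ?k ?i) <= 1 / real ?N * norm (Ps n p)"
  by (simp add: prim2_def Ps_def stp_def del: of_nat_Suc)
  have "u n ?k ?i - ?L n p = (T / real ?N) * V n ?k ?i" using T by (simp add: stp_def V_def)
  then have 2: "norm (u n ?k ?i - ?L n p) = T / real ?N * norm (Vs n p)"
  using T by (simp add: Vs_def stp_def abs_mult del: of_nat_Suc)
  have "norm (?h n p) = norm ((prim2 (Ps n) p - u n ?k ?i) + (u n ?k ?i - ?L n p))" by (simp add: abs_minus_commute)
  also have "... <= 1 / real ?N * norm (Ps n p) + T / real ?N * norm (Vs n p)"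
  using norm_triangle_ineq 1 2 by (smt (verit))
  finally show ?thesis by simp
  qed
  then have "nsq ?Q (?h n) <= nsq ?Q (%p. (1 / real ?N) *R norm (Ps n p) + (T / real ?N) *R norm (Vs n p))"
  unfolding nsq_def by (intro integral_mono sq_intD(2)[OF hq] sq_intD(2)[OF q] power_mono) auto
  also have "... <= 2 * nsq ?Q (%p. (1 / real ?N) *R norm (Ps n p)) + 2 * nsq ?Q (%p. (T / real ?N) *R norm (Vs n p))"
  by (intro nsq_add_le sq_int_scale sq_int_norm steps_sq_int)
  also have "... = (2 * nsq ?Q (Ps n) + 2 * T^2 * nsq ?Q (Vs n)) / (real ?N)^2"
  unfolding nsq_scale by (simp add: nsq_def power_divide add_divide_distrib del: of_nat_Suc)
  also have "... <= (2 * (T * K) + 2 * T^2 * (T * K)) / (real ?N)^2"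
  using steps_nsq(1,2)[of n] T by (intro divide_right_mono add_mono mult_left_mono) auto
  finally show ?thesis .
 qed
 have h0: "(%n. nsq ?Q (?h n)) ----> 0"
 proof (rule tendsto_sandwich[OF _ _ tendsto_const])
  show "(%n. (2 * (T * K) + 2 * T^2 * (T * K)) / (rS n)^2) ----> 0"
  using tendsto_mult[OF LIMSEQ_Suc[OF lim_const_over_n[of "2 * (T * K) + 2 * T^2 * (T * K)"]] LIMSEQ_Suc[OF lim_const_over_n[of 1]]]
  by (simp add: power2_eq_square del: of_nat_Suc)
 qed (intro always_eventually allI nsq_nonneg hb)+
 have Lb: "nsq ?Q (?L n) <= 2 * (2 * (T * K)) + 2 * (2 * (T * K) + 2 * T^2 * (T * K))" for n
 proof -
  have "nsq ?Q (%p. prim2 (Ps n) p + ?h n p) <= 2 * nsq ?Q (prim2 (Ps n)) + 2 * nsq ?Q (?h n)" by (rule nsq_add_le[OF p2(1) hq])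
  moreover have "(2 * (T * K) + 2 * T^2 * (T * K)) / (rS n)^2 <= 2 * (T * K) + 2 * T^2 * (T * K)"
  proof -
  have "1 <= (rS n)^2" by (rule one_le_power) simp
  moreover have "0 <= 2 * (T * K) + 2 * T^2 * (T * K)" using T K by simp
  ultimately show ?thesis using divide_left_mono[of 1 "(rS n)^2" "2 * (T * K) + 2 * T^2 * (T * K)"] by simp
  qed
  ultimately show ?thesis using p2(2)[of n] hb[of n] by (simp add: algebra_simps)
 qed
 have 1: "(%n. (LINT p|?Q. Vs n p <.> ?X n p) - (LINT p|?Q. Vs n p <.> xi p)) ----> 0"
  by (rule uniform_inner[OF steps_sq_int(2) steps_nsq(2) stq sq(1) gconv_uniform[OF gconv_smp c(1) T]])
 have 2: "(%n. (LINT p|?Q. ?L n p <.> ?Xt n p) - (LINT p|?Q. ?L n p <.> xit p)) ----> 0"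
  by (rule uniform_inner[OF stq Lb stq sq(2) gconv_uniform[OF gconv_dt[OF T c(2) d] c(2) T]])
 have 3: "(%n. LINT p|?Q. ?h n p <.> xit p) ----> 0" by (rule inner_null[OF hq h0 sq(2)])
 have e0: "(LINT p|?Q. Vs n p <.> ?X n p) + (LINT p|?Q. ?L n p <.> ?Xt n p) = 0" for n
 proof -
  have "smp T xi n (Suc n) i = 0" if "i < Suc n" for i using z[of "real i / (rS n)"] that by (simp add: smp_def)
  then show ?thesis using summation_by_parts_stp[OF T, of "Suc n" "u n" "smp T xi n"]
  unfolding Vs_def V_def[abs_def] by (simp add: initial del: of_nat_Suc sum.lessThan_Suc)
 qed
 have "(LINT p|?Q. ?h n p <.> xit p) = (LINT p|?Q. ?L n p <.> xit p) - (LINT p|?Q. prim2 (Ps n) p <.> xit p)" for n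
  unfolding inner_diff_left by (rule Bint_diff) (intro sq_int_inner_integrable stq p2 sq)+
 then have "(LINT p|?Q. Vs n p <.> xi p) + (LINT p|?Q. prim2 (Ps n) p <.> xit p)
  = 0 - ((LINT p|?Q. Vs n p <.> ?X n p) - (LINT p|?Q. Vs n p <.> xi p)) - ((LINT p|?Q. ?L n p <.> ?Xt n p) - (LINT p|?Q. ?L n p <.> xit p))
  - (LINT p|?Q. ?h n p <.> xit p)" for n
  using e0[of n] by simp
 then have "(%n. (LINT p|?Q. Vs n p <.> xi p) + (LINT p|?Q. prim2 (Ps n) p <.> xit p)) ----> 0 - 0 - 0 - 0"
  by (simp only:) (intro tendsto_diff 1 2 3 tendsto_const)
 then have "(%n. (LINT p|?Q. Vs (r n) p <.> xi p) + (LINT p|?Q. prim2 (Ps (r n)) p <.> xit p)) ----> 0"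
  using along_r by simp
 moreover have "(%n. \<Sum>k\<in>A n. c n k *R ((LINT p|?Q. Vs (r k) p <.> xi p) + (LINT p|?Q. prim2 (Ps (r k)) p <.> xit p)))
  ----> (LINT p|?Q. ut p <.> xi p) + (LINT p|?Q. prim2 ux p <.> xit p)"
  unfolding scaleR_add_right sum.distrib by (intro tendsto_add conv_ints(2)[OF sq(1) sq_int_zero] conv_prim2[OF sq(2)])
 ultimately show ?thesis by (rule transfer)
qed

end

lemma fst_sq_int:
 fixes u :: "real => 'b::euclidean_space"
 assumes T: "T > 0" and u: "sq_int lO u"
 shows "sq_int (lC T) (%p. u (fst p))"
 unfolding sq_int_def
 using integral_cell2_fst(1)[OF T, of 0 1, OF _ Om.sq_int_integrable[OF u]] integral_cell2_fst(1)[OF T, of 0 1, OF _ sq_intD(2)[OF u]]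
 by auto

lemma integral_Cyl_fst:
 fixes h :: "real => real"
 assumes T: "T > 0" and h: "integrable lO h"
 shows "(LINT p|lC T. h (fst p)) = T * (LINT x|lO. h x)"
proof -
 have "(LINT p|lC T. h (fst p)) = (LINT t|tint T. LINT x|lO. h (fst (x, t)))"
  by (rule integral_Cyl_iterated(1)[OF integral_cell2_fst(1)[OF T _ h, of 0 1]]) simp
 also have "... = measure (tint T) {0<..<T} * (LINT x|lO. h x)" by simp
 also have "measure (tint T) {0<..<T} = T" using T by (simp add: measure_def measure_lbo)
 finally show ?thesis .
qed

lemma bounded_linear_Lam: "bounded_linear Lam"
 unfolding linear_conv_bounded_linear[symmetric] by (rule linearI) (simp_all add: Lam_def vec_eq_iff forall_2)

lemma nsq_bounded_le:
 assumes "finite_measure M" and f: "f \<in> bms M" "!!x. x \<in> space M ==> norm (f x) <= C"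
 shows "nsq M f <= C^2 * measure M (space M)"
proof -
 interpret finite_measure M by fact
 have "nsq M f <= (LINT x|M. C^2)"
  unfolding nsq_def by (rule integral_mono) (auto intro!: power_mono f sq_intD(2)[OF sq_int_bounded[OF f]])
 then show ?thesis by (simp add: mult.commute)
qed

context limit_point
begin

lemma CB_bounded:
 fixes xi :: "real*real => 'b::euclidean_space"
 assumes "continuous_on (CB T) xi" shows "bounded (xi ` Cyl T)"
proof -
 have "Cyl T \<subseteq> CB T" by (auto simp: Cyl_def Omega_def)
 then show ?thesis using compact_imp_bounded[OF compact_continuous_image[OF assms compact_CB]] by (meson bounded_subset image_mono)
qed

lemma mu_bounded: "bounded (mu ` Cyl T)" by (intro boundedI[of _ Mb]) (use muM in auto)

lemma composition_uniform:
 fixes kp :: "real ^ 2 => 'b::euclidean_space"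
 assumes kp: "continuous_on UNIV kp" and h: "!!n p. p \<in> Cyl T ==> norm (h n p) <= Mb" "uniform_limit (Cyl T) h mu sequentially"
 shows "uniform_limit (Cyl T) (%n p. kp (h n p)) (%p. kp (mu p)) sequentially"
proof (rule uniform_limit_compose_uniformly_continuous_on[OF h(2)])
 show "uniformly_continuous_on (cball 0 Mb) kp" by (intro compact_uniformly_continuous continuous_on_subset[OF kp]) auto
qed (use h(1) in auto)

text \<open>Two replacements: first \<open>Y n\<close> by its limit against the bounded
  compositions, then the compositions by their uniform limit against the fixed factor
  \<open>Yl\<close>.\<close>

lemma composition_integral:
 fixes kp :: "real ^ 2 => 'b::euclidean_space"
 assumes kp: "continuous_on UNIV kp" and h: "!!n p. p \<in> Cyl T ==> norm (h n p) <= Mb" "uniform_limit (Cyl T) h mu sequentially"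
  and hb: "!!n. h n \<in> bms borel"
  and Y: "!!n. sq_int (lC T) (Y n)" "sq_int (lC T) Yl" "uniform_limit (Cyl T) Y Yl sequentially"
 shows "(%n. LINT p|lC T. kp (h n p) <.> Y n p) ----> (LINT p|lC T. kp (mu p) <.> Yl p)"
proof -
 interpret Q: finite_measure "lC T" by (rule finite_measure_Cyl)
 have "compact (kp ` cball 0 Mb)" by (intro compact_continuous_image continuous_on_subset[OF kp]) auto
 then obtain C where "\<forall>y\<in>kp ` cball 0 Mb. norm y <= C" using compact_imp_bounded bounded_iff by blast
 then have C: "norm (kp y) <= C" if "norm y <= Mb" for y using that by auto
 have [measurable]: "kp \<in> bms borel" by (rule borel_measurable_continuous_onI[OF kp])
 have mh: "(%p. kp (h n p)) \<in> bms (lC T)" "(%p. kp (mu p)) \<in> bms (lC T)" for n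
  using hb[of n] mub by (auto intro: borel_imp_lbo)
 have sq: "sq_int (lC T) (%p. kp (h n p))" "sq_int (lC T) (%p. kp (mu p))" for n
  by (rule Q.sq_int_bounded[OF mh(1), of n C], use C h(1) in auto) (rule Q.sq_int_bounded[OF mh(2), of C], use C muM in auto)
 have nb: "nsq (lC T) (%p. kp (h n p)) <= C^2 * measure (lC T) (space (lC T))" for n
  by (rule nsq_bounded_le[OF finite_measure_Cyl mh(1)]) (use C h(1) in auto)
 have 1: "(%n. (LINT p|lC T. kp (h n p) <.> Y n p) - (LINT p|lC T. kp (h n p) <.> Yl p)) ----> 0"
  by (rule uniform_inner[OF sq(1) nb Y])
 have 2: "(%n. (LINT p|lC T. Yl p <.> kp (h n p)) - (LINT p|lC T. Yl p <.> kp (mu p))) ----> 0"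
  by (rule uniform_inner[OF Y(2) order_refl sq composition_uniform[OF kp h]])
 have "(%n. (LINT p|lC T. kp (h n p) <.> Y n p) - (LINT p|lC T. kp (mu p) <.> Yl p)) ----> 0"
  using tendsto_add[OF 1 2] by (simp add: inner_commute[of "Yl _"])
 then show ?thesis by (simp add: LIM_zero_iff)
qed

lemma Ms_conditions: "p \<in> Cyl T ==> norm (Ms (r n) p) <= Mb" "p \<in> Cyl T ==> norm (Ls (r n) p) <= Mb"
 "uniform_limit (Cyl T) (%n. Ls (r n)) mu sequentially"
proof -
 show "p \<in> Cyl T ==> norm (Ms (r n) p) <= Mb" "p \<in> Cyl T ==> norm (Ls (r n) p) <= Mb" by (rule Ms_bounded; assumption)+
 have "uniform_limit (Cyl T) (%n p. Ms (r n) p - (Ms (r n) p - Ls (r n) p)) (%p. mu p - 0) sequentially"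
  by (intro uniform_limit_minus ul uniform_along_r[OF Ls_uniform])
 then show "uniform_limit (Cyl T) (%n. Ls (r n)) mu sequentially" by simp
qed

lemma stp_sq_int: "sq_int (lC T) (stp (Suc n) T (a :: nat => nat => 'b::euclidean_space))"
 by (rule nsq_stp(1)[OF T]) simp

text \<open>In contrast to the displacement, the initial level does not vanish: it consists of cell
  averages of \<open>w\<close> and produces the term on the right.\<close>

lemma time_by_parts_m:
 fixes ps pst :: "real*real => real ^ 2"
 assumes c: "continuous_on (CB T) ps" "continuous_on (CB T) pst"
  and d: "!!x t. x \<in> {0..1} ==> t \<in> {0..T} ==> ((%s. ps (x, s)) has_vector_derivative pst (x, t)) (at t within {0..T})"
  and z: "!!x. x \<in> {0..1} ==> ps (x, T) = 0"
 shows "(LINT p|lC T. mt p <.> ps p) + (LINT p|lC T. mu p <.> pst p) = - (LINT x|lO. w x <.> ps (x, 0))"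
proof -
 let ?Q = "lC T"
 let ?X = "%n. stp (Suc n) T (smp T ps n)"
 let ?Xt = "%n. stp (Suc n) T (%k i. ((rS n) / T) *R (smp T ps n k i - smp T ps n (k - 1) i))"
 \<comment> \<open>The initial values of \<open>ps\<close> extended constantly in time: the sum over
   the initial level becomes an integral over the cylinder divided by T, to which the convergence
   lemmas on the cylinder apply.\<close>
 let ?zt = "%p. ps (fst p, 0)"
 let ?Z = "%n. stp (Suc n) T (smp T ?zt n)"
 note sq = CB_sq_int(1)[OF c(1)] CB_sq_int(1)[OF c(2)]
 have c0: "continuous_on (CB T) ?zt"
  by (rule continuous_on_compose2[OF c(1)]) (use T in \<open>auto intro!: continuous_intros\<close>)
 have sw: "sq_int lO (%x. ps (x, 0))"
 proof -
  have cc: "continuous_on {0..1} (%x. ps (x, 0))" by (rule continuous_on_compose2[OF c(1)]) (use T in \<open>auto intro!: continuous_intros\<close>)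
  have "continuous_on Omega (%x. ps (x, 0))" by (rule continuous_on_subset[OF cc]) (auto simp: Omega_def)
  then have "(%x. ps (x, 0)) \<in> bms lO"
  unfolding lbo_measurable_iff[OF Omega_borel] by (rule borel_measurable_continuous_on_indicator[OF Omega_borel])
  moreover obtain C where "\<forall>p\<in>CB T. norm (ps p) <= C" using CB_sq_int(2)[OF c(1)] by blast
  ultimately show ?thesis by (intro Om.sq_int_bounded[where C = C]) (use T in \<open>auto simp: Omega_def\<close>)
 qed
 have 1: "(%n. (LINT p|?Q. Ts (r n) p <.> ?X (r n) p) - (LINT p|?Q. Ts (r n) p <.> ps p)) ----> 0"
  by (rule uniform_inner[OF steps_sq_int(4) steps_nsq(4) stp_sq_int sq(1) uniform_along_r[OF gconv_uniform[OF gconv_smp c(1) T]]])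
 have 2: "(%n. LINT p|?Q. Ls (r n) p <.> ?Xt (r n) p) ----> (LINT p|?Q. mu p <.> pst p)"
  by (rule composition_integral[where kp = "%y. y", OF continuous_on_id Ms_conditions(2,3) steps_borel(6) stp_sq_int sq(2)
  uniform_along_r[OF gconv_uniform[OF gconv_dt[OF T c(2) d] c(2) T]]])
 have 3: "(%n. (LINT p|?Q. w (fst p) <.> ?Z (r n) p) - (LINT p|?Q. w (fst p) <.> ?zt p)) ----> 0"
  by (rule uniform_inner[OF fst_sq_int[OF T w] order_refl stp_sq_int CB_sq_int(1)[OF c0] uniform_along_r[OF gconv_uniform[OF gconv_smp c0 T]]])
 have iw: "integrable lO w" by (rule Om.sq_int_integrable[OF w])
 have e0: "(LINT p|?Q. Ts n p <.> ?X n p) + (LINT p|?Q. Ls n p <.> ?Xt n p) = - (1 / T * (LINT p|?Q. w (fst p) <.> ?Z n p))" for n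
 proof -
  let ?N = "Suc n"
  let ?W = "%i. LINT x|lO. ind (cell ?N i) x *R w x"
  have zN: "smp T ps n ?N i = 0" if "i < ?N" for i using z[of "real i / real ?N"] that by (simp add: smp_def)
  have "(LINT p|?Q. ?Z n p <.> w (fst p)) = (SUM k<?N. SUM i<?N. smp T ?zt n (Suc k) i <.> ((T / real ?N) *R ?W i))"
  proof -
  have "(LINT p|?Q. ?Z n p <.> w (fst p)) = (SUM k<?N. SUM i<?N. smp T ?zt n (Suc k) i <.> (LINT p|?Q. ind (cell2 ?N T k i) p *R w (fst p)))"
  by (rule integral_stp_inner(2)[OF T _ integral_cell2_fst(1)[OF T _ iw, of 0 1]]) auto
  also have "... = (SUM k<?N. SUM i<?N. smp T ?zt n (Suc k) i <.> ((T / real ?N) *R ?W i))"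
  proof (intro sum.cong refl)
  fix k i assume "k \<in> {..<?N}"
  then show "smp T ?zt n (Suc k) i <.> (LINT p|?Q. ind (cell2 ?N T k i) p *R w (fst p)) = smp T ?zt n (Suc k) i <.> ((T / real ?N) *R ?W i)"
  by (subst integral_cell2_fst(2)[OF T _ iw]) auto
  qed
  finally show ?thesis .
  qed
  also have "... = (SUM k<?N. (T / real ?N) * (SUM i<?N. smp T ps n 0 i <.> ?W i))"
  by (simp add: smp_def sum_distrib_left del: of_nat_Suc sum.lessThan_Suc)
  also have "... = T * (SUM i<?N. smp T ps n 0 i <.> ?W i)" by (simp del: of_nat_Suc sum.lessThan_Suc)
  finally have A: "(LINT p|?Q. w (fst p) <.> ?Z n p) = T * (SUM i<?N. smp T ps n 0 i <.> ?W i)" by (simp only: inner_commute)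
  have "1 / real ?N * (SUM i<?N. m n ?N i <.> smp T ps n ?N i - m n 0 i <.> smp T ps n 0 i) = 1 / real ?N * (SUM i<?N. - (real ?N * (smp T ps n 0 i <.> ?W i)))"
  by (intro arg_cong[where f = "%s. 1 / real ?N * s"] sum.cong refl) (simp add: zN initial inner_commute del: of_nat_Suc)
  also have "... = - (SUM i<?N. smp T ps n 0 i <.> ?W i)"
  unfolding sum_negf sum_distrib_left[symmetric] by (simp del: of_nat_Suc sum.lessThan_Suc)
  also have "... = - (1 / T * (LINT p|?Q. w (fst p) <.> ?Z n p))" using T unfolding A by simp
  finally show ?thesis using summation_by_parts_stp[OF T, of "Suc n" "m n" "smp T ps n"]
  unfolding Ts_def Tm_def[abs_def] Ls_def by simp
 qed
 have B: "1 / T * (LINT p|?Q. w (fst p) <.> ?zt p) = (LINT x|lO. w x <.> ps (x, 0))"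
  using integral_Cyl_fst[OF T sq_int_inner_integrable[OF w sw]] T by simp
 have eq: "(LINT p|?Q. Ts (r n) p <.> ps p) = - ((LINT p|?Q. Ts (r n) p <.> ?X (r n) p) - (LINT p|?Q. Ts (r n) p <.> ps p))
  - 1 / T * ((LINT p|?Q. w (fst p) <.> ?Z (r n) p) - (LINT p|?Q. w (fst p) <.> ?zt p)) - 1 / T * (LINT p|?Q. w (fst p) <.> ?zt p)
  - (LINT p|?Q. Ls (r n) p <.> ?Xt (r n) p)" for n
  using e0[of "r n"] by (simp add: right_diff_distrib)
 have lim: "(%n. - ((LINT p|?Q. Ts (r n) p <.> ?X (r n) p) - (LINT p|?Q. Ts (r n) p <.> ps p))
  - 1 / T * ((LINT p|?Q. w (fst p) <.> ?Z (r n) p) - (LINT p|?Q. w (fst p) <.> ?zt p)) - 1 / T * (LINT p|?Q. w (fst p) <.> ?zt p)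
  - (LINT p|?Q. Ls (r n) p <.> ?Xt (r n) p)) ----> - 0 - 1 / T * 0 - 1 / T * (LINT p|?Q. w (fst p) <.> ?zt p) - (LINT p|?Q. mu p <.> pst p)"
  by (intro tendsto_diff tendsto_minus tendsto_mult 1 2 3 tendsto_const)
 have "(%n. LINT p|?Q. Ts (r n) p <.> ps p) ----> - 0 - 1 / T * 0 - 1 / T * (LINT p|?Q. w (fst p) <.> ?zt p) - (LINT p|?Q. mu p <.> pst p)"
  by (rule tendsto_cong[THEN iffD2, OF always_eventually lim]) (rule allI, rule eq)
 then have "(%n. LINT p|?Q. Ts (r n) p <.> ps p) ----> - (LINT x|lO. w x <.> ps (x, 0)) - (LINT p|?Q. mu p <.> pst p)"
  unfolding B by simp
 from transfer[OF this conv_ints(4)[OF sq_int_zero sq(1)]] show ?thesis by simp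
qed

text \<open>In the coupling, \<open>Ps\<close> converges only through combinations, but its partner,
  \<open>Lam\<close> of the magnetization against \<open>ps\<close>, converges uniformly. The cubic
  term contains the magnetization alone and converges outright.\<close>

lemma magnetization_limit:
 fixes ps psx :: "real*real => real ^ 2"
 assumes c: "continuous_on (CB T) ps" "continuous_on (CB T) psx"
  and d: "!!x t. x \<in> {0..1} ==> t \<in> {0..T} ==> ((%y. ps (y, t)) has_vector_derivative psx (x, t)) (at x within {0..1})"
 shows "(LINT p|lC T. mt p <.> ps p) + (LINT p|lC T. ((((norm (mu p))^2 - 1) / dl) *R mu p) <.> ps p)
  + (LINT p|lC T. ux p <.> (lam * (Lam (mu p) <.> ps p))) + (LINT p|lC T. mx p <.> psx p) = 0"
proof -
 let ?Q = "lC T"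
 interpret Q: finite_measure ?Q by (rule finite_measure_Cyl)
 let ?X = "%n. stp (Suc n) T (smp T ps n)"
 let ?Xx = "%n. stp (Suc n) T (%k i. (rS n) *R (smp T ps n k (Suc i) - smp T ps n k i))"
 let ?k = "%y. (((norm y)^2 - 1) / dl) *R (y :: real ^ 2)"
 note sq = CB_sq_int(1)[OF c(1)] CB_sq_int(1)[OF c(2)]
 note uX = uniform_along_r[OF gconv_uniform[OF gconv_smp c(1) T]]
 have LamX: "uniform_limit (Cyl T) (%n p. lam * (Lam (Ms (r n) p) <.> ?X (r n) p)) (%p. lam * (Lam (mu p) <.> ps p)) sequentially"
 proof -
  have "bounded ((%p. Lam (mu p)) ` Cyl T)"
  using bounded_linear_image[OF mu_bounded bounded_linear_Lam] by (simp add: image_image)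
  then have "uniform_limit (Cyl T) (%n p. Lam (Ms (r n) p) <.> ?X (r n) p) (%p. Lam (mu p) <.> ps p) sequentially"
  by (rule bounded_bilinear.bounded_uniform_limit[OF bounded_bilinear_inner bounded_linear.uniform_limit[OF bounded_linear_Lam ul] uX CB_bounded[OF c(1)]])
  then show ?thesis by (rule bounded_linear.uniform_limit[OF bounded_linear_mult_right])
 qed
 have Lq: "sq_int ?Q (%p. lam * (Lam (mu p) <.> ps p))"
 proof -
  have [measurable]: "Lam \<in> bms borel"
  by (rule borel_measurable_continuous_onI[OF linear_continuous_on[OF bounded_linear_Lam]])
  have [measurable]: "mu \<in> bms ?Q" "ps \<in> bms ?Q" using sq_intD(1)[OF sq(1)] mub by (auto intro: borel_imp_lbo)
  have b: "bounded ((%p. lam * (Lam (mu p) <.> ps p)) ` Cyl T)"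
  proof -
  obtain C where C: "!!p. p \<in> Cyl T ==> norm (ps p) <= C" using CB_bounded[OF c(1)] by (auto simp: bounded_iff)
  have "norm (lam * (Lam (mu p) <.> ps p)) <= \<bar>lam\<bar> * (Mb * C)" if "p \<in> Cyl T" for p
  proof -
  have "\<bar>Lam (mu p) <.> ps p\<bar> <= norm (Lam (mu p)) * norm (ps p)" by (rule Cauchy_Schwarz_ineq2)
  also have "... <= Mb * C" using muM[of p] C[OF that] by (intro mult_mono) (auto simp: norm_Lam intro: order_trans[OF norm_ge_zero])
  finally show ?thesis by (simp add: abs_mult mult_left_mono)
  qed
  then show ?thesis by (intro boundedI[of _ "\<bar>lam\<bar> * (Mb * C)"]) auto
  qed
  then obtain C where "!!p. p \<in> Cyl T ==> norm (lam * (Lam (mu p) <.> ps p)) <= C" by (auto simp: bounded_iff)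
  then show ?thesis by (intro Q.sq_int_bounded[where C = C]) auto
 qed
 have 1: "(%n. (LINT p|?Q. Ts (r n) p <.> ?X (r n) p) - (LINT p|?Q. Ts (r n) p <.> ps p)) ----> 0"
  by (rule uniform_inner[OF steps_sq_int(4) steps_nsq(4) stp_sq_int sq(1) uX])
 have 2: "(%n. LINT p|?Q. ?k (Ms (r n) p) <.> ?X (r n) p) ----> (LINT p|?Q. ?k (mu p) <.> ps p)"
  by (rule composition_integral[OF _ Ms_conditions(1) ul steps_borel(5) stp_sq_int sq(1) uX]) (intro continuous_intros, use dl in auto)
 have 3: "(%n. (LINT p|?Q. Ps (r n) p <.> (lam * (Lam (Ms (r n) p) <.> ?X (r n) p))) - (LINT p|?Q. Ps (r n) p <.> (lam * (Lam (mu p) <.> ps p)))) ----> 0"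
 proof (rule uniform_inner[OF steps_sq_int(1) steps_nsq(1) _ Lq LamX])
  show "sq_int ?Q (%p. lam * (Lam (Ms (r n) p) <.> ?X (r n) p))" for n
  using stp_sq_int[of "r n" "%k i. lam * (Lam (m (r n) k i) <.> smp T ps (r n) k i)"] by (simp add: stp_def[abs_def] Ms_def)
 qed
 have 4: "(%n. (LINT p|?Q. Ds (r n) p <.> ?Xx (r n) p) - (LINT p|?Q. Ds (r n) p <.> psx p)) ----> 0"
  by (rule uniform_inner[OF steps_sq_int(3) steps_nsq(3) stp_sq_int sq(2) uniform_along_r[OF gconv_uniform[OF gconv_dx[OF T c(2) d] c(2) T]]])
 have e0: "(LINT p|?Q. Ts n p <.> ?X n p) + (LINT p|?Q. ?k (Ms n p) <.> ?X n p) + (LINT p|?Q. Ps n p <.> (lam * (Lam (Ms n p) <.> ?X n p)))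
  + (LINT p|?Q. Ds n p <.> ?Xx n p) = 0" for n
 proof -
  have "(LINT p|?Q. Ds n p <.> ?Xx n p) = (LINT p|?Q. Ds n p <.> stp (Suc n) T (%k. dxm (Suc n) (smp T ps n k)) p)"
  by (intro Bint_cong refl) (simp add: Ds_def Dm_def stp_def dxm_def)
  then show ?thesis using magnetization_identity[of n "smp T ps n"] by (simp add: Ts_def Ms_def Ps_def Ds_def stp_def)
 qed
 let ?a = "%n. (LINT p|?Q. Ts (r n) p <.> ps p) + (LINT p|?Q. ?k (mu p) <.> ps p) + (LINT p|?Q. Ps (r n) p <.> (lam * (Lam (mu p) <.> ps p)))
  + (LINT p|?Q. Ds (r n) p <.> psx p)"
 have eq: "?a n = - ((LINT p|?Q. Ts (r n) p <.> ?X (r n) p) - (LINT p|?Q. Ts (r n) p <.> ps p))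
  + ((LINT p|?Q. ?k (mu p) <.> ps p) - (LINT p|?Q. ?k (Ms (r n) p) <.> ?X (r n) p))
  - ((LINT p|?Q. Ps (r n) p <.> (lam * (Lam (Ms (r n) p) <.> ?X (r n) p))) - (LINT p|?Q. Ps (r n) p <.> (lam * (Lam (mu p) <.> ps p))))
  - ((LINT p|?Q. Ds (r n) p <.> ?Xx (r n) p) - (LINT p|?Q. Ds (r n) p <.> psx p))" for n
  using e0[of "r n"] by linarith
 have lim: "(%n. - ((LINT p|?Q. Ts (r n) p <.> ?X (r n) p) - (LINT p|?Q. Ts (r n) p <.> ps p))
  + ((LINT p|?Q. ?k (mu p) <.> ps p) - (LINT p|?Q. ?k (Ms (r n) p) <.> ?X (r n) p))
  - ((LINT p|?Q. Ps (r n) p <.> (lam * (Lam (Ms (r n) p) <.> ?X (r n) p))) - (LINT p|?Q. Ps (r n) p <.> (lam * (Lam (mu p) <.> ps p))))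
  - ((LINT p|?Q. Ds (r n) p <.> ?Xx (r n) p) - (LINT p|?Q. Ds (r n) p <.> psx p))) ---->
  - 0 + ((LINT p|?Q. ?k (mu p) <.> ps p) - (LINT p|?Q. ?k (mu p) <.> ps p)) - 0 - 0"
  by (intro tendsto_add tendsto_diff tendsto_minus 1 2 3 4 tendsto_const)
 have "?a ----> - 0 + ((LINT p|?Q. ?k (mu p) <.> ps p) - (LINT p|?Q. ?k (mu p) <.> ps p)) - 0 - 0"
  by (rule tendsto_cong[THEN iffD2, OF always_eventually lim]) (rule allI, rule eq)
 then have "?a ----> 0" by simp
 moreover have "(%n. \<Sum>k\<in>A n. c n k *R ?a k) ----> (LINT p|?Q. mt p <.> ps p) + (LINT p|?Q. ?k (mu p) <.> ps p)
  + (LINT p|?Q. ux p <.> (lam * (Lam (mu p) <.> ps p))) + (LINT p|?Q. mx p <.> psx p)"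
  unfolding scaleR_add_right sum.distrib
  by (intro tendsto_add conv_ints(1)[OF Lq sq(1)] conv_ints(3,4)[OF sq_int_zero] sq conv_weights_tendsto[OF cw tendsto_const])
 ultimately show ?thesis by (rule transfer)
qed

end

text \<open>The transposed Volterra operator of \<open>volterra_swap\<close>, applied to a test
  function cut to the cylinder.\<close>

definition volt :: "real => (real => real) => (real*real => real) => real*real => real" where
 "volt T k ph p = (LINT r|tint T. k r * (ind (Cyl T) (fst p, snd p + r) * ph (fst p, snd p + r)))"

lemma volt_facts:
 assumes T: "T > 0" and k: "k \<in> bms borel" "integrable (tint T) k" and c: "continuous_on (CB T) ph"
 shows "sq_int (lC T) (volt T k ph)"
  "g \<in> bms borel ==> integrable (lC T) g ==>
  (LINT p|lC T. LINT s|tint (snd p). k (snd p - s) * g (fst p, s) * (ind (Cyl T) p * ph p)) = (LINT p|lC T. g p * volt T k ph p)"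
  "g \<in> bms borel ==> integrable (lC T) g ==>
  integrable (lC T) (%p. LINT s|tint (snd p). k (snd p - s) * g (fst p, s) * (ind (Cyl T) p * ph p))"
proof -
 let ?xi = "%p. ind (Cyl T) p * ph p"
 have b: "?xi \<in> bms borel" using CB_sq_int(3)[OF c] by simp
 obtain C where C: "\<forall>p\<in>CB T. norm (ph p) <= C" using CB_sq_int(2)[OF c] by blast
 have bd: "\<bar>?xi p\<bar> <= max C 0" for p
 proof (cases "p \<in> Cyl T")
  case True
  then have "p \<in> CB T" by (auto simp: Cyl_def Omega_def)
  then have "norm (ph p) <= C" using C by blast
  then show ?thesis using True by simp
 qed simp
 have z: "p \<notin> Cyl T ==> ?xi p = 0" for p by simp
 have g0: "(%_. 0::real) \<in> bms borel" "integrable (lC T) (%_. 0::real)" by simp_all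
 have "volt T k ph \<in> bms borel"
  unfolding volt_def[abs_def] by (rule volterra_swap(1)[OF T k g0 b bd z])
 moreover have "norm (volt T k ph p) <= max C 0 * (LINT r|tint T. \<bar>k r\<bar>)" for p
  unfolding volt_def real_norm_def by (rule volterra_swap(2)[OF T k g0 b bd z])
 ultimately show "sq_int (lC T) (volt T k ph)" by (rule bounded_measurable_sq_int)
 show "(LINT p|lC T. LINT s|tint (snd p). k (snd p - s) * g (fst p, s) * ?xi p) = (LINT p|lC T. g p * volt T k ph p)"
  if "g \<in> bms borel" "integrable (lC T) g"
  unfolding volt_def by (rule volterra_swap(3)[OF T k that b bd z])
 show "integrable (lC T) (%p. LINT s|tint (snd p). k (snd p - s) * g (fst p, s) * ?xi p)"
  if "g \<in> bms borel" "integrable (lC T) g"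
  by (rule volterra_swap(4)[OF T k that b bd z])
qed

lemma continuous_qf: "continuous_on UNIV (qf lam)"
 unfolding qf_def by (intro continuous_intros linear_continuous_on[OF bounded_linear_Lam])

context limit_point
begin

text \<open>All kernels sit on the test side, where convergence is uniform by
  \<open>kernel_uniform\<close>. So \<open>Ps\<close> and \<open>Vs\<close> enter linearly, and the
  nonlinear stress enters through the uniformly convergent \<open>Ls\<close>.\<close>

lemma momentum_limit:
 fixes ph phx :: "real*real => real"
 assumes c: "continuous_on (CB T) ph" "continuous_on (CB T) phx"
  and d: "!!x t. x \<in> {0..1} ==> t \<in> {0..T} ==> ((%y. ph (y, t)) has_vector_derivative phx (x, t)) (at x within {0..1})"
  and z: "!!t. t \<in> {0..T} ==> ph (0, t) = 0" "!!t. t \<in> {0..T} ==> ph (1, t) = 0" "!!x. x \<in> {0..1} ==> ph (x, T) = 0"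
 shows "(LINT p|lC T. ut p <.> ph p) + (LINT p|lC T. ux p <.> volt T (Gz G) phx p)
  + (LINT p|lC T. qf lam (mu p) <.> volt T (%r. 1) phx p)
  = (LINT p|lC T. u1 (fst p) <.> ph p) + (LINT p|lC T. f p <.> volt T (%r. 1) ph p)"
proof -
 let ?Q = "lC T"
 interpret I: finite_measure "tint T" by (rule finite_measure_lbo_Ioo)
 \<comment> \<open>Cutting from node N on yields a discrete Dirichlet test function. At node N the
   cut changes nothing because \<open>ph\<close> is zero at x = 1, so the differences are those of
   the samples.\<close>
 define b where "b n k i = (if i < Suc n then smp T ph n k i else 0)" for n k i
 let ?D = "%n k i. (rS n) *R (smp T ph n k (Suc i) - smp T ph n k i)"
 let ?X = "%n. stp (Suc n) T (b n)"
 let ?KG = "%n. stp (Suc n) T (kstp (Suc n) T (Gz G) (%k. dx (Suc n) (b n k)))"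
 let ?K1 = "%n. stp (Suc n) T (kstp (Suc n) T (%r. 1) (%k. dx (Suc n) (b n k)))"
 let ?KF = "%n. stp (Suc n) T (kstp (Suc n) T (%r. 1) (b n))"
 have k1: "(%r::real. 1::real) \<in> bms borel" "integrable (tint T) (%r. 1::real)" by simp_all
 have kG: "Gz G \<in> bms borel" "integrable (tint T) (Gz G)"
  using relaxation_borel[OF G] Gz_integrable[OF G T] by (simp_all add: Gz_def[abs_def])
 have bs: "b n k i = smp T ph n k i" if "i <= Suc n" "k <= Suc n" for n k i
 proof (cases "i < Suc n")
  case False
  then have i: "i = Suc n" using that by simp
  have "real k * (T / (rS n)) \<in> {0..T}" using grid_in_CB[of 0 "Suc n" k T] that T by simp
  then show ?thesis using z(2) by (simp add: b_def smp_def i del: of_nat_Suc)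
 qed (simp add: b_def)
 have sup: "supp0 (Suc n) (b n k)" if "k <= Suc n" for n k
 proof -
  have "real k * (T / (rS n)) \<in> {0..T}" using grid_in_CB[of 0 "Suc n" k T] that T by simp
  then show ?thesis using z(1) by (simp add: supp0_def b_def smp_def del: of_nat_Suc)
 qed
 have gb: "gconv T b ph" using gconv_smp[of T ph] unfolding gconv_def by (simp add: b_def)
 have gD: "gconv T (%n k. dx (Suc n) (b n k)) phx"
 proof -
  have "dx (Suc n) (b n k) i = ?D n k i" if "i < Suc n" "k <= Suc n" for n k i
  using bs[of i n k] bs[of "Suc i" n k] that by (simp add: dx_def)
  then show ?thesis using gconv_dx[OF T c(2) d] unfolding gconv_def by simp
 qed
 \<comment> \<open>\<open>kernel_uniform\<close> asks for vanishing at time T; for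
   \<open>phx\<close> this follows by differentiating \<open>ph (x, T) = 0\<close> along the top
   edge.\<close>
 have zx: "phx (x, T) = 0" if x: "x \<in> {0..1}" for x
 proof (rule vector_derivative_unique_within)
  show "((%y. ph (y, T)) has_vector_derivative phx (x, T)) (at x within {0..1})" using d[OF x, of T] T by simp
  have "((%y. 0::real) has_vector_derivative 0) (at x within {0..1})" by (rule has_vector_derivative_const)
  then show "((%y. ph (y, T)) has_vector_derivative 0) (at x within {0..1})"
  by (rule has_vector_derivative_transform[OF x, rotated]) (use z(3) in auto)
  show "at x within {0..1} ~= bot" using x by (simp add: trivial_limit_within islimpt_Icc)
 qed
 have uX: "uniform_limit (Cyl T) (%n. ?X (r n)) ph sequentially"
  by (rule uniform_along_r[OF gconv_uniform[OF gb c(1) T]])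
 have uKG: "uniform_limit (Cyl T) (%n. ?KG (r n)) (volt T (Gz G) phx) sequentially"
  unfolding kstp_def[abs_def] volt_def[abs_def] by (rule uniform_along_r[OF kernel_uniform[OF gD c(2) T zx kG(2,1)]])
 have uK1: "uniform_limit (Cyl T) (%n. ?K1 (r n)) (volt T (%r. 1) phx) sequentially"
  unfolding kstp_def[abs_def] volt_def[abs_def] by (rule uniform_along_r[OF kernel_uniform[OF gD c(2) T zx k1(2,1)]])
 have uKF: "uniform_limit (Cyl T) (%n. ?KF (r n)) (volt T (%r. 1) ph) sequentially"
  unfolding kstp_def[abs_def] volt_def[abs_def] by (rule uniform_along_r[OF kernel_uniform[OF gb c(1) T z(3) k1(2,1)]])
 note sq = CB_sq_int(1)[OF c(1)] volt_facts(1)[OF T kG c(2)] volt_facts(1)[OF T k1 c(2)] volt_facts(1)[OF T k1 c(1)]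
 have 1: "(%n. (LINT p|?Q. Vs (r n) p <.> ?X (r n) p) - (LINT p|?Q. Vs (r n) p <.> ph p)) ----> 0"
  by (rule uniform_inner[OF steps_sq_int(2) steps_nsq(2) stp_sq_int sq(1) uX])
 have 2: "(%n. (LINT p|?Q. Ps (r n) p <.> ?KG (r n) p) - (LINT p|?Q. Ps (r n) p <.> volt T (Gz G) phx p)) ----> 0"
  by (rule uniform_inner[OF steps_sq_int(1) steps_nsq(1) stp_sq_int sq(2) uKG])
 have 3: "(%n. LINT p|?Q. qf lam (Ls (r n) p) <.> ?K1 (r n) p) ----> (LINT p|?Q. qf lam (mu p) <.> volt T (%r. 1) phx p)"
  by (rule composition_integral[OF continuous_qf Ms_conditions(2,3) steps_borel(6) stp_sq_int sq(3) uK1])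
 have 4: "(%n. (LINT p|?Q. u1 (fst p) <.> ?X (r n) p) - (LINT p|?Q. u1 (fst p) <.> ph p)) ----> 0"
  by (rule uniform_inner[OF fst_sq_int[OF T u1] order_refl stp_sq_int sq(1) uX])
 have 5: "(%n. (LINT p|?Q. f p <.> ?KF (r n) p) - (LINT p|?Q. f p <.> volt T (%r. 1) ph p)) ----> 0"
  by (rule uniform_inner[OF f order_refl stp_sq_int sq(4) uKF])
 have e0: "(LINT p|?Q. Vs n p <.> ?X n p) + (LINT p|?Q. Ps n p <.> ?KG n p) + (LINT p|?Q. qf lam (Ls n p) <.> ?K1 n p)
  = (LINT p|?Q. u1 (fst p) <.> ?X n p) + (LINT p|?Q. f p <.> ?KF n p)" for n
  using momentum_identity[of n "b n", OF sup] unfolding Vs_def Ps_def Ls_def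
  by (simp add: stp_def mult.commute)
 let ?a = "%n. (LINT p|?Q. Vs (r n) p <.> ph p) + (LINT p|?Q. Ps (r n) p <.> volt T (Gz G) phx p)"
 let ?R = "(LINT p|?Q. u1 (fst p) <.> ph p) + (LINT p|?Q. f p <.> volt T (%r. 1) ph p)"
 let ?b = "%n. ?R + ((LINT p|?Q. u1 (fst p) <.> ?X (r n) p) - (LINT p|?Q. u1 (fst p) <.> ph p))
  + ((LINT p|?Q. f p <.> ?KF (r n) p) - (LINT p|?Q. f p <.> volt T (%r. 1) ph p))
  - ((LINT p|?Q. Vs (r n) p <.> ?X (r n) p) - (LINT p|?Q. Vs (r n) p <.> ph p))
  - ((LINT p|?Q. Ps (r n) p <.> ?KG (r n) p) - (LINT p|?Q. Ps (r n) p <.> volt T (Gz G) phx p))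
  - (LINT p|?Q. qf lam (Ls (r n) p) <.> ?K1 (r n) p)"
 have eq: "?a n = ?b n" for n using e0[of "r n"] by linarith
 have lim: "?b ----> ?R + 0 + 0 - 0 - 0 - (LINT p|?Q. qf lam (mu p) <.> volt T (%r. 1) phx p)"
  by (intro tendsto_add tendsto_diff tendsto_minus 1 2 3 4 5 tendsto_const)
 have "?a ----> ?R + 0 + 0 - 0 - 0 - (LINT p|?Q. qf lam (mu p) <.> volt T (%r. 1) phx p)"
  by (rule tendsto_cong[THEN iffD2, OF always_eventually lim]) (rule allI, rule eq)
 moreover have "(%n. \<Sum>k\<in>A n. c n k *R ?a k) ----> (LINT p|?Q. ut p <.> ph p) + (LINT p|?Q. ux p <.> volt T (Gz G) phx p)"
  unfolding scaleR_add_right sum.distrib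
  by (intro tendsto_add conv_ints(1)[OF sq(2) sq_int_zero] conv_ints(2)[OF sq(1) sq_int_zero])
 ultimately have "(LINT p|?Q. ut p <.> ph p) + (LINT p|?Q. ux p <.> volt T (Gz G) phx p) = ?R + 0 + 0 - 0 - 0 - (LINT p|?Q. qf lam (mu p) <.> volt T (%r. 1) phx p)"
  by (rule transfer)
 then show ?thesis by simp
qed

end

section \<open>The weak equations for the limit\<close>

lemma integral_lebesgue_on_AE:
 fixes f g :: "'a::euclidean_space => 'b::euclidean_space"
 assumes S: "S \<in> sets borel" and g: "g \<in> bms (lbo S)" and ae: "AE x in lbo S. f x = g x"
 shows "(LINT x|lebesgue_on S. f x) = (LINT x|lbo S. g x)"
proof -
 have gm: "g \<in> bms (lebesgue_on S)" by (rule lebesgue_on_measurable[OF S g])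
 have ae': "AE x in lebesgue_on S. f x = g x" using ae AE_lebesgue_on[OF S] by blast
 have "(LINT x|lebesgue_on S. f x) = (LINT x|lebesgue_on S. g x)"
  by (rule integral_cong_AE[OF lebesgue_on_measurable_AE[OF S gm ae'] gm ae'])
 then show ?thesis using integral_lebesgue_on[OF S g] by simp
qed

lemma integral_lebesgue_on_space:
 fixes f g :: "'a::euclidean_space => 'b::euclidean_space"
 assumes "S \<in> sets borel" "g \<in> bms (lbo S)" "!!x. x \<in> S ==> f x = g x"
 shows "(LINT x|lebesgue_on S. f x) = (LINT x|lbo S. g x)"
 by (rule integral_lebesgue_on_AE[OF assms(1,2)]) (auto intro!: AE_I2 assms(3))

lemma AE_Cyl_fst:
 assumes "AE x in lO. P x"
 shows "AE p in lC T. P (fst p)"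
proof -
 interpret Pr: pair_sigma_finite "lO" "tint T" by (rule pair_sf)
 obtain N where N: "{x \<in> space lO. \<not> P x} \<subseteq> N" "emeasure lO N = 0" "N \<in> sets lO"
  using AE_E[OF assms] by blast
 have S: "{0<..<T} \<in> sets (tint T)" using sets.top[of "tint T"] by simp
 have "emeasure (lO OX tint T) (N \<times> {0<..<T}) = 0"
  using Pr.M2.emeasure_pair_measure_Times[OF N(3) S] N(2) by simp
 moreover have "N \<times> {0<..<T} \<in> sets (lO OX tint T)" using N(3) S by (rule pair_measureI)
 moreover have "{p \<in> space (lO OX tint T). \<not> P (fst p)} \<subseteq> N \<times> {0<..<T}"
  using N(1) by (auto simp: space_pair_measure)
 ultimately show ?thesis unfolding Cyl_eq by (rule AE_I[rotated])
qed

lemma AE_tint_mono: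
 assumes "AE s in tint T. Q s" "t <= T" shows "AE s in tint t. Q s"
proof -
 have "AE s in lborel. s \<in> {0<..<T} --> Q s" using assms(1) unfolding lbo_def by (subst (asm) AE_restrict_space_iff) simp_all
 then have "AE s in lborel. s \<in> {0<..<t} --> Q s" by eventually_elim (use assms(2) in auto)
 then show ?thesis unfolding lbo_def by (subst AE_restrict_space_iff) simp_all
qed

lemma inner_lebesgue:
 fixes k :: "real => real" and g ph :: "real*real => real"
 assumes k[measurable]: "k \<in> bms borel" and g: "g \<in> bms borel"
  and p: "(x, t) \<in> Cyl T" and ae: "AE s in tint t. h s = k (t - s) * g (x, s) * ph (x, t)"
 shows "(LINT s|lebesgue_on {0<..<t}. h s) = (LINT s|tint t. k (t - s) * g (x, s) * (ind (Cyl T) (x, t) * ph (x, t)))"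
proof (rule integral_lebesgue_on_AE)
 have [measurable]: "(%s. g (x, s)) \<in> bms borel"
  by (rule measurable_compose[OF _ g]) (intro borel_measurable_continuous_onI continuous_intros)
 show "(%s. k (t - s) * g (x, s) * (ind (Cyl T) (x, t) * ph (x, t))) \<in> bms (tint t)"
  by (rule borel_imp_lbo) measurable
 show "AE s in tint t. h s = k (t - s) * g (x, s) * (ind (Cyl T) (x, t) * ph (x, t))"
  using ae by eventually_elim (use p in simp)
qed simp

context limit_point
begin

lemma magnetization_equation:
 assumes w0: "AE x in lO. w0 x = w x"
 shows "weak_magnetization_equation T lam dl w0 ux mu mx"
 unfolding weak_magnetization_equation_def
proof (intro allI impI)
 fix ps :: "real*real => real ^ 2"
 assume s: "smooth_on (closure (Cyl T)) ps" and z: "\<forall>x\<in>{0..1}. ps (x, T) = 0"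
 note sm = smooth_on_CB[OF s T]
 let ?t = "dir_deriv (0, 1) ps" and ?x = "dir_deriv (1, 0) ps"
 have A: "(LINT p|lC T. mt p <.> ps p) + (LINT p|lC T. mu p <.> ?t p) = - (LINT x|lO. w x <.> ps (x, 0))"
  by (rule time_by_parts_m[OF sm(1) sm(2) sm(5)]) (use z in auto)
 note B = magnetization_limit[OF sm(1) sm(2) sm(4)]
 have [measurable]: "Lam \<in> bms borel"
  by (rule borel_measurable_continuous_onI[OF linear_continuous_on[OF bounded_linear_Lam]])
 have [measurable]: "ps \<in> bms (lC T)" "?t \<in> bms (lC T)" "?x \<in> bms (lC T)"
  "mu \<in> bms (lC T)" "ux \<in> bms (lC T)" "mx \<in> bms (lC T)"
  using sq_intD(1)[OF CB_sq_int(1)[OF sm(1)]] sq_intD(1)[OF CB_sq_int(1)[OF sm(2)]] mub lb by (auto intro: borel_imp_lbo)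
 have 1: "(LINT p|lebesgue_on (Cyl T). ?t p <.> mu p) = (LINT p|lC T. mu p <.> ?t p)"
  by (rule integral_lebesgue_on_space) (simp, measurable, simp add: inner_commute)
 have 2: "(LINT p|lebesgue_on (Cyl T). ((norm (mu p))^2 - 1) / dl * (ps p <.> mu p)) = (LINT p|lC T. ((((norm (mu p))^2 - 1) / dl) *R mu p) <.> ps p)"
  by (rule integral_lebesgue_on_space) (simp, measurable, simp add: inner_commute)
 have 3: "(LINT p|lebesgue_on (Cyl T). lam * ux p * (Lam (mu p) <.> ps p)) = (LINT p|lC T. ux p <.> (lam * (Lam (mu p) <.> ps p)))"
 proof (rule integral_lebesgue_on_space[OF Cyl_borel])
  have "(%p. Lam (mu p)) \<in> bms (lC T)"
  by (rule measurable_compose[of mu _ borel Lam]) simp_all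
  then show "(%p. ux p <.> (lam * (Lam (mu p) <.> ps p))) \<in> bms (lC T)" by simp
 qed simp
 have 4: "(LINT p|lebesgue_on (Cyl T). mx p <.> ?x p) = (LINT p|lC T. mx p <.> ?x p)"
  by (rule integral_lebesgue_on[OF Cyl_borel]) measurable
 have 5: "(LINT x|lebesgue_on Omega. w0 x <.> ps (x, 0)) = (LINT x|lO. w x <.> ps (x, 0))"
 proof (rule integral_lebesgue_on_AE[OF Omega_borel])
  have cc: "continuous_on {0..1} (%x. ps (x, 0))" by (rule continuous_on_compose2[OF sm(1)]) (use T in \<open>auto intro!: continuous_intros\<close>)
  have "continuous_on Omega (%x. ps (x, 0))" by (rule continuous_on_subset[OF cc]) (auto simp: Omega_def)
  then have "(%x. ps (x, 0)) \<in> bms lO"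
  unfolding lbo_measurable_iff[OF Omega_borel] by (rule borel_measurable_continuous_on_indicator[OF Omega_borel])
  then show "(%x. w x <.> ps (x, 0)) \<in> bms lO" using sq_intD(1)[OF w] by (intro borel_measurable_inner)
  show "AE x in lO. w0 x <.> ps (x, 0) = w x <.> ps (x, 0)" using w0 by eventually_elim simp
 qed
 show "- (LINT p|lebesgue_on (Cyl T). ?t p <.> mu p) + (LINT p|lebesgue_on (Cyl T). ((norm (mu p))^2 - 1) / dl * (ps p <.> mu p))
  + (LINT p|lebesgue_on (Cyl T). lam * ux p * (Lam (mu p) <.> ps p)) + (LINT p|lebesgue_on (Cyl T). mx p <.> ?x p)
  - (LINT x|lebesgue_on Omega. w0 x <.> ps (x, 0)) = 0"
  unfolding 1 2 3 4 5 using A B by linarith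
qed

lemma momentum_equation:
 assumes fb: "f \<in> bms borel" and u1': "AE x in lO. u1' x = u1 x" and f': "AE p in lC T. f' p = f p"
 shows "weak_momentum_equation T lam G u1' f' (prim2 ux) ux mu"
 unfolding weak_momentum_equation_def
proof (intro allI impI)
 fix ph :: "real*real => real"
 assume s: "smooth_on (closure (Cyl T)) ph" and z: "\<forall>t\<in>{0..T}. ph (0, t) = 0 & ph (1, t) = 0" and zT: "\<forall>x\<in>{0..1}. ph (x, T) = 0"
 note sm = smooth_on_CB[OF s T]
 let ?t = "dir_deriv (0, 1) ph" and ?x = "dir_deriv (1, 0) ph" and ?Q = "lC T"
 interpret Q: finite_measure ?Q by (rule finite_measure_Cyl)
 interpret I: finite_measure "tint T" by (rule finite_measure_lbo_Ioo)
 interpret Pr: pair_sigma_finite "lO" "tint T" by (rule pair_sf)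
 have k1: "(%r::real. 1::real) \<in> bms borel" "integrable (tint T) (%r. 1::real)" by simp_all
 have kG: "Gz G \<in> bms borel" "integrable (tint T) (Gz G)"
  using relaxation_borel[OF G] Gz_integrable[OF G T] by (simp_all add: Gz_def[abs_def])
 have A: "(LINT p|?Q. ut p <.> ph p) + (LINT p|?Q. prim2 ux p <.> ?t p) = 0"
  by (rule time_by_parts_u[OF sm(1) sm(2) sm(5)]) (use zT in auto)
 have B: "(LINT p|?Q. ut p <.> ph p) + (LINT p|?Q. ux p <.> volt T (Gz G) ?x p) + (LINT p|?Q. qf lam (mu p) <.> volt T (%r. 1) ?x p)
  = (LINT p|?Q. u1 (fst p) <.> ph p) + (LINT p|?Q. f p <.> volt T (%r. 1) ph p)"
  by (rule momentum_limit[OF sm(1) sm(2) sm(4)]) (use z zT in auto)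
 have m: "ph \<in> bms ?Q" "?t \<in> bms ?Q" "prim2 ux \<in> bms ?Q"
  using sq_intD(1)[OF CB_sq_int(1)[OF sm(1)]] sq_intD(1)[OF CB_sq_int(1)[OF sm(2)]] prim2_measurable[OF borel_imp_lbo[OF lb(1)]] by auto
 have qb: "(%p. qf lam (mu p)) \<in> bms borel"
  by (rule measurable_compose[OF mub borel_measurable_continuous_onI[OF continuous_qf]])
 have qi: "integrable ?Q (%p. qf lam (mu p))"
 proof -
  have "compact (qf lam ` cball 0 Mb)" by (intro compact_continuous_image continuous_on_subset[OF continuous_qf]) auto
  then obtain C where "\<forall>y\<in>qf lam ` cball 0 Mb. norm y <= C" using compact_imp_bounded bounded_iff by blast
  then have "norm (qf lam (mu p)) <= C" for p using muM[of p] by auto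
  then show ?thesis by (intro Q.sq_int_integrable bounded_measurable_sq_int[OF qb])
 qed
 have ui: "integrable ?Q ux" and fi: "integrable ?Q f" by (intro Q.sq_int_integrable lq f)+
 have 1: "(LINT (x, t)|lebesgue_on (Cyl T). ?t (x, t) * prim2 ux (x, t)) = (LINT p|?Q. prim2 ux p <.> ?t p)"
  by (rule integral_lebesgue_on_space) (use m in auto)
 have 2: "(LINT (x, t)|lebesgue_on (Cyl T). LINT \<tau>|lebesgue_on {0<..<t}. G (t - \<tau>) * ux (x, \<tau>) * ?x (x, t)) = (LINT p|?Q. ux p <.> volt T (Gz G) ?x p)"
 proof -
  have "(LINT (x, t)|lebesgue_on (Cyl T). LINT \<tau>|lebesgue_on {0<..<t}. G (t - \<tau>) * ux (x, \<tau>) * ?x (x, t))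
  = (LINT p|?Q. LINT s|tint (snd p). Gz G (snd p - s) * ux (fst p, s) * (ind (Cyl T) p * ?x p))"
  proof (rule integral_lebesgue_on_space[OF Cyl_borel])
  show "(%p. LINT s|tint (snd p). Gz G (snd p - s) * ux (fst p, s) * (ind (Cyl T) p * ?x p)) \<in> bms ?Q"
  using volt_facts(3)[OF T kG sm(2) lb(1) ui] by (rule borel_measurable_integrable)
  fix p assume p: "p \<in> Cyl T"
  obtain x t where xt: "p = (x, t)" by (cases p)
  \<comment> \<open>Inside the integral t - s is positive, so \<open>G\<close> and
    \<open>Gz G\<close> agree.\<close>
  show "(case p of (x, t) => LINT \<tau>|lebesgue_on {0<..<t}. G (t - \<tau>) * ux (x, \<tau>) * ?x (x, t)) = (LINT s|tint (snd p). Gz G (snd p - s) * ux (fst p, s) * (ind (Cyl T) p * ?x p))"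
  unfolding xt prod.case fst_conv snd_conv
  by (rule inner_lebesgue[OF kG(1) lb(1)]) (use p in \<open>auto simp: xt Gz_pos intro!: AE_I2\<close>)
  qed
  then show ?thesis using volt_facts(2)[OF T kG sm(2) lb(1) ui] by simp
 qed
 have 3: "(LINT (x, t)|lebesgue_on (Cyl T). LINT \<tau>|lebesgue_on {0<..<t}. lam / 2 * (Lam (mu (x, \<tau>)) <.> mu (x, \<tau>)) * ?x (x, t)) = (LINT p|?Q. qf lam (mu p) <.> volt T (%r. 1) ?x p)"
 proof -
  have "(LINT (x, t)|lebesgue_on (Cyl T). LINT \<tau>|lebesgue_on {0<..<t}. lam / 2 * (Lam (mu (x, \<tau>)) <.> mu (x, \<tau>)) * ?x (x, t))
  = (LINT p|?Q. LINT s|tint (snd p). (%r. 1) (snd p - s) * qf lam (mu (fst p, s)) * (ind (Cyl T) p * ?x p))"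
  proof (rule integral_lebesgue_on_space[OF Cyl_borel])
  show "(%p. LINT s|tint (snd p). (%r. 1) (snd p - s) * qf lam (mu (fst p, s)) * (ind (Cyl T) p * ?x p)) \<in> bms ?Q"
  using volt_facts(3)[OF T k1 sm(2) qb qi] by (rule borel_measurable_integrable)
  fix p assume p: "p \<in> Cyl T"
  obtain x t where xt: "p = (x, t)" by (cases p)
  show "(case p of (x, t) => LINT \<tau>|lebesgue_on {0<..<t}. lam / 2 * (Lam (mu (x, \<tau>)) <.> mu (x, \<tau>)) * ?x (x, t)) = (LINT s|tint (snd p). (%r. 1) (snd p - s) * qf lam (mu (fst p, s)) * (ind (Cyl T) p * ?x p))"
  unfolding xt prod.case fst_conv snd_conv
  by (rule inner_lebesgue[OF k1(1) qb]) (use p in \<open>auto simp: xt qf_def intro!: AE_I2\<close>)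
  qed
  also have "... = (LINT p|?Q. qf lam (mu p) * volt T (%r. 1) ?x p)" by (rule volt_facts(2)[OF T k1 sm(2) qb qi])
  finally show ?thesis by simp
 qed
 have 4: "(LINT (x, t)|lebesgue_on (Cyl T). (u1' x + (LINT \<tau>|lebesgue_on {0<..<t}. f' (x, \<tau>))) * ph (x, t)) = (LINT p|?Q. u1 (fst p) <.> ph p) + (LINT p|?Q. f p <.> volt T (%r. 1) ph p)"
 proof -
  let ?J = "%p. LINT s|tint (snd p). (%r. 1) (snd p - s) * f (fst p, s) * (ind (Cyl T) p * ph p)"
  have iJ: "integrable ?Q ?J" by (rule volt_facts(3)[OF T k1 sm(1) fb fi])
  have iu: "integrable ?Q (%p. u1 (fst p) <.> ph p)" by (intro sq_int_inner_integrable fst_sq_int[OF T u1] CB_sq_int(1)[OF sm(1)])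
  have "(LINT (x, t)|lebesgue_on (Cyl T). (u1' x + (LINT \<tau>|lebesgue_on {0<..<t}. f' (x, \<tau>))) * ph (x, t)) = (LINT p|?Q. u1 (fst p) <.> ph p + ?J p)"
  proof (rule integral_lebesgue_on_AE[OF Cyl_borel])
  show "(%p. u1 (fst p) <.> ph p + ?J p) \<in> bms ?Q"
  by (intro borel_measurable_add borel_measurable_integrable iJ iu)
  have "AE p in lO OX tint T. f' p = f p" using f' unfolding Cyl_eq .
  \<comment> \<open>Equality almost everywhere on the cylinder becomes equality for almost every s
    on almost every line x = const, which is what the inner time integral sees.\<close>
  then have "AE x in lO. AE s in tint T. f' (x, s) = f (x, s)" by (rule Pr.AE_pair)
  from AE_Cyl_fst[OF this] AE_Cyl_fst[OF u1'] AE_space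
  show "AE p in ?Q. (case p of (x, t) => (u1' x + (LINT \<tau>|lebesgue_on {0<..<t}. f' (x, \<tau>))) * ph (x, t)) = u1 (fst p) <.> ph p + ?J p"
  proof eventually_elim
  case (elim p)
  obtain x t where xt: "p = (x, t)" by (cases p)
  have tT: "t <= T" using elim(3) by (simp add: xt Cyl_def)
  have "AE s in tint t. f' (x, s) * ph (x, t) = 1 * f (x, s) * ph (x, t)"
  using AE_tint_mono[OF elim(1)[unfolded xt fst_conv] tT] by eventually_elim simp
  then have "(LINT \<tau>|lebesgue_on {0<..<t}. f' (x, \<tau>) * ph (x, t)) = ?J p"
  unfolding xt fst_conv snd_conv using elim(3) by (intro inner_lebesgue[OF k1(1) fb]) (auto simp: xt)
  then have J: "(LINT \<tau>|lebesgue_on {0<..<t}. f' (x, \<tau>)) * ph (x, t) = ?J p" by simp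
  have "u1' x = u1 x" using elim(2) by (simp add: xt)
  then show ?case unfolding xt prod.case distrib_right J[unfolded xt] by simp
  qed
  qed
  also have "... = (LINT p|?Q. u1 (fst p) <.> ph p) + (LINT p|?Q. ?J p)" by (rule Bint_add[OF iu iJ])
  also have "(LINT p|?Q. ?J p) = (LINT p|?Q. f p * volt T (%r. 1) ph p)" by (rule volt_facts(2)[OF T k1 sm(1) fb fi])
  finally show ?thesis by simp
 qed
 show "- (LINT (x, t)|lebesgue_on (Cyl T). ?t (x, t) * prim2 ux (x, t))
  + (LINT (x, t)|lebesgue_on (Cyl T). LINT \<tau>|lebesgue_on {0<..<t}. G (t - \<tau>) * ux (x, \<tau>) * ?x (x, t))
  + (LINT (x, t)|lebesgue_on (Cyl T). LINT \<tau>|lebesgue_on {0<..<t}. lam / 2 * (Lam (mu (x, \<tau>)) <.> mu (x, \<tau>)) * ?x (x, t))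
  = (LINT (x, t)|lebesgue_on (Cyl T). (u1' x + (LINT \<tau>|lebesgue_on {0<..<t}. f' (x, \<tau>))) * ph (x, t))"
  unfolding 1 2 3 4 using A B by linarith
qed

end

section \<open>Weak derivatives by slices\<close>

lemma test_function_Cyl:
 fixes ph :: "real*real => real"
 assumes t: "test_function (Cyl T) ph"
 shows "smooth_on (closure (Cyl T)) ph" "p \<notin> Cyl T ==> ph p = 0"
 using t unfolding test_function_def smooth_on_def by blast+

text \<open>Integration by parts on almost every time slice, then integration in time. The constant
  \<open>b\<close> may vary with the slice; its boundary terms drop out because the test function
  vanishes at both ends.\<close>

lemma slice_weak_deriv:
 fixes v g :: "real*real => 'b::euclidean_space"
 assumes T: "T > 0" and v: "sq_int (lC T) v" and g: "sq_int (lC T) g"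
  and ae: "AE t in tint T. \<exists>b. \<forall>x\<in>Omega. v (x, t) = prim b (%y. g (y, t)) x"
 shows "has_weak_deriv (Cyl T) (1, 0) v g"
 unfolding has_weak_deriv_def
proof (intro conjI allI impI)
 interpret Q: finite_measure "lC T" by (rule finite_measure_Cyl)
 show "locally_integrable (Cyl T) v" "locally_integrable (Cyl T) g"
  by (intro locally_integrable_lbo Cyl_borel Q.sq_int_integrable v g)+
 fix ph :: "real*real => real" assume t: "test_function (Cyl T) ph"
 note sm = smooth_on_CB[OF test_function_Cyl(1)[OF t] T]
 note sx = smooth_on_CB(2)[OF test_function_Cyl(1)[OF t] T, where v = "(1, 0)"]
 let ?x = "dir_deriv (1, 0) ph"
 have m: "(%p. ?x p *R v p) \<in> bms (lC T)" "(%p. ph p *R g p) \<in> bms (lC T)"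
  by (intro borel_measurable_scaleR sq_intD(1)[OF CB_sq_int(1)[OF sm(1)]] sq_intD(1)[OF CB_sq_int(1)[OF sx]] sq_intD(1) v g)+
 have i: "integrable (lC T) (%p. ?x p *R v p)" "integrable (lC T) (%p. ph p *R g p)"
  by (rule Bitg_bound[OF sq_int_mult_integrable[OF CB_sq_int(1)[OF sx] v] m(1)], simp)
  (rule Bitg_bound[OF sq_int_mult_integrable[OF CB_sq_int(1)[OF sm(1)] g] m(2)], simp)
 have "AE t in tint T. (LINT x|lO. ?x (x, t) *R v (x, t) + ph (x, t) *R g (x, t)) = 0"
  using ae slice_sq_int(1)[OF g] integral_Cyl_iterated(3)[OF i(1)] integral_Cyl_iterated(3)[OF i(2)] AE_space
 proof eventually_elim
  case (elim s)
  have s: "s \<in> {0..T}" using elim(5) by simp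
  obtain b where b: "!!x. x \<in> Omega ==> v (x, s) = prim b (%y. g (y, s)) x" using elim(1) by blast
  have c: "continuous_on {0..1} (%x. ?x (x, s))" by (rule continuous_on_compose2[OF sx]) (use s in \<open>auto intro!: continuous_intros\<close>)
  have d: "((%x. ph (x, s)) has_real_derivative ?x (x, s)) (at x within {0..1})" if "x \<in> {0..1}" for x
  using sm(4)[OF that s] by (simp add: has_real_derivative_iff_has_vector_derivative)
  have "(LINT x|lO. ?x (x, s) *R v (x, s)) = (LINT x|lO. ?x (x, s) *R prim b (%y. g (y, s)) x)"
  by (intro Bint_cong refl) (simp add: b)
  also have "... = ph (1, s) *R prim b (%y. g (y, s)) 1 - ph (0, s) *R b - (LINT x|lO. ph (x, s) *R g (x, s))"
  by (rule prim_by_parts[OF d c Om.sq_int_integrable[OF elim(2)]])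
  also have "... = - (LINT x|lO. ph (x, s) *R g (x, s))"
  using test_function_Cyl(2)[OF t, of "(1, s)"] test_function_Cyl(2)[OF t, of "(0, s)"] by (simp add: Cyl_def Omega_def)
  finally show ?case using elim(3,4) by simp
 qed
 then have "(LINT t|tint T. LINT x|lO. ?x (x, t) *R v (x, t) + ph (x, t) *R g (x, t)) = 0"
  by (rule integral_eq_zero_AE)
 then have "(LINT p|lC T. ?x p *R v p + ph p *R g p) = 0"
  using integral_Cyl_iterated(1)[OF Bitg_add[OF i]] by simp
 then have "(LINT p|lC T. ?x p *R v p) = - (LINT p|lC T. ph p *R g p)"
  using i by (simp add: add_eq_0_iff2)
 then show "(LINT p|lebesgue_on (Cyl T). ?x p *R v p) = - (LINT p|lebesgue_on (Cyl T). ph p *R g p)"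
  by (simp add: integral_lebesgue_on m)
qed

lemma has_weak_deriv_cong:
 assumes eq: "!!x. x \<in> S ==> f x = f' x"
 shows "has_weak_deriv S v f g \<longleftrightarrow> has_weak_deriv S v f' g"
proof -
 have "integrable (lebesgue_on K) f \<longleftrightarrow> integrable (lebesgue_on K) f'" if "K \<subseteq> S" for K
  by (rule Bitg_cong) (use that eq in auto)
 moreover have "(LINT p|lebesgue_on S. dir_deriv v ph p *R f p) = (LINT p|lebesgue_on S. dir_deriv v ph p *R f' p)" for ph
  by (rule Bint_cong) (use eq in auto)
 ultimately show ?thesis unfolding has_weak_deriv_def locally_integrable_def by (simp cong: conj_cong)
qed

text \<open>The limit magnetization is identified with a primitive at the points of
  \<open>Omega\<close> only, so membership and norm must be transported along equality on that
  set.\<close>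

lemma H1_cong:
 assumes eq: "!!x. x \<in> S ==> f x = f' x"
 shows "H1 S f \<longleftrightarrow> H1 S f'" "H1_norm S f = H1_norm S f'"
proof -
 have 1: "has_weak_deriv S v f = has_weak_deriv S v f'" for v
  using has_weak_deriv_cong[of S f f', OF eq] by (simp add: fun_eq_iff)
 have 2: "f \<in> bms (lebesgue_on S) \<longleftrightarrow> f' \<in> bms (lebesgue_on S)"
  by (rule measurable_cong) (simp add: eq)
 have 3: "integrable (lebesgue_on S) (%p. (norm (f p))^2) \<longleftrightarrow> integrable (lebesgue_on S) (%p. (norm (f' p))^2)"
  by (rule Bitg_cong) (auto simp: eq)
 have 4: "(LINT p|lebesgue_on S. (norm (f p))^2) = (LINT p|lebesgue_on S. (norm (f' p))^2)"
  by (rule Bint_cong) (auto simp: eq)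
 show "H1 S f \<longleftrightarrow> H1 S f'" unfolding H1_def L2_def 1 2 3 ..
 show "H1_norm S f = H1_norm S f'" unfolding H1_norm_def weak_deriv_def L2_norm_def 1 4 ..
qed

section \<open>Combinations over different grids\<close>

lemma ix_refine: "0 <= y ==> 0 < M ==> ix (N * M) y div M = ix N y"
proof -
 assume y: "0 <= y" and M: "0 < M"
 have "\<lfloor>(real (N * M) * y) / real_of_int (int M)\<rfloor> = \<lfloor>real (N * M) * y\<rfloor> div int M"
  by (rule floor_divide_real_eq_div) simp
 moreover have "(real (N * M) * y) / real_of_int (int M) = real N * y" using M by simp
 ultimately have "\<lfloor>real N * y\<rfloor> = \<lfloor>real (N * M) * y\<rfloor> div int M" by simp
 then show ?thesis using y unfolding ix_def by (simp add: nat_div_distrib)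
qed

lemma prim_cong: "(!!y. y \<in> Omega ==> g y = g' y) ==> prim c g = prim c g'"
 unfolding prim_def by (intro ext arg_cong2[where f = "(+)"] refl Bint_cong) auto

text \<open>Step functions on different grids become step functions on the common refinement whose
  cell count is the product; the integral of the combination is a combination of zero means. Thus
  \<open>H1_0_step\<close> applies to Mazur combinations.\<close>

lemma H1_0_step_combination:
 fixes q :: "'k => nat => real"
 assumes A: "finite A" and N: "!!k. k \<in> A ==> 0 < N k" and z: "!!k. k \<in> A ==> (SUM i<N k. q k i) = 0"
 shows "H1_0 Omega (prim 0 (%y. \<Sum>k\<in>A. c k *R q k (ix (N k) y)))"
proof -
 define M where "M = (\<Prod>k\<in>A. N k)"
 have M: "0 < M" unfolding M_def using N by (intro prod_pos) auto
 define a where "a j = (\<Sum>k\<in>A. c k *R q k (j div (M div N k)))" for j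
 have ae: "a (ix M y) = (\<Sum>k\<in>A. c k *R q k (ix (N k) y))" if "y \<in> Omega" for y
  unfolding a_def
 proof (intro sum.cong refl)
  fix k assume k: "k \<in> A"
  have "N k dvd M" unfolding M_def by (rule dvd_prodI[OF A k])
  then have e: "M = N k * (M div N k)" by simp
  then have "0 < M div N k" using M by (metis gr0I mult_0_right)
  then have "ix M y div (M div N k) = ix (N k) y" using ix_refine[of y "M div N k" "N k"] e that by (simp add: Omega_def)
  then show "c k *R q k (ix M y div (M div N k)) = c k *R q k (ix (N k) y)" by simp
 qed
 have "(1 / real M) *R (SUM i<M. a i) = (LINT y|lO. a (ix M y))" by (rule integral_step1(2)[OF M, symmetric])
 also have "... = (LINT y|lO. (\<Sum>k\<in>A. c k *R q k (ix (N k) y)))"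
  by (intro Bint_cong refl) (simp add: ae)
 also have "... = (\<Sum>k\<in>A. LINT y|lO. c k *R q k (ix (N k) y))"
  by (rule Bint_sum) (intro integrable_scaleR_right integral_step1(1) N)
 also have "... = (\<Sum>k\<in>A. c k *R ((1 / real (N k)) *R (SUM i<N k. q k i)))"
  by (intro sum.cong refl) (simp only: integral_scaleR_right integral_step1(2)[OF N])
 also have "... = 0" by (simp add: z)
 finally have "(SUM i<M. a i) = 0" using M by simp
 from H1_0_step[OF M this] show ?thesis using prim_cong[of "%y. a (ix M y)", OF ae] by simp
qed

lemma simple_function_ix: "N > 0 ==> T > 0 ==> simple_function (lebesgue_on {0<..<T}) (%t. ix N (t / T))"
 unfolding simple_function_def
proof (intro conjI ballI)
 assume N: "N > 0" and T: "T > 0"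
 have "(%t. ix N (t / T)) ` space (lebesgue_on {0<..<T}) \<subseteq> {..<N}"
  using N T by (auto intro!: ix_less)
 then show "finite ((%t. ix N (t / T)) ` space (lebesgue_on {0<..<T}))" by (rule finite_subset) simp
 fix k :: nat
 have "(%t. ix N (t / T)) -` {k} \<inter> space (lebesgue_on {0<..<T}) = {0<..<T} \<inter> tcell N T k"
  by (auto simp: tcell_def)
 also have "... \<in> sets (lebesgue_on {0<..<T})"
  unfolding sets_restrict_space by (intro imageI sets_completionI_sets) simp
 finally show "(%t. ix N (t / T)) -` {k} \<inter> space (lebesgue_on {0<..<T}) \<in> sets (lebesgue_on {0<..<T})" .
qed

text \<open>All time grids of one combination at once: the vector of their cell indices is a simple
  function of t, and so is every function of it, whatever space its values lie in. The default 0
  outside \<open>A\<close> keeps the range finite.\<close>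

lemma simple_function_indices:
 fixes N :: "nat => nat"
 assumes "finite A" "!!k. N k > 0" "T > 0"
 shows "simple_function (lebesgue_on {0<..<T}) (%t k. if k \<in> A then ix (N k) (t / T) else 0)"
 using assms(1)
proof (induction A rule: finite_induct)
 case (insert a B)
 have "simple_function (lebesgue_on {0<..<T}) (%t. (%j v. v(a := j)) (ix (N a) (t / T)) (%k. if k \<in> B then ix (N k) (t / T) else 0))"
  by (rule simple_function_compose2[OF simple_function_ix[OF assms(2,3)] insert.IH])
 moreover have "(%t. (%j v. v(a := j)) (ix (N a) (t / T)) (%k. if k \<in> B then ix (N k) (t / T) else 0)) = (%t k. if k \<in> insert a B then ix (N k) (t / T) else 0)"
  by (auto simp: fun_eq_iff)
 ultimately show ?case by simp
qed simp

section \<open>Weak derivatives of the displacement and the magnetization\<close>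

context limit_point
begin

lemma weak_deriv_u: "has_weak_deriv (Cyl T) (1, 0) (prim2 ux) ux" "has_weak_deriv (Cyl T) (0, 1) (prim2 ux) ut"
proof -
 show "has_weak_deriv (Cyl T) (1, 0) (prim2 ux) ux"
  by (rule slice_weak_deriv[OF T prim2_sq_int(1)[OF lq(1)] lq(1)]) (auto simp: prim2_def intro!: AE_I2)
 interpret Q: finite_measure "lC T" by (rule finite_measure_Cyl)
 show "has_weak_deriv (Cyl T) (0, 1) (prim2 ux) ut"
  unfolding has_weak_deriv_def
 proof (intro conjI allI impI)
  show "locally_integrable (Cyl T) (prim2 ux)" "locally_integrable (Cyl T) ut"
  by (intro locally_integrable_lbo Cyl_borel Q.sq_int_integrable prim2_sq_int(1) lq)+
  fix ph :: "real*real => real" assume t: "test_function (Cyl T) ph"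
  note sm = smooth_on_CB[OF test_function_Cyl(1)[OF t] T]
 note sx = smooth_on_CB(2)[OF test_function_Cyl(1)[OF t] T, where v = "(0, 1)"]
  let ?t = "dir_deriv (0, 1) ph"
  have "(LINT p|lC T. ut p <.> ph p) + (LINT p|lC T. prim2 ux p <.> ?t p) = 0"
  by (rule time_by_parts_u[OF sm(1) sx sm(5)]) (use test_function_Cyl(2)[OF t] in \<open>auto simp: Cyl_def\<close>)
  then have "(LINT p|lC T. ?t p *R prim2 ux p) = - (LINT p|lC T. ph p *R ut p)" by (simp add: mult.commute)
  moreover have "(LINT p|lebesgue_on (Cyl T). ?t p *R prim2 ux p) = (LINT p|lC T. ?t p *R prim2 ux p)"
  "(LINT p|lebesgue_on (Cyl T). ph p *R ut p) = (LINT p|lC T. ph p *R ut p)"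
  by (intro integral_lebesgue_on Cyl_borel borel_measurable_scaleR sq_intD(1)[OF CB_sq_int(1)[OF sm(1)]] sq_intD(1)[OF CB_sq_int(1)[OF sx]]
  sq_intD(1)[OF prim2_sq_int(1)[OF lq(1)]] sq_intD(1)[OF lq(2)])+
  ultimately show "(LINT p|lebesgue_on (Cyl T). ?t p *R prim2 ux p) = - (LINT p|lebesgue_on (Cyl T). ph p *R ut p)" by simp
 qed
qed

lemma mu_sq_int: "sq_int (lC T) mu"
 by (rule bounded_measurable_sq_int[OF mub muM])

lemma weak_deriv_m_t: "has_weak_deriv (Cyl T) (0, 1) mu mt"
 unfolding has_weak_deriv_def
proof (intro conjI allI impI)
 interpret Q: finite_measure "lC T" by (rule finite_measure_Cyl)
 show "locally_integrable (Cyl T) mu" "locally_integrable (Cyl T) mt"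
  by (intro locally_integrable_lbo Cyl_borel Q.sq_int_integrable mu_sq_int lq)+
 fix ph :: "real*real => real" assume t: "test_function (Cyl T) ph"
 note sm = smooth_on_CB[OF test_function_Cyl(1)[OF t] T]
 note sx = smooth_on_CB(2)[OF test_function_Cyl(1)[OF t] T, where v = "(0, 1)"]
 let ?t = "dir_deriv (0, 1) ph"
 note z = test_function_Cyl(2)[OF t]
 have m: "(%p. ?t p *R mu p) \<in> bms (lC T)" "(%p. ph p *R mt p) \<in> bms (lC T)"
  by (intro borel_measurable_scaleR sq_intD(1)[OF CB_sq_int(1)[OF sm(1)]] sq_intD(1)[OF CB_sq_int(1)[OF sx]] sq_intD(1)[OF mu_sq_int] sq_intD(1)[OF lq(4)])+
 have i: "integrable (lC T) (%p. ?t p *R mu p)" "integrable (lC T) (%p. ph p *R mt p)"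
  by (rule Bitg_bound[OF sq_int_mult_integrable[OF CB_sq_int(1)[OF sx] mu_sq_int] m(1)], simp)
  (rule Bitg_bound[OF sq_int_mult_integrable[OF CB_sq_int(1)[OF sm(1)] lq(4)] m(2)], simp)
 have "(LINT p|lC T. ?t p *R mu p) = - (LINT p|lC T. ph p *R mt p)"
 proof (rule euclidean_eqI)
  \<comment> \<open>A scalar test function times a constant vector is an admissible
    \<open>ps\<close> in \<open>time_by_parts_m\<close>; this gives the vector identity component by
    component.\<close>
  fix b :: "real ^ 2"
  have z0: "ph (x, 0) = 0" "ph (x, T) = 0" for x using z[of "(x, 0)"] z[of "(x, T)"] by (auto simp: Cyl_def)
  have "(LINT p|lC T. mt p <.> (ph p *R b)) + (LINT p|lC T. mu p <.> (?t p *R b)) = - (LINT x|lO. w x <.> (ph (x, 0) *R b))"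
  proof (rule time_by_parts_m)
  show "((%s. ph (x, s) *R b) has_vector_derivative ?t (x, s) *R b) (at s within {0..T})" if "x \<in> {0..1}" "s \<in> {0..T}" for x s
  using bounded_linear.has_vector_derivative[OF bounded_linear_scaleR_left sm(5)[OF that]] .
  qed (use sm(1) sx z0 in \<open>auto intro!: continuous_on_scaleR continuous_on_const\<close>)
  then have "(LINT p|lC T. (ph p *R mt p) <.> b) + (LINT p|lC T. (?t p *R mu p) <.> b) = 0" by (simp add: z0)
  then show "(LINT p|lC T. ?t p *R mu p) <.> b = (- (LINT p|lC T. ph p *R mt p)) <.> b"
  unfolding inner_minus_left integral_inner_left[OF i(1), symmetric] integral_inner_left[OF i(2), symmetric] by linarith
 qed
 then show "(LINT p|lebesgue_on (Cyl T). ?t p *R mu p) = - (LINT p|lebesgue_on (Cyl T). ph p *R mt p)"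
  by (simp add: integral_lebesgue_on m)
qed

end

section \<open>Membership in the Bochner spaces\<close>

text \<open>The factor 2 comes from the crude triangle inequality for squared norms.\<close>

lemma nsq_limit_le:
 assumes y: "!!n. sq_int M (y n)" and z: "sq_int M z" and K: "!!n. nsq M (y n) <= K"
  and lim: "(%n. nsq M (%x. y n x - z x)) ----> 0"
 shows "nsq M z <= 2 * K"
proof (rule LIMSEQ_le_const)
 show "(%n. 2 * K + 2 * nsq M (%x. y n x - z x)) ----> 2 * K"
  using tendsto_add[OF tendsto_const[of "2 * K"] tendsto_mult_right_zero[OF lim, of 2]] by simp
 have "nsq M z <= 2 * K + 2 * nsq M (%x. y n x - z x)" for n using nsq_le_diff[OF z y[of n]] K[of n] by linarith
 then show "\<exists>N. \<forall>n\<ge>N. nsq M z <= 2 * K + 2 * nsq M (%x. y n x - z x)" by blast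
qed

lemma H1_norm_nonneg: "0 <= H1_norm S f"
 by (simp add: H1_norm_def)

text \<open>The approximants see t through cell indices only and are therefore simple in time. They
  are required to lie in the space for every index vector \<open>J\<close>, as the definition asks
  for membership at every t.\<close>

lemma Linf_Bochner_steps:
 fixes N :: "nat => nat" and A :: "nat => nat set"
 assumes T: "T > 0" and A: "!!n. finite (A n)" and N: "!!k. N k > 0" and X: "!!n J. X (S n J)"
  and w: "AE t in tint T. X (%x. w (x, t))"
  and conv: "AE t in tint T. (%n. Nrm (%x. S n (%k. if k \<in> A n then ix (N k) (t / T) else 0) x - w (x, t))) ----> 0"
  and bd: "AE t in tint T. Nrm (%x. w (x, t)) <= C"
 shows "Linf_Bochner T X Nrm w"
proof -
 have S: "{0<..<T} \<in> sets borel" by simp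
 have "simple_function (lebesgue_on {0<..<T}) (%t. S n (%k. if k \<in> A n then ix (N k) (t / T) else 0))" for n
  using simple_function_compose[OF simple_function_indices[OF A N T, of n], of "S n"] by (simp add: o_def)
 then show ?thesis unfolding Linf_Bochner_def AE_lebesgue_on[OF S] using w conv bd X
  by (intro conjI exI[of _ "%n t. S n (%k. if k \<in> A n then ix (N k) (t / T) else 0)"] exI[of _ C] allI) auto
qed

lemma L2_representative:
 fixes f :: "'a::euclidean_space => 'b::euclidean_space"
 assumes S: "S \<in> sets borel" and f: "L2 S f"
 obtains f' where "f' \<in> bms borel" "sq_int (lbo S) f'" "AE x in lbo S. f x = f' x"
proof -
 obtain f' where f': "f' \<in> bms borel" "AE x in lbo S. f x = f' x"
  using borel_representative[OF S] f unfolding L2_def by blast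
 have m: "(%x. (norm (f' x))^2) \<in> bms (lbo S)"
  by (intro borel_measurable_power borel_imp_lbo measurable_compose[OF f'(1) borel_measurable_norm])
 have "integrable (lebesgue_on S) (%x. (norm (f x))^2)" using f by (simp add: L2_def)
 moreover have "AE x in lebesgue_on S. (norm (f x))^2 = (norm (f' x))^2"
  unfolding AE_lebesgue_on[OF S] using f'(2) by eventually_elim simp
 ultimately have "integrable (lebesgue_on S) (%x. (norm (f' x))^2)"
  using lebesgue_on_measurable[OF S m] by (blast intro: integrable_cong_AE_imp)
 then have "sq_int (lbo S) f'"
  unfolding sq_int_def using integrable_lebesgue_on[OF S m] borel_imp_lbo[OF f'(1)] by simp
 then show ?thesis using that f' by blast
qed

context limit_point
begin

lemma weights_finite: "finite (A n)" using cw[of n] by (simp add: conv_weights_def)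

definition "index n t = (%k. if k \<in> A n then ix (Suc (r k)) (t / T) else 0)"

text \<open>The strains telescope between two zero boundary values; this is the mean condition of
  \<open>H1_0_step_combination\<close>.\<close>

lemma P_mean: "(SUM i<Suc n. P n k i) = 0"
proof -
 have "(SUM i<Suc n. P n k i) = (rS n) * (SUM i<Suc n. u n k (Suc i) - u n k i)"
  unfolding P_def dx_def sum_distrib_left ..
 also have "... = 0" unfolding sum_lessThan_telescope using initial(3)[of n k] by (simp add: supp0_def)
 finally show ?thesis .
qed

lemma H1_norm_diff_tendsto:
 fixes g :: "real => 'b::euclidean_space"
 assumes y: "!!n. sq_int lO (y n)" and g: "sq_int lO g"
  and lim: "(%n. nsq lO (%x. y n x - g x)) ----> 0" and b: "b ----> b0"
 shows "(%n. H1_norm Omega (%x. prim (b n) (y n) x - prim b0 g x)) ----> 0"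
proof (rule tendsto_sandwich[OF _ _ tendsto_const])
 have "(%n. sqrt (2 * (norm (b n - b0))^2 + 3 * nsq lO (%x. y n x - g x))) ----> sqrt (2 * (norm (b0 - b0))^2 + 3 * 0)"
  by (intro tendsto_intros b lim)
 then show "(%n. sqrt (2 * (norm (b n - b0))^2 + 3 * nsq lO (%x. y n x - g x))) ----> 0" by simp
qed (intro always_eventually allI H1_norm_nonneg W1_diff_prim(2) y g)+

lemma Linf_u: "Linf_Bochner T (H1_0 Omega) (H1_norm Omega) (prim2 ux)"
proof -
 define S where "S n J = prim 0 (%y. \<Sum>k\<in>A n. c n k *R P (r k) (Suc (J k)) (ix (Suc (r k)) y))" for n and J :: "nat => nat"
 define Y where "Y n t y = (\<Sum>k\<in>A n. c n k *R Ps (r k) (y, t))" for n t y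
 have SY: "S n (index n t) = prim 0 (Y n t)" for n t
  unfolding S_def Y_def[abs_def] by (intro arg_cong[where f = "prim 0"] ext sum.cong refl) (simp add: index_def Ps_def stp_def)
 have X: "H1_0 Omega (S n J)" for n J
  unfolding S_def by (rule H1_0_step_combination[OF weights_finite _ P_mean]) simp
 have Yq: "sq_int lO (Y n t)" for n t unfolding Y_def[abs_def] by (rule sq_int_sum[OF steps_slice(1)])
 have p2: "(%x. prim2 ux (x, t)) = prim 0 (%y. ux (y, t))" for t by (simp add: prim2_def fun_eq_iff)
 have good: "AE t in tint T. sq_int lO (%x. ux (x, t)) & (%n. nsq lO (%x. Y n t x - ux (x, t))) ----> 0 & t \<in> {0<..<T}"
  using slice_sq_int(1)[OF lq(1)] slices AE_space by eventually_elim (simp add: Y_def)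
 show ?thesis
 \<comment> \<open>6 K is 2 K for \<open>ux\<close> by \<open>nsq_limit_le\<close> plus 4 K for its
   primitive by \<open>nsq_prim_le\<close>.\<close>
 proof (rule Linf_Bochner_steps[where A = A and N = "%k. Suc (r k)" and S = S and C = "sqrt (6 * K)"])
  show "AE t in tint T. H1_0 Omega (%x. prim2 ux (x, t))"
  using good
  proof eventually_elim
  case (elim t)
  have h: "H1_0 Omega (prim 0 (Y n t))" for n using X[of n "index n t"] unfolding SY .
  show ?case unfolding p2 by (rule H1_0_limit[OF _ Yq h]) (use elim in auto)
  qed
  show "AE t in tint T. (%n. H1_norm Omega (%x. S n (%k. if k \<in> A n then ix (Suc (r k)) (t / T) else 0) x - prim2 ux (x, t))) ----> 0"
  using good
  proof eventually_elim
  case (elim t)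
  have "(%n. H1_norm Omega (%x. prim 0 (Y n t) x - prim 0 (%y. ux (y, t)) x)) ----> 0"
  by (rule H1_norm_diff_tendsto) (use elim Yq in auto)
  then show ?case unfolding index_def[symmetric] SY by (simp add: prim2_def)
  qed
  show "AE t in tint T. H1_norm Omega (%x. prim2 ux (x, t)) <= sqrt (6 * K)"
  using good
  proof eventually_elim
  case (elim t)
  have q: "sq_int lO (%x. ux (x, t))" using elim by blast
  have "nsq lO (Y n t) <= K" for n
  unfolding Y_def[abs_def] using elim by (intro conv_weights_nsq_le[OF cw] steps_slice(1) steps_slice_nsq(1)) auto
  then have "nsq lO (%x. ux (x, t)) <= 2 * K"
  using elim by (intro nsq_limit_le[of _ "%n. Y n t", OF Yq]) auto
  then show ?case unfolding p2 H1_norm_W1[OF W1_prim[OF q]] using nsq_prim_le[OF q, of 0] by simp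
  qed
 qed (rule T weights_finite X zero_less_Suc)+
qed

lemma Linf_ut: "Linf_Bochner T (L2 Omega) (L2_norm Omega) ut"
proof -
 define S where "S n J x = (\<Sum>k\<in>A n. c n k *R V (r k) (Suc (J k)) (ix (Suc (r k)) x))" for n x and J :: "nat => nat"
 define Y where "Y n t y = (\<Sum>k\<in>A n. c n k *R Vs (r k) (y, t))" for n t y
 have SY: "S n (index n t) x = Y n t x" for n t x
  unfolding S_def Y_def by (intro sum.cong refl) (simp add: index_def Vs_def stp_def)
 have Sq: "sq_int lO (S n J)" for n J unfolding S_def[abs_def] by (intro sq_int_sum nsq_step1(2)) simp
 have X: "L2 Omega (S n J)" for n J using L2_lbo(1)[OF Omega_borel sq_intD(1)[OF Sq]] Sq by blast
 have Yq: "sq_int lO (Y n t)" for n t unfolding Y_def[abs_def] by (rule sq_int_sum[OF steps_slice(2)])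
 have good: "AE t in tint T. sq_int lO (%x. ut (x, t)) & (%n. nsq lO (%x. Y n t x - ut (x, t))) ----> 0 & t \<in> {0<..<T}"
  using slice_sq_int(1)[OF lq(2)] slices AE_space by eventually_elim (simp add: Y_def)
 show ?thesis
 proof (rule Linf_Bochner_steps[where A = A and N = "%k. Suc (r k)" and S = S and C = "sqrt (2 * K)"])
  show "AE t in tint T. L2 Omega (%x. ut (x, t))"
  using good by eventually_elim (use L2_lbo(1)[OF Omega_borel] sq_intD(1) in blast)
  show "AE t in tint T. (%n. L2_norm Omega (%x. S n (%k. if k \<in> A n then ix (Suc (r k)) (t / T) else 0) x - ut (x, t))) ----> 0"
  using good
  proof eventually_elim
  case (elim t)
  have "L2_norm Omega (%x. Y n t x - ut (x, t)) = sqrt (nsq lO (%x. Y n t x - ut (x, t)))" for n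
  using elim by (intro L2_lbo(2)[OF Omega_borel] sq_intD(1)[OF sq_int_diff[OF Yq]]) auto
  moreover have "(%n. sqrt (nsq lO (%x. Y n t x - ut (x, t)))) ----> 0"
  using tendsto_real_sqrt[of _ 0] elim by fastforce
  ultimately show ?case unfolding index_def[symmetric] SY by simp
  qed
  show "AE t in tint T. L2_norm Omega (%x. ut (x, t)) <= sqrt (2 * K)"
  using good
  proof eventually_elim
  case (elim t)
  have q: "sq_int lO (%x. ut (x, t))" using elim by blast
  have "nsq lO (Y n t) <= K" for n
  unfolding Y_def[abs_def] using elim by (intro conv_weights_nsq_le[OF cw] steps_slice(2) steps_slice_nsq(2)) auto
  then have "nsq lO (%x. ut (x, t)) <= 2 * K"
  using elim by (intro nsq_limit_le[of _ "%n. Y n t", OF Yq]) auto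
  then show ?case unfolding L2_lbo(2)[OF Omega_borel sq_intD(1)[OF q]] by simp
  qed
 qed (rule T weights_finite X zero_less_Suc)+
qed

text \<open>The left trace of the combined interpolants at time t. Its convergence is not part of
  the compactness results and is obtained slice by slice below.\<close>

definition "btrace n t = (\<Sum>k\<in>A n. c n k *R m (r k) (Suc (ix (Suc (r k)) (t / T))) 0)"

text \<open>At each x of the slice the combined interpolants converge to \<open>mu (x, t)\<close>,
  since they are within sqrt(K/N) of the step functions, while their derivative parts converge to
  the primitive of \<open>mx\<close>. So the traces converge, and the limit cannot depend on x: it
  is the constant \<open>b\<close>.\<close>

lemma slice_representation:
 "AE t in tint T. \<exists>b. (%n. btrace n t) ----> b & (\<forall>x\<in>Omega. mu (x, t) = prim b (%y. mx (y, t)) x)"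
 using slices slice_sq_int(1)[OF lq(3)] AE_space
proof eventually_elim
 case (elim t)
 have t: "t \<in> {0<..<T}" using elim(3) by simp
 define Y where "Y n y = (\<Sum>k\<in>A n. c n k *R Ds (r k) (y, t))" for n y
 have Yq: "sq_int lO (Y n)" for n unfolding Y_def[abs_def] by (rule sq_int_sum[OF steps_slice(3)])
 have conv: "(%n. nsq lO (%x. Y n x - mx (x, t))) ----> 0" using elim(1) by (simp add: Y_def)
 let ?b = "%k. m (r k) (Suc (ix (Suc (r k)) (t / T))) 0"
 have close: "norm (prim (?b k) (%y. Ds (r k) (y, t)) x - Ms (r k) (x, t)) <= sqrt (K / real (Suc (r k)))" if x: "x \<in> Omega" for k x
 proof -
  let ?N = "Suc (r k)" and ?k = "Suc (ix (Suc (r k)) (t / T))"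
  have x': "0 < x" "x < 1" using x by (auto simp: Omega_def)
  have p: "(x, t) \<in> Cyl T" using x t by (simp add: Cyl_def)
  have i: "ix ?N x < ?N" "ix ?N (t / T) < ?N" using grid_index[OF p, of "r k"] by auto
  have "norm (prim (m (r k) ?k 0) (%y. Dm (r k) ?k (ix ?N y)) x - m (r k) ?k (ix ?N x)) <= 1 / real ?N * norm (Dm (r k) ?k (ix ?N x))"
  by (rule prim_step[OF _ x']) (use i(1) in \<open>auto simp: Dm_def dxm_def simp del: of_nat_Suc\<close>)
  then have 1: "norm (prim (?b k) (%y. Ds (r k) (y, t)) x - Ms (r k) (x, t)) <= 1 / real ?N * norm (Dm (r k) ?k (ix ?N x))"
  by (simp add: Ds_def Ms_def stp_def del: of_nat_Suc)
  have "(norm (Dm (r k) ?k (ix ?N x)))^2 <= (SUM i<?N. (norm (Dm (r k) ?k i))^2)"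
  by (rule member_le_sum) (use i in auto)
  also have "... <= real ?N * K" unfolding Dm_def by (rule bd) (use i in simp)
  finally have "(1 / real ?N)^2 * (norm (Dm (r k) ?k (ix ?N x)))^2 <= (1 / real ?N)^2 * (real ?N * K)" by (intro mult_left_mono) auto
  also have "... = K / real ?N" by (simp add: power2_eq_square del: of_nat_Suc)
  finally have "1 / real ?N * norm (Dm (r k) ?k (ix ?N x)) <= sqrt (K / real ?N)"
  by (intro real_le_rsqrt) (simp only: power_mult_distrib)
  with 1 show ?thesis by (rule order_trans)
 qed
 have lim: "(%n. btrace n t) ----> mu (x, t) - prim 0 (%y. mx (y, t)) x" if x: "x \<in> Omega" for x
 proof -
  have p: "(x, t) \<in> Cyl T" using x t by (simp add: Cyl_def)
  have "(%n. sqrt (K / (rS n))) ----> sqrt 0" by (intro tendsto_real_sqrt LIMSEQ_Suc[OF lim_const_over_n])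
  then have "(%k. sqrt (K / real (Suc (r k)))) ----> 0" using along_r[of "%n. sqrt (K / (rS n))" 0] by simp
  then have "(%k. prim (?b k) (%y. Ds (r k) (y, t)) x - Ms (r k) (x, t)) ----> 0"
  by (rule Lim_null_comparison[rotated]) (intro always_eventually allI close x)
  from tendsto_add[OF this tendsto_uniform_limitI[OF ul p]]
  have "(%k. prim (?b k) (%y. Ds (r k) (y, t)) x) ----> mu (x, t)" by simp
  from conv_weights_tendsto[OF cw this]
  have 1: "(%n. \<Sum>k\<in>A n. c n k *R prim (?b k) (%y. Ds (r k) (y, t)) x) ----> mu (x, t)" .
  have e: "(\<Sum>k\<in>A n. c n k *R prim (?b k) (%y. Ds (r k) (y, t)) x) = btrace n t + prim 0 (Y n) x" for n
  proof -
  have "(\<Sum>k\<in>A n. c n k *R prim (?b k) (%y. Ds (r k) (y, t)) x) = prim (btrace n t) (Y n) x"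
  unfolding btrace_def Y_def[abs_def] by (rule prim_lincomb) (rule Om.sq_int_integrable[OF steps_slice(3)])
  then show ?thesis by (simp add: prim_def)
  qed
  have 2: "(%n. prim 0 (Y n) x - prim 0 (%y. mx (y, t)) x) ----> 0"
  proof (rule Lim_null_comparison)
  show "\<forall>\<^sub>F n in sequentially. norm (prim 0 (Y n) x - prim 0 (%y. mx (y, t)) x) <= sqrt (nsq lO (%x. Y n x - mx (x, t)))"
  proof (intro always_eventually allI)
  fix n
  have d: "sq_int lO (%y. Y n y - mx (y, t))" by (rule sq_int_diff[OF Yq elim(2)])
  have "prim 0 (Y n) x - prim 0 (%y. mx (y, t)) x = prim (0 - 0) (%y. Y n y - mx (y, t)) x"
  by (rule prim_diff) (intro Om.sq_int_integrable Yq elim(2))+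
  also have "norm ... <= norm (0 - 0 :: real ^ 2) + (LINT y|lO. norm (Y n y - mx (y, t)))"
  by (rule prim_norm_le[OF Om.sq_int_integrable[OF d]])
  also have "... <= sqrt (nsq lO (%x. Y n x - mx (x, t)))"
  using Om.L1_le_nsq[OF d] by (simp add: measure_Omega real_le_rsqrt)
  finally show "norm (prim 0 (Y n) x - prim 0 (%y. mx (y, t)) x) <= sqrt (nsq lO (%x. Y n x - mx (x, t)))" .
  qed
  show "(%n. sqrt (nsq lO (%x. Y n x - mx (x, t)))) ----> 0"
  using tendsto_real_sqrt[OF conv] by simp
  qed
  have "(%n. (btrace n t + prim 0 (Y n) x) - (prim 0 (Y n) x - prim 0 (%y. mx (y, t)) x) - prim 0 (%y. mx (y, t)) x) ----> mu (x, t) - 0 - prim 0 (%y. mx (y, t)) x"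
  using 1 unfolding e by (intro tendsto_diff 2 tendsto_const)
  then show ?thesis by simp
 qed
 \<comment> \<open>Every point of \<open>Omega\<close> gives the same value; 1/2 is one of
   them.\<close>
 define b where "b = mu (1/2, t) - prim 0 (%y. mx (y, t)) (1/2)"
 have b: "(%n. btrace n t) ----> b" unfolding b_def by (rule lim) (simp add: Omega_def)
 have "mu (x, t) = prim b (%y. mx (y, t)) x" if "x \<in> Omega" for x
 proof -
  have "mu (x, t) - prim 0 (%y. mx (y, t)) x = b" by (rule LIMSEQ_unique[OF lim[OF that] b])
  then show ?thesis by (simp add: prim_def algebra_simps)
 qed
 with b show ?case by blast
qed

lemma weak_deriv_m_x: "has_weak_deriv (Cyl T) (1, 0) mu mx"
 by (rule slice_weak_deriv[OF T mu_sq_int lq(3)]) (use slice_representation in \<open>eventually_elim, blast\<close>)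

lemma Linf_m: "Linf_Bochner T (H1 Omega) (H1_norm Omega) mu"
proof -
 define S where "S n J = prim (\<Sum>k\<in>A n. c n k *R m (r k) (Suc (J k)) 0) (%y. \<Sum>k\<in>A n. c n k *R Dm (r k) (Suc (J k)) (ix (Suc (r k)) y))"
  for n and J :: "nat => nat"
 define Y where "Y n t y = (\<Sum>k\<in>A n. c n k *R Ds (r k) (y, t))" for n t y
 have SY: "S n (index n t) = prim (btrace n t) (Y n t)" for n t
  unfolding S_def Y_def[abs_def] btrace_def by (intro arg_cong2[where f = prim] ext sum.cong refl) (simp_all add: index_def Ds_def stp_def)
 have X: "H1 Omega (S n J)" for n J
  unfolding S_def by (intro W1_H1[OF W1_prim] sq_int_sum nsq_step1(2)) simp
 have Yq: "sq_int lO (Y n t)" for n t unfolding Y_def[abs_def] by (rule sq_int_sum[OF steps_slice(3)])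
 have good: "AE t in tint T. sq_int lO (%x. mx (x, t)) & (%n. nsq lO (%x. Y n t x - mx (x, t))) ----> 0 & t \<in> {0<..<T}"
  using slice_sq_int(1)[OF lq(3)] slices AE_space by eventually_elim (simp add: Y_def)
 show ?thesis
 \<comment> \<open>\<open>Mb\<close> bounds \<open>mu\<close> pointwise on a domain of measure one,
   and 2 K bounds the square norm of its derivative by \<open>nsq_limit_le\<close>.\<close>
 proof (rule Linf_Bochner_steps[where A = A and N = "%k. Suc (r k)" and S = S and C = "sqrt (Mb^2 + 2 * K)"])
  show "AE t in tint T. H1 Omega (%x. mu (x, t))"
  using good slice_representation
  proof eventually_elim
  case (elim t)
  obtain b where b: "!!x. x \<in> Omega ==> mu (x, t) = prim b (%y. mx (y, t)) x" using elim(2) by blast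
  show ?case using H1_cong(1)[OF b] W1_H1[OF W1_prim, of "%y. mx (y, t)" b] elim(1) by simp
  qed
  show "AE t in tint T. (%n. H1_norm Omega (%x. S n (%k. if k \<in> A n then ix (Suc (r k)) (t / T) else 0) x - mu (x, t))) ----> 0"
  using good slice_representation
  proof eventually_elim
  case (elim t)
  obtain b where b: "(%n. btrace n t) ----> b" "!!x. x \<in> Omega ==> mu (x, t) = prim b (%y. mx (y, t)) x" using elim(2) by blast
  have "H1_norm Omega (%x. prim (btrace n t) (Y n t) x - mu (x, t)) = H1_norm Omega (%x. prim (btrace n t) (Y n t) x - prim b (%y. mx (y, t)) x)" for n
  by (rule H1_cong(2)) (simp add: b(2))
  then show ?case unfolding index_def[symmetric] SY
  using H1_norm_diff_tendsto[of "%n. Y n t" "%y. mx (y, t)" "%n. btrace n t" b, OF Yq _ _ b(1)] elim(1) by simp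
  qed
  show "AE t in tint T. H1_norm Omega (%x. mu (x, t)) <= sqrt (Mb^2 + 2 * K)"
  using good slice_representation
  proof eventually_elim
  case (elim t)
  have q: "sq_int lO (%x. mx (x, t))" using elim by blast
  obtain b where b: "!!x. x \<in> Omega ==> mu (x, t) = prim b (%y. mx (y, t)) x" using elim(2) by blast
  have "nsq lO (Y n t) <= K" for n
  unfolding Y_def[abs_def] using elim by (intro conv_weights_nsq_le[OF cw] steps_slice(3) steps_slice_nsq(3)) auto
  then have 1: "nsq lO (%x. mx (x, t)) <= 2 * K"
  using elim by (intro nsq_limit_le[of _ "%n. Y n t", OF Yq]) auto
  have "nsq lO (prim b (%y. mx (y, t))) <= Mb^2 * measure lO (space lO)"
  by (rule nsq_bounded_le[OF Om.finite_measure_axioms sq_intD(1)[OF integrable_prim[OF Om.sq_int_integrable[OF q]]]])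
  (use b muM in \<open>simp flip: b\<close>)
  with 1 have "nsq lO (prim b (%y. mx (y, t))) + nsq lO (%x. mx (x, t)) <= Mb^2 + 2 * K"
  by (simp add: measure_Omega)
  moreover have e: "H1_norm Omega (%x. mu (x, t)) = H1_norm Omega (prim b (%y. mx (y, t)))"
  by (rule H1_cong(2)) (rule b)
  ultimately show ?case unfolding e H1_norm_W1[OF W1_prim[OF q]] by simp
  qed
 qed (rule T weights_finite X zero_less_Suc)+
qed

end

theorem theorem3p1:
  fixes lam T :: real and G :: "real \<Rightarrow> real"
  assumes "lam > 0" and "T > 0" and "relaxation_function G"
  shows "\<exists>\<delta>0. 0 < \<delta>0 \<and> \<delta>0 < 1 \<and>
    (\<forall>\<delta> (u1 :: real \<Rightarrow> real) (m0 :: real \<Rightarrow> real ^ 2) (f :: real \<times> real \<Rightarrow> real).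
       0 < \<delta> \<and> \<delta> < \<delta>0 \<and>
       L2 Omega u1 \<and>
       H1 Omega m0 \<and> (AE x in lebesgue_on Omega. norm (m0 x) = 1) \<and>
       L2 (Cyl T) f \<longrightarrow>
       (\<exists>(u :: real \<times> real \<Rightarrow> real) ux ut (m :: real \<times> real \<Rightarrow> real ^ 2) mx mt.
          has_weak_deriv (Cyl T) (1, 0) u ux \<and> has_weak_deriv (Cyl T) (0, 1) u ut \<and>
          has_weak_deriv (Cyl T) (1, 0) m mx \<and> has_weak_deriv (Cyl T) (0, 1) m mt \<and>
          Linf_Bochner T (H1_0 Omega) (H1_norm Omega) u \<and>
          Linf_Bochner T (L2 Omega) (L2_norm Omega) ut \<and>
          Linf_Bochner T (H1 Omega) (H1_norm Omega) m \<and>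
          L2 (Cyl T) mt \<and>
          weak_momentum_equation T lam G u1 f u ux m \<and>
          weak_magnetization_equation T lam \<delta> m0 ux m mx))"
proof (intro exI[of _ "min (1 / 2) (G (2 * T) / (4 * lam^2))"] conjI allI impI)
 \<comment> \<open>In the threshold, 1/2 secures a value below 1; the other term is the absorption
   condition of \<open>total_energy_lower\<close> with \<open>gm = G (2 * T)\<close>.\<close>
 have G2: "G (2 * T) > 0" using assms(2,3) by (simp add: relaxation_function_def)
 then show "0 < min (1 / 2) (G (2 * T) / (4 * lam^2))" using assms(1) by simp
 show "min (1 / 2) (G (2 * T) / (4 * lam^2)) < 1" by simp
 fix dl and u1 :: "real => real" and m0 :: "real => real ^ 2" and f :: "real*real => real"
 assume "0 < dl & dl < min (1 / 2) (G (2 * T) / (4 * lam^2)) & L2 Omega u1 & H1 Omega m0 & (AE x in lebesgue_on Omega. norm (m0 x) = 1) & L2 (Cyl T) f"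
 then have dl: "0 < dl" "dl < G (2 * T) / (4 * lam^2)" and u1: "L2 Omega u1" and m0: "H1 Omega m0"
  and m1: "AE x in lebesgue_on Omega. norm (m0 x) = 1" and f: "L2 (Cyl T) f" by auto
 have dl2: "dl * (4 * lam^2) <= G (2 * T)" using dl(2) assms(1) by (simp add: pos_less_divide_eq)
 obtain g0 where g0: "has_weak_deriv Omega 1 m0 g0" "L2 Omega g0" and m0L: "L2 Omega m0" using m0 unfolding H1_def by blast
 obtain u1' where u1': "sq_int lO u1'" "AE x in lO. u1 x = u1' x" by (rule L2_representative[OF Omega_borel u1])
 obtain f' where f': "f' \<in> bms borel" "sq_int (lC T) f'" "AE x in lC T. f x = f' x" by (rule L2_representative[OF Cyl_borel f])
 obtain w where w: "sq_int lO w" "AE x in lO. m0 x = w x" by (rule L2_representative[OF Omega_borel m0L])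
 obtain g where g: "sq_int lO g" "AE x in lO. g0 x = g x" by (rule L2_representative[OF Omega_borel g0(2)])
 \<comment> \<open>The unit length of the datum enters through this bound, which controls the
   initial double well energy of the cell averages.\<close>
 have w1: "AE x in lO. norm (w x) <= 1"
  using m1 w(2) unfolding AE_lebesgue_on[OF Omega_borel] by eventually_elim simp
 obtain K u m where K: "K > 0" and sol: "!!n. scheme (Suc n) (T / (rS n)) lam dl (Gavg G (T / (rS n)))
  (%i. (rS n) * (LINT x|lO. ind (cell (Suc n) i) x * u1' x))
  (%k i. (rS n)^2 / T * (LINT p|lC T. ind (cell2 (Suc n) T (k - 1) i) p * f' p))
  (%i. (rS n) *R (LINT x|lO. ind (cell (Suc n) i) x *R w x)) (u n) (m n)
  & (\<forall>k<Suc n. (SUM i<Suc n. (((rS n) / T) * (u n (Suc k) i - u n k i))^2) <= (rS n) * K)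
  & (\<forall>k\<le>Suc n. (SUM i<Suc n. (dx (Suc n) (u n k) i)^2) <= (rS n) * K)
  & (\<forall>k\<le>Suc n. (SUM i<Suc n. (norm (m n k i))^2) <= (rS n) * K)
  & (\<forall>k\<le>Suc n. (SUM i<Suc n. (norm (dxm (Suc n) (m n k) i))^2) <= (rS n) * K)
  & (SUM k<Suc n. SUM i<Suc n. (norm (m n (Suc k) i - m n k i))^2) <= T / (rS n) * ((rS n) * K)"
  using discrete_solutions[OF assms(2,3) dl(1) dl2 u1'(1) f'(2) g0(1) Om.sq_int_integrable[OF w(1)] w(2)[folded AE_lebesgue_on[OF Omega_borel]]
  g(1) g(2)[folded AE_lebesgue_on[OF Omega_borel]] w1] by (elim exE conjE) (rule that, assumption, erule spec)
 note w0 = w(2) and u1r = u1'(2) f'(3) and fr = f'(1)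
 interpret discrete_family T lam dl K G u1' f' w u m
  by (rule discrete_family.intro[OF assms(2,3) dl(1) K u1'(1) f'(2) w(1)])
  (use sol in \<open>(simp only: simp_thms | blast)+\<close>)
 obtain r mu ux ut mx mt A c where "limit_point T lam dl K G u1' f' w u m r mu ux ut mx mt A c" using limit_point_exists by blast
 then interpret limit_point T lam dl K G u1' f' w u m r mu ux ut mx mt A c .
 have mtL: "L2 (Cyl T) mt" using L2_lbo(1)[OF Cyl_borel sq_intD(1)[OF lq(4)]] lq(4) by blast
 show "\<exists>(u :: real*real => real) ux ut (m :: real*real => real ^ 2) mx mt.
  has_weak_deriv (Cyl T) (1, 0) u ux & has_weak_deriv (Cyl T) (0, 1) u ut &
  has_weak_deriv (Cyl T) (1, 0) m mx & has_weak_deriv (Cyl T) (0, 1) m mt &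
  Linf_Bochner T (H1_0 Omega) (H1_norm Omega) u &
  Linf_Bochner T (L2 Omega) (L2_norm Omega) ut &
  Linf_Bochner T (H1 Omega) (H1_norm Omega) m &
  L2 (Cyl T) mt &
  weak_momentum_equation T lam G u1 f u ux m &
  weak_magnetization_equation T lam dl m0 ux m mx"
  by (rule exI[of _ "prim2 ux"], rule exI[of _ ux], rule exI[of _ ut], rule exI[of _ mu], rule exI[of _ mx], rule exI[of _ mt])
  (intro conjI weak_deriv_u weak_deriv_m_x weak_deriv_m_t Linf_u Linf_ut Linf_m mtL momentum_equation[OF fr u1r] magnetization_equation[OF w0])
qed

end
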